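(* Let $k$ be an algebraically closed field of characteristic $0$. Consider triples $(B,A,g)$ where $B$ is a finite dimensional semisimple $k$-algebra, $A\subseteq Z(B)$ is a (unital) commutative subalgebra, and $g\in B$ is an invertible element such that $\mathrm{Tr}(\pi(g))=\deg\pi$ for every finite dimensional representation $\pi$ of $B$. Every minimal weak Hopf algebra over $k$ is completely determined by such a triple, in the following way. Given $(B,A,g)$, let $H_{\min}(B,A,g)=B\otimes_A B^{\mathrm{op}}$ as an algebra, i.e. the algebra generated by elements $b\in B$ and $\overline{c}\in B^{\mathrm{op}}$ (where $c\mapsto\overline{c}$ is the canonical algebra anti-isomorphism $B\to B^{\mathrm{op}}$) subject to the relations of $B$ and $B^{\mathrm{op}}$ and $b\,\overline{c}=\overline{c}\,b$ for $b,c\in B$, $a=\overline{a}$ for $a\in A$. Let $e=e^{(1)}\otimes e^{(2)}\in B\otimes_k B$ be the unique two-sided separability element of $B$ and $\mathrm{Tr}_{\mathrm{reg}}$ the trace of the regular representation of $B$. The comultiplication, counit and antipode are $$\Delta(b\,\overline{c})=b\,\overline{(g e^{(1)})}\otimes e^{(2)}\,\overline{c},\qquad \epsilon(b\,\overline{c})=\mathrm{Tr}_{\mathrm{reg}}(g^{-1}cb),\qquad S(b\,\overline{c})=g^{-1}cg\,\overline{b}.$$ These operations make $H_{\min}(B,A,g)$ a minimal weak Hopf algebra, and every minimal weak Hopf algebra over $k$ is isomorphic to $H_{\min}(B,A,g)$ for some such triple. Moreover, the minimal weak Hopf algebras defined by $(B,A,g)$ and $(B',A',g')$ are isomorphic (as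 weak Hopf algebras) if and only if there exists an algebra isomorphism $\tau:B\to B'$ such that $\tau(A)=A'$ and $\tau(g)=g'$.
   Context: A weak Hopf algebra over a field $k$ is a $k$-vector space $H$ with an associative unital algebra structure $(m,1)$, a coassociative counital coalgebra structure $(\Delta,\epsilon)$ (Sweedler notation $\Delta(h)=h_{(1)}\otimes h_{(2)}$) and a linear map $S:H\to H$ (antipode) such that for all $f,g,h\in H$: $\Delta(hg)=\Delta(h)\Delta(g)$; $(\Delta\otimes\mathrm{id})\Delta(1)=(\Delta(1)\otimes1)(1\otimes\Delta(1))=(1\otimes\Delta(1))(\Delta(1)\otimes1)$; $\epsilon(fgh)=\epsilon(fg_{(1)})\epsilon(g_{(2)}h)=\epsilon(fg_{(2)})\epsilon(g_{(1)}h)$; $m(\mathrm{id}\otimes S)\Delta(h)=(\epsilon\otimes\mathrm{id})(\Delta(1)(h\otimes1))$; $m(S\otimes\mathrm{id})\Delta(h)=(\mathrm{id}\otimes\epsilon)((1\otimes h)\Delta(1))$; $S(h)=S(h_{(1)})h_{(2)}S(h_{(3)})$. ($\Delta(1)\neq1\otimes1$ in general.) A morphism of weak Hopf algebras is a map that is an algebra and coalgebra homomorphism preserving $1$ and $\epsilon$ and commuting with the antipodes. A weak Hopf subalgebra is a unital subalgebra (containing $1$) that is a subcoalgebra stable under $S$. A weak Hopf algebra is called minimal if it has no proper weak Hopf subalgebras; equivalently $H=H_tH_s$, where $H_t=\varepsilon_t(H)$, $H_s=\varepsilon_s(H)$, $\varepsilon_t(h)=\epsilon(1_{(1)}h)1_{(2)}$,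 $\varepsilon_s(h)=1_{(1)}\epsilon(h1_{(2)})$. For an algebra $B$, a separability element is $\mathcal E\in B\otimes B$ with $(a\otimes1)\mathcal E=\mathcal E(1\otimes a)$ for all $a\in B$ and $m(\mathcal E)=1$; it is two-sided if also $\mathcal E(a\otimes 1)=(1\otimes a)\mathcal E$ for all $a$. A two-sided separability element is unique if it exists. $Z(B)$ is the center of $B$. *)

theory Defs
  imports "Jordan_Normal_Form.VS_Connect" "HOL-Algebra.Subrings" "HOL-Library.FuncSet"
begin

text \<open>
  The ground field is a type \<open>'k\<close> of class \<open>field\<close>; as an object of HOL-Algebra it
  is \<open>class_ring\<close>. Vector spaces and algebras are \<open>module\<close> records with explicit
  carriers.
\<close>

section \<open>Tensor products\<close>

definition free_module :: "('r, 'q) ring_scheme \<Rightarrow> 'x set \<Rightarrow> ('r, 'x \<Rightarrow> 'r) module" where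
  "free_module R X =
     \<lparr> carrier = {f. (\<forall>x\<in>X. f x \<in> carrier R) \<and> (\<forall>x. x \<notin> X \<longrightarrow> f x = \<zero>\<^bsub>R\<^esub>) \<and>
                      finite {x. f x \<noteq> \<zero>\<^bsub>R\<^esub>}},
       mult = undefined, one = undefined,
       zero = (\<lambda>_. \<zero>\<^bsub>R\<^esub>),
       add = (\<lambda>f g x. f x \<oplus>\<^bsub>R\<^esub> g x),
       smult = (\<lambda>r f x. r \<otimes>\<^bsub>R\<^esub> f x) \<rparr>"

definition free_gen :: "('r, 'q) ring_scheme \<Rightarrow> 'x \<Rightarrow> 'x \<Rightarrow> 'r" where
  "free_gen R x = (\<lambda>y. if y = x then \<one>\<^bsub>R\<^esub> else \<zero>\<^bsub>R\<^esub>)"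

definition tensor_relations ::
  "('r, 'q) ring_scheme \<Rightarrow> ('r, 'm, 'u) module_scheme \<Rightarrow> ('r, 'n, 'v) module_scheme
    \<Rightarrow> ('m \<times> 'n \<Rightarrow> 'r) set" where
  "tensor_relations R M N =
    (let F = free_module R (carrier M \<times> carrier N); d = free_gen R in
     LinearCombinations.module.span R F
      ({d (x \<oplus>\<^bsub>M\<^esub> x', y) \<ominus>\<^bsub>F\<^esub> (d (x, y) \<oplus>\<^bsub>F\<^esub> d (x', y)) | x x' y.
          x \<in> carrier M \<and> x' \<in> carrier M \<and> y \<in> carrier N} \<union>
       {d (x, y \<oplus>\<^bsub>N\<^esub> y') \<ominus>\<^bsub>F\<^esub> (d (x, y) \<oplus>\<^bsub>F\<^esub> d (x, y')) | x y y'.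
          x \<in> carrier M \<and> y \<in> carrier N \<and> y' \<in> carrier N} \<union>
       {d (r \<odot>\<^bsub>M\<^esub> x, y) \<ominus>\<^bsub>F\<^esub> (r \<odot>\<^bsub>F\<^esub> d (x, y)) | r x y.
          r \<in> carrier R \<and> x \<in> carrier M \<and> y \<in> carrier N} \<union>
       {d (x, r \<odot>\<^bsub>N\<^esub> y) \<ominus>\<^bsub>F\<^esub> (r \<odot>\<^bsub>F\<^esub> d (x, y)) | r x y.
          r \<in> carrier R \<and> x \<in> carrier M \<and> y \<in> carrier N}))"

text \<open>
  \<open>M \<otimes>\<^sub>R N\<close> for modules over a commutative ring \<open>R\<close>: the free module on
  \<open>carrier M \<times> carrier N\<close> modulo the bilinearity relations, elements being cosets.
  The fields \<open>mult\<close> and \<open>one\<close> carry no meaning here.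
\<close>

definition tensor_product ::
  "('r, 'q) ring_scheme \<Rightarrow> ('r, 'm, 'u) module_scheme \<Rightarrow> ('r, 'n, 'v) module_scheme
    \<Rightarrow> ('r, ('m \<times> 'n \<Rightarrow> 'r) set) module" where
  "tensor_product R M N =
    (let F = free_module R (carrier M \<times> carrier N); U = tensor_relations R M N in
     \<lparr> carrier = a_rcosets\<^bsub>F\<^esub> U,
       mult = undefined, one = undefined,
       zero = U,
       add = (\<lambda>X Y. X <+>\<^bsub>F\<^esub> Y),
       smult = (\<lambda>r X. U <+>\<^bsub>F\<^esub> ((\<lambda>x. r \<odot>\<^bsub>F\<^esub> x) ` X)) \<rparr>)"

definition tens ::
  "('r, 'q) ring_scheme \<Rightarrow> ('r, 'm, 'u) module_scheme \<Rightarrow> ('r, 'n, 'v) module_scheme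
    \<Rightarrow> 'm \<Rightarrow> 'n \<Rightarrow> ('m \<times> 'n \<Rightarrow> 'r) set" where
  "tens R M N x y =
     tensor_relations R M N +>\<^bsub>free_module R (carrier M \<times> carrier N)\<^esub> free_gen R (x, y)"

text \<open>
  The additive map on \<open>M \<otimes>\<^sub>R N\<close> determined by \<open>x \<otimes> y \<mapsto> \<beta> x y\<close> (unique, since pure tensors
  generate additively; it exists when \<open>\<beta>\<close> is biadditive and \<open>R\<close>-balanced). Only the
  additive group of the target matters, so this also defines maps out of a tensor product
  over a subalgebra \<open>A\<close> into vector spaces.
\<close>

definition tensor_lift ::
  "('r, 'q) ring_scheme \<Rightarrow> ('r, 'm, 'u) module_scheme \<Rightarrow> ('r, 'n, 'v) module_scheme
    \<Rightarrow> ('p, 'w) ring_scheme \<Rightarrow> ('m \<Rightarrow> 'n \<Rightarrow> 'p) \<Rightarrow> ('m \<times> 'n \<Rightarrow> 'r) set \<Rightarrow> 'p" where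
  "tensor_lift R M N P \<beta> =
    (THE \<phi>. \<phi> \<in> extensional (carrier (tensor_product R M N)) \<and>
            \<phi> \<in> hom (add_monoid (tensor_product R M N)) (add_monoid P) \<and>
            (\<forall>x\<in>carrier M. \<forall>y\<in>carrier N. \<phi> (tens R M N x y) = \<beta> x y))"

definition tensor_map ::
  "('r, 'q) ring_scheme \<Rightarrow> ('r, 'm, 'u) module_scheme \<Rightarrow> ('r, 'n, 'v) module_scheme
    \<Rightarrow> ('r, 'm2, 'u2) module_scheme \<Rightarrow> ('r, 'n2, 'v2) module_scheme
    \<Rightarrow> ('m \<Rightarrow> 'm2) \<Rightarrow> ('n \<Rightarrow> 'n2) \<Rightarrow> ('m \<times> 'n \<Rightarrow> 'r) set \<Rightarrow> ('m2 \<times> 'n2 \<Rightarrow> 'r) set" where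
  "tensor_map R M N M' N' f g =
     tensor_lift R M N (tensor_product R M' N') (\<lambda>x y. tens R M' N' (f x) (g y))"

definition tensor_algebra ::
  "('r, 'q) ring_scheme \<Rightarrow> ('r, 'm, 'u) module_scheme \<Rightarrow> ('r, 'n, 'v) module_scheme
    \<Rightarrow> ('r, ('m \<times> 'n \<Rightarrow> 'r) set) module" where
  "tensor_algebra R M N =
    (let T = tensor_product R M N in
     T \<lparr> mult := (\<lambda>s t. tensor_lift R M N T (\<lambda>x y.
             tensor_lift R M N T (\<lambda>x' y'. tens R M N (x \<otimes>\<^bsub>M\<^esub> x') (y \<otimes>\<^bsub>N\<^esub> y')) t) s),
         one := tens R M N \<one>\<^bsub>M\<^esub> \<one>\<^bsub>N\<^esub> \<rparr>)"

abbreviation tensor_k ::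
  "('k::field, 'm, 'u) module_scheme \<Rightarrow> ('k, 'n, 'v) module_scheme
    \<Rightarrow> ('k, ('m \<times> 'n \<Rightarrow> 'k) set) module" (infixl "\<otimes>\<^sub>k" 70) where
  "M \<otimes>\<^sub>k N \<equiv> tensor_algebra class_ring M N"

definition tensor_assoc ::
  "('k::field, 'm, 'u) module_scheme \<Rightarrow> ('k, 'n, 'v) module_scheme
    \<Rightarrow> ('k, 'p, 'w) module_scheme
    \<Rightarrow> (('m \<times> 'n \<Rightarrow> 'k) set \<times> 'p \<Rightarrow> 'k) set \<Rightarrow> ('m \<times> ('n \<times> 'p \<Rightarrow> 'k) set \<Rightarrow> 'k) set" where
  "tensor_assoc M N P =
     tensor_lift class_ring (M \<otimes>\<^sub>k N) P (M \<otimes>\<^sub>k (N \<otimes>\<^sub>k P)) (\<lambda>t z.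
       tensor_lift class_ring M N (M \<otimes>\<^sub>k (N \<otimes>\<^sub>k P)) (\<lambda>x y.
         tens class_ring M (N \<otimes>\<^sub>k P) x (tens class_ring N P y z)) t)"


section \<open>Algebras over a field\<close>

definition k_algebra :: "('k::field, 'b, 'u) module_scheme \<Rightarrow> bool" where
  "k_algebra B \<longleftrightarrow>
     vectorspace class_ring B \<and> ring B \<and>
     (\<forall>c. \<forall>x\<in>carrier B. \<forall>y\<in>carrier B.
        (c \<odot>\<^bsub>B\<^esub> x) \<otimes>\<^bsub>B\<^esub> y = c \<odot>\<^bsub>B\<^esub> (x \<otimes>\<^bsub>B\<^esub> y) \<and>
        x \<otimes>\<^bsub>B\<^esub> (c \<odot>\<^bsub>B\<^esub> y) = c \<odot>\<^bsub>B\<^esub> (x \<otimes>\<^bsub>B\<^esub> y))"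

definition algebra_hom ::
  "('k::field, 'b, 'u) module_scheme \<Rightarrow> ('k, 'c, 'v) module_scheme \<Rightarrow> ('b \<Rightarrow> 'c) set" where
  "algebra_hom B C =
     {f \<in> Ring.ring_hom B C. \<forall>c. \<forall>x\<in>carrier B. f (c \<odot>\<^bsub>B\<^esub> x) = c \<odot>\<^bsub>C\<^esub> f x}"

definition algebra_iso ::
  "('k::field, 'b, 'u) module_scheme \<Rightarrow> ('k, 'c, 'v) module_scheme \<Rightarrow> ('b \<Rightarrow> 'c) set" where
  "algebra_iso B C = {f \<in> algebra_hom B C. bij_betw f (carrier B) (carrier C)}"

definition subalgebra :: "'b set \<Rightarrow> ('k::field, 'b, 'u) module_scheme \<Rightarrow> bool" where
  "subalgebra A B \<longleftrightarrow> subring A B \<and> (\<forall>c. \<forall>x\<in>A. c \<odot>\<^bsub>B\<^esub> x \<in> A)"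

definition ring_center :: "('b, 'u) ring_scheme \<Rightarrow> 'b set" where
  "ring_center B = {z \<in> carrier B. \<forall>x\<in>carrier B. z \<otimes>\<^bsub>B\<^esub> x = x \<otimes>\<^bsub>B\<^esub> z}"

definition left_ideal :: "'b set \<Rightarrow> ('b, 'u) ring_scheme \<Rightarrow> bool" where
  "left_ideal I B \<longleftrightarrow>
     additive_subgroup I B \<and> (\<forall>x\<in>carrier B. \<forall>y\<in>I. x \<otimes>\<^bsub>B\<^esub> y \<in> I)"

text \<open>The left regular module is semisimple: every submodule is a direct summand.\<close>

definition semisimple_ring :: "('b, 'u) ring_scheme \<Rightarrow> bool" where
  "semisimple_ring B \<longleftrightarrow>
     (\<forall>I. left_ideal I B \<longrightarrow>
        (\<exists>J. left_ideal J B \<and> I \<inter> J = {\<zero>\<^bsub>B\<^esub>} \<and> I <+>\<^bsub>B\<^esub> J = carrier B))"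

definition opposite :: "('k, 'b) module \<Rightarrow> ('k, 'b) module" where
  "opposite B = B \<lparr> mult := (\<lambda>x y. y \<otimes>\<^bsub>B\<^esub> x) \<rparr>"

definition mat_trace :: "'k::comm_monoid_add mat \<Rightarrow> 'k" where
  "mat_trace M = (\<Sum>i<dim_row M. M $$ (i, i))"

text \<open>Finite dimensional representations, on \<open>k\<^sup>n\<close>.\<close>

definition matrix_representation ::
  "('k::field, 'b, 'u) module_scheme \<Rightarrow> nat \<Rightarrow> ('b \<Rightarrow> 'k mat) \<Rightarrow> bool" where
  "matrix_representation B n \<pi> \<longleftrightarrow>
     (\<forall>x\<in>carrier B. \<pi> x \<in> carrier_mat n n) \<and>
     \<pi> \<one>\<^bsub>B\<^esub> = 1\<^sub>m n \<and>
     (\<forall>x\<in>carrier B. \<forall>y\<in>carrier B.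
        \<pi> (x \<otimes>\<^bsub>B\<^esub> y) = \<pi> x * \<pi> y \<and> \<pi> (x \<oplus>\<^bsub>B\<^esub> y) = \<pi> x + \<pi> y) \<and>
     (\<forall>c. \<forall>x\<in>carrier B. \<pi> (c \<odot>\<^bsub>B\<^esub> x) = c \<cdot>\<^sub>m \<pi> x)"

text \<open>
  The trace of an endomorphism of a finite dimensional space; \<open>a s t\<close> is the matrix
  coefficient of \<open>f\<close> at the basis vectors \<open>s\<close>, \<open>t\<close>, and the value does not depend on the basis.
\<close>

definition endo_trace :: "('k::field, 'b, 'u) module_scheme \<Rightarrow> ('b \<Rightarrow> 'b) \<Rightarrow> 'k" where
  "endo_trace V f =
    (THE \<tau>. \<exists>S a. finite S \<and> vectorspace.basis class_ring V S \<and>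
        (\<forall>s\<in>S. f s = (\<Oplus>\<^bsub>V\<^esub>t\<in>S. a s t \<odot>\<^bsub>V\<^esub> t)) \<and> \<tau> = (\<Sum>s\<in>S. a s s))"

definition reg_trace :: "('k::field, 'b, 'u) module_scheme \<Rightarrow> 'b \<Rightarrow> 'k" where
  "reg_trace B x = endo_trace B (\<lambda>y. x \<otimes>\<^bsub>B\<^esub> y)"

definition separability_element ::
  "('k::field, 'b, 'u) module_scheme \<Rightarrow> ('b \<times> 'b \<Rightarrow> 'k) set \<Rightarrow> bool" where
  "separability_element B E \<longleftrightarrow>
     E \<in> carrier (B \<otimes>\<^sub>k B) \<and>
     (\<forall>a\<in>carrier B. tens class_ring B B a \<one>\<^bsub>B\<^esub> \<otimes>\<^bsub>B \<otimes>\<^sub>k B\<^esub> E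
                  = E \<otimes>\<^bsub>B \<otimes>\<^sub>k B\<^esub> tens class_ring B B \<one>\<^bsub>B\<^esub> a) \<and>
     tensor_lift class_ring B B B (\<lambda>x y. x \<otimes>\<^bsub>B\<^esub> y) E = \<one>\<^bsub>B\<^esub>"

definition two_sided_separability_element ::
  "('k::field, 'b, 'u) module_scheme \<Rightarrow> ('b \<times> 'b \<Rightarrow> 'k) set \<Rightarrow> bool" where
  "two_sided_separability_element B E \<longleftrightarrow>
     separability_element B E \<and>
     (\<forall>a\<in>carrier B. E \<otimes>\<^bsub>B \<otimes>\<^sub>k B\<^esub> tens class_ring B B a \<one>\<^bsub>B\<^esub>
                  = tens class_ring B B \<one>\<^bsub>B\<^esub> a \<otimes>\<^bsub>B \<otimes>\<^sub>k B\<^esub> E)"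


section \<open>Weak Hopf algebras\<close>

record ('k, 'h) weak_hopf = "('k, 'h) module" +
  comult :: "'h \<Rightarrow> ('h \<times> 'h \<Rightarrow> 'k) set"
  counit :: "'h \<Rightarrow> 'k"
  antipode :: "'h \<Rightarrow> 'h"

definition coalgebra :: "('k::field, 'h, 'u) weak_hopf_scheme \<Rightarrow> bool" where
  "coalgebra H \<longleftrightarrow>
    (let D = comult H; \<epsilon> = counit H in
     vectorspace class_ring H \<and>
     D \<in> LinearCombinations.module_hom class_ring H (H \<otimes>\<^sub>k H) \<and>
     (\<forall>x\<in>carrier H. \<forall>y\<in>carrier H. \<epsilon> (x \<oplus>\<^bsub>H\<^esub> y) = \<epsilon> x + \<epsilon> y) \<and>
     (\<forall>c. \<forall>x\<in>carrier H. \<epsilon> (c \<odot>\<^bsub>H\<^esub> x) = c * \<epsilon> x) \<and>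
     (\<forall>h\<in>carrier H.
        tensor_assoc H H H (tensor_map class_ring H H (H \<otimes>\<^sub>k H) H D id (D h))
          = tensor_map class_ring H H H (H \<otimes>\<^sub>k H) id D (D h)) \<and>
     (\<forall>h\<in>carrier H.
        tensor_lift class_ring H H H (\<lambda>x y. \<epsilon> x \<odot>\<^bsub>H\<^esub> y) (D h) = h \<and>
        tensor_lift class_ring H H H (\<lambda>x y. \<epsilon> y \<odot>\<^bsub>H\<^esub> x) (D h) = h))"

text \<open>
  Triple tensors are compared in \<open>H \<otimes> (H \<otimes> H)\<close>; the canonical isomorphism
  \<open>tensor_assoc\<close> transports \<open>(\<Delta> \<otimes> id) \<Delta>(1)\<close> and \<open>\<Delta>(1) \<otimes> 1\<close> there.
\<close>

definition weak_hopf_algebra :: "('k::field, 'h, 'u) weak_hopf_scheme \<Rightarrow> bool" where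
  "weak_hopf_algebra H \<longleftrightarrow>
    (let D = comult H; \<epsilon> = counit H; S = antipode H;
         HH = H \<otimes>\<^sub>k H; H3 = H \<otimes>\<^sub>k HH;
         D1 = D \<one>\<^bsub>H\<^esub>;
         D_id = tensor_map class_ring H H HH H D id;
         D1_left = tensor_assoc H H H (tens class_ring HH H D1 \<one>\<^bsub>H\<^esub>);
         D1_right = tens class_ring H HH \<one>\<^bsub>H\<^esub> D1
     in
     k_algebra H \<and> coalgebra H \<and>
     S \<in> LinearCombinations.module_hom class_ring H H \<and>
     (\<forall>h\<in>carrier H. \<forall>g\<in>carrier H. D (h \<otimes>\<^bsub>H\<^esub> g) = D h \<otimes>\<^bsub>HH\<^esub> D g) \<and>
     tensor_assoc H H H (D_id D1) = D1_left \<otimes>\<^bsub>H3\<^esub> D1_right \<and>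
     tensor_assoc H H H (D_id D1) = D1_right \<otimes>\<^bsub>H3\<^esub> D1_left \<and>
     (\<forall>f\<in>carrier H. \<forall>g\<in>carrier H. \<forall>h\<in>carrier H.
        \<epsilon> (f \<otimes>\<^bsub>H\<^esub> g \<otimes>\<^bsub>H\<^esub> h)
          = tensor_lift class_ring H H (class_ring :: 'k ring)
              (\<lambda>g1 g2. \<epsilon> (f \<otimes>\<^bsub>H\<^esub> g1) * \<epsilon> (g2 \<otimes>\<^bsub>H\<^esub> h)) (D g) \<and>
        \<epsilon> (f \<otimes>\<^bsub>H\<^esub> g \<otimes>\<^bsub>H\<^esub> h)
          = tensor_lift class_ring H H (class_ring :: 'k ring)
              (\<lambda>g1 g2. \<epsilon> (f \<otimes>\<^bsub>H\<^esub> g2) * \<epsilon> (g1 \<otimes>\<^bsub>H\<^esub> h)) (D g)) \<and>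
     (\<forall>h\<in>carrier H.
        tensor_lift class_ring H H H (\<lambda>h1 h2. h1 \<otimes>\<^bsub>H\<^esub> S h2) (D h)
          = tensor_lift class_ring H H H (\<lambda>x y. \<epsilon> x \<odot>\<^bsub>H\<^esub> y)
              (D1 \<otimes>\<^bsub>HH\<^esub> tens class_ring H H h \<one>\<^bsub>H\<^esub>) \<and>
        tensor_lift class_ring H H H (\<lambda>h1 h2. S h1 \<otimes>\<^bsub>H\<^esub> h2) (D h)
          = tensor_lift class_ring H H H (\<lambda>x y. \<epsilon> y \<odot>\<^bsub>H\<^esub> x)
              (tens class_ring H H \<one>\<^bsub>H\<^esub> h \<otimes>\<^bsub>HH\<^esub> D1) \<and>
        S h = tensor_lift class_ring HH H H
                (\<lambda>t h3. tensor_lift class_ring H H H (\<lambda>h1 h2. S h1 \<otimes>\<^bsub>H\<^esub> h2) t \<otimes>\<^bsub>H\<^esub> S h3)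
                (D_id (D h))))"

definition weak_hopf_hom ::
  "('k::field, 'h, 'u) weak_hopf_scheme \<Rightarrow> ('k, 'l, 'v) weak_hopf_scheme \<Rightarrow> ('h \<Rightarrow> 'l) set" where
  "weak_hopf_hom H L =
     {f \<in> algebra_hom H L.
        \<forall>h\<in>carrier H.
          comult L (f h) = tensor_map class_ring H H L L f f (comult H h) \<and>
          counit L (f h) = counit H h \<and>
          antipode L (f h) = f (antipode H h)}"

definition weak_hopf_isomorphic ::
  "('k::field, 'h, 'u) weak_hopf_scheme \<Rightarrow> ('k, 'l, 'v) weak_hopf_scheme \<Rightarrow> bool" where
  "weak_hopf_isomorphic H L \<longleftrightarrow>
     (\<exists>f \<in> weak_hopf_hom H L. bij_betw f (carrier H) (carrier L))"

text \<open>The span below is the image of \<open>U \<otimes> U\<close> in \<open>H \<otimes> H\<close>.\<close>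

definition weak_hopf_subalgebra ::
  "'h set \<Rightarrow> ('k::field, 'h, 'u) weak_hopf_scheme \<Rightarrow> bool" where
  "weak_hopf_subalgebra U H \<longleftrightarrow>
     subalgebra U H \<and>
     (\<forall>u\<in>U. comult H u \<in> LinearCombinations.module.span class_ring (H \<otimes>\<^sub>k H)
                             {tens class_ring H H x y | x y. x \<in> U \<and> y \<in> U}) \<and>
     (\<forall>u\<in>U. antipode H u \<in> U)"

definition minimal_weak_hopf_algebra :: "('k::field, 'h, 'u) weak_hopf_scheme \<Rightarrow> bool" where
  "minimal_weak_hopf_algebra H \<longleftrightarrow>
     weak_hopf_algebra H \<and> (\<forall>U. weak_hopf_subalgebra U H \<longrightarrow> U = carrier H)"


section \<open>The weak Hopf algebra of a triple\<close>

definition admissible_triple :: "('k::field, 'b) module \<Rightarrow> 'b set \<Rightarrow> 'b \<Rightarrow> bool" where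
  "admissible_triple B A g \<longleftrightarrow>
     k_algebra B \<and> vectorspace.fin_dim class_ring B \<and> semisimple_ring B \<and>
     subalgebra A B \<and> A \<subseteq> ring_center B \<and>
     g \<in> Units B \<and>
     (\<forall>n \<pi>. matrix_representation B n \<pi> \<longrightarrow> mat_trace (\<pi> g) = of_nat n)"

definition regular_module :: "('k, 'b) module \<Rightarrow> ('b, 'b) module" where
  "regular_module B =
     \<lparr> carrier = carrier B, mult = mult B, one = \<one>\<^bsub>B\<^esub>, zero = \<zero>\<^bsub>B\<^esub>, add = add B,
       smult = mult B \<rparr>"

text \<open>
  \<open>bbar B A b c\<close> is the element \<open>b \<otimes> c\<close> of \<open>B \<otimes>\<^sub>A B\<^sup>o\<^sup>p\<close>, that is, the product of \<open>b\<close>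
  and the copy of \<open>c\<close> in the opposite algebra.
\<close>

definition bbar :: "('k::field, 'b) module \<Rightarrow> 'b set \<Rightarrow> 'b \<Rightarrow> 'b \<Rightarrow> ('b \<times> 'b \<Rightarrow> 'b) set" where
  "bbar B A = tens (B\<lparr>carrier := A\<rparr>) (regular_module B) (regular_module (opposite B))"

definition bbar_lift ::
  "('k::field, 'b) module \<Rightarrow> 'b set \<Rightarrow> ('p, 'w) ring_scheme \<Rightarrow> ('b \<Rightarrow> 'b \<Rightarrow> 'p)
    \<Rightarrow> ('b \<times> 'b \<Rightarrow> 'b) set \<Rightarrow> 'p" where
  "bbar_lift B A =
     tensor_lift (B\<lparr>carrier := A\<rparr>) (regular_module B) (regular_module (opposite B))"

definition Hmin_algebra ::
  "('k::field, 'b) module \<Rightarrow> 'b set \<Rightarrow> ('k, ('b \<times> 'b \<Rightarrow> 'b) set) module" where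
  "Hmin_algebra B A =
    (let T = tensor_algebra (B\<lparr>carrier := A\<rparr>) (regular_module B) (regular_module (opposite B)) in
     \<lparr> carrier = carrier T, mult = mult T, one = \<one>\<^bsub>T\<^esub>, zero = \<zero>\<^bsub>T\<^esub>, add = add T,
       smult = (\<lambda>c t. (c \<odot>\<^bsub>B\<^esub> \<one>\<^bsub>B\<^esub>) \<odot>\<^bsub>T\<^esub> t) \<rparr>)"

text \<open>\<open>Hmin_delta B A g E b c\<close> is \<open>\<Sum> b \<otimes> g e\<^sub>1\<close> (in the first factor) tensor \<open>e\<^sub>2 \<otimes> c\<close>, for \<open>E = \<Sum> e\<^sub>1 \<otimes> e\<^sub>2\<close>.\<close>

definition Hmin_delta ::
  "('k::field, 'b) module \<Rightarrow> 'b set \<Rightarrow> 'b \<Rightarrow> ('b \<times> 'b \<Rightarrow> 'k) set \<Rightarrow> 'b \<Rightarrow> 'b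
    \<Rightarrow> (('b \<times> 'b \<Rightarrow> 'b) set \<times> ('b \<times> 'b \<Rightarrow> 'b) set \<Rightarrow> 'k) set" where
  "Hmin_delta B A g E b c =
    (let H = Hmin_algebra B A in
     tensor_lift class_ring B B (H \<otimes>\<^sub>k H)
       (\<lambda>e1 e2. tens class_ring H H (bbar B A b (g \<otimes>\<^bsub>B\<^esub> e1)) (bbar B A e2 c)) E)"

definition Hmin ::
  "('k::field, 'b) module \<Rightarrow> 'b set \<Rightarrow> 'b \<Rightarrow> ('k, ('b \<times> 'b \<Rightarrow> 'b) set) weak_hopf" where
  "Hmin B A g =
    (let H = Hmin_algebra B A; E = (THE E. two_sided_separability_element B E) in
     \<lparr> carrier = carrier H, mult = mult H, one = \<one>\<^bsub>H\<^esub>, zero = \<zero>\<^bsub>H\<^esub>, add = add H,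
       smult = smult H,
       comult = bbar_lift B A (H \<otimes>\<^sub>k H) (Hmin_delta B A g E),
       counit = bbar_lift B A (class_ring :: 'k ring)
         (\<lambda>b c. reg_trace B (inv\<^bsub>B\<^esub> g \<otimes>\<^bsub>B\<^esub> c \<otimes>\<^bsub>B\<^esub> b)),
       antipode = bbar_lift B A H
         (\<lambda>b c. bbar B A (inv\<^bsub>B\<^esub> g \<otimes>\<^bsub>B\<^esub> c \<otimes>\<^bsub>B\<^esub> g) b) \<rparr>)"

end

theory Submission
  imports Defs "Jordan_Normal_Form.Char_Poly"
begin

text \<open>
  Write \<open>\<Sum> X\<^sub>i \<otimes> Y\<^sub>i\<close> for the Casimir element of the trace form \<open>(x, y) \<mapsto> Tr (x y)\<close> of \<open>B\<close>, where \<open>Tr\<close> is the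
  trace of the regular representation. In characteristic \<open>0\<close> a finite dimensional semisimple algebra has a
  nondegenerate trace form (\<open>Tr_nondegenerate\<close>: the trace of an idempotent \<open>e\<close> is the dimension of
  \<open>e B\<close>), so dual bases exist. Moving elements across the Casimir element (\<open>casimir_left\<close>,
  \<open>casimir_right\<close>, \<open>casimir_sym\<close>) shows that it is the unique two-sided separability element. The condition
  \<open>Tr (\<pi> g) = deg \<pi>\<close> for all \<open>\<pi>\<close> is equivalent to the single equation \<open>\<Sum> X\<^sub>i g Y\<^sub>i = 1\<close>
  (\<open>avg_one_imp_trace\<close>, \<open>trace_imp_avg_one\<close>), and in this form it enters everything that follows. In
  particular the axioms for \<open>H\<^sub>m\<^sub>i\<^sub>n\<close> become Casimir calculations on the generators \<open>b c\<close> (locale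
  \<open>hmin\<close>). It is minimal because slicing \<open>\<Delta>(1)\<close> with the counit recovers both copies of \<open>B\<close>.

  For the isomorphism criterion, an isomorphism of weak Hopf algebras preserves the target counital map,
  whose image is the left copy of \<open>B\<close>; this gives \<open>\<tau>\<close>. It maps \<open>A\<close> to \<open>A'\<close> because \<open>A\<close> consists of those
  \<open>b\<close> whose left and right copies agree (\<open>A_characterization\<close>), and \<open>g\<close> to \<open>g'\<close> because the counit
  determines \<open>g\<close> through the nondegenerate trace form.

  Conversely let \<open>H\<close> be minimal and \<open>B = H\<^sub>t\<close>. The legs of \<open>\<Delta>(1) = \<Sum> w\<^sub>i \<otimes> z\<^sub>i\<close> lie in \<open>H\<^sub>s\<close> and \<open>H\<^sub>t\<close>,
  and \<open>S\<close> restricts to an anti-isomorphism \<open>H\<^sub>t \<rightarrow> H\<^sub>s\<close>. With \<open>w\<^sub>i = S e\<^sub>i\<close> the families \<open>z\<close> and \<open>e\<close> are dual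
  for the counit, so the counit is a Frobenius form on \<open>B\<close> and \<open>\<Sum> z\<^sub>i \<otimes> e\<^sub>i\<close> is a separability element;
  hence \<open>B\<close> is semisimple. Comparing the Frobenius form with the trace form yields \<open>g\<close>
  (locale \<open>frobenius\<close>): \<open>\<epsilon>(x) = Tr (g\<^sup>-\<^sup>1 x)\<close>, \<open>\<Sum> X\<^sub>i g Y\<^sub>i = 1\<close> and \<open>S\<^sup>2 x = g\<^sup>-\<^sup>1 x g\<close>. With \<open>A = H\<^sub>t \<inter> H\<^sub>s\<close>
  the formula \<open>b c \<mapsto> b S(c)\<close> defines a morphism from the weak Hopf algebra of \<open>(B, A, g)\<close> to \<open>H\<close>, and its
  image is a weak Hopf subalgebra, hence all of \<open>H\<close>.

  It remains to see that the kernel vanishes. The kernel of \<open>\<phi> : B \<otimes> B\<^sup>o\<^sup>p \<rightarrow> H\<close> is generated by \<open>1 - p\<close> for a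
  central idempotent \<open>p\<close>, because \<open>B \<otimes> B\<^sup>o\<^sup>p\<close> is semisimple. Write \<open>p = \<Sum> a\<^sub>r \<otimes> b\<^sub>r\<close> with central \<open>a\<^sub>r\<close>,
  \<open>b\<^sub>r\<close>. Evaluating \<open>\<Delta>(1) = \<Delta>(\<phi> p)\<close> in two ways shows that every slice \<open>\<Sum> l(b\<^sub>r) a\<^sub>r\<close> of \<open>p\<close> is fixed by the
  antipode, so that it lies in \<open>A\<close> (\<open>leg_in_A\<close>). In \<open>B \<otimes>\<^sub>A B\<^sup>o\<^sup>p\<close> these slices move to the right leg, where
  \<open>\<phi> p = 1\<close> shows that \<open>p\<close> becomes \<open>1\<close> (\<open>q_p\<close>). An element of the kernel is therefore \<open>0\<close> there.
\<close>


section \<open>Additive maps and finite sums\<close>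

syntax
  "_finsum_less" :: "index \<Rightarrow> idt \<Rightarrow> 'b \<Rightarrow> 'c \<Rightarrow> 'c"  ("(3\<Oplus>__<_. _)" [1000, 0, 51, 10] 10)
translations
  "\<Oplus>\<^bsub>G\<^esub>i<n. b" \<rightleftharpoons> "CONST finsum G (\<lambda>i. b) {..<n}"

definition addmap :: "('a, 'm) ring_scheme \<Rightarrow> ('b, 'n) ring_scheme \<Rightarrow> ('a \<Rightarrow> 'b) \<Rightarrow> bool" where
  "addmap M P f \<longleftrightarrow> (\<forall>x\<in>carrier M. f x \<in> carrier P) \<and>
     (\<forall>x\<in>carrier M. \<forall>y\<in>carrier M. f (x \<oplus>\<^bsub>M\<^esub> y) = f x \<oplus>\<^bsub>P\<^esub> f y)"

lemma addmapI:
  assumes "\<And>x. x \<in> carrier M ==> f x \<in> carrier P"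
    and "\<And>x y. x \<in> carrier M ==> y \<in> carrier M ==> f (x \<oplus>\<^bsub>M\<^esub> y) = f x \<oplus>\<^bsub>P\<^esub> f y"
  shows "addmap M P f"
  using assms by (simp add: addmap_def)

lemma addmap_closed: "addmap M P f ==> x \<in> carrier M ==> f x \<in> carrier P"
  by (simp add: addmap_def)

lemma addmap_add:
  "addmap M P f ==> x \<in> carrier M ==> y \<in> carrier M ==> f (x \<oplus>\<^bsub>M\<^esub> y) = f x \<oplus>\<^bsub>P\<^esub> f y"
  by (simp add: addmap_def)

lemma addmap_zero:
  assumes "abelian_group M" "abelian_group P" "addmap M P f"
  shows "f \<zero>\<^bsub>M\<^esub> = \<zero>\<^bsub>P\<^esub>"
proof -
  interpret M: abelian_group M by fact
  interpret P: abelian_group P by fact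
  have "f \<zero>\<^bsub>M\<^esub> \<oplus>\<^bsub>P\<^esub> f \<zero>\<^bsub>M\<^esub> = f \<zero>\<^bsub>M\<^esub>"
    using addmap_add[OF assms(3), of "\<zero>\<^bsub>M\<^esub>" "\<zero>\<^bsub>M\<^esub>"] by simp
  then show ?thesis
    using addmap_closed[OF assms(3), of "\<zero>\<^bsub>M\<^esub>"] P.add.r_cancel_one by simp
qed

lemma addmap_minus:
  assumes "abelian_group M" "abelian_group P" "addmap M P f" "x \<in> carrier M"
  shows "f (\<ominus>\<^bsub>M\<^esub> x) = \<ominus>\<^bsub>P\<^esub> f x"
proof -
  interpret M: abelian_group M by fact
  interpret P: abelian_group P by fact
  have "f (\<ominus>\<^bsub>M\<^esub> x) \<oplus>\<^bsub>P\<^esub> f x = \<zero>\<^bsub>P\<^esub>"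
    using addmap_add[OF assms(3), of "\<ominus>\<^bsub>M\<^esub> x" x] assms(4) addmap_zero[OF assms(1-3)]
    by (simp add: M.l_neg)
  then show ?thesis
    using addmap_closed[OF assms(3)] assms(4) by (metis M.a_inv_closed P.minus_equality)
qed

lemma addmap_finsum:
  assumes "abelian_group M" "abelian_group P" "addmap M P f"
    and "\<And>i. i \<in> I ==> a i \<in> carrier M"
  shows "f (\<Oplus>\<^bsub>M\<^esub>i\<in>I. a i) = (\<Oplus>\<^bsub>P\<^esub>i\<in>I. f (a i))"
proof -
  interpret M: abelian_group M by fact
  interpret P: abelian_group P by fact
  have "(\<forall>i\<in>I. a i \<in> carrier M) \<longrightarrow> f (\<Oplus>\<^bsub>M\<^esub>i\<in>I. a i) = (\<Oplus>\<^bsub>P\<^esub>i\<in>I. f (a i))"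
  proof (induction I rule: infinite_finite_induct)
    case (insert i I)
    then show ?case
      by (auto simp: addmap_add[OF assms(3)] addmap_closed[OF assms(3)] Pi_def)
  qed (auto simp: addmap_zero[OF assms(1-3)])
  then show ?thesis using assms(4) by blast
qed

lemma hom_add_monoid_iff: "f \<in> hom (add_monoid M) (add_monoid P) \<longleftrightarrow> addmap M P f"
  by (auto simp: hom_def addmap_def)

lemma class_ring_abelian_group: "abelian_group (class_ring :: 'k::field ring)"
  using class_field field.is_ring ring.is_abelian_group by blast

lemma finsum_swap:
  assumes "abelian_group P" "finite I" "finite J"
    and "\<And>i j. i \<in> I ==> j \<in> J ==> a i j \<in> carrier P"
  shows "(\<Oplus>\<^bsub>P\<^esub>i\<in>I. \<Oplus>\<^bsub>P\<^esub>j\<in>J. a i j) = (\<Oplus>\<^bsub>P\<^esub>j\<in>J. \<Oplus>\<^bsub>P\<^esub>i\<in>I. a i j)"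
proof -
  interpret P: abelian_group P by fact
  from assms(2,4) show ?thesis
  proof (induction I rule: finite_induct)
    case (insert i I)
    have "(\<Oplus>\<^bsub>P\<^esub>i\<in>insert i I. \<Oplus>\<^bsub>P\<^esub>j\<in>J. a i j)
        = (\<Oplus>\<^bsub>P\<^esub>j\<in>J. a i j) \<oplus>\<^bsub>P\<^esub> (\<Oplus>\<^bsub>P\<^esub>j\<in>J. \<Oplus>\<^bsub>P\<^esub>i\<in>I. a i j)"
      using insert by (simp add: Pi_def)
    also have "\<dots> = (\<Oplus>\<^bsub>P\<^esub>j\<in>J. a i j \<oplus>\<^bsub>P\<^esub> (\<Oplus>\<^bsub>P\<^esub>i\<in>I. a i j))"
      using insert by (subst P.finsum_addf) (auto simp: Pi_def)
    also have "\<dots> = (\<Oplus>\<^bsub>P\<^esub>j\<in>J. \<Oplus>\<^bsub>P\<^esub>i\<in>insert i I. a i j)"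
      using insert by (intro P.finsum_cong') (auto simp: Pi_def)
    finally show ?case .
  qed simp
qed

lemma finsum_cong_P:
  assumes "abelian_group P" "\<And>i. i \<in> I ==> a i = b i" "\<And>i. i \<in> I ==> b i \<in> carrier P"
  shows "(\<Oplus>\<^bsub>P\<^esub>i\<in>I. a i) = (\<Oplus>\<^bsub>P\<^esub>i\<in>I. b i)"
proof -
  interpret P: abelian_group P by fact
  show ?thesis using assms by (intro P.finsum_cong') auto
qed

section \<open>Tensor products of modules\<close>

text \<open>Any biadditive balanced map extends to the tensor product; this is the hypothesis of every \<open>tensor_lift\<close> below.\<close>

definition balanced ::
  "('r, 'q) ring_scheme \<Rightarrow> ('r, 'm, 'u) module_scheme \<Rightarrow> ('r, 'n, 'v) module_scheme
    \<Rightarrow> ('p, 'w) ring_scheme \<Rightarrow> ('m \<Rightarrow> 'n \<Rightarrow> 'p) \<Rightarrow> bool" where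
  "balanced R M N P \<beta> \<longleftrightarrow>
     (\<forall>x\<in>carrier M. \<forall>y\<in>carrier N. \<beta> x y \<in> carrier P) \<and>
     (\<forall>x\<in>carrier M. \<forall>x'\<in>carrier M. \<forall>y\<in>carrier N.
        \<beta> (x \<oplus>\<^bsub>M\<^esub> x') y = \<beta> x y \<oplus>\<^bsub>P\<^esub> \<beta> x' y) \<and>
     (\<forall>x\<in>carrier M. \<forall>y\<in>carrier N. \<forall>y'\<in>carrier N.
        \<beta> x (y \<oplus>\<^bsub>N\<^esub> y') = \<beta> x y \<oplus>\<^bsub>P\<^esub> \<beta> x y') \<and>
     (\<forall>r\<in>carrier R. \<forall>x\<in>carrier M. \<forall>y\<in>carrier N.
        \<beta> (r \<odot>\<^bsub>M\<^esub> x) y = \<beta> x (r \<odot>\<^bsub>N\<^esub> y))"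

lemma balancedI:
  assumes "\<And>x y. x \<in> carrier M ==> y \<in> carrier N ==> \<beta> x y \<in> carrier P"
    and "\<And>x x' y. x \<in> carrier M ==> x' \<in> carrier M ==> y \<in> carrier N ==>
          \<beta> (x \<oplus>\<^bsub>M\<^esub> x') y = \<beta> x y \<oplus>\<^bsub>P\<^esub> \<beta> x' y"
    and "\<And>x y y'. x \<in> carrier M ==> y \<in> carrier N ==> y' \<in> carrier N ==>
          \<beta> x (y \<oplus>\<^bsub>N\<^esub> y') = \<beta> x y \<oplus>\<^bsub>P\<^esub> \<beta> x y'"
    and "\<And>r x y. r \<in> carrier R ==> x \<in> carrier M ==> y \<in> carrier N ==>
          \<beta> (r \<odot>\<^bsub>M\<^esub> x) y = \<beta> x (r \<odot>\<^bsub>N\<^esub> y)"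
  shows "balanced R M N P \<beta>"
  using assms by (simp add: balanced_def)

text \<open>Finite support is what makes the pointwise operations stay inside the free module.\<close>

lemma free_module_is_module:
  fixes R :: "('a, 'q) ring_scheme" (structure) and X :: "'b set"
  assumes "cring R"
  shows "Module.module R (free_module R X)"
proof -
  interpret cring R by fact
  have fin: "finite {x. f x \<oplus> g x \<noteq> \<zero>}"
    if "finite {x. f x \<noteq> \<zero>}" "finite {x. g x \<noteq> \<zero>}" for f g :: "'b \<Rightarrow> 'a"
    by (rule finite_subset[OF _ finite_UnI[OF that]]) auto
  have fin2: "finite {x. r \<otimes> f x \<noteq> \<zero>}"
    if "finite {x. f x \<noteq> \<zero>}" "r \<in> carrier R" for f :: "'b \<Rightarrow> 'a" and r
    by (rule finite_subset[OF _ that(1)]) (use that(2) in auto)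
  let ?F = "free_module R X"
  have mem: "f x \<in> carrier R" if "f \<in> carrier ?F" for f x
    using that by (cases "x \<in> X") (auto simp: free_module_def)
  have memI: "f \<in> carrier ?F"
    if "\<And>x. x \<in> X ==> f x \<in> carrier R" "\<And>x. x \<notin> X ==> f x = \<zero>" "finite {x. f x \<noteq> \<zero>}" for f
    using that by (simp add: free_module_def)
  have out: "f x = \<zero>" if "f \<in> carrier ?F" "x \<notin> X" for f x
    using that by (simp add: free_module_def)
  have supp: "finite {x. f x \<noteq> \<zero>}" if "f \<in> carrier ?F" for f
    using that by (simp add: free_module_def)
  have add: "f \<oplus>\<^bsub>?F\<^esub> g = (\<lambda>x. f x \<oplus> g x)" for f g by (simp add: free_module_def)
  have smult: "r \<odot>\<^bsub>?F\<^esub> f = (\<lambda>x. r \<otimes> f x)" for r f by (simp add: free_module_def)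
  have zero: "\<zero>\<^bsub>?F\<^esub> = (\<lambda>x. \<zero>)" by (simp add: free_module_def)
  show ?thesis
  proof (rule module_criteria[OF assms], goal_cases)
    case 1
    show ?case unfolding zero by (rule memI) auto
  next
    case 2
    show ?case unfolding add by (intro allI impI memI) (simp_all add: mem out fin[OF supp supp])
  next
    case 3
    show ?case
    proof
      fix v assume v: "v \<in> carrier ?F"
      have "{x. \<ominus> v x \<noteq> \<zero>} \<subseteq> {x. v x \<noteq> \<zero>}" by auto
      then have "finite {x. \<ominus> v x \<noteq> \<zero>}" using supp[OF v] finite_subset by blast
      then show "\<exists>w\<in>carrier ?F. v \<oplus>\<^bsub>?F\<^esub> w = \<zero>\<^bsub>?F\<^esub>"
        unfolding add zero
        by (intro bexI[of _ "\<lambda>x. \<ominus> v x"] memI ext) (simp_all add: mem[OF v] out[OF v] r_neg)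
    qed
  next
    case 4
    show ?case unfolding smult by (intro allI impI memI) (simp_all add: mem out fin2[OF supp])
  next
    case 5
    show ?case unfolding add by (auto intro!: ext simp: mem a_comm)
  next
    case 6
    show ?case unfolding add by (auto intro!: ext simp: mem a_assoc)
  next
    case 7
    show ?case unfolding add zero by (auto intro!: ext simp: mem)
  next
    case 8
    show ?case unfolding smult by (auto intro!: ext simp: mem m_assoc)
  next
    case 9
    show ?case unfolding smult by (auto intro!: ext simp: mem)
  next
    case 10
    show ?case unfolding smult add by (auto intro!: ext simp: mem l_distr)
  next
    case 11
    show ?case unfolding smult add by (auto intro!: ext simp: mem r_distr)
  qed
qed

locale tensor_pair = M: Module.module R M + N: Module.module R N for R (structure) and M and N
begin

abbreviation "X \<equiv> carrier M \<times> carrier N"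
abbreviation "F \<equiv> free_module R X"
abbreviation "U \<equiv> tensor_relations R M N"
abbreviation "T \<equiv> tensor_product R M N"
abbreviation "tn \<equiv> tens R M N"

sublocale F: Module.module R F
  by (rule free_module_is_module) (rule M.R.is_cring)

lemma gen_closed: "p \<in> X ==> free_gen R p \<in> carrier F"
proof -
  assume p: "p \<in> X"
  have "finite {x. free_gen R p x \<noteq> \<zero>}"
    by (rule finite_subset[of _ "{p}"]) (auto simp: free_gen_def)
  with p show ?thesis by (auto simp: free_module_def free_gen_def)
qed

definition rels where "rels =
      ({free_gen R (x \<oplus>\<^bsub>M\<^esub> x', y) \<ominus>\<^bsub>F\<^esub> (free_gen R (x, y) \<oplus>\<^bsub>F\<^esub> free_gen R (x', y)) | x x' y.
          x \<in> carrier M \<and> x' \<in> carrier M \<and> y \<in> carrier N} \<union>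
       {free_gen R (x, y \<oplus>\<^bsub>N\<^esub> y') \<ominus>\<^bsub>F\<^esub> (free_gen R (x, y) \<oplus>\<^bsub>F\<^esub> free_gen R (x, y')) | x y y'.
          x \<in> carrier M \<and> y \<in> carrier N \<and> y' \<in> carrier N} \<union>
       {free_gen R (r \<odot>\<^bsub>M\<^esub> x, y) \<ominus>\<^bsub>F\<^esub> (r \<odot>\<^bsub>F\<^esub> free_gen R (x, y)) | r x y.
          r \<in> carrier R \<and> x \<in> carrier M \<and> y \<in> carrier N} \<union>
       {free_gen R (x, r \<odot>\<^bsub>N\<^esub> y) \<ominus>\<^bsub>F\<^esub> (r \<odot>\<^bsub>F\<^esub> free_gen R (x, y)) | r x y.
          r \<in> carrier R \<and> x \<in> carrier M \<and> y \<in> carrier N})"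

lemma U_eq: "U = F.span rels"
  by (simp add: tensor_relations_def rels_def Let_def)

lemma rels_closed: "rels \<subseteq> carrier F"
  unfolding rels_def
  by (auto intro!: F.M.minus_closed F.M.a_closed F.smult_closed gen_closed)

lemma U_submodule: "submodule R U F"
  unfolding U_eq by (rule F.span_is_submodule[OF rels_closed])

lemma U_subset: "U \<subseteq> carrier F"
  using submodule.subset[OF U_submodule] .

lemma rels_in_U: "rels \<subseteq> U"
  unfolding U_eq by (rule F.in_own_span[OF rels_closed])

lemma U_zero: "\<zero>\<^bsub>F\<^esub> \<in> U" and U_add: "u \<in> U ==> v \<in> U ==> u \<oplus>\<^bsub>F\<^esub> v \<in> U"
  and U_smult: "r \<in> carrier R ==> u \<in> U ==> r \<odot>\<^bsub>F\<^esub> u \<in> U"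
  using U_submodule unfolding submodule_def by auto

lemma U_minus: "u \<in> U ==> \<ominus>\<^bsub>F\<^esub> u \<in> U"
proof -
  assume u: "u \<in> U"
  then have "(\<ominus> \<one>) \<odot>\<^bsub>F\<^esub> u \<in> U" by (intro U_smult) auto
  then show ?thesis using u U_subset F.smult_minus_1 by auto
qed

definition cls where "cls f = U +>\<^bsub>F\<^esub> f"

lemma cls_mem: "h \<in> cls f \<longleftrightarrow> (\<exists>u\<in>U. h = u \<oplus>\<^bsub>F\<^esub> f)"
  by (auto simp: cls_def a_r_coset_def r_coset_def)

lemma carrier_T: "carrier T = cls ` carrier F"
  by (auto simp: tensor_product_def Let_def A_RCOSETS_def RCOSETS_def cls_def a_r_coset_def)

lemma cls_self: "f \<in> carrier F ==> f \<in> cls f"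
  unfolding cls_mem by (rule bexI[OF _ U_zero]) simp

text \<open>Cosets of the relation submodule are handled through their representatives: equality becomes membership of a difference in
  \<open>U\<close>.\<close>

lemma cls_eq_iff:
  assumes "f \<in> carrier F" "g \<in> carrier F"
  shows "cls f = cls g \<longleftrightarrow> f \<ominus>\<^bsub>F\<^esub> g \<in> U"
proof
  assume "cls f = cls g"
  then obtain u where u: "u \<in> U" "f = u \<oplus>\<^bsub>F\<^esub> g"
    using cls_self[OF assms(1)] cls_mem by auto
  then have "f \<ominus>\<^bsub>F\<^esub> g = u"
    using assms U_subset by (auto simp: F.M.minus_eq F.M.a_assoc F.M.r_neg subset_eq)
  then show "f \<ominus>\<^bsub>F\<^esub> g \<in> U" using u by simp
next
  assume d: "f \<ominus>\<^bsub>F\<^esub> g \<in> U"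
  have sub: "cls f' \<subseteq> cls g'" if "f' \<in> carrier F" "g' \<in> carrier F" "f' \<ominus>\<^bsub>F\<^esub> g' \<in> U" for f' g'
  proof
    fix h assume "h \<in> cls f'"
    then obtain u where u: "u \<in> U" "h = u \<oplus>\<^bsub>F\<^esub> f'" using cls_mem by auto
    have uF: "u \<in> carrier F" using u U_subset by blast
    have "h = (u \<oplus>\<^bsub>F\<^esub> (f' \<ominus>\<^bsub>F\<^esub> g')) \<oplus>\<^bsub>F\<^esub> g'"
      using uF that(1,2) u(2) by (simp add: F.M.minus_eq F.M.a_assoc F.M.l_neg)
    then show "h \<in> cls g'" using u(1) that(3) U_add cls_mem by blast
  qed
  have "g \<ominus>\<^bsub>F\<^esub> f = \<ominus>\<^bsub>F\<^esub> (f \<ominus>\<^bsub>F\<^esub> g)"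
    using assms by (simp add: F.M.minus_eq F.M.minus_add F.M.a_comm)
  then have "g \<ominus>\<^bsub>F\<^esub> f \<in> U" using U_minus[OF d] by simp
  then show "cls f = cls g" using sub assms d by blast
qed

lemma cls_add:
  assumes "f \<in> carrier F" "g \<in> carrier F"
  shows "cls f \<oplus>\<^bsub>T\<^esub> cls g = cls (f \<oplus>\<^bsub>F\<^esub> g)"
proof -
  have "cls f \<oplus>\<^bsub>T\<^esub> cls g = {h \<oplus>\<^bsub>F\<^esub> h' | h h'. h \<in> cls f \<and> h' \<in> cls g}"
    by (auto simp: tensor_product_def Let_def set_add_def set_mult_def)
  also have "\<dots> = cls (f \<oplus>\<^bsub>F\<^esub> g)"
  proof (intro equalityI subsetI)
    fix h assume "h \<in> {h \<oplus>\<^bsub>F\<^esub> h' | h h'. h \<in> cls f \<and> h' \<in> cls g}"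
    then obtain u v where uv: "u \<in> U" "v \<in> U" "h = (u \<oplus>\<^bsub>F\<^esub> f) \<oplus>\<^bsub>F\<^esub> (v \<oplus>\<^bsub>F\<^esub> g)"
      using cls_mem by auto
    have "u \<in> carrier F" "v \<in> carrier F" using uv U_subset by auto
    then have "h = (u \<oplus>\<^bsub>F\<^esub> v) \<oplus>\<^bsub>F\<^esub> (f \<oplus>\<^bsub>F\<^esub> g)"
      using uv(3) assms by (simp add: F.M.a_assoc F.M.a_lcomm)
    then show "h \<in> cls (f \<oplus>\<^bsub>F\<^esub> g)" using uv U_add cls_mem by blast
  next
    fix h assume "h \<in> cls (f \<oplus>\<^bsub>F\<^esub> g)"
    then obtain u where u: "u \<in> U" "h = u \<oplus>\<^bsub>F\<^esub> (f \<oplus>\<^bsub>F\<^esub> g)" using cls_mem by auto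
    have "u \<in> carrier F" using u U_subset by auto
    then have "h = (u \<oplus>\<^bsub>F\<^esub> f) \<oplus>\<^bsub>F\<^esub> g" using u assms by (simp add: F.M.a_assoc)
    then show "h \<in> {h \<oplus>\<^bsub>F\<^esub> h' | h h'. h \<in> cls f \<and> h' \<in> cls g}"
      using u(1) cls_mem cls_self[OF assms(2)] by blast
  qed
  finally show ?thesis .
qed

lemma cls_smult:
  assumes "r \<in> carrier R" "f \<in> carrier F"
  shows "r \<odot>\<^bsub>T\<^esub> cls f = cls (r \<odot>\<^bsub>F\<^esub> f)"
proof -
  have "r \<odot>\<^bsub>T\<^esub> cls f = {u \<oplus>\<^bsub>F\<^esub> (r \<odot>\<^bsub>F\<^esub> h) | u h. u \<in> U \<and> h \<in> cls f}"
    by (auto simp: tensor_product_def Let_def set_add_def set_mult_def cls_def)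
  also have "\<dots> = cls (r \<odot>\<^bsub>F\<^esub> f)"
  proof (intro equalityI subsetI)
    fix h assume "h \<in> {u \<oplus>\<^bsub>F\<^esub> (r \<odot>\<^bsub>F\<^esub> h) | u h. u \<in> U \<and> h \<in> cls f}"
    then obtain u v where uv: "u \<in> U" "v \<in> U" "h = u \<oplus>\<^bsub>F\<^esub> (r \<odot>\<^bsub>F\<^esub> (v \<oplus>\<^bsub>F\<^esub> f))"
      using cls_mem by auto
    have "u \<in> carrier F" "v \<in> carrier F" using uv U_subset by auto
    then have "h = (u \<oplus>\<^bsub>F\<^esub> (r \<odot>\<^bsub>F\<^esub> v)) \<oplus>\<^bsub>F\<^esub> (r \<odot>\<^bsub>F\<^esub> f)"
      using uv(3) assms by (simp add: F.M.a_assoc F.smult_r_distr)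
    then show "h \<in> cls (r \<odot>\<^bsub>F\<^esub> f)" using uv U_add U_smult assms(1) cls_mem by blast
  qed (use cls_mem cls_self[OF assms(2)] in blast)
  finally show ?thesis .
qed

lemma cls_zero: "cls \<zero>\<^bsub>F\<^esub> = \<zero>\<^bsub>T\<^esub>"
proof -
  have "cls \<zero>\<^bsub>F\<^esub> = U" using U_subset by (auto simp: cls_mem subset_eq)
  then show ?thesis by (simp add: tensor_product_def Let_def)
qed

lemma T_module: "Module.module R T"
proof (rule module_criteria[OF M.R.is_cring], goal_cases)
  case 3
  show ?case
  proof
    fix v assume "v \<in> carrier T"
    then obtain f where f: "f \<in> carrier F" "v = cls f" by (auto simp: carrier_T)
    show "\<exists>w\<in>carrier T. v \<oplus>\<^bsub>T\<^esub> w = \<zero>\<^bsub>T\<^esub>"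
      by (rule bexI[of _ "cls (\<ominus>\<^bsub>F\<^esub> f)"]) (auto simp: f carrier_T cls_add F.M.r_neg cls_zero)
  qed
next
  case 5
  show ?case by (clarsimp simp: carrier_T cls_add) (metis F.M.a_comm)
next
  case 6
  show ?case by (auto simp: carrier_T cls_add F.M.a_assoc)
qed (auto simp: carrier_T cls_add cls_smult F.smult_assoc1 F.smult_l_distr
      F.smult_r_distr simp flip: cls_zero)

sublocale T: Module.module R T by (rule T_module)

lemma tn_cls: "tn x y = cls (free_gen R (x, y))"
  by (simp add: tens_def cls_def)

lemma tn_closed: "x \<in> carrier M ==> y \<in> carrier N ==> tn x y \<in> carrier T"
  by (simp add: tn_cls carrier_T gen_closed)

lemma tn_add_left:
  assumes "x \<in> carrier M" "x' \<in> carrier M" "y \<in> carrier N"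
  shows "tn (x \<oplus>\<^bsub>M\<^esub> x') y = tn x y \<oplus>\<^bsub>T\<^esub> tn x' y"
proof -
  have "free_gen R (x \<oplus>\<^bsub>M\<^esub> x', y) \<ominus>\<^bsub>F\<^esub> (free_gen R (x, y) \<oplus>\<^bsub>F\<^esub> free_gen R (x', y)) \<in> U"
    by (rule subsetD[OF rels_in_U], unfold rels_def, rule UnI1, rule UnI1, rule UnI1, rule CollectI)
      (intro exI conjI, rule refl, (rule assms)+)
  then show ?thesis using assms by (simp add: tn_cls cls_add gen_closed cls_eq_iff)
qed

lemma tn_add_right:
  assumes "x \<in> carrier M" "y \<in> carrier N" "y' \<in> carrier N"
  shows "tn x (y \<oplus>\<^bsub>N\<^esub> y') = tn x y \<oplus>\<^bsub>T\<^esub> tn x y'"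
proof -
  have "free_gen R (x, y \<oplus>\<^bsub>N\<^esub> y') \<ominus>\<^bsub>F\<^esub> (free_gen R (x, y) \<oplus>\<^bsub>F\<^esub> free_gen R (x, y')) \<in> U"
    by (rule subsetD[OF rels_in_U], unfold rels_def, rule UnI1, rule UnI1, rule UnI2, rule CollectI)
      (intro exI conjI, rule refl, (rule assms)+)
  then show ?thesis using assms by (simp add: tn_cls cls_add gen_closed cls_eq_iff)
qed

lemma tn_smult_left:
  assumes "r \<in> carrier R" "x \<in> carrier M" "y \<in> carrier N"
  shows "tn (r \<odot>\<^bsub>M\<^esub> x) y = r \<odot>\<^bsub>T\<^esub> tn x y"
proof -
  have "free_gen R (r \<odot>\<^bsub>M\<^esub> x, y) \<ominus>\<^bsub>F\<^esub> (r \<odot>\<^bsub>F\<^esub> free_gen R (x, y)) \<in> U"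
    by (rule subsetD[OF rels_in_U], unfold rels_def, rule UnI1, rule UnI2, rule CollectI)
      (intro exI conjI, rule refl, (rule assms)+)
  then show ?thesis using assms by (simp add: tn_cls cls_smult gen_closed cls_eq_iff)
qed

lemma tn_smult_right:
  assumes "r \<in> carrier R" "x \<in> carrier M" "y \<in> carrier N"
  shows "tn x (r \<odot>\<^bsub>N\<^esub> y) = r \<odot>\<^bsub>T\<^esub> tn x y"
proof -
  have "free_gen R (x, r \<odot>\<^bsub>N\<^esub> y) \<ominus>\<^bsub>F\<^esub> (r \<odot>\<^bsub>F\<^esub> free_gen R (x, y)) \<in> U"
    by (rule subsetD[OF rels_in_U], unfold rels_def, rule UnI2, rule CollectI)
      (intro exI conjI, rule refl, (rule assms)+)
  then show ?thesis using assms by (simp add: tn_cls cls_smult gen_closed cls_eq_iff)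
qed

lemma F_mem: "f \<in> carrier F ==> f p \<in> carrier R"
  by (cases p; cases "p \<in> X") (auto simp: free_module_def)

lemma F_supp: "f \<in> carrier F ==> f p \<noteq> \<zero> ==> p \<in> X"
  by (rule ccontr) (cases p, auto simp: free_module_def)

lemma F_induct [consumes 1, case_names zero gen]:
  assumes "f \<in> carrier F" and z: "Q \<zero>\<^bsub>F\<^esub>"
    and g: "\<And>r p f. r \<in> carrier R ==> p \<in> X ==> f \<in> carrier F ==> Q f ==>
          Q ((r \<odot>\<^bsub>F\<^esub> free_gen R p) \<oplus>\<^bsub>F\<^esub> f)"
  shows "Q f"
proof -
  have "finite S ==> \<forall>f\<in>carrier F. {p. f p \<noteq> \<zero>} = S \<longrightarrow> Q f" for S
  proof (induction S rule: finite_induct)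
    case empty
    have "f = \<zero>\<^bsub>F\<^esub>" if "{p. f p \<noteq> \<zero>} = {}" for f
      using that by (auto simp: free_module_def)
    then show ?case using z by blast
  next
    case (insert p S)
    show ?case
    proof (intro ballI impI)
      fix f assume f: "f \<in> carrier F" and s: "{p. f p \<noteq> \<zero>} = insert p S"
      define f' where "f' = f(p := \<zero>)"
      have s': "{p. f' p \<noteq> \<zero>} = S" using s insert(2) by (auto simp: f'_def)
      have p: "p \<in> X" using f s by (intro F_supp[OF f]) blast
      have f': "f' \<in> carrier F"
        using f s' insert(1) by (auto simp: free_module_def f'_def)
      have "f = (f p \<odot>\<^bsub>F\<^esub> free_gen R p) \<oplus>\<^bsub>F\<^esub> f'"
        using F_mem[OF f] by (intro ext) (simp add: free_module_def f'_def free_gen_def)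
      then show "Q f" using g[OF F_mem[OF f] p f'] insert(3) f' s' by metis
    qed
  qed
  moreover have "finite {p. f p \<noteq> \<zero>}" using assms(1) by (simp add: free_module_def)
  ultimately show ?thesis using assms(1) by blast
qed

lemma T_induct [consumes 1, case_names pure add]:
  assumes t: "t \<in> carrier T"
    and pure: "\<And>x y. x \<in> carrier M ==> y \<in> carrier N ==> Q (tn x y)"
    and add: "\<And>s t. s \<in> carrier T ==> t \<in> carrier T ==> Q s ==> Q t ==> Q (s \<oplus>\<^bsub>T\<^esub> t)"
  shows "Q t"
proof -
  have zero: "Q \<zero>\<^bsub>T\<^esub>"
  proof -
    have "tn \<zero>\<^bsub>M\<^esub> \<zero>\<^bsub>N\<^esub> = \<zero>\<^bsub>T\<^esub>"
      using tn_smult_left[of \<zero> "\<zero>\<^bsub>M\<^esub>" "\<zero>\<^bsub>N\<^esub>"] tn_closed by simp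
    then show ?thesis using pure[of "\<zero>\<^bsub>M\<^esub>" "\<zero>\<^bsub>N\<^esub>"] by simp
  qed
  obtain f where f: "f \<in> carrier F" "t = cls f" using t by (auto simp: carrier_T)
  from f(1) have "Q (cls f)"
  proof (induction rule: F_induct)
    case zero
    then show ?case using \<open>Q \<zero>\<^bsub>T\<^esub>\<close> by (simp add: cls_zero)
  next
    case (gen r p f)
    obtain x y where p: "p = (x, y)" "x \<in> carrier M" "y \<in> carrier N" using gen(2) by auto
    have "cls ((r \<odot>\<^bsub>F\<^esub> free_gen R p) \<oplus>\<^bsub>F\<^esub> f) = (r \<odot>\<^bsub>T\<^esub> tn x y) \<oplus>\<^bsub>T\<^esub> cls f"
      using gen p by (simp add: tn_cls cls_smult cls_add gen_closed)
    then have "cls ((r \<odot>\<^bsub>F\<^esub> free_gen R p) \<oplus>\<^bsub>F\<^esub> f) = tn (r \<odot>\<^bsub>M\<^esub> x) y \<oplus>\<^bsub>T\<^esub> cls f"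
      using gen p by (simp add: tn_smult_left)
    then show ?case using add[OF tn_closed _ pure] gen p by (simp add: carrier_T)
  qed
  then show ?thesis using f by simp
qed

text \<open>The linear extension of \<open>\<beta>\<close> to the free module. The coefficient is moved into the first argument, so only the
  additive structure of the target \<open>P\<close> is used.\<close>

definition ev :: "('p, 'w) ring_scheme \<Rightarrow> ('c \<Rightarrow> 'e \<Rightarrow> 'p) \<Rightarrow> ('c \<times> 'e \<Rightarrow> 'a) \<Rightarrow> 'p" where
  "ev P \<beta> f = (\<Oplus>\<^bsub>P\<^esub>p\<in>{p. f p \<noteq> \<zero>}. \<beta> (f p \<odot>\<^bsub>M\<^esub> fst p) (snd p))"

context
  fixes P :: "('p, 'w) ring_scheme" and \<beta>
  assumes P: "abelian_group P" and \<beta>: "balanced R M N P \<beta>"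
begin

interpretation P: abelian_group P by (rule P)

lemma \<beta>_closed: "x \<in> carrier M ==> y \<in> carrier N ==> \<beta> x y \<in> carrier P"
  and \<beta>_addl: "x \<in> carrier M ==> x' \<in> carrier M ==> y \<in> carrier N ==>
        \<beta> (x \<oplus>\<^bsub>M\<^esub> x') y = \<beta> x y \<oplus>\<^bsub>P\<^esub> \<beta> x' y"
  and \<beta>_addr: "x \<in> carrier M ==> y \<in> carrier N ==> y' \<in> carrier N ==>
        \<beta> x (y \<oplus>\<^bsub>N\<^esub> y') = \<beta> x y \<oplus>\<^bsub>P\<^esub> \<beta> x y'"
  and \<beta>_bal: "r \<in> carrier R ==> x \<in> carrier M ==> y \<in> carrier N ==>
        \<beta> (r \<odot>\<^bsub>M\<^esub> x) y = \<beta> x (r \<odot>\<^bsub>N\<^esub> y)"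
  using \<beta> by (auto simp: balanced_def)

lemma \<beta>_zero: "y \<in> carrier N ==> \<beta> \<zero>\<^bsub>M\<^esub> y = \<zero>\<^bsub>P\<^esub>"
  using \<beta>_addl[of "\<zero>\<^bsub>M\<^esub>" "\<zero>\<^bsub>M\<^esub>" y] \<beta>_closed[of "\<zero>\<^bsub>M\<^esub>" y] P.add.r_cancel_one by simp

lemma ev_superset:
  assumes "f \<in> carrier F" "finite S" "{p. f p \<noteq> \<zero>} \<subseteq> S" "S \<subseteq> X"
  shows "ev P \<beta> f = (\<Oplus>\<^bsub>P\<^esub>p\<in>S. \<beta> (f p \<odot>\<^bsub>M\<^esub> fst p) (snd p))"
  unfolding ev_def
proof (rule P.add.finprod_mono_neutral_cong_left[OF assms(2,3)])
  show "\<And>i. i \<in> S - {p. f p \<noteq> \<zero>} ==> \<beta> (f i \<odot>\<^bsub>M\<^esub> fst i) (snd i) = \<zero>\<^bsub>P\<^esub>"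
    using assms by (auto simp: \<beta>_zero)
  show "(\<lambda>p. \<beta> (f p \<odot>\<^bsub>M\<^esub> fst p) (snd p)) \<in> S \<rightarrow> carrier P"
    using assms F_mem[OF assms(1)] by (auto intro!: \<beta>_closed)
qed auto

lemma ev_addmap: "addmap F P (ev P \<beta>)"
proof (rule addmapI)
  fix f assume f: "f \<in> carrier F"
  show "ev P \<beta> f \<in> carrier P"
    unfolding ev_def using F_mem[OF f] F_supp[OF f]
    by (intro P.finsum_closed) (auto intro!: \<beta>_closed)
next
  fix f g assume fg: "f \<in> carrier F" "g \<in> carrier F"
  define S where "S = {p. f p \<noteq> \<zero>} \<union> {p. g p \<noteq> \<zero>}"
  have S: "finite S" "S \<subseteq> X" using fg by (auto simp: free_module_def S_def)
  have fgS: "{p. (f \<oplus>\<^bsub>F\<^esub> g) p \<noteq> \<zero>} \<subseteq> S" by (auto simp: S_def free_module_def)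
  have "ev P \<beta> (f \<oplus>\<^bsub>F\<^esub> g) = (\<Oplus>\<^bsub>P\<^esub>p\<in>S. \<beta> ((f \<oplus>\<^bsub>F\<^esub> g) p \<odot>\<^bsub>M\<^esub> fst p) (snd p))"
    using ev_superset[OF _ S(1) fgS S(2)] fg by simp
  also have "\<dots> = (\<Oplus>\<^bsub>P\<^esub>p\<in>S. \<beta> (f p \<odot>\<^bsub>M\<^esub> fst p) (snd p) \<oplus>\<^bsub>P\<^esub> \<beta> (g p \<odot>\<^bsub>M\<^esub> fst p) (snd p))"
  proof (rule finsum_cong_P[OF P])
    fix p assume p: "p \<in> S"
    have "(f \<oplus>\<^bsub>F\<^esub> g) p = f p \<oplus> g p" by (simp add: free_module_def)
    then show "\<beta> ((f \<oplus>\<^bsub>F\<^esub> g) p \<odot>\<^bsub>M\<^esub> fst p) (snd p)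
        = \<beta> (f p \<odot>\<^bsub>M\<^esub> fst p) (snd p) \<oplus>\<^bsub>P\<^esub> \<beta> (g p \<odot>\<^bsub>M\<^esub> fst p) (snd p)"
      using p S(2) F_mem fg by (auto simp: M.smult_l_distr \<beta>_addl subset_eq)
    show "\<beta> (f p \<odot>\<^bsub>M\<^esub> fst p) (snd p) \<oplus>\<^bsub>P\<^esub> \<beta> (g p \<odot>\<^bsub>M\<^esub> fst p) (snd p) \<in> carrier P"
      using p S(2) F_mem fg by (auto simp: subset_eq \<beta>_closed)
  qed
  also have "\<dots> = (\<Oplus>\<^bsub>P\<^esub>p\<in>S. \<beta> (f p \<odot>\<^bsub>M\<^esub> fst p) (snd p))
      \<oplus>\<^bsub>P\<^esub> (\<Oplus>\<^bsub>P\<^esub>p\<in>S. \<beta> (g p \<odot>\<^bsub>M\<^esub> fst p) (snd p))"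
    using S(2) F_mem fg by (intro P.finsum_addf) (auto intro!: \<beta>_closed)
  also have "\<dots> = ev P \<beta> f \<oplus>\<^bsub>P\<^esub> ev P \<beta> g"
    using ev_superset[OF fg(1) S(1) _ S(2)] ev_superset[OF fg(2) S(1) _ S(2)] by (simp add: S_def)
  finally show "ev P \<beta> (f \<oplus>\<^bsub>F\<^esub> g) = ev P \<beta> f \<oplus>\<^bsub>P\<^esub> ev P \<beta> g" .
qed

lemma ev_gen:
  assumes "r \<in> carrier R" "x \<in> carrier M" "y \<in> carrier N"
  shows "ev P \<beta> (r \<odot>\<^bsub>F\<^esub> free_gen R (x, y)) = \<beta> (r \<odot>\<^bsub>M\<^esub> x) y"
proof -
  have "ev P \<beta> (r \<odot>\<^bsub>F\<^esub> free_gen R (x, y))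
      = (\<Oplus>\<^bsub>P\<^esub>p\<in>{(x, y)}. \<beta> ((r \<odot>\<^bsub>F\<^esub> free_gen R (x, y)) p \<odot>\<^bsub>M\<^esub> fst p) (snd p))"
    using assms
    by (intro ev_superset) (auto simp: gen_closed, auto simp: free_module_def free_gen_def split: if_splits)
  also have "\<dots> = \<beta> (r \<odot>\<^bsub>M\<^esub> x) y"
    using assms \<beta>_closed by (simp add: free_module_def free_gen_def)
  finally show ?thesis .
qed

text \<open>The extension kills each generator of the relation submodule, and so it factors through the tensor product.\<close>

lemma ev_U: "u \<in> U ==> ev P \<beta> u = \<zero>\<^bsub>P\<^esub>"
proof -
  let ?K = "{f \<in> carrier F. \<forall>r\<in>carrier R. ev P \<beta> (r \<odot>\<^bsub>F\<^esub> f) = \<zero>\<^bsub>P\<^esub>}"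
  have Fg: "abelian_group F" by (rule F.abelian_group_axioms)
  have ev0: "ev P \<beta> \<zero>\<^bsub>F\<^esub> = \<zero>\<^bsub>P\<^esub>" by (rule addmap_zero[OF Fg P ev_addmap])
  have K: "submodule R ?K F"
    using F.module_axioms
    by (auto simp: submodule_def ev0 F.smult_r_distr addmap_add[OF ev_addmap] simp flip: F.smult_assoc1)
  have evm: "ev P \<beta> (a \<ominus>\<^bsub>F\<^esub> b) = ev P \<beta> a \<ominus>\<^bsub>P\<^esub> ev P \<beta> b"
    if "a \<in> carrier F" "b \<in> carrier F" for a b
    using that by (simp add: F.M.minus_eq P.minus_eq addmap_add[OF ev_addmap] addmap_minus[OF Fg P ev_addmap])
  have eva: "ev P \<beta> (a \<oplus>\<^bsub>F\<^esub> b) = ev P \<beta> a \<oplus>\<^bsub>P\<^esub> ev P \<beta> b"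
    if "a \<in> carrier F" "b \<in> carrier F" for a b
    using that by (simp add: addmap_add[OF ev_addmap])
  have sm: "r \<odot>\<^bsub>F\<^esub> (a \<ominus>\<^bsub>F\<^esub> b) = r \<odot>\<^bsub>F\<^esub> a \<ominus>\<^bsub>F\<^esub> r \<odot>\<^bsub>F\<^esub> b"
    if "r \<in> carrier R" "a \<in> carrier F" "b \<in> carrier F" for r a b
    using that by (simp add: F.M.minus_eq F.smult_r_distr F.smult_r_minus)
  have lcomm: "s \<odot>\<^bsub>N\<^esub> (r \<odot>\<^bsub>N\<^esub> y) = r \<odot>\<^bsub>N\<^esub> (s \<odot>\<^bsub>N\<^esub> y)"
    if "r \<in> carrier R" "s \<in> carrier R" "y \<in> carrier N" for r s y
    using that by (metis M.R.m_comm N.smult_assoc1)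
  have "rels \<subseteq> ?K"
    unfolding rels_def
    by (auto simp: gen_closed sm evm eva F.smult_r_distr ev_gen M.smult_r_distr \<beta>_addl \<beta>_addr \<beta>_closed
        P.r_neg P.minus_eq M.smult_assoc1 \<beta>_bal lcomm simp flip: F.smult_assoc1)
  then have "U \<subseteq> ?K" unfolding U_eq using F.span_is_subset[OF _ K] by blast
  moreover assume "u \<in> U"
  ultimately have "ev P \<beta> (\<one> \<odot>\<^bsub>F\<^esub> u) = \<zero>\<^bsub>P\<^esub>" "u \<in> carrier F" by auto
  then show ?thesis by simp
qed

lemma lift_ex1:
  "\<exists>!\<phi>. \<phi> \<in> extensional (carrier T) \<and> \<phi> \<in> hom (add_monoid T) (add_monoid P) \<and>
       (\<forall>x\<in>carrier M. \<forall>y\<in>carrier N. \<phi> (tn x y) = \<beta> x y)"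
proof (rule ex_ex1I)
  define \<phi> where "\<phi> = restrict (\<lambda>t. ev P \<beta> (SOME f. f \<in> carrier F \<and> cls f = t)) (carrier T)"
  have \<phi>: "\<phi> (cls f) = ev P \<beta> f" if f: "f \<in> carrier F" for f
  proof -
    define g where "g = (SOME g. g \<in> carrier F \<and> cls g = cls f)"
    have g: "g \<in> carrier F \<and> cls g = cls f"
      unfolding g_def by (rule someI[of _ f]) (use f in simp)
    then have "g \<ominus>\<^bsub>F\<^esub> f \<in> U" using f cls_eq_iff[of g f] by blast
    then have "ev P \<beta> ((g \<ominus>\<^bsub>F\<^esub> f) \<oplus>\<^bsub>F\<^esub> f) = ev P \<beta> f"
      using f g by (subst addmap_add[OF ev_addmap])
        (auto simp: ev_U addmap_closed[OF ev_addmap])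
    moreover have "(g \<ominus>\<^bsub>F\<^esub> f) \<oplus>\<^bsub>F\<^esub> f = g"
      using f g by (simp add: F.M.minus_eq F.M.a_assoc F.M.l_neg)
    ultimately show ?thesis using f by (simp add: \<phi>_def carrier_T flip: g_def)
  qed
  have "addmap T P \<phi>"
    by (auto simp: addmap_def carrier_T cls_add \<phi> addmap_closed[OF ev_addmap] addmap_add[OF ev_addmap])
  moreover have "\<phi> (tn x y) = \<beta> x y" if "x \<in> carrier M" "y \<in> carrier N" for x y
    using ev_gen[of \<one> x y] that by (simp add: tn_cls \<phi> gen_closed)
  ultimately show "\<exists>\<phi>. \<phi> \<in> extensional (carrier T) \<and> \<phi> \<in> hom (add_monoid T) (add_monoid P) \<and>
       (\<forall>x\<in>carrier M. \<forall>y\<in>carrier N. \<phi> (tn x y) = \<beta> x y)"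
    by (intro exI[of _ \<phi>]) (auto simp: hom_add_monoid_iff \<phi>_def)
next
  fix \<phi> \<psi>
  assume a: "\<phi> \<in> extensional (carrier T) \<and> \<phi> \<in> hom (add_monoid T) (add_monoid P) \<and>
       (\<forall>x\<in>carrier M. \<forall>y\<in>carrier N. \<phi> (tn x y) = \<beta> x y)"
    and b: "\<psi> \<in> extensional (carrier T) \<and> \<psi> \<in> hom (add_monoid T) (add_monoid P) \<and>
       (\<forall>x\<in>carrier M. \<forall>y\<in>carrier N. \<psi> (tn x y) = \<beta> x y)"
  have "\<phi> t = \<psi> t" if "t \<in> carrier T" for t
    using that
  proof (induction rule: T_induct)
    case (add s t)
    have "addmap T P \<phi>" "addmap T P \<psi>" using a b by (auto simp: hom_add_monoid_iff)
    then show ?case using add by (simp add: addmap_add)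
  qed (use a b in auto)
  then show "\<phi> = \<psi>" using a b by (intro extensionalityI) auto
qed

lemma lift_addmap: "addmap T P (tensor_lift R M N P \<beta>)"
  and lift_tn: "x \<in> carrier M ==> y \<in> carrier N ==> tensor_lift R M N P \<beta> (tn x y) = \<beta> x y"
  using theI'[OF lift_ex1, folded tensor_lift_def] by (simp_all add: hom_add_monoid_iff)

end

end


subsection \<open>The tensor algebra record\<close>

text \<open>As modules, \<open>tensor_algebra R M N\<close> and \<open>tensor_product R M N\<close> coincide; the lemmas below
  are stated for the former, which is the one that carries the multiplication.\<close>

lemma tensor_algebra_simps:
  "carrier (tensor_algebra R M N) = carrier (tensor_product R M N)"
  "add (tensor_algebra R M N) = add (tensor_product R M N)"
  "zero (tensor_algebra R M N) = zero (tensor_product R M N)"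
  "module.smult (tensor_algebra R M N) = module.smult (tensor_product R M N)"
  by (simp_all add: tensor_algebra_def Let_def)

lemma module_cong:
  assumes "Module.module R M" "carrier M' = carrier M" "add M' = add M" "zero M' = zero M" "module.smult M' = module.smult M"
  shows "Module.module R M'"
proof -
  interpret Module.module R M by fact
  show ?thesis
  proof (rule module_criteria[OF R.is_cring], goal_cases)
    case 3
    show ?case using assms(2-4) a_inv_closed r_neg by auto
  next
    case 5
    show ?case using assms(2-3) a_comm by auto
  qed (simp_all add: assms(2-5) a_assoc smult_assoc1 smult_l_distr smult_r_distr)
qed

locale tensor_alg = M: Module.module R M + N: Module.module R N
  for R (structure) and M and N
begin

interpretation tp: tensor_pair R M N ..

abbreviation "TA \<equiv> tensor_algebra R M N"

lemma module: "Module.module R TA"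
  by (rule module_cong[OF tp.T_module]) (simp_all add: tensor_algebra_simps)

lemma tens_closed: "x \<in> carrier M ==> y \<in> carrier N ==> tens R M N x y \<in> carrier TA"
  by (simp add: tensor_algebra_simps tp.tn_closed)

lemma tens_add_left:
  "x \<in> carrier M ==> x' \<in> carrier M ==> y \<in> carrier N ==>
    tens R M N (x \<oplus>\<^bsub>M\<^esub> x') y = tens R M N x y \<oplus>\<^bsub>TA\<^esub> tens R M N x' y"
  by (simp add: tensor_algebra_simps tp.tn_add_left)

lemma tens_add_right:
  "x \<in> carrier M ==> y \<in> carrier N ==> y' \<in> carrier N ==>
    tens R M N x (y \<oplus>\<^bsub>N\<^esub> y') = tens R M N x y \<oplus>\<^bsub>TA\<^esub> tens R M N x y'"
  by (simp add: tensor_algebra_simps tp.tn_add_right)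

lemma tens_smult_left:
  "r \<in> carrier R ==> x \<in> carrier M ==> y \<in> carrier N ==>
    tens R M N (r \<odot>\<^bsub>M\<^esub> x) y = r \<odot>\<^bsub>TA\<^esub> tens R M N x y"
  by (simp add: tensor_algebra_simps tp.tn_smult_left)

lemma tens_smult_right:
  "r \<in> carrier R ==> x \<in> carrier M ==> y \<in> carrier N ==>
    tens R M N x (r \<odot>\<^bsub>N\<^esub> y) = r \<odot>\<^bsub>TA\<^esub> tens R M N x y"
  by (simp add: tensor_algebra_simps tp.tn_smult_right)

lemma tensor_induct [consumes 1, case_names pure add]:
  assumes "t \<in> carrier TA"
    and "\<And>x y. x \<in> carrier M ==> y \<in> carrier N ==> Q (tens R M N x y)"
    and "\<And>s t. s \<in> carrier TA ==> t \<in> carrier TA ==> Q s ==> Q t ==> Q (s \<oplus>\<^bsub>TA\<^esub> t)"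
  shows "Q t"
  using assms tp.T_induct[of t Q] by (simp add: tensor_algebra_simps)

lemma lift_addmap:
  "abelian_group P ==> balanced R M N P \<beta> ==> addmap TA P (tensor_lift R M N P \<beta>)"
  using tp.lift_addmap[of P \<beta>] by (simp add: tensor_algebra_simps addmap_def)

lemma lift_tens:
  "abelian_group P ==> balanced R M N P \<beta> ==> x \<in> carrier M ==> y \<in> carrier N ==>
    tensor_lift R M N P \<beta> (tens R M N x y) = \<beta> x y"
  using tp.lift_tn by blast

lemma balanced_tens: "balanced R M N TA (tens R M N)"
  by (rule balancedI)
    (simp_all add: tens_closed tens_add_left tens_add_right
      tens_smult_left tens_smult_right)

lemma addmap_eqI:
  assumes "addmap TA P f" "addmap TA P f'" "t \<in> carrier TA"
    and "\<And>x y. x \<in> carrier M ==> y \<in> carrier N ==> f (tens R M N x y) = f' (tens R M N x y)"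
  shows "f t = f' t"
  using assms(3)
  by (induction rule: tensor_induct) (use assms in \<open>simp_all add: addmap_def\<close>)

lemma tensor_sum_exists:
  assumes "t \<in> carrier TA"
  shows "\<exists>(n::nat) u v. (\<forall>i<n. u i \<in> carrier M \<and> v i \<in> carrier N) \<and>
           t = (\<Oplus>\<^bsub>TA\<^esub>i<n. tens R M N (u i) (v i))"
  using assms
proof (induction rule: tensor_induct)
  case (pure x y)
  interpret TA: Module.module R TA by (rule module)
  have "tens R M N x y \<in> carrier TA" using pure by (rule tens_closed)
  then show ?case using pure
    by (intro exI[of _ "1::nat"] exI[of _ "\<lambda>_. x"] exI[of _ "\<lambda>_. y"])
      (simp add: lessThan_Suc TA.M.finsum_insert)
next
  case (add s t)
  interpret TA: Module.module R TA by (rule module)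
  obtain m :: nat and u v where s: "\<forall>i<m. u i \<in> carrier M \<and> v i \<in> carrier N"
    "s = (\<Oplus>\<^bsub>TA\<^esub>i<m. tens R M N (u i) (v i))" using add by blast
  obtain n :: nat and u' v' where t: "\<forall>i<n. u' i \<in> carrier M \<and> v' i \<in> carrier N"
    "t = (\<Oplus>\<^bsub>TA\<^esub>i<n. tens R M N (u' i) (v' i))" using add by blast
  define w where "w i = (if i < m then u i else u' (i - m))" for i
  define z where "z i = (if i < m then v i else v' (i - m))" for i
  have wz: "\<forall>i<m + n. w i \<in> carrier M \<and> z i \<in> carrier N"
    using s(1) t(1) by (auto simp: w_def z_def)
  have split: "{..<m + n} = {..<m} \<union> {m..<m + n}" by auto
  have "(\<Oplus>\<^bsub>TA\<^esub>i\<in>{..<m + n}. tens R M N (w i) (z i))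
      = (\<Oplus>\<^bsub>TA\<^esub>i<m. tens R M N (w i) (z i)) \<oplus>\<^bsub>TA\<^esub> (\<Oplus>\<^bsub>TA\<^esub>i\<in>{m..<m + n}. tens R M N (w i) (z i))"
    unfolding split using wz by (intro TA.M.finsum_Un_disjoint) (auto intro!: tens_closed)
  also have "(\<Oplus>\<^bsub>TA\<^esub>i<m. tens R M N (w i) (z i)) = s"
    unfolding s(2) using s(1)
    by (intro TA.M.finsum_cong') (auto simp: w_def z_def intro!: tens_closed)
  also have "(\<Oplus>\<^bsub>TA\<^esub>i\<in>{m..<m + n}. tens R M N (w i) (z i)) = t"
  proof -
    have "(\<Oplus>\<^bsub>TA\<^esub>i\<in>(\<lambda>i. i + m) ` {..<n}. tens R M N (w i) (z i))
        = (\<Oplus>\<^bsub>TA\<^esub>i<n. tens R M N (w (i + m)) (z (i + m)))"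
      using wz by (intro TA.M.finsum_reindex) (auto intro!: tens_closed)
    moreover have "(\<lambda>i. i + m) ` {..<n} = {m..<m + n}"
      by (simp add: lessThan_atLeast0 image_add_atLeastLessThan' add.commute)
    moreover have "(\<Oplus>\<^bsub>TA\<^esub>i<n. tens R M N (w (i + m)) (z (i + m))) = t"
      unfolding t(2) using t(1)
      by (intro TA.M.finsum_cong') (auto simp: w_def z_def intro!: tens_closed)
    ultimately show ?thesis by simp
  qed
  finally show ?case using wz by (intro exI[of _ "m + n"] exI[of _ w] exI[of _ z] conjI) (rule wz, rule sym)
qed

end

context tensor_alg
begin

lemma TA_grp: "abelian_group TA"
  using module by (simp add: Module.module_def)

lemma lift_finsum:
  assumes "abelian_group P" "balanced R M N P \<beta>"
    and "\<And>i. i \<in> I ==> u i \<in> carrier M" "\<And>i. i \<in> I ==> v i \<in> carrier N"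
  shows "tensor_lift R M N P \<beta> (\<Oplus>\<^bsub>TA\<^esub>i\<in>I. tens R M N (u i) (v i)) = (\<Oplus>\<^bsub>P\<^esub>i\<in>I. \<beta> (u i) (v i))"
proof -
  have "tensor_lift R M N P \<beta> (\<Oplus>\<^bsub>TA\<^esub>i\<in>I. tens R M N (u i) (v i))
      = (\<Oplus>\<^bsub>P\<^esub>i\<in>I. tensor_lift R M N P \<beta> (tens R M N (u i) (v i)))"
    by (rule addmap_finsum[OF TA_grp assms(1) lift_addmap[OF assms(1,2)]]) (intro tens_closed assms)
  also have "\<dots> = (\<Oplus>\<^bsub>P\<^esub>i\<in>I. \<beta> (u i) (v i))"
    using assms by (intro finsum_cong_P) (auto simp: lift_tens balanced_def)
  finally show ?thesis .
qed

lemma tens_finsum_left: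
  assumes "\<And>i. i \<in> I ==> u i \<in> carrier M" "y \<in> carrier N"
  shows "tens R M N (\<Oplus>\<^bsub>M\<^esub>i\<in>I. u i) y = (\<Oplus>\<^bsub>TA\<^esub>i\<in>I. tens R M N (u i) y)"
  by (rule addmap_finsum[OF M.abelian_group_axioms TA_grp, of "\<lambda>x. tens R M N x y"])
    (auto intro!: addmapI simp: tens_closed tens_add_left assms)

lemma tens_finsum_right:
  assumes "\<And>i. i \<in> I ==> v i \<in> carrier N" "x \<in> carrier M"
  shows "tens R M N x (\<Oplus>\<^bsub>N\<^esub>i\<in>I. v i) = (\<Oplus>\<^bsub>TA\<^esub>i\<in>I. tens R M N x (v i))"
  by (rule addmap_finsum[OF N.abelian_group_axioms TA_grp, of "\<lambda>y. tens R M N x y"])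
    (auto intro!: addmapI simp: tens_closed tens_add_right assms)

end

lemma tensor_lift_cong:
  assumes "\<And>x y. x \<in> carrier M ==> y \<in> carrier N ==> \<beta> x y = \<beta>' x y"
    and "carrier P = carrier P'" "add P = add P'"
  shows "tensor_lift R M N P \<beta> = tensor_lift R M N P' \<beta>'"
  unfolding tensor_lift_def hom_add_monoid_iff addmap_def
  by (intro arg_cong[where f = The] ext) (simp add: assms cong: ball_cong)

subsection \<open>Tensor products of algebras\<close>

definition algebra_over :: "('r, 'q) ring_scheme \<Rightarrow> ('r, 'm, 'u) module_scheme \<Rightarrow> bool" where
  "algebra_over R M \<longleftrightarrow> Module.module R M \<and> ring M \<and>
     (\<forall>r\<in>carrier R. \<forall>x\<in>carrier M. \<forall>y\<in>carrier M.
        (r \<odot>\<^bsub>M\<^esub> x) \<otimes>\<^bsub>M\<^esub> y = r \<odot>\<^bsub>M\<^esub> (x \<otimes>\<^bsub>M\<^esub> y) \<and>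
        x \<otimes>\<^bsub>M\<^esub> (r \<odot>\<^bsub>M\<^esub> y) = r \<odot>\<^bsub>M\<^esub> (x \<otimes>\<^bsub>M\<^esub> y))"

locale algebra_pair =
  fixes R (structure) and M and N
  assumes M: "algebra_over R M" and N: "algebra_over R N"
begin

sublocale M: Module.module R M using M by (simp add: algebra_over_def)
sublocale N: Module.module R N using N by (simp add: algebra_over_def)
sublocale tensor_alg R M N ..
sublocale MR: ring M using M by (simp add: algebra_over_def)
sublocale NR: ring N using N by (simp add: algebra_over_def)
sublocale TA: Module.module R TA by (rule module)

lemma M_smult:
  "r \<in> carrier R ==> x \<in> carrier M ==> y \<in> carrier M ==> (r \<odot>\<^bsub>M\<^esub> x) \<otimes>\<^bsub>M\<^esub> y = r \<odot>\<^bsub>M\<^esub> (x \<otimes>\<^bsub>M\<^esub> y)"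
  "r \<in> carrier R ==> x \<in> carrier M ==> y \<in> carrier M ==> x \<otimes>\<^bsub>M\<^esub> (r \<odot>\<^bsub>M\<^esub> y) = r \<odot>\<^bsub>M\<^esub> (x \<otimes>\<^bsub>M\<^esub> y)"
  using M by (auto simp: algebra_over_def)

lemma N_smult:
  "r \<in> carrier R ==> x \<in> carrier N ==> y \<in> carrier N ==> (r \<odot>\<^bsub>N\<^esub> x) \<otimes>\<^bsub>N\<^esub> y = r \<odot>\<^bsub>N\<^esub> (x \<otimes>\<^bsub>N\<^esub> y)"
  "r \<in> carrier R ==> x \<in> carrier N ==> y \<in> carrier N ==> x \<otimes>\<^bsub>N\<^esub> (r \<odot>\<^bsub>N\<^esub> y) = r \<odot>\<^bsub>N\<^esub> (x \<otimes>\<^bsub>N\<^esub> y)"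
  using N by (auto simp: algebra_over_def)

abbreviation "tt \<equiv> tens R M N"

lemmas tens_rules = tens_closed tens_add_left tens_add_right tens_smult_left tens_smult_right

text \<open>Left multiplication by a pure tensor. Multiplication of the tensor algebra is the lift of \<open>lmul\<close> in its remaining
  arguments.\<close>

definition lmul where
  "lmul x y t = tensor_lift R M N TA (\<lambda>x' y'. tt (x \<otimes>\<^bsub>M\<^esub> x') (y \<otimes>\<^bsub>N\<^esub> y')) t"

lemma TA_group: "abelian_group TA" by (rule TA.abelian_group_axioms)

lemma inner_balanced:
  assumes "x \<in> carrier M" "y \<in> carrier N"
  shows "balanced R M N TA (\<lambda>x' y'. tt (x \<otimes>\<^bsub>M\<^esub> x') (y \<otimes>\<^bsub>N\<^esub> y'))"
  by (rule balancedI) (use assms in \<open>simp_all add: tens_rules MR.r_distr NR.r_distr M_smult N_smult\<close>)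

lemma lmul_addmap: "x \<in> carrier M ==> y \<in> carrier N ==> addmap TA TA (lmul x y)"
  unfolding lmul_def[abs_def] by (rule lift_addmap[OF TA_group inner_balanced])

lemma lmul_tens:
  "x \<in> carrier M ==> y \<in> carrier N ==> x' \<in> carrier M ==> y' \<in> carrier N ==>
    lmul x y (tt x' y') = tt (x \<otimes>\<^bsub>M\<^esub> x') (y \<otimes>\<^bsub>N\<^esub> y')"
  unfolding lmul_def by (rule lift_tens[OF TA_group inner_balanced])

lemma addmap_sum:
  assumes "addmap TA TA f" "addmap TA TA f'"
  shows "addmap TA TA (\<lambda>t. f t \<oplus>\<^bsub>TA\<^esub> f' t)"
  using assms unfolding addmap_def
  by (simp add: TA.M.a_ac)

lemma outer_balanced:
  assumes t: "t \<in> carrier TA"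
  shows "balanced R M N TA (\<lambda>x y. lmul x y t)"
proof (rule balancedI)
  fix x x' y assume "x \<in> carrier M" "x' \<in> carrier M" "y \<in> carrier N"
  then show "lmul (x \<oplus>\<^bsub>M\<^esub> x') y t = lmul x y t \<oplus>\<^bsub>TA\<^esub> lmul x' y t"
    by (intro addmap_eqI[where f = "lmul (x \<oplus>\<^bsub>M\<^esub> x') y" and f' = "\<lambda>t. lmul x y t \<oplus>\<^bsub>TA\<^esub> lmul x' y t",
          OF lmul_addmap addmap_sum[OF lmul_addmap lmul_addmap] t])
      (simp_all add: lmul_tens MR.l_distr tens_rules)
next
  fix x y y' assume "x \<in> carrier M" "y \<in> carrier N" "y' \<in> carrier N"
  then show "lmul x (y \<oplus>\<^bsub>N\<^esub> y') t = lmul x y t \<oplus>\<^bsub>TA\<^esub> lmul x y' t"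
    by (intro addmap_eqI[where f = "lmul x (y \<oplus>\<^bsub>N\<^esub> y')" and f' = "\<lambda>t. lmul x y t \<oplus>\<^bsub>TA\<^esub> lmul x y' t",
          OF lmul_addmap addmap_sum[OF lmul_addmap lmul_addmap] t])
      (simp_all add: lmul_tens NR.l_distr tens_rules)
next
  fix r x y assume "r \<in> carrier R" "x \<in> carrier M" "y \<in> carrier N"
  then show "lmul (r \<odot>\<^bsub>M\<^esub> x) y t = lmul x (r \<odot>\<^bsub>N\<^esub> y) t"
    by (intro addmap_eqI[where f = "lmul (r \<odot>\<^bsub>M\<^esub> x) y" and f' = "lmul x (r \<odot>\<^bsub>N\<^esub> y)",
          OF lmul_addmap lmul_addmap t])
      (simp_all add: lmul_tens M_smult N_smult tens_rules)
qed (rule addmap_closed[OF lmul_addmap t])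

lemma lift_TA: "tensor_lift R M N TA \<beta> = tensor_lift R M N (tensor_product R M N) \<beta>"
  by (rule tensor_lift_cong) (simp_all add: tensor_algebra_simps)

lemma mult_eq: "s \<otimes>\<^bsub>TA\<^esub> t = tensor_lift R M N TA (\<lambda>x y. lmul x y t) s"
  unfolding lmul_def lift_TA by (simp add: tensor_algebra_def Let_def)

lemma mult_addmap_left: "t \<in> carrier TA ==> addmap TA TA (\<lambda>s. s \<otimes>\<^bsub>TA\<^esub> t)"
  unfolding mult_eq by (rule lift_addmap[OF TA_group outer_balanced])

lemma mult_closed: "s \<in> carrier TA ==> t \<in> carrier TA ==> s \<otimes>\<^bsub>TA\<^esub> t \<in> carrier TA"
  using addmap_closed[OF mult_addmap_left] .

lemma tens_mult_left:
  "x \<in> carrier M ==> y \<in> carrier N ==> t \<in> carrier TA ==> tt x y \<otimes>\<^bsub>TA\<^esub> t = lmul x y t"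
  unfolding mult_eq by (rule lift_tens[OF TA_group outer_balanced])

lemma tens_mult:
  "x \<in> carrier M ==> y \<in> carrier N ==> x' \<in> carrier M ==> y' \<in> carrier N ==>
    tt x y \<otimes>\<^bsub>TA\<^esub> tt x' y' = tt (x \<otimes>\<^bsub>M\<^esub> x') (y \<otimes>\<^bsub>N\<^esub> y')"
  using tens_mult_left[OF _ _ tens_closed] lmul_tens by simp

lemma mult_addmap_right: "s \<in> carrier TA ==> addmap TA TA (\<lambda>t. s \<otimes>\<^bsub>TA\<^esub> t)"
proof (induction rule: tensor_induct)
  case (pure x y)
  then show ?case using lmul_addmap[of x y] by (simp add: addmap_def tens_mult_left)
next
  case (add s s')
  have "(s \<oplus>\<^bsub>TA\<^esub> s') \<otimes>\<^bsub>TA\<^esub> t = (s \<otimes>\<^bsub>TA\<^esub> t) \<oplus>\<^bsub>TA\<^esub> (s' \<otimes>\<^bsub>TA\<^esub> t)" if "t \<in> carrier TA" for t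
    using addmap_add[OF mult_addmap_left[OF that] add(1,2)] .
  then show ?case using addmap_sum[OF add(3,4)]
    unfolding addmap_def by (auto)
qed

lemma one_TA: "\<one>\<^bsub>TA\<^esub> = tt \<one>\<^bsub>M\<^esub> \<one>\<^bsub>N\<^esub>"
  by (simp add: tensor_algebra_def Let_def)

lemma mult_assoc:
  assumes "s \<in> carrier TA" "t \<in> carrier TA" "u \<in> carrier TA"
  shows "(s \<otimes>\<^bsub>TA\<^esub> t) \<otimes>\<^bsub>TA\<^esub> u = s \<otimes>\<^bsub>TA\<^esub> (t \<otimes>\<^bsub>TA\<^esub> u)"
  using assms
proof (induction rule: tensor_induct)
  case (pure x y)
  from pure(3,1,2,4) show ?case
  proof (induction rule: tensor_induct)
    case (pure x' y')
    from pure(5,1-4) show ?case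
    proof (induction rule: tensor_induct)
      case (pure x'' y'')
      then show ?case by (simp add: tens_mult MR.m_assoc NR.m_assoc)
    next
      case (add v w)
      then show ?case
        by (simp add: addmap_add[OF mult_addmap_right] tens_closed mult_closed)
    qed
  next
    case (add v w)
    then show ?case
      by (simp add: addmap_add[OF mult_addmap_right] addmap_add[OF mult_addmap_left] tens_closed mult_closed)
  qed
next
  case (add v w)
  then show ?case
    by (simp add: addmap_add[OF mult_addmap_left] mult_closed)
qed

lemma one_closed: "\<one>\<^bsub>TA\<^esub> \<in> carrier TA"
  unfolding one_TA by (rule tens_closed) simp_all

lemma one_left: "t \<in> carrier TA ==> \<one>\<^bsub>TA\<^esub> \<otimes>\<^bsub>TA\<^esub> t = t"
proof (induction rule: tensor_induct)
  case (pure x y)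
  then show ?case by (simp add: one_TA tens_mult)
next
  case (add s t)
  then show ?case
    by (simp add: addmap_add[OF mult_addmap_right] one_closed)
qed

lemma one_right: "t \<in> carrier TA ==> t \<otimes>\<^bsub>TA\<^esub> \<one>\<^bsub>TA\<^esub> = t"
proof (induction rule: tensor_induct)
  case (pure x y)
  then show ?case by (simp add: one_TA tens_mult)
next
  case (add s t)
  then show ?case
    by (simp add: addmap_add[OF mult_addmap_left] one_closed)
qed

lemma ring: "ring TA"
proof (rule ringI)
  show "monoid TA"
    by (rule monoidI) (simp_all add: mult_closed one_closed mult_assoc one_left one_right)
qed (simp_all add: addmap_add[OF mult_addmap_left] addmap_add[OF mult_addmap_right] TA_group)

lemma smult_mult_left:
  assumes r: "r \<in> carrier R" and "s \<in> carrier TA" "t \<in> carrier TA"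
  shows "(r \<odot>\<^bsub>TA\<^esub> s) \<otimes>\<^bsub>TA\<^esub> t = r \<odot>\<^bsub>TA\<^esub> (s \<otimes>\<^bsub>TA\<^esub> t)"
  using assms(2,3)
proof (induction rule: tensor_induct)
  case (pure x y)
  from pure(3,1,2) show ?case
  proof (induction rule: tensor_induct)
    case (pure x' y')
    then show ?case using r
      by (simp add: tens_mult M_smult flip: tens_smult_left)
  next
    case (add v w)
    then show ?case using r
      by (simp add: addmap_add[OF mult_addmap_right] TA.smult_r_distr tens_closed mult_closed)
  qed
next
  case (add v w)
  then show ?case using r
    by (simp add: TA.smult_r_distr addmap_add[OF mult_addmap_left] mult_closed)
qed

lemma smult_mult_right:
  assumes r: "r \<in> carrier R" and "s \<in> carrier TA" "t \<in> carrier TA"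
  shows "s \<otimes>\<^bsub>TA\<^esub> (r \<odot>\<^bsub>TA\<^esub> t) = r \<odot>\<^bsub>TA\<^esub> (s \<otimes>\<^bsub>TA\<^esub> t)"
  using assms(2,3)
proof (induction rule: tensor_induct)
  case (pure x y)
  from pure(3,1,2) show ?case
  proof (induction rule: tensor_induct)
    case (pure x' y')
    then show ?case using r
      by (simp add: tens_mult M_smult flip: tens_smult_left)
  next
    case (add v w)
    then show ?case using r
      by (simp add: addmap_add[OF mult_addmap_right] TA.smult_r_distr tens_closed mult_closed)
  qed
next
  case (add v w)
  then show ?case using r
    by (simp add: TA.smult_r_distr addmap_add[OF mult_addmap_left] mult_closed)
qed

lemma algebra_over_TA: "algebra_over R TA"
  unfolding algebra_over_def by (simp add: module ring smult_mult_left smult_mult_right)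

end

section \<open>Frames, traces and eigenvectors\<close>

definition linfun :: "('k::field, 'v, 'u) module_scheme \<Rightarrow> ('v \<Rightarrow> 'k) \<Rightarrow> bool" where
  "linfun V l \<longleftrightarrow> (\<forall>x\<in>carrier V. \<forall>y\<in>carrier V. l (x \<oplus>\<^bsub>V\<^esub> y) = l x + l y) \<and>
     (\<forall>c. \<forall>x\<in>carrier V. l (c \<odot>\<^bsub>V\<^esub> x) = c * l x)"

definition linend :: "('k::field, 'v, 'u) module_scheme \<Rightarrow> ('v \<Rightarrow> 'v) \<Rightarrow> bool" where
  "linend V f \<longleftrightarrow> (\<forall>x\<in>carrier V. f x \<in> carrier V) \<and>
     (\<forall>x\<in>carrier V. \<forall>y\<in>carrier V. f (x \<oplus>\<^bsub>V\<^esub> y) = f x \<oplus>\<^bsub>V\<^esub> f y) \<and>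
     (\<forall>c. \<forall>x\<in>carrier V. f (c \<odot>\<^bsub>V\<^esub> x) = c \<odot>\<^bsub>V\<^esub> f x)"

text \<open>A dual-basis presentation \<open>x = \<Sum> co\<^sub>i(x) b\<^sub>i\<close>. The \<open>b\<^sub>i\<close> may be dependent, so
  that dual families such as the legs of \<open>\<Delta>(1)\<close> qualify.\<close>

definition frame ::
  "('k::field, 'v, 'u) module_scheme \<Rightarrow> 'i set \<Rightarrow> ('i \<Rightarrow> 'v) \<Rightarrow> ('i \<Rightarrow> 'v \<Rightarrow> 'k) \<Rightarrow> bool" where
  "frame V I b co \<longleftrightarrow> finite I \<and> (\<forall>i\<in>I. b i \<in> carrier V) \<and> (\<forall>i\<in>I. linfun V (co i)) \<and>
     (\<forall>x\<in>carrier V. x = (\<Oplus>\<^bsub>V\<^esub>i\<in>I. co i x \<odot>\<^bsub>V\<^esub> b i))"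

lemma linfun_addmap: "linfun V l ==> addmap V class_ring l"
  by (simp add: linfun_def addmap_def)

lemma linfun_add: "linfun V l ==> x \<in> carrier V ==> y \<in> carrier V ==> l (x \<oplus>\<^bsub>V\<^esub> y) = l x + l y"
  and linfun_smult: "linfun V l ==> x \<in> carrier V ==> l (c \<odot>\<^bsub>V\<^esub> x) = c * l x"
  by (simp_all add: linfun_def)

lemma linfun_finsum:
  assumes "abelian_group V" "linfun V l" "\<And>i. i \<in> I ==> a i \<in> carrier V"
  shows "l (\<Oplus>\<^bsub>V\<^esub>i\<in>I. a i) = (\<Sum>i\<in>I. l (a i))"
  using addmap_finsum[OF assms(1) class_ring_abelian_group linfun_addmap[OF assms(2)] assms(3)]
  by (simp add: class_ring_simps)

lemma linfun_zero: "abelian_group V ==> linfun V l ==> l \<zero>\<^bsub>V\<^esub> = 0"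
  using addmap_zero[OF _ class_ring_abelian_group linfun_addmap] by fastforce

locale kspace = fixes V :: "('k::field, 'v, 'u) module_scheme" (structure)
  assumes module_V: "Module.module class_ring V"
begin

sublocale Module.module class_ring V by (rule module_V)
sublocale vs: vectorspace class_ring V
  using module_V class_field by (simp add: vectorspace_def)

lemma grp: "abelian_group V" by (rule abelian_group_axioms)
lemmas ks = kspace_axioms
lemmas sum_cong = finsum_cong_P[OF grp]

lemma smult_simps [simp]:
  "x \<in> carrier V ==> c \<odot> x \<in> carrier V"
  "x \<in> carrier V ==> 1 \<odot> x = x"
  "x \<in> carrier V ==> 0 \<odot> x = \<zero>"
  "c \<odot> \<zero> = \<zero>"
proof -
  show "x \<in> carrier V ==> c \<odot> x \<in> carrier V" using smult_closed[of c x] by simp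
  show "x \<in> carrier V ==> 1 \<odot> x = x" using smult_one[of x] by simp
  show "x \<in> carrier V ==> 0 \<odot> x = \<zero>" using lmult_0[of x] by simp
  show "c \<odot> \<zero> = \<zero>" using rmult_0[of c] by simp
qed

lemma smult_distr:
  "x \<in> carrier V ==> y \<in> carrier V ==> c \<odot> (x \<oplus> y) = c \<odot> x \<oplus> c \<odot> y"
  "x \<in> carrier V ==> (c + d) \<odot> x = c \<odot> x \<oplus> d \<odot> x"
  "x \<in> carrier V ==> c \<odot> (d \<odot> x) = (c * d) \<odot> x"
  using smult_r_distr[of c x y] smult_l_distr[of c d x] smult_assoc1[of c d x] by simp_all

lemma finsum_smult_right:
  assumes "\<And>i. i \<in> I ==> a i \<in> carrier V"
  shows "c \<odot> (\<Oplus>i\<in>I. a i) = (\<Oplus>i\<in>I. c \<odot> a i)"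
proof -
  have "addmap V V (\<lambda>x. c \<odot> x)" by (rule addmapI) (simp_all add: smult_distr)
  from addmap_finsum[OF grp grp this assms] show ?thesis .
qed

text \<open>The trace of an endomorphism can be computed in any frame, independent or not.\<close>

lemma frame_trace_unique:
  assumes F: "frame V I b co" and F': "frame V J b' co'" and f: "linend V f"
  shows "(\<Sum>i\<in>I. co i (f (b i))) = (\<Sum>j\<in>J. co' j (f (b' j)))"
proof -
  have b: "b i \<in> carrier V" "f (b i) \<in> carrier V" "linfun V (co i)" if "i \<in> I" for i
    using F f that by (auto simp: frame_def linend_def)
  have b': "b' i \<in> carrier V" "f (b' i) \<in> carrier V" "linfun V (co' i)" if "i \<in> J" for i
    using F' f that by (auto simp: frame_def linend_def)
  have fin: "finite I" "finite J" using F F' by (auto simp: frame_def)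
  have exp: "x = (\<Oplus>i\<in>I. co i x \<odot> b i)" "x = (\<Oplus>i\<in>J. co' i x \<odot> b' i)" if "x \<in> carrier V" for x
    using F F' that by (auto simp: frame_def)
  have 1: "co i (f (b i)) = (\<Sum>j\<in>J. co' j (f (b i)) * co i (b' j))" if i: "i \<in> I" for i
  proof -
    have "co i (f (b i)) = co i (\<Oplus>j\<in>J. co' j (f (b i)) \<odot> b' j)" using exp(2)[OF b(2)[OF i]] by simp
    also have "\<dots> = (\<Sum>j\<in>J. co i (co' j (f (b i)) \<odot> b' j))"
      by (rule linfun_finsum[OF grp b(3)[OF i]]) (use b' in simp)
    finally show ?thesis using b' by (simp add: linfun_smult[OF b(3)[OF i]])
  qed
  have 2: "co' j (f (b' j)) = (\<Sum>i\<in>I. co' j (f (b i)) * co i (b' j))" if j: "j \<in> J" for j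
  proof -
    have cf: "linfun V (\<lambda>x. co' j (f x))"
      using f b'(3)[OF j] by (simp add: linfun_def linend_def)
    have "co' j (f (b' j)) = co' j (f (\<Oplus>i\<in>I. co i (b' j) \<odot> b i))" using exp(1)[OF b'(1)[OF j]] by simp
    also have "\<dots> = (\<Sum>i\<in>I. co' j (f (co i (b' j) \<odot> b i)))"
      by (rule linfun_finsum[OF grp cf]) (use b in simp)
    finally show ?thesis using b by (simp add: linfun_smult[OF cf] mult.commute)
  qed
  have "(\<Sum>i\<in>I. co i (f (b i))) = (\<Sum>i\<in>I. \<Sum>j\<in>J. co' j (f (b i)) * co i (b' j))"
    by (rule sum.cong) (simp_all add: 1)
  also have "\<dots> = (\<Sum>j\<in>J. \<Sum>i\<in>I. co' j (f (b i)) * co i (b' j))" by (rule sum.swap)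
  also have "\<dots> = (\<Sum>j\<in>J. co' j (f (b' j)))"
    by (rule sum.cong) (simp_all add: 2)
  finally show ?thesis .
qed

lemma frame_trace_comm:
  assumes F: "frame V I b co" and f: "linend V f" and g: "linend V g"
  shows "(\<Sum>i\<in>I. co i (f (g (b i)))) = (\<Sum>i\<in>I. co i (g (f (b i))))"
proof -
  have b: "b i \<in> carrier V" "f (b i) \<in> carrier V" "g (b i) \<in> carrier V" "linfun V (co i)" if "i \<in> I" for i
    using F f g that by (auto simp: frame_def linend_def)
  have fin: "finite I" using F by (auto simp: frame_def)
  have exp: "x = (\<Oplus>i\<in>I. co i x \<odot> b i)" if "x \<in> carrier V" for x
    using F that by (auto simp: frame_def)
  have 1: "co i (f (g (b i))) = (\<Sum>j\<in>I. co j (g (b i)) * co i (f (b j)))"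
    if i: "i \<in> I" and "linend V f" "linend V g" for i f g
  proof -
    have cf: "linfun V (\<lambda>x. co i (f x))"
      using that b(4)[OF i] by (simp add: linfun_def linend_def)
    have gi: "g (b i) \<in> carrier V" using that b by (simp add: linend_def)
    have "co i (f (g (b i))) = co i (f (\<Oplus>j\<in>I. co j (g (b i)) \<odot> b j))" using exp[OF gi] by simp
    also have "\<dots> = (\<Sum>j\<in>I. co i (f (co j (g (b i)) \<odot> b j)))"
      by (rule linfun_finsum[OF grp cf]) (use b in simp)
    finally show ?thesis using b by (simp add: linfun_smult[OF cf])
  qed
  have "(\<Sum>i\<in>I. co i (f (g (b i)))) = (\<Sum>i\<in>I. \<Sum>j\<in>I. co j (g (b i)) * co i (f (b j)))"
    using 1[OF _ f g] by simp
  also have "\<dots> = (\<Sum>j\<in>I. \<Sum>i\<in>I. co i (f (b j)) * co j (g (b i)))"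
    by (subst sum.swap) (simp add: mult.commute)
  also have "\<dots> = (\<Sum>j\<in>I. co j (g (f (b j))))" using 1[OF _ g f] by simp
  finally show ?thesis .
qed

lemma basis_frame:
  assumes fin: "finite S" and bas: "vs.basis S"
  shows "\<exists>co. frame V S (\<lambda>s. s) co \<and> (\<forall>s\<in>S. \<forall>t\<in>S. co s t = (if s = t then 1 else 0))"
proof -
  have S: "S \<subseteq> carrier V" using bas by (simp add: vs.basis_def)
  have ex: "\<exists>!a. a \<in> S \<rightarrow>\<^sub>E carrier (class_ring :: 'k ring) \<and> lincomb a S = v" if "v \<in> carrier V" for v
    using vs.basis_criterion[OF fin S] bas that by blast
  define co where "co v = (THE a. a \<in> S \<rightarrow>\<^sub>E carrier (class_ring :: 'k ring) \<and> lincomb a S = v)" for v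
  have co: "co v \<in> S \<rightarrow>\<^sub>E carrier (class_ring :: 'k ring)" "lincomb (co v) S = v" if "v \<in> carrier V" for v
    using theI'[OF ex[OF that]] unfolding co_def by blast+
  have uniq: "co v s = a s" if "v \<in> carrier V" "lincomb a S = v" "s \<in> S" for v a s
  proof -
    have "lincomb (restrict a S) S = v"
      using that S unfolding lincomb_def by (subst finsum_cong_P[OF grp, where b = "\<lambda>v. a v \<odot> v"]) auto
    then have "co v = restrict a S" using ex[OF that(1)] co[OF that(1)] by (metis PiE_iff UNIV_I extensional_restrict partial_object.select_convs(1) restrict_PiE_iff)
    then show ?thesis using that by simp
  qed
  have lin: "linfun V (\<lambda>v. co v s)" if s: "s \<in> S" for s
    unfolding linfun_def
  proof (intro conjI ballI allI)
    fix x y assume xy: "x \<in> carrier V" "y \<in> carrier V"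
    have "lincomb (\<lambda>s. co x s + co y s) S = lincomb (co x) S \<oplus> lincomb (co y) S"
      using lincomb_sum[OF fin S, of "co x" "co y"] by simp
    then show "co (x \<oplus> y) s = co x s + co y s"
      using uniq[of "x \<oplus> y" "\<lambda>s. co x s + co y s" s] co xy s by simp
  next
    fix c x assume x: "x \<in> carrier V"
    have "lincomb (\<lambda>s. c * co x s) S = c \<odot> lincomb (co x) S"
      using lincomb_smult[OF S, of "co x" c] by simp
    then show "co (c \<odot> x) s = c * co x s"
      using uniq[of "c \<odot> x" "\<lambda>s. c * co x s" s] co x s by simp
  qed
  have "frame V S (\<lambda>s. s) (\<lambda>s v. co v s)"
    using fin S lin co(2) by (auto simp: frame_def lincomb_def)
  moreover have "co t s = (if s = t then 1 else 0)" if st: "s \<in> S" "t \<in> S" for s t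
  proof -
    have "lincomb (\<lambda>s. if s = t then 1 else 0) S = (\<Oplus>s\<in>S. if t = s then s else \<zero>)"
      unfolding lincomb_def using S by (intro sum_cong) auto
    also have "\<dots> = t" using st S fin by (intro finsum_singleton) auto
    finally show ?thesis using uniq[of t "\<lambda>s. if s = t then 1 else 0" s] st S by auto
  qed
  ultimately show ?thesis by blast
qed

lemma endo_trace_frame:
  assumes fd: "vs.fin_dim" and f: "linend V f" and F: "frame V I b co"
  shows "endo_trace V f = (\<Sum>i\<in>I. co i (f (b i)))"
  unfolding endo_trace_def
proof (rule the_equality)
  obtain S where S: "finite S" "vs.basis S" using vs.finite_basis_exists[OF fd] by blast
  obtain co' where co': "frame V S (\<lambda>s. s) co'" using basis_frame[OF S] by blast
  show "\<exists>S a. finite S \<and> vs.basis S \<and> (\<forall>s\<in>S. f s = (\<Oplus>t\<in>S. a s t \<odot> t)) \<and>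
      (\<Sum>i\<in>I. co i (f (b i))) = (\<Sum>s\<in>S. a s s)"
    using S co' f frame_trace_unique[OF F co' f]
    by (intro exI[of _ S] exI[of _ "\<lambda>s t. co' t (f s)"]) (auto simp: frame_def linend_def)
next
  fix \<tau> assume "\<exists>S a. finite S \<and> vs.basis S \<and> (\<forall>s\<in>S. f s = (\<Oplus>t\<in>S. a s t \<odot> t)) \<and> \<tau> = (\<Sum>s\<in>S. a s s)"
  then obtain S a where S: "finite S" "vs.basis S" "\<forall>s\<in>S. f s = (\<Oplus>t\<in>S. a s t \<odot> t)" "\<tau> = (\<Sum>s\<in>S. a s s)"
    by blast
  obtain co' where co': "frame V S (\<lambda>s. s) co'" "\<forall>s\<in>S. \<forall>t\<in>S. co' s t = (if s = t then 1 else 0)"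
    using basis_frame[OF S(1,2)] by blast
  have SV: "S \<subseteq> carrier V" using S(2) by (simp add: vs.basis_def)
  have "co' s (f s) = a s s" if s: "s \<in> S" for s
  proof -
    have l: "linfun V (co' s)" using co'(1) s by (simp add: frame_def)
    have "co' s (f s) = (\<Sum>t\<in>S. co' s (a s t \<odot> t))"
      using S(3) s linfun_finsum[OF grp l, of S "\<lambda>t. a s t \<odot> t"] by (simp add: subsetD[OF SV])
    also have "\<dots> = (\<Sum>t\<in>S. a s t * (if s = t then 1 else 0))"
      using SV co'(2) s by (intro sum.cong) (auto simp: linfun_smult[OF l])
    also have "\<dots> = (\<Sum>t\<in>S. if s = t then a s t else 0)" by (rule sum.cong) auto
    finally show ?thesis using s S(1) by simp
  qed
  then show "\<tau> = (\<Sum>i\<in>I. co i (f (b i)))"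
    using frame_trace_unique[OF F co'(1) f] S(4) by simp
qed

text \<open>A basis of the subspace is extended to a basis of the whole space; the coordinates of the added vectors vanish on the subspace.\<close>

lemma adapted_frame:
  assumes fd: "vs.fin_dim" and W: "submodule class_ring W V"
  shows "\<exists>m n b co. m \<le> n \<and> frame V {..<n::nat} b co \<and>
     (\<forall>i<n. \<forall>j<n. co i (b j) = (if i = j then 1 else 0)) \<and>
     (\<forall>i<m. b i \<in> W) \<and> (\<forall>w\<in>W. \<forall>i<n. m \<le> i \<longrightarrow> co i w = 0)"
proof -
  interpret W: submodule class_ring W V by fact
  have li_bound: "finite A \<and> card A \<le> vs.dim" if "A \<subseteq> carrier V" "lin_indpt A" for A
    using vs.li_le_dim[OF fd that] by blast
  have li_empty: "lin_indpt {}" by (simp add: lin_dep_def)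
  obtain A where A: "finite A" "VectorSpace.maximal A (\<lambda>A. A \<subseteq> W \<and> lin_indpt A)"
  proof -
    have "\<exists>A. finite A \<and> VectorSpace.maximal A (\<lambda>A. A \<subseteq> W \<and> lin_indpt A)"
    proof (rule VectorSpace.maximal_exists)
      show "finite A \<and> card A \<le> vs.dim" if "A \<subseteq> W \<and> lin_indpt A" for A
        using li_bound[of A] that W.subset by blast
      show "{} \<subseteq> W \<and> lin_indpt {}" using li_empty by simp
    qed
    then show ?thesis using that by blast
  qed
  have AW: "A \<subseteq> W" and Ali: "lin_indpt A" and AV: "A \<subseteq> carrier V"
    using A(2) W.subset by (auto simp: VectorSpace.maximal_def)
  have span: "W \<subseteq> span A"
  proof
    fix w assume w: "w \<in> W"
    show "w \<in> span A"
    proof (rule ccontr)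
      assume n: "w \<notin> span A"
      then have wA: "w \<notin> A" using in_own_span[OF AV] by blast
      then have "lin_indpt (A \<union> {w})" using vs.lin_dep_iff_in_span[OF AV Ali _ wA] n w W.subset by blast
      then have "A \<union> {w} = A" using A(2) w AW unfolding VectorSpace.maximal_def by auto
      then show False using wA by auto
    qed
  qed
  obtain S where S: "finite S" "VectorSpace.maximal S (\<lambda>S. A \<subseteq> S \<and> S \<subseteq> carrier V \<and> lin_indpt S)"
    using VectorSpace.maximal_exists[of "\<lambda>S. A \<subseteq> S \<and> S \<subseteq> carrier V \<and> lin_indpt S" vs.dim A] li_bound Ali AV
    by blast
  have AS: "A \<subseteq> S" using S(2) by (simp add: VectorSpace.maximal_def)
  have "VectorSpace.maximal S (\<lambda>S. S \<subseteq> carrier V \<and> lin_indpt S)"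
    unfolding VectorSpace.maximal_def
  proof (intro conjI allI impI)
    show "S \<subseteq> carrier V" "lin_indpt S" using S(2) by (simp_all add: VectorSpace.maximal_def)
    fix B assume B: "S \<subseteq> B \<and> B \<subseteq> carrier V \<and> lin_indpt B"
    then have "A \<subseteq> B" using AS by (meson subset_trans)
    then show "B = S" using S(2) B by (simp add: VectorSpace.maximal_def)
  qed
  then have bas: "vs.basis S" by (rule vs.max_li_is_basis)
  then have SV: "S \<subseteq> carrier V" by (simp add: vs.basis_def)
  obtain co where co: "frame V S (\<lambda>s. s) co" "\<forall>s\<in>S. \<forall>t\<in>S. co s t = (if s = t then 1 else 0)"
    using basis_frame[OF S(1) bas] by blast
  obtain xs where xs: "set xs = A" "distinct xs" using finite_distinct_list[OF A(1)] by blast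
  obtain ys where ys: "set ys = S - A" "distinct ys" using finite_distinct_list[of "S - A"] S(1) by blast
  define zs where "zs = xs @ ys"
  have zs: "set zs = S" "distinct zs" using xs ys AS by (auto simp: zs_def)
  define n where "n = length zs"
  define m where "m = length xs"
  have bij: "bij_betw ((!) zs) {..<n} S" using zs by (simp add: n_def bij_betw_nth)
  have zsS: "zs ! i \<in> S" if "i < n" for i using that zs by (auto simp: n_def)
  have "frame V {..<n} ((!) zs) (\<lambda>i. co (zs ! i))"
    unfolding frame_def
  proof (intro conjI ballI)
    fix x assume x: "x \<in> carrier V"
    have "x = (\<Oplus>s\<in>(!) zs ` {..<n}. co s x \<odot> s)" using co(1) x bij by (simp add: frame_def bij_betw_def)
    also have "\<dots> = (\<Oplus>i<n. co (zs ! i) x \<odot> zs ! i)"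
      using bij SV by (intro finsum_reindex) (auto simp: bij_betw_def)
    finally show "x = (\<Oplus>i<n. co (zs ! i) x \<odot> zs ! i)" .
  qed (use zsS SV co(1) in \<open>auto simp: frame_def\<close>)
  moreover have "\<forall>i<n. \<forall>j<n. co (zs ! i) (zs ! j) = (if i = j then 1 else 0)"
    using co(2) zsS zs(2) by (simp add: n_def nth_eq_iff_index_eq)
  moreover have "\<forall>i<m. zs ! i \<in> W" using xs AW by (auto simp: zs_def m_def nth_append)
  moreover have "co (zs ! i) w = 0" if w: "w \<in> W" and i: "i < n" "m \<le> i" for w i
  proof -
    obtain a where a: "w = lincomb a A" using span w finite_in_span[OF A(1) AV] by blast
    have l: "linfun V (co (zs ! i))" using co(1) zsS i by (simp add: frame_def)
    have "zs ! i \<notin> A"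
    proof -
      have "zs ! i = ys ! (i - m)" "i - m < length ys"
        using i by (auto simp: zs_def m_def nth_append n_def)
      then show ?thesis using ys(1) nth_mem by (metis DiffD2)
    qed
    then have "co (zs ! i) s = 0" if "s \<in> A" for s using co(2) that AS zsS[OF i(1)] by auto
    then show ?thesis
      unfolding a lincomb_def using linfun_finsum[OF grp l, of A "\<lambda>s. a s \<odot> s"] AV
      by (auto simp: linfun_smult[OF l] subset_eq)
  qed
  moreover have "m \<le> n" by (simp add: m_def n_def zs_def)
  ultimately show ?thesis by blast
qed

lemma frame_exists:
  assumes fd: "vs.fin_dim"
  shows "\<exists>n b co. frame V {..<n::nat} b co \<and> (\<forall>i<n. \<forall>j<n. co i (b j) = (if i = j then 1 else 0))"
proof -
  have "submodule class_ring (carrier V) V"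
    using module_V by (simp add: submodule_def)
  from adapted_frame[OF fd this] show ?thesis by blast
qed

lemma frame_fin_dim:
  assumes F: "frame V I b co"
  shows "vs.fin_dim"
proof -
  have b: "b ` I \<subseteq> carrier V" "finite (b ` I)" using F by (auto simp: frame_def)
  have sub: "submodule class_ring (span (b ` I)) V" by (rule span_is_submodule[OF b(1)])
  interpret S: submodule class_ring "span (b ` I)" V by fact
  have "x \<in> span (b ` I)" if x: "x \<in> carrier V" for x
  proof -
    have mem: "co i x \<odot> b i \<in> span (b ` I)" if "i \<in> I" for i
      using in_own_span[OF b(1)] that by (intro S.smult_closed) auto
    have "finite J ==> J \<subseteq> I ==> (\<Oplus>i\<in>J. co i x \<odot> b i) \<in> span (b ` I)" for J
    proof (induction J rule: finite_induct)
      case (insert j J)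
      then show ?case using mem b(1) by (subst finsum_insert) auto
    qed simp
    moreover have "x = (\<Oplus>i\<in>I. co i x \<odot> b i)" "finite I" using F x by (simp_all add: frame_def)
    ultimately show ?thesis by (metis subset_refl)
  qed
  then have "span (b ` I) = carrier V" using S.subset by blast
  then show ?thesis unfolding vs.fin_dim_def using b by blast
qed

lemma subspace_kspace:
  assumes W: "submodule class_ring W V"
  shows "kspace (V\<lparr>carrier := W\<rparr>)"
  using submodule_is_module[OF W] by (simp add: kspace_def)

lemma subspace_frame:
  assumes W: "submodule class_ring W V" and F: "frame V {..<n::nat} b co" and m: "m \<le> n"
    and b: "\<forall>i<m. b i \<in> W" and co: "\<forall>w\<in>W. \<forall>i<n. m \<le> i \<longrightarrow> co i w = 0"
  shows "frame (V\<lparr>carrier := W\<rparr>) {..<m} b co"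
  unfolding frame_def
proof (intro conjI ballI)
  interpret W: submodule class_ring W V by fact
  fix x assume "x \<in> carrier (V\<lparr>carrier := W\<rparr>)"
  then have x: "x \<in> W" by simp
  have bV: "b i \<in> carrier V" if "i < n" for i using F that by (simp add: frame_def)
  have split: "{..<n} = {..<m} \<union> {m..<n}" using m by auto
  have "x = (\<Oplus>i<n. co i x \<odot> b i)" using F x W.subset by (auto simp: frame_def)
  also have "\<dots> = (\<Oplus>i<m. co i x \<odot> b i) \<oplus> (\<Oplus>i\<in>{m..<n}. co i x \<odot> b i)"
    unfolding split by (rule finsum_Un_disjoint) (use bV m in auto)
  also have "(\<Oplus>i\<in>{m..<n}. co i x \<odot> b i) = \<zero>"
    using co x bV by (intro add.finprod_one_eqI) auto
  also have "(\<Oplus>i<m. co i x \<odot> b i) \<oplus> \<zero> = (\<Oplus>i<m. co i x \<odot> b i)"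
    using bV m by (intro r_zero finsum_closed) auto
  also have "\<dots> = (\<Oplus>\<^bsub>V\<lparr>carrier := W\<rparr>\<^esub>i<m. co i x \<odot> b i)"
  proof -
    interpret WV: kspace "V\<lparr>carrier := W\<rparr>" by (rule subspace_kspace[OF W])
    have "addmap (V\<lparr>carrier := W\<rparr>) V (\<lambda>x. x)" using W.subset by (auto simp: addmap_def)
    from addmap_finsum[OF WV.grp grp this, of "{..<m}" "\<lambda>i. co i x \<odot> b i"] show ?thesis
      using b by simp
  qed
  finally show "x = (\<Oplus>\<^bsub>V\<lparr>carrier := W\<rparr>\<^esub>i<m. co i x \<odot>\<^bsub>V\<lparr>carrier := W\<rparr>\<^esub> b i)" by simp
next
  interpret W: submodule class_ring W V by fact
  fix i assume "i \<in> {..<m}"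
  then have "linfun V (co i)" using F m by (simp add: frame_def)
  then show "linfun (V\<lparr>carrier := W\<rparr>) (co i)" by (simp add: linfun_def subsetD[OF W.subset])
qed (use b in auto)

lemma subspace_fin_dim:
  assumes "vs.fin_dim" "submodule class_ring W V"
  shows "vectorspace.fin_dim class_ring (V\<lparr>carrier := W\<rparr>)"
proof -
  interpret W: kspace "V\<lparr>carrier := W\<rparr>" by (rule subspace_kspace[OF assms(2)])
  obtain m n b co where *: "m \<le> n" "frame V {..<n::nat} b co" "\<forall>i<m. b i \<in> W"
     "\<forall>w\<in>W. \<forall>i<n. m \<le> i \<longrightarrow> co i w = 0"
    using adapted_frame[OF assms] by metis
  show ?thesis by (rule W.frame_fin_dim[OF subspace_frame[OF assms(2) *(2,1,3,4)]])
qed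

text \<open>An injective endomorphism maps a basis to an independent set with as many elements, hence to a basis.\<close>

lemma linend_inj_surj:
  assumes fd: "vs.fin_dim" and f: "linend V f"
    and inj: "\<And>x. x \<in> carrier V ==> f x = \<zero> ==> x = \<zero>" and y: "y \<in> carrier V"
  shows "\<exists>x\<in>carrier V. f x = y"
proof -
  interpret L: linear_map class_ring V V f
    by unfold_locales (use f in \<open>auto simp: LinearCombinations.module_hom_def linend_def\<close>)
  obtain S where S: "finite S" "vs.basis S" using vs.finite_basis_exists[OF fd] by blast
  have SV: "S \<subseteq> carrier V" using S(2) by (simp add: vs.basis_def)
  have "carrier (V\<lparr>carrier := L.kerT\<rparr>) = {\<zero>}"
    using inj L.f0_is_0 by (auto simp: L.ker_def)
  then have inj': "inj_on f (carrier V)" by (rule L.Ke0_imp_inj)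
  have im: "f ` S \<subseteq> carrier V" "finite (f ` S)" using SV S(1) f by (auto simp: linend_def)
  have "lin_indpt (f ` S)"
  proof (rule finite_lin_indpt2[OF im(2,1)])
    fix a :: "'v \<Rightarrow> 'k" assume a: "a \<in> f ` S \<rightarrow> carrier class_ring" "lincomb a (f ` S) = \<zero>"
    have cl: "lincomb (a \<circ> f) S \<in> carrier V" using SV by (intro lincomb_closed) auto
    have "f (lincomb (a \<circ> f) S) = \<zero>" using L.lincomb_linear_image[OF inj' SV a(1) S(1)] a(2) by simp
    then have z: "lincomb (a \<circ> f) S = \<zero>" using inj cl by blast
    have "(a \<circ> f) s = 0" if "s \<in> S" for s
    proof (rule ccontr)
      assume "(a \<circ> f) s \<noteq> 0"
      then have "lin_dep S" using lin_dep_crit[OF S(1) subset_refl, of "a \<circ> f" s] z that by auto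
      then show False using S(2) by (simp add: vs.basis_def)
    qed
    then show "\<forall>v\<in>f ` S. a v = \<zero>\<^bsub>class_ring\<^esub>" by auto
  qed
  moreover have "card (f ` S) \<ge> vs.dim"
    using vs.dim_basis[OF S] card_image[OF inj_on_subset[OF inj' SV]] by simp
  ultimately have "vs.basis (f ` S)" by (intro vs.dim_li_is_basis[OF fd im(2,1)])
  then have "y \<in> span (f ` S)" using y by (simp add: vs.basis_def)
  then obtain a where a: "lincomb a (f ` S) = y" using finite_in_span[OF im(2,1)] by blast
  have "f (lincomb (a \<circ> f) S) = y" using L.lincomb_linear_image[OF inj' SV _ S(1), of a] a by simp
  moreover have "lincomb (a \<circ> f) S \<in> carrier V" using SV by (intro lincomb_closed) auto
  ultimately show ?thesis by blast
qed

end

text \<open>The matrix of \<open>f\<close> in a basis has an eigenvector because its characteristic polynomial has a root.\<close>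

lemma eigenvector_exists:
  fixes V :: "('k::alg_closed_field, 'v, 'u) module_scheme" (structure)
  assumes "kspace V" "vectorspace.fin_dim class_ring V" and f: "linend V f"
    and x0: "x0 \<in> carrier V" "x0 \<noteq> \<zero>"
  shows "\<exists>c. \<exists>x\<in>carrier V. x \<noteq> \<zero> \<and> f x = c \<odot> x"
proof -
  interpret kspace V by fact
  obtain n b co where F: "frame V {..<n::nat} b co"
    and dl: "\<forall>i<n. \<forall>j<n. co i (b j) = (if i = j then 1 else 0)"
    using frame_exists[OF assms(2)] by blast
  have b: "b i \<in> carrier V" "f (b i) \<in> carrier V" "linfun V (co i)" if "i < n" for i
    using F f that by (auto simp: frame_def linend_def)
  have exp: "x = (\<Oplus>i<n. co i x \<odot> b i)" if "x \<in> carrier V" for x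
    using F that by (auto simp: frame_def)
  have n: "n > 0"
  proof (rule ccontr)
    assume "\<not> n > 0"
    then have "{..<n} = {}" by auto
    then show False using exp[OF x0(1)] x0(2) by (simp only: finsum_empty)
  qed
  define A where "A = mat n n (\<lambda>(i, j). co i (f (b j)))"
  have A: "A \<in> carrier_mat n n" by (simp add: A_def)
  have "degree (char_poly A) > 0" using degree_monic_char_poly[OF A] n by simp
  then obtain c where "poly (char_poly A) c = 0" using alg_closed_imp_poly_has_root by blast
  then obtain v where v: "eigenvector A v c" using eigenvalue_root_char_poly[OF A] by (auto simp: eigenvalue_def)
  then have vc: "v \<in> carrier_vec n" "v \<noteq> 0\<^sub>v n" "A *\<^sub>v v = c \<cdot>\<^sub>v v" using A by (auto simp: eigenvector_def)
  define x where "x = (\<Oplus>i<n. v $ i \<odot> b i)"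
  have x: "x \<in> carrier V" unfolding x_def using b by (intro finsum_closed) auto
  have cox: "co i x = v $ i" if i: "i < n" for i
  proof -
    have "co i x = (\<Sum>j\<in>{..<n}. co i (v $ j \<odot> b j))"
      unfolding x_def by (rule linfun_finsum[OF grp b(3)[OF i]]) (use b in simp)
    also have "\<dots> = (\<Sum>j\<in>{..<n}. if i = j then v $ j else 0)"
      using b dl i by (intro sum.cong) (auto simp: linfun_smult[OF b(3)[OF i]])
    finally show ?thesis using i by simp
  qed
  have "x \<noteq> \<zero>"
  proof
    assume "x = \<zero>"
    then have "v $ i = 0" if "i < n" for i using cox[OF that] linfun_zero[OF grp b(3)[OF that]] by simp
    then have "v = 0\<^sub>v n" using vc(1) by (intro eq_vecI) auto
    then show False using vc by simp
  qed
  moreover have "f x = c \<odot> x"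
  proof -
    have fx: "f x \<in> carrier V" using x f by (simp add: linend_def)
    have co_eq: "co i (f x) = co i (c \<odot> x)" if i: "i < n" for i
    proof -
      have cf: "linfun V (\<lambda>x. co i (f x))" using f b(3)[OF i] by (simp add: linfun_def linend_def)
      have "co i (f x) = (\<Sum>j\<in>{..<n}. co i (f (v $ j \<odot> b j)))"
        unfolding x_def by (rule linfun_finsum[OF grp cf]) (use b in simp)
      also have "\<dots> = (\<Sum>j\<in>{..<n}. co i (f (b j)) * v $ j)"
        using b by (intro sum.cong) (auto simp: linfun_smult[OF cf] mult.commute)
      also have "\<dots> = (A *\<^sub>v v) $ i"
        using i vc(1) by (simp add: A_def scalar_prod_def lessThan_atLeast0)
      also have "\<dots> = c * v $ i" using vc i by simp
      finally show ?thesis using cox[OF i] x by (simp add: linfun_smult[OF b(3)[OF i]])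
    qed
    have "f x = (\<Oplus>i<n. co i (f x) \<odot> b i)" using exp[OF fx] .
    also have "\<dots> = (\<Oplus>i<n. co i (c \<odot> x) \<odot> b i)"
      using b co_eq by (intro sum_cong) auto
    also have "\<dots> = c \<odot> x" using exp[of "c \<odot> x"] x by simp
    finally show ?thesis .
  qed
  ultimately show ?thesis using x by blast
qed

section \<open>Semisimple algebras in characteristic zero\<close>

lemma k_algebra_iff: "k_algebra B \<longleftrightarrow> algebra_over class_ring B"
  using class_field by (auto simp: k_algebra_def algebra_over_def vectorspace_def)

locale kalg = fixes B :: "('k::field, 'b, 'u) module_scheme" (structure)
  assumes k_algebra_B: "k_algebra B"
begin

sublocale kspace B
  using k_algebra_B by (simp add: kspace_def k_algebra_iff algebra_over_def)

sublocale ring B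
  using k_algebra_B by (simp add: k_algebra_def)

lemma smult_mult [simp]:
  "x \<in> carrier B ==> y \<in> carrier B ==> (c \<odot> x) \<otimes> y = c \<odot> (x \<otimes> y)"
  "x \<in> carrier B ==> y \<in> carrier B ==> x \<otimes> (c \<odot> y) = c \<odot> (x \<otimes> y)"
  using k_algebra_B by (simp_all add: k_algebra_def)

lemma balanced_mult: "balanced class_ring B B B (\<lambda>x y. x \<otimes> y)"
  by (rule balancedI) (simp_all add: l_distr r_distr)

lemma left_ideal_submodule:
  assumes "left_ideal I B"
  shows "submodule class_ring I B"
proof -
  interpret additive_subgroup I B using assms by (simp add: left_ideal_def)
  have "c \<odot> y \<in> I" if "y \<in> I" for c y
  proof -
    have y: "y \<in> carrier B" using that a_subset by blast
    have "(c \<odot> \<one>) \<otimes> y \<in> I" using assms that unfolding left_ideal_def by (meson one_closed smult_simps(1))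
    then show ?thesis using y by simp
  qed
  then show ?thesis
    using module_V a_subset by (simp add: submodule_def)
qed

lemma linend_left: "x \<in> carrier B ==> linend B (\<lambda>y. x \<otimes> y)"
  by (simp add: linend_def r_distr)

lemma left_idealI:
  assumes "I \<subseteq> carrier B" "\<zero> \<in> I" "\<And>x y. x \<in> I ==> y \<in> I ==> x \<oplus> y \<in> I"
    and "\<And>x y. x \<in> carrier B ==> y \<in> I ==> x \<otimes> y \<in> I"
  shows "left_ideal I B"
proof -
  have neg: "\<ominus> x \<in> I" if "x \<in> I" for x
  proof -
    have "(\<ominus> \<one>) \<otimes> x \<in> I" using assms(4)[of "\<ominus> \<one>" x] that by simp
    then show ?thesis using that assms(1) by (auto simp: l_minus)
  qed
  have "additive_subgroup I B"
    unfolding additive_subgroup_def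
    by (rule group.subgroupI[OF a_group]) (use assms(1-3) neg in \<open>auto simp: a_inv_def[symmetric]\<close>)
  then show ?thesis using assms(4) by (simp add: left_ideal_def)
qed

end

locale fdalg = kalg +
  assumes fd: "vs.fin_dim"
begin

abbreviation "Tr \<equiv> reg_trace B"

lemma Tr_frame:
  assumes "frame B I b co" "x \<in> carrier B"
  shows "Tr x = (\<Sum>i\<in>I. co i (x \<otimes> b i))"
  unfolding reg_trace_def by (rule endo_trace_frame[OF fd linend_left[OF assms(2)] assms(1)])

lemma Tr_linfun: "linfun B Tr"
proof -
  obtain n b co where F: "frame B {..<n::nat} b co" using frame_exists[OF fd] by blast
  have b: "b i \<in> carrier B" "linfun B (co i)" if "i < n" for i using F that by (auto simp: frame_def)
  show ?thesis
    unfolding linfun_def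
    by (auto simp: Tr_frame[OF F] b l_distr linfun_add linfun_smult sum.distrib sum_distrib_left)
qed

lemma Tr_add: "x \<in> carrier B ==> y \<in> carrier B ==> Tr (x \<oplus> y) = Tr x + Tr y"
  and Tr_smult: "x \<in> carrier B ==> Tr (c \<odot> x) = c * Tr x"
  by (simp_all add: linfun_add[OF Tr_linfun] linfun_smult[OF Tr_linfun])

lemma Tr_zero [simp]: "Tr \<zero> = 0"
  by (rule linfun_zero[OF grp Tr_linfun])

lemma Tr_minus: "x \<in> carrier B ==> y \<in> carrier B ==> Tr (x \<ominus> y) = Tr x - Tr y"
  using Tr_add[of "x \<ominus> y" y] by (simp add: minus_eq a_assoc l_neg)

lemma Tr_finsum: "(\<And>i. i \<in> I ==> a i \<in> carrier B) ==> Tr (\<Oplus>i\<in>I. a i) = (\<Sum>i\<in>I. Tr (a i))"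
  by (rule linfun_finsum[OF grp Tr_linfun])

lemma Tr_comm:
  assumes "x \<in> carrier B" "y \<in> carrier B"
  shows "Tr (x \<otimes> y) = Tr (y \<otimes> x)"
proof -
  obtain n b co where F: "frame B {..<n::nat} b co" using frame_exists[OF fd] by blast
  have b: "b i \<in> carrier B" if "i < n" for i using F that by (auto simp: frame_def)
  have "Tr (x \<otimes> y) = (\<Sum>i<n. co i (x \<otimes> (y \<otimes> b i)))"
    using assms b by (simp add: Tr_frame[OF F] m_assoc)
  also have "\<dots> = (\<Sum>i<n. co i (y \<otimes> (x \<otimes> b i)))"
    by (rule frame_trace_comm[OF F linend_left[OF assms(1)] linend_left[OF assms(2)]])
  also have "\<dots> = Tr (y \<otimes> x)" using assms b by (simp add: Tr_frame[OF F] m_assoc)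
  finally show ?thesis .
qed

end

locale ssalg = fdalg B for B :: "('k::field_char_0, 'b, 'u) module_scheme" (structure) +
  assumes ss: "semisimple_ring B"
begin

text \<open>Decompose \<open>1 = i + j\<close> along \<open>I \<oplus> J\<close>. For \<open>x \<in> I\<close> the element \<open>x j = x - x
  i\<close> lies in \<open>I \<inter> J = 0\<close>.\<close>

lemma left_ideal_idempotent:
  assumes I: "left_ideal I B"
  shows "\<exists>i\<in>I. i \<otimes> i = i \<and> (\<forall>x\<in>I. x \<otimes> i = x)"
proof -
  obtain J where J: "left_ideal J B" "I \<inter> J = {\<zero>}" "I <+> J = carrier B"
    using ss I unfolding semisimple_ring_def by blast
  interpret I: submodule class_ring I B by (rule left_ideal_submodule[OF I])
  interpret J: submodule class_ring J B by (rule left_ideal_submodule[OF J(1)])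
  have "\<one> \<in> I <+> J" using J(3) by simp
  then obtain i j where ij: "i \<in> I" "j \<in> J" "\<one> = i \<oplus> j" by (auto simp: set_add_def')
  have c: "i \<in> carrier B" "j \<in> carrier B" using ij I.subset J.subset by auto
  have "x \<otimes> i = x" if x: "x \<in> I" for x
  proof -
    have xc: "x \<in> carrier B" using x I.subset by auto
    have e: "x = x \<otimes> i \<oplus> x \<otimes> j" using xc c by (simp flip: r_distr ij(3))
    have xi: "x \<otimes> i \<in> I" "x \<otimes> j \<in> J" using I J(1) ij xc by (auto simp: left_ideal_def)
    have "x \<otimes> j = x \<oplus> (- 1) \<odot> (x \<otimes> i)"
    proof -
      have "x \<oplus> (- 1) \<odot> (x \<otimes> i) = (x \<otimes> i \<oplus> x \<otimes> j) \<oplus> (- 1) \<odot> (x \<otimes> i)" using e by simp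
      also have "\<dots> = x \<otimes> j \<oplus> (1 \<odot> (x \<otimes> i) \<oplus> (- 1) \<odot> (x \<otimes> i))" using xc c by (simp add: a_ac)
      also have "\<dots> = x \<otimes> j" using xc c by (subst smult_distr(2)[symmetric]) simp_all
      finally show ?thesis by simp
    qed
    then have "x \<otimes> j \<in> I" using x xi I.smult_closed[of "- 1"] I.m_closed by simp
    then have "x \<otimes> j = \<zero>" using xi J(2) by blast
    then show ?thesis using e xc c by simp
  qed
  then show ?thesis using ij(1) by blast
qed

text \<open>In a basis adapted to \<open>i B\<close>, left multiplication by the idempotent \<open>i\<close> is a projection, and its trace is
  the dimension of \<open>i B\<close>; characteristic \<open>0\<close> is needed to conclude that this dimension vanishes.\<close>

lemma Tr_idempotent:
  assumes i: "i \<in> carrier B" "i \<otimes> i = i" and tr: "Tr i = 0"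
  shows "i = \<zero>"
proof -
  let ?W = "(\<lambda>x. i \<otimes> x) ` carrier B"
  have W: "submodule class_ring ?W B"
    unfolding submodule_def
  proof (intro conjI allI impI)
    fix v w assume vw: "v \<in> ?W" "w \<in> ?W"
    then obtain x y where "v = i \<otimes> x" "w = i \<otimes> y" "x \<in> carrier B" "y \<in> carrier B" by blast
    then have "v \<oplus> w = i \<otimes> (x \<oplus> y)" "x \<oplus> y \<in> carrier B" using i by (simp_all add: r_distr)
    then show "v \<oplus> w \<in> ?W" by blast
  next
    show "\<zero> \<in> ?W" using i by (intro image_eqI[of _ _ \<zero>]) simp_all
  next
    fix c :: 'k and v assume "c \<in> carrier class_ring" "v \<in> ?W"
    then obtain x where "v = i \<otimes> x" "x \<in> carrier B" by blast
    then have "c \<odot> v = i \<otimes> (c \<odot> x)" "c \<odot> x \<in> carrier B" using i by simp_all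
    then show "c \<odot> v \<in> ?W" by blast
  qed (use i module_V in auto)
  obtain m n b co where *: "m \<le> n" "frame B {..<n::nat} b co"
     "\<forall>i<n. \<forall>j<n. co i (b j) = (if i = j then 1 else 0)"
     "\<forall>i<m. b i \<in> ?W" "\<forall>w\<in>?W. \<forall>i<n. m \<le> i \<longrightarrow> co i w = 0"
    using adapted_frame[OF fd W] by metis
  have b: "b j \<in> carrier B" "linfun B (co j)" if "j < n" for j using *(2) that by (auto simp: frame_def)
  have "co j (i \<otimes> b j) = (if j < m then 1 else 0)" if j: "j < n" for j
  proof (cases "j < m")
    case True
    then obtain x where x: "b j = i \<otimes> x" "x \<in> carrier B" using *(4) by blast
    then have "i \<otimes> b j = b j" using i by (simp flip: m_assoc)
    then show ?thesis using *(3) j True by simp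
  next
    case False
    then show ?thesis using *(5) j b(1)[OF j] by auto
  qed
  then have "Tr i = (\<Sum>j<n. if j < m then 1 else 0)" by (simp add: Tr_frame[OF *(2) i(1)])
  also have "\<dots> = (\<Sum>j<m. 1)" using *(1) by (intro sum.mono_neutral_cong_right) auto
  finally have "m = 0" using tr by simp
  moreover have "i \<in> ?W" using i by (intro image_eqI[of _ _ \<one>]) simp_all
  ultimately have "co j i = 0" if "j < n" for j using *(5) that by blast
  then have "(\<Oplus>j<n. co j i \<odot> b j) = \<zero>" using b by (intro add.finprod_one_eqI) simp
  then show ?thesis using *(2) i by (simp add: frame_def)
qed

text \<open>The radical of the trace form is a left ideal, generated by an idempotent of trace \<open>0\<close>.\<close>

lemma Tr_nondegenerate:
  assumes x: "x \<in> carrier B" and z: "\<And>y. y \<in> carrier B ==> Tr (x \<otimes> y) = 0"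
  shows "x = \<zero>"
proof -
  let ?I = "{x \<in> carrier B. \<forall>y\<in>carrier B. Tr (x \<otimes> y) = 0}"
  have I: "left_ideal ?I B"
  proof (rule left_idealI)
    fix u v assume u: "u \<in> carrier B" and v: "v \<in> ?I"
    have "Tr (u \<otimes> v \<otimes> y) = 0" if y: "y \<in> carrier B" for y
    proof -
      have "Tr (u \<otimes> v \<otimes> y) = Tr (v \<otimes> (y \<otimes> u))"
        using u v y Tr_comm[of u "v \<otimes> y"] by (simp add: m_assoc)
      then show ?thesis using v y u by simp
    qed
    then show "u \<otimes> v \<in> ?I" using u v by simp
  qed (auto simp: l_distr Tr_add)
  obtain i where i: "i \<in> ?I" "i \<otimes> i = i" "\<forall>x\<in>?I. x \<otimes> i = x"
    using left_ideal_idempotent[OF I] by blast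
  have "Tr (i \<otimes> \<one>) = 0" using i(1) by blast
  then have "i = \<zero>" using i by (intro Tr_idempotent) auto
  then show ?thesis using i(3) x z by fastforce
qed

lemma Tr_eqI:
  assumes "x \<in> carrier B" "y \<in> carrier B" "\<And>z. z \<in> carrier B ==> Tr (x \<otimes> z) = Tr (y \<otimes> z)"
  shows "x = y"
proof -
  have "x \<ominus> y = \<zero>"
  proof (rule Tr_nondegenerate)
    fix z assume "z \<in> carrier B"
    then show "Tr ((x \<ominus> y) \<otimes> z) = 0"
    proof -
      have "(x \<ominus> y) \<otimes> z = x \<otimes> z \<ominus> y \<otimes> z"
        using assms(1,2) \<open>z \<in> carrier B\<close> by (simp add: minus_eq l_distr l_minus)
      then show ?thesis using assms \<open>z \<in> carrier B\<close> by (simp add: Tr_minus)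
    qed
  qed (use assms in simp)
  then show ?thesis using assms by simp
qed

text \<open>As \<open>d\<close> is central, the idempotent that generates the left ideal \<open>B d x\<close> is a multiple of \<open>d d
  x\<close>.\<close>

lemma central_square_zero:
  assumes d: "d \<in> ring_center B" and x: "x \<in> carrier B" and z: "d \<otimes> (d \<otimes> x) = \<zero>"
  shows "d \<otimes> x = \<zero>"
proof -
  have dc: "d \<in> carrier B" and dcomm: "\<And>y. y \<in> carrier B ==> d \<otimes> y = y \<otimes> d"
    using d by (auto simp: ring_center_def)
  let ?w = "d \<otimes> x"
  let ?I = "(\<lambda>y. y \<otimes> ?w) ` carrier B"
  have w: "?w \<in> carrier B" using dc x by simp
  have I: "left_ideal ?I B"
  proof (rule left_idealI)
    show "\<zero> \<in> ?I" using w by (intro image_eqI[of _ _ \<zero>]) simp_all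
  next
    fix u v assume "u \<in> ?I" "v \<in> ?I"
    then obtain p q where "u = p \<otimes> ?w" "v = q \<otimes> ?w" "p \<in> carrier B" "q \<in> carrier B" by blast
    then have "u \<oplus> v = (p \<oplus> q) \<otimes> ?w" "p \<oplus> q \<in> carrier B" using w by (simp_all add: l_distr)
    then show "u \<oplus> v \<in> ?I" by blast
  next
    fix u v assume "u \<in> carrier B" "v \<in> ?I"
    then obtain q where "v = q \<otimes> ?w" "q \<in> carrier B" by blast
    then have "u \<otimes> v = (u \<otimes> q) \<otimes> ?w" "u \<otimes> q \<in> carrier B" using w \<open>u \<in> carrier B\<close> by (simp_all add: m_assoc)
    then show "u \<otimes> v \<in> ?I" by blast
  qed (use w in auto)
  obtain i where i: "i \<in> ?I" "i \<otimes> i = i" "\<forall>x\<in>?I. x \<otimes> i = x"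
    using left_ideal_idempotent[OF I] by blast
  obtain y where y: "i = y \<otimes> ?w" "y \<in> carrier B" using i(1) by blast
  have "i \<otimes> i = y \<otimes> x \<otimes> y \<otimes> (d \<otimes> (d \<otimes> x))"
  proof -
    have "i \<otimes> i = y \<otimes> (d \<otimes> x) \<otimes> (y \<otimes> (d \<otimes> x))" using y by simp
    also have "\<dots> = y \<otimes> (x \<otimes> d) \<otimes> (y \<otimes> (d \<otimes> x))" using dcomm[OF x] by simp
    also have "\<dots> = y \<otimes> x \<otimes> (d \<otimes> y) \<otimes> (d \<otimes> x)" using y x dc by (simp add: m_assoc)
    also have "\<dots> = y \<otimes> x \<otimes> (y \<otimes> d) \<otimes> (d \<otimes> x)" using dcomm[OF y(2)] by simp
    finally show ?thesis using y x dc by (simp add: m_assoc)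
  qed
  then have "i = \<zero>" using i(2) z y x by simp
  moreover have "?w \<in> ?I" using w by (intro image_eqI[of _ _ \<one>]) simp_all
  then have "?w \<otimes> i = ?w" using i(3) by blast
  ultimately show ?thesis using w by simp
qed

text \<open>Nondegeneracy makes the map from \<open>B\<close> to coordinate vectors of the trace form injective, hence surjective, so that
  each coordinate functional is \<open>Tr (\<cdot> Y\<^sub>i)\<close>.\<close>

lemma dual_frame_exists:
  "\<exists>n X Y. (\<forall>i<n. X i \<in> carrier B \<and> Y i \<in> carrier B) \<and>
     frame B {..<n::nat} X (\<lambda>i x. Tr (x \<otimes> Y i))"
proof -
  obtain n b co where F: "frame B {..<n::nat} b co"
    and dl: "\<forall>i<n. \<forall>j<n. co i (b j) = (if i = j then 1 else 0)"
    using frame_exists[OF fd] by blast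
  have b: "b i \<in> carrier B" "linfun B (co i)" if "i < n" for i using F that by (auto simp: frame_def)
  define f where "f x = (\<Oplus>i<n. Tr (x \<otimes> b i) \<odot> b i)" for x
  have f: "linend B f"
    unfolding linend_def
  proof (intro conjI ballI allI)
    fix x y assume xy: "x \<in> carrier B" "y \<in> carrier B"
    have "f (x \<oplus> y) = (\<Oplus>i<n. Tr (x \<otimes> b i) \<odot> b i \<oplus> Tr (y \<otimes> b i) \<odot> b i)"
      unfolding f_def using xy b by (intro sum_cong) (simp_all add: l_distr Tr_add smult_distr)
    also have "\<dots> = f x \<oplus> f y" unfolding f_def using xy b by (intro finsum_addf) auto
    finally show "f (x \<oplus> y) = f x \<oplus> f y" .
  next
    fix c x assume x: "x \<in> carrier B"
    show "f (c \<odot> x) = c \<odot> f x"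
      unfolding f_def using x b
      by (subst finsum_smult_right) (auto intro!: sum_cong simp: Tr_smult smult_distr)
  qed (use b in \<open>auto simp: f_def intro!: finsum_closed\<close>)
  have cof: "co i (f x) = Tr (x \<otimes> b i)" if i: "i < n" and x: "x \<in> carrier B" for i x
  proof -
    have "co i (f x) = (\<Sum>j\<in>{..<n}. co i (Tr (x \<otimes> b j) \<odot> b j))"
      unfolding f_def by (rule linfun_finsum[OF grp b(2)[OF i]]) (use b in simp)
    also have "\<dots> = (\<Sum>j\<in>{..<n}. if i = j then Tr (x \<otimes> b j) else 0)"
      using b dl i by (intro sum.cong) (auto simp: linfun_smult[OF b(2)[OF i]])
    finally show ?thesis using i by simp
  qed
  have inj: "x = \<zero>" if x: "x \<in> carrier B" "f x = \<zero>" for x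
  proof (rule Tr_nondegenerate[OF x(1)])
    have t: "Tr (x \<otimes> b i) = 0" if "i < n" for i
      using cof[OF that x(1)] x(2) linfun_zero[OF grp b(2)[OF that]] by simp
    fix y assume y: "y \<in> carrier B"
    have lf: "linfun B (\<lambda>y. Tr (x \<otimes> y))"
      using x by (simp add: linfun_def r_distr Tr_add Tr_smult)
    have "y = (\<Oplus>i<n. co i y \<odot> b i)" using F y by (simp add: frame_def)
    then have "Tr (x \<otimes> y) = Tr (x \<otimes> (\<Oplus>i<n. co i y \<odot> b i))" by simp
    also have "\<dots> = (\<Sum>i\<in>{..<n}. Tr (x \<otimes> (co i y \<odot> b i)))"
      by (rule linfun_finsum[OF grp lf]) (use b in simp)
    also have "\<dots> = 0" using x b t by (simp add: Tr_smult)
    finally show "Tr (x \<otimes> y) = 0" .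
  qed
  have "\<exists>y\<in>carrier B. f y = b j" if "j < n" for j
    using linend_inj_surj[OF fd f inj b(1)[OF that]] .
  then obtain Y where Y: "\<And>j. j < n ==> Y j \<in> carrier B \<and> f (Y j) = b j" by metis
  have TY: "Tr (Y j \<otimes> b i) = (if i = j then 1 else 0)" if "i < n" "j < n" for i j
    using cof[OF that(1), of "Y j"] Y[OF that(2)] dl that by simp
  have "co i x = Tr (x \<otimes> Y i)" if i: "i < n" and x: "x \<in> carrier B" for i x
  proof -
    have Yi: "Y i \<in> carrier B" using Y i by blast
    have lf: "linfun B (\<lambda>y. Tr (Y i \<otimes> y))"
      using Yi by (simp add: linfun_def r_distr Tr_add Tr_smult)
    have "x = (\<Oplus>i<n. co i x \<odot> b i)" using F x by (simp add: frame_def)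
    then have "Tr (Y i \<otimes> x) = Tr (Y i \<otimes> (\<Oplus>i<n. co i x \<odot> b i))" by simp
    also have "\<dots> = (\<Sum>j\<in>{..<n}. Tr (Y i \<otimes> (co j x \<odot> b j)))"
      by (rule linfun_finsum[OF grp lf]) (use b in simp)
    also have "\<dots> = (\<Sum>j\<in>{..<n}. if i = j then co j x else 0)"
      using b Yi TY i by (intro sum.cong) (auto simp: Tr_smult)
    finally show ?thesis using i Tr_comm[OF x Yi] by simp
  qed
  note co_Tr = this
  have "frame B {..<n} b (\<lambda>i x. Tr (x \<otimes> Y i))"
    unfolding frame_def
  proof (intro conjI ballI)
    fix x assume x: "x \<in> carrier B"
    have "x = (\<Oplus>i<n. co i x \<odot> b i)" using F x by (simp add: frame_def)
    also have "\<dots> = (\<Oplus>i<n. Tr (x \<otimes> Y i) \<odot> b i)"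
      using b x by (intro sum_cong) (simp_all add: co_Tr)
    finally show "x = (\<Oplus>i<n. Tr (x \<otimes> Y i) \<odot> b i)" .
  next
    fix i assume "i \<in> {..<n}"
    then show "linfun B (\<lambda>x. Tr (x \<otimes> Y i))" using Y by (simp add: linfun_def l_distr Tr_add Tr_smult)
  qed (simp_all add: b)
  then show ?thesis using b Y by blast
qed

end

subsection \<open>The Casimir element of the trace form\<close>

locale casimir = ssalg +
  fixes n :: nat and X Y
  assumes X [simp]: "\<And>i. i < n ==> X i \<in> carrier B" and Y [simp]: "\<And>i. i < n ==> Y i \<in> carrier B"
    and XY: "frame B {..<n} X (\<lambda>i x. reg_trace B (x \<otimes> Y i))"
begin

lemma expand_X: "x \<in> carrier B ==> x = (\<Oplus>i<n. Tr (x \<otimes> Y i) \<odot> X i)"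
  using XY by (simp add: frame_def)

lemma expand_Y:
  assumes x: "x \<in> carrier B"
  shows "x = (\<Oplus>i<n. Tr (x \<otimes> X i) \<odot> Y i)"
proof (rule Tr_eqI[OF x])
  show "(\<Oplus>i<n. Tr (x \<otimes> X i) \<odot> Y i) \<in> carrier B" by (intro finsum_closed) auto
  fix z assume z: "z \<in> carrier B"
  have lf: "linfun B (\<lambda>y. Tr (x \<otimes> y))" "linfun B (\<lambda>y. Tr (y \<otimes> z))"
    using x z by (simp_all add: linfun_def r_distr l_distr Tr_add Tr_smult)
  have "Tr (x \<otimes> z) = Tr (x \<otimes> (\<Oplus>i<n. Tr (z \<otimes> Y i) \<odot> X i))" using expand_X[OF z] by simp
  also have "\<dots> = (\<Sum>i\<in>{..<n}. Tr (x \<otimes> (Tr (z \<otimes> Y i) \<odot> X i)))"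
    by (rule linfun_finsum[OF grp lf(1)]) simp
  also have "\<dots> = (\<Sum>i\<in>{..<n}. Tr ((Tr (x \<otimes> X i) \<odot> Y i) \<otimes> z))"
    using x z by (intro sum.cong) (auto simp: Tr_smult mult.commute Tr_comm[OF z])
  also have "\<dots> = Tr ((\<Oplus>i<n. Tr (x \<otimes> X i) \<odot> Y i) \<otimes> z)"
    by (rule linfun_finsum[OF grp lf(2), symmetric]) simp
  finally show "Tr (x \<otimes> z) = Tr ((\<Oplus>i<n. Tr (x \<otimes> X i) \<odot> Y i) \<otimes> z)" .
qed

context
  fixes P :: "('p, 'w) ring_scheme" and \<beta>
  assumes P: "abelian_group P" and \<beta>: "balanced class_ring B B P \<beta>"
begin

interpretation P: abelian_group P by (rule P)

lemma \<beta>_closed [simp]: "x \<in> carrier B ==> y \<in> carrier B ==> \<beta> x y \<in> carrier P"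
  using \<beta> by (simp add: balanced_def)

lemma \<beta>_sum_left: "(\<And>i. i \<in> I ==> a i \<in> carrier B) ==> y \<in> carrier B ==>
    \<beta> (\<Oplus>i\<in>I. a i) y = (\<Oplus>\<^bsub>P\<^esub>i\<in>I. \<beta> (a i) y)"
  using \<beta> by (intro addmap_finsum[OF grp P, of "\<lambda>x. \<beta> x y"]) (auto simp: balanced_def addmap_def)

lemma \<beta>_sum_right: "(\<And>i. i \<in> I ==> a i \<in> carrier B) ==> x \<in> carrier B ==>
    \<beta> x (\<Oplus>i\<in>I. a i) = (\<Oplus>\<^bsub>P\<^esub>i\<in>I. \<beta> x (a i))"
  using \<beta> by (intro addmap_finsum[OF grp P, of "\<lambda>y. \<beta> x y"]) (auto simp: balanced_def addmap_def)

lemma \<beta>_smult: "x \<in> carrier B ==> y \<in> carrier B ==> \<beta> (c \<odot> x) y = \<beta> x (c \<odot> y)"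
  using \<beta> by (simp add: balanced_def)

text \<open>Adjoint maps for the trace form can be moved across the Casimir element.\<close>

lemma casimir_adjoint:
  assumes f: "\<And>x. x \<in> carrier B ==> f x \<in> carrier B" and f': "\<And>x. x \<in> carrier B ==> f' x \<in> carrier B"
    and adj: "\<And>x y. x \<in> carrier B ==> y \<in> carrier B ==> Tr (f x \<otimes> y) = Tr (f' y \<otimes> x)"
  shows "(\<Oplus>\<^bsub>P\<^esub>i<n. \<beta> (f (X i)) (Y i)) = (\<Oplus>\<^bsub>P\<^esub>i<n. \<beta> (X i) (f' (Y i)))"
proof -
  have "(\<Oplus>\<^bsub>P\<^esub>i<n. \<beta> (f (X i)) (Y i))
      = (\<Oplus>\<^bsub>P\<^esub>i<n. \<Oplus>\<^bsub>P\<^esub>j<n. \<beta> (X j) (Tr (f (X i) \<otimes> Y j) \<odot> Y i))"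
  proof (rule finsum_cong_P[OF P])
    fix i assume i: "i \<in> {..<n}"
    have "\<beta> (f (X i)) (Y i) = \<beta> (\<Oplus>j<n. Tr (f (X i) \<otimes> Y j) \<odot> X j) (Y i)"
      using expand_X[of "f (X i)"] f i by simp
    also have "\<dots> = (\<Oplus>\<^bsub>P\<^esub>j<n. \<beta> (Tr (f (X i) \<otimes> Y j) \<odot> X j) (Y i))"
      using i by (intro \<beta>_sum_left) auto
    also have "\<dots> = (\<Oplus>\<^bsub>P\<^esub>j<n. \<beta> (X j) (Tr (f (X i) \<otimes> Y j) \<odot> Y i))"
      using i by (intro finsum_cong_P[OF P]) (auto simp: \<beta>_smult)
    finally show "\<beta> (f (X i)) (Y i) = \<dots>" .
  qed (auto intro!: P.finsum_closed)
  also have "\<dots> = (\<Oplus>\<^bsub>P\<^esub>j<n. \<Oplus>\<^bsub>P\<^esub>i<n. \<beta> (X j) (Tr (f (X i) \<otimes> Y j) \<odot> Y i))"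
    by (rule finsum_swap[OF P]) auto
  also have "\<dots> = (\<Oplus>\<^bsub>P\<^esub>j<n. \<beta> (X j) (f' (Y j)))"
  proof (rule finsum_cong_P[OF P])
    fix j assume j: "j \<in> {..<n}"
    have "(\<Oplus>\<^bsub>P\<^esub>i<n. \<beta> (X j) (Tr (f (X i) \<otimes> Y j) \<odot> Y i))
        = \<beta> (X j) (\<Oplus>i<n. Tr (f (X i) \<otimes> Y j) \<odot> Y i)"
      using j by (intro \<beta>_sum_right[symmetric]) auto
    also have "(\<Oplus>i<n. Tr (f (X i) \<otimes> Y j) \<odot> Y i) = (\<Oplus>i<n. Tr (f' (Y j) \<otimes> X i) \<odot> Y i)"
      using j adj by (intro sum_cong) auto
    also have "\<dots> = f' (Y j)" using expand_Y[of "f' (Y j)"] f' j by simp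
    finally show "(\<Oplus>\<^bsub>P\<^esub>i<n. \<beta> (X j) (Tr (f (X i) \<otimes> Y j) \<odot> Y i)) = \<beta> (X j) (f' (Y j))" .
  qed (use f' in auto)
  finally show ?thesis .
qed

lemma casimir_left:
  assumes "a \<in> carrier B"
  shows "(\<Oplus>\<^bsub>P\<^esub>i<n. \<beta> (a \<otimes> X i) (Y i)) = (\<Oplus>\<^bsub>P\<^esub>i<n. \<beta> (X i) (Y i \<otimes> a))"
proof (rule casimir_adjoint)
  fix x y assume "x \<in> carrier B" "y \<in> carrier B"
  then show "Tr (a \<otimes> x \<otimes> y) = Tr (y \<otimes> a \<otimes> x)"
    using assms Tr_comm[of "a \<otimes> x" y] by (simp add: m_assoc)
qed (use assms in auto)

lemma casimir_right:
  assumes "a \<in> carrier B"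
  shows "(\<Oplus>\<^bsub>P\<^esub>i<n. \<beta> (X i \<otimes> a) (Y i)) = (\<Oplus>\<^bsub>P\<^esub>i<n. \<beta> (X i) (a \<otimes> Y i))"
proof (rule casimir_adjoint)
  fix x y assume "x \<in> carrier B" "y \<in> carrier B"
  then show "Tr (x \<otimes> a \<otimes> y) = Tr (a \<otimes> y \<otimes> x)"
    using assms Tr_comm[of x "a \<otimes> y"] by (simp add: m_assoc)
qed (use assms in auto)

lemma casimir_sym:
  "(\<Oplus>\<^bsub>P\<^esub>i<n. \<beta> (X i) (Y i)) = (\<Oplus>\<^bsub>P\<^esub>i<n. \<beta> (Y i) (X i))"
proof -
  have "(\<Oplus>\<^bsub>P\<^esub>i<n. \<beta> (X i) (Y i))
      = (\<Oplus>\<^bsub>P\<^esub>i<n. \<Oplus>\<^bsub>P\<^esub>j<n. \<beta> (Y j) (Tr (X i \<otimes> X j) \<odot> Y i))"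
  proof (rule finsum_cong_P[OF P])
    fix i assume i: "i \<in> {..<n}"
    have "\<beta> (X i) (Y i) = \<beta> (\<Oplus>j<n. Tr (X i \<otimes> X j) \<odot> Y j) (Y i)"
      using expand_Y[of "X i"] i by simp
    also have "\<dots> = (\<Oplus>\<^bsub>P\<^esub>j<n. \<beta> (Tr (X i \<otimes> X j) \<odot> Y j) (Y i))"
      using i by (intro \<beta>_sum_left) auto
    also have "\<dots> = (\<Oplus>\<^bsub>P\<^esub>j<n. \<beta> (Y j) (Tr (X i \<otimes> X j) \<odot> Y i))"
      using i by (intro finsum_cong_P[OF P]) (auto simp: \<beta>_smult)
    finally show "\<beta> (X i) (Y i) = \<dots>" .
  qed (auto intro!: P.finsum_closed)
  also have "\<dots> = (\<Oplus>\<^bsub>P\<^esub>j<n. \<Oplus>\<^bsub>P\<^esub>i<n. \<beta> (Y j) (Tr (X i \<otimes> X j) \<odot> Y i))"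
    by (rule finsum_swap[OF P]) auto
  also have "\<dots> = (\<Oplus>\<^bsub>P\<^esub>j<n. \<beta> (Y j) (X j))"
  proof (rule finsum_cong_P[OF P])
    fix j assume j: "j \<in> {..<n}"
    have "(\<Oplus>\<^bsub>P\<^esub>i<n. \<beta> (Y j) (Tr (X i \<otimes> X j) \<odot> Y i))
        = \<beta> (Y j) (\<Oplus>i<n. Tr (X i \<otimes> X j) \<odot> Y i)"
      using j by (intro \<beta>_sum_right[symmetric]) auto
    also have "(\<Oplus>i<n. Tr (X i \<otimes> X j) \<odot> Y i) = (\<Oplus>i<n. Tr (X j \<otimes> X i) \<odot> Y i)"
      using j by (intro sum_cong) (auto simp: Tr_comm[of "X j"])
    also have "\<dots> = X j" using expand_Y[of "X j"] j by simp
    finally show "(\<Oplus>\<^bsub>P\<^esub>i<n. \<beta> (Y j) (Tr (X i \<otimes> X j) \<odot> Y i)) = \<beta> (Y j) (X j)" .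
  qed auto
  finally show ?thesis .
qed

end

text \<open>The trace of multiplication by \<open>z\<close>, computed in the dual bases, is \<open>Tr (\<Sum> X\<^sub>i Y\<^sub>i z)\<close>.\<close>

lemma casimir_one: "(\<Oplus>i<n. X i \<otimes> Y i) = \<one>"
proof (rule Tr_eqI)
  fix z assume z: "z \<in> carrier B"
  have "Tr ((\<Oplus>i<n. X i \<otimes> Y i) \<otimes> z) = (\<Sum>i<n. Tr (X i \<otimes> Y i \<otimes> z))"
    using z linfun_finsum[OF grp, of "\<lambda>y. Tr (y \<otimes> z)" "{..<n}" "\<lambda>i. X i \<otimes> Y i"]
    by (simp add: linfun_def l_distr Tr_add Tr_smult)
  also have "\<dots> = (\<Sum>i<n. Tr (z \<otimes> X i \<otimes> Y i))"
    using z by (intro sum.cong) (auto simp: Tr_comm[of z] m_assoc)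
  also have "\<dots> = Tr z" using Tr_frame[OF XY z] by simp
  finally show "Tr ((\<Oplus>i<n. X i \<otimes> Y i) \<otimes> z) = Tr (\<one> \<otimes> z)" using z by simp
qed auto

lemma casimir_one': "(\<Oplus>i<n. Y i \<otimes> X i) = \<one>"
  using casimir_sym[OF grp balanced_mult] casimir_one by simp

end

lemma algebra_pairI: "k_algebra M ==> k_algebra N ==> algebra_pair class_ring M N"
  by (simp add: algebra_pair_def k_algebra_iff)

context kalg
begin

sublocale BB: algebra_pair class_ring B B
  by (rule algebra_pairI[OF k_algebra_B k_algebra_B])

end

subsection \<open>The two-sided separability element\<close>

context casimir
begin

definition casimir_elt where
  "casimir_elt = (\<Oplus>\<^bsub>B \<otimes>\<^sub>k B\<^esub>i<n. tens class_ring B B (X i) (Y i))"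

lemma casimir_elt_closed: "casimir_elt \<in> carrier (B \<otimes>\<^sub>k B)"
  unfolding casimir_elt_def by (intro BB.TA.M.finsum_closed) (auto intro!: BB.tens_closed)

lemma casimir_lift:
  assumes "abelian_group P" "balanced class_ring B B P \<beta>"
  shows "tensor_lift class_ring B B P \<beta> casimir_elt = (\<Oplus>\<^bsub>P\<^esub>i<n. \<beta> (X i) (Y i))"
proof -
  interpret P: abelian_group P by fact
  have "tensor_lift class_ring B B P \<beta> casimir_elt
      = (\<Oplus>\<^bsub>P\<^esub>i<n. tensor_lift class_ring B B P \<beta> (tens class_ring B B (X i) (Y i)))"
    unfolding casimir_elt_def
    by (rule addmap_finsum[OF BB.TA_group assms(1) BB.lift_addmap[OF assms]]) (auto intro!: BB.tens_closed)
  also have "\<dots> = (\<Oplus>\<^bsub>P\<^esub>i<n. \<beta> (X i) (Y i))"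
    using assms by (intro finsum_cong_P) (auto simp: BB.lift_tens balanced_def)
  finally show ?thesis .
qed

lemma casimir_mult_left:
  assumes "a \<in> carrier B" "b \<in> carrier B"
  shows "tens class_ring B B a b \<otimes>\<^bsub>B \<otimes>\<^sub>k B\<^esub> casimir_elt
    = (\<Oplus>\<^bsub>B \<otimes>\<^sub>k B\<^esub>i<n. tens class_ring B B (a \<otimes> X i) (b \<otimes> Y i))"
proof -
  have t: "tens class_ring B B a b \<in> carrier (B \<otimes>\<^sub>k B)" using assms by (rule BB.tens_closed)
  show ?thesis
    unfolding casimir_elt_def
    by (subst addmap_finsum[OF BB.TA_group BB.TA_group BB.mult_addmap_right[OF t]])
       (use assms in \<open>auto intro!: BB.tens_closed finsum_cong_P[OF BB.TA_group] simp: BB.tens_mult\<close>)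
qed

lemma casimir_mult_right:
  assumes "a \<in> carrier B" "b \<in> carrier B"
  shows "casimir_elt \<otimes>\<^bsub>B \<otimes>\<^sub>k B\<^esub> tens class_ring B B a b
    = (\<Oplus>\<^bsub>B \<otimes>\<^sub>k B\<^esub>i<n. tens class_ring B B (X i \<otimes> a) (Y i \<otimes> b))"
proof -
  have t: "tens class_ring B B a b \<in> carrier (B \<otimes>\<^sub>k B)" using assms by (rule BB.tens_closed)
  show ?thesis
    unfolding casimir_elt_def
    by (subst addmap_finsum[OF BB.TA_group BB.TA_group BB.mult_addmap_left[OF t]])
       (use assms in \<open>auto intro!: BB.tens_closed finsum_cong_P[OF BB.TA_group] simp: BB.tens_mult\<close>)
qed

lemma casimir_separability: "two_sided_separability_element B casimir_elt"
  unfolding two_sided_separability_element_def separability_element_def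
proof (intro conjI ballI)
  fix a assume a: "a \<in> carrier B"
  have "(\<Oplus>\<^bsub>B \<otimes>\<^sub>k B\<^esub>i<n. tens class_ring B B (a \<otimes> X i) (\<one> \<otimes> Y i))
      = (\<Oplus>\<^bsub>B \<otimes>\<^sub>k B\<^esub>i<n. tens class_ring B B (a \<otimes> X i) (Y i))"
    using a by (intro finsum_cong_P[OF BB.TA_group]) (auto intro!: BB.tens_closed)
  also have "\<dots> = (\<Oplus>\<^bsub>B \<otimes>\<^sub>k B\<^esub>i<n. tens class_ring B B (X i) (Y i \<otimes> a))"
    by (rule casimir_left[OF BB.TA_group BB.balanced_tens a])
  also have "\<dots> = (\<Oplus>\<^bsub>B \<otimes>\<^sub>k B\<^esub>i<n. tens class_ring B B (X i \<otimes> \<one>) (Y i \<otimes> a))"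
    using a by (intro finsum_cong_P[OF BB.TA_group]) (auto intro!: BB.tens_closed)
  finally show "tens class_ring B B a \<one> \<otimes>\<^bsub>B \<otimes>\<^sub>k B\<^esub> casimir_elt = casimir_elt \<otimes>\<^bsub>B \<otimes>\<^sub>k B\<^esub> tens class_ring B B \<one> a"
    using a by (simp add: casimir_mult_left casimir_mult_right)
next
  fix a assume a: "a \<in> carrier B"
  have "(\<Oplus>\<^bsub>B \<otimes>\<^sub>k B\<^esub>i<n. tens class_ring B B (X i \<otimes> a) (Y i \<otimes> \<one>))
      = (\<Oplus>\<^bsub>B \<otimes>\<^sub>k B\<^esub>i<n. tens class_ring B B (X i \<otimes> a) (Y i))"
    using a by (intro finsum_cong_P[OF BB.TA_group]) (auto intro!: BB.tens_closed)
  also have "\<dots> = (\<Oplus>\<^bsub>B \<otimes>\<^sub>k B\<^esub>i<n. tens class_ring B B (X i) (a \<otimes> Y i))"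
    by (rule casimir_right[OF BB.TA_group BB.balanced_tens a])
  also have "\<dots> = (\<Oplus>\<^bsub>B \<otimes>\<^sub>k B\<^esub>i<n. tens class_ring B B (\<one> \<otimes> X i) (a \<otimes> Y i))"
    using a by (intro finsum_cong_P[OF BB.TA_group]) (auto intro!: BB.tens_closed)
  finally show "casimir_elt \<otimes>\<^bsub>B \<otimes>\<^sub>k B\<^esub> tens class_ring B B a \<one> = tens class_ring B B \<one> a \<otimes>\<^bsub>B \<otimes>\<^sub>k B\<^esub> casimir_elt"
    using a by (simp add: casimir_mult_left casimir_mult_right)
next
  show "tensor_lift class_ring B B B (\<otimes>) casimir_elt = \<one>"
    using casimir_lift[OF grp balanced_mult] casimir_one by simp
qed (rule casimir_elt_closed)

text \<open>For a two-sided separability element \<open>E = \<Sum> u \<otimes> v\<close> and the Casimir element \<open>\<Sum> X \<otimes> Y\<close>, the sum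
  \<open>\<Sum> u X \<otimes> Y v\<close> can be evaluated in two ways: moving \<open>u\<close> across the Casimir element gives
  \<open>\<Sum> X \<otimes> Y u v = \<Sum> X \<otimes> Y\<close>, moving \<open>X\<close> across \<open>E\<close> gives \<open>\<Sum> u \<otimes> Y X v = E\<close>.\<close>

lemma two_sided_separability_unique:
  assumes E: "two_sided_separability_element B E"
  shows "E = casimir_elt"
proof -
  let ?P = "B \<otimes>\<^sub>k B" and ?t = "tens class_ring B B"
  note P = BB.TA_group
  note c [simp] = BB.tens_closed
  have Ec: "E \<in> carrier ?P"
    and E2: "\<And>a. a \<in> carrier B ==> E \<otimes>\<^bsub>?P\<^esub> ?t a \<one> = ?t \<one> a \<otimes>\<^bsub>?P\<^esub> E"
    and Em: "tensor_lift class_ring B B B (\<lambda>x y. x \<otimes> y) E = \<one>"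
    using E unfolding two_sided_separability_element_def separability_element_def by blast+
  obtain m :: nat and u v where uv: "\<forall>i<m. u i \<in> carrier B \<and> v i \<in> carrier B"
    and Euv: "E = (\<Oplus>\<^bsub>?P\<^esub>i<m. ?t (u i) (v i))"
    using BB.tensor_sum_exists[OF Ec] by blast
  have uv' [simp]: "u i \<in> carrier B" "v i \<in> carrier B" if "i < m" for i using uv that by auto
  have uv_one: "(\<Oplus>i<m. u i \<otimes> v i) = \<one>"
    using Em unfolding Euv by (subst (asm) BB.lift_finsum[OF grp balanced_mult]) auto
  have move: "(\<Oplus>\<^bsub>?P\<^esub>i<m. ?t (u i \<otimes> a) (b \<otimes> v i)) = (\<Oplus>\<^bsub>?P\<^esub>i<m. ?t (u i) (b \<otimes> (a \<otimes> v i)))"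
    if ab: "a \<in> carrier B" "b \<in> carrier B" for a b
  proof -
    have bal: "balanced class_ring B B ?P (\<lambda>p q. ?t p (b \<otimes> q))"
      using ab by (intro balancedI) (simp_all add: r_distr BB.tens_rules)
    have "E \<otimes>\<^bsub>?P\<^esub> ?t a \<one> = (\<Oplus>\<^bsub>?P\<^esub>i<m. ?t (u i \<otimes> a) (v i))"
      unfolding Euv using ab
      by (subst addmap_finsum[OF P P BB.mult_addmap_left[OF c[OF ab(1) one_closed]]])
        (auto intro!: finsum_cong_P[OF P] simp: BB.tens_mult)
    moreover have "?t \<one> a \<otimes>\<^bsub>?P\<^esub> E = (\<Oplus>\<^bsub>?P\<^esub>i<m. ?t (u i) (a \<otimes> v i))"
      unfolding Euv using ab
      by (subst addmap_finsum[OF P P BB.mult_addmap_right[OF c[OF one_closed ab(1)]]])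
        (auto intro!: finsum_cong_P[OF P] simp: BB.tens_mult)
    ultimately have "tensor_lift class_ring B B ?P (\<lambda>p q. ?t p (b \<otimes> q)) (\<Oplus>\<^bsub>?P\<^esub>i<m. ?t (u i \<otimes> a) (v i))
        = tensor_lift class_ring B B ?P (\<lambda>p q. ?t p (b \<otimes> q)) (\<Oplus>\<^bsub>?P\<^esub>i<m. ?t (u i) (a \<otimes> v i))"
      using E2[OF ab(1)] by simp
    then show ?thesis
      using ab by (subst (asm) (1 2) BB.lift_finsum[OF P bal]) auto
  qed
  have "(\<Oplus>\<^bsub>?P\<^esub>j<n. \<Oplus>\<^bsub>?P\<^esub>i<m. ?t (u i \<otimes> X j) (Y j \<otimes> v i))
      = (\<Oplus>\<^bsub>?P\<^esub>i<m. \<Oplus>\<^bsub>?P\<^esub>j<n. ?t (u i \<otimes> X j) (Y j \<otimes> v i))"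
    by (intro finsum_swap[OF P]) auto
  also have "\<dots> = (\<Oplus>\<^bsub>?P\<^esub>i<m. \<Oplus>\<^bsub>?P\<^esub>j<n. ?t (X j) (Y j \<otimes> (u i \<otimes> v i)))"
  proof (rule finsum_cong_P[OF P])
    fix i assume i: "i \<in> {..<m}"
    have "balanced class_ring B B ?P (\<lambda>x y. ?t x (y \<otimes> v i))"
      using i by (intro balancedI) (simp_all add: l_distr BB.tens_rules)
    from casimir_left[OF P this, of "u i"] i
    show "(\<Oplus>\<^bsub>?P\<^esub>j<n. ?t (u i \<otimes> X j) (Y j \<otimes> v i)) = (\<Oplus>\<^bsub>?P\<^esub>j<n. ?t (X j) (Y j \<otimes> (u i \<otimes> v i)))"
      by (subst trans) (auto intro!: finsum_cong_P[OF P] simp: m_assoc)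
  qed (auto intro!: BB.TA.M.finsum_closed)
  also have "\<dots> = (\<Oplus>\<^bsub>?P\<^esub>j<n. \<Oplus>\<^bsub>?P\<^esub>i<m. ?t (X j) (Y j \<otimes> (u i \<otimes> v i)))"
    by (intro finsum_swap[OF P]) auto
  also have "\<dots> = casimir_elt"
    unfolding casimir_elt_def
  proof (rule finsum_cong_P[OF P])
    fix j assume j: "j \<in> {..<n}"
    have "Y j = (\<Oplus>i<m. Y j \<otimes> (u i \<otimes> v i))"
      using j uv_one finsum_rdistr[of "{..<m}" "Y j" "\<lambda>i. u i \<otimes> v i"] by simp
    then have "?t (X j) (Y j) = ?t (X j) (\<Oplus>i<m. Y j \<otimes> (u i \<otimes> v i))" by simp
    also have "\<dots> = (\<Oplus>\<^bsub>?P\<^esub>i<m. ?t (X j) (Y j \<otimes> (u i \<otimes> v i)))"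
      using j by (intro BB.tens_finsum_right) auto
    finally show "(\<Oplus>\<^bsub>?P\<^esub>i<m. ?t (X j) (Y j \<otimes> (u i \<otimes> v i))) = ?t (X j) (Y j)" by (rule sym)
  qed auto
  finally have 1: "(\<Oplus>\<^bsub>?P\<^esub>j<n. \<Oplus>\<^bsub>?P\<^esub>i<m. ?t (u i \<otimes> X j) (Y j \<otimes> v i)) = casimir_elt" .
  have "(\<Oplus>\<^bsub>?P\<^esub>j<n. \<Oplus>\<^bsub>?P\<^esub>i<m. ?t (u i \<otimes> X j) (Y j \<otimes> v i))
      = (\<Oplus>\<^bsub>?P\<^esub>j<n. \<Oplus>\<^bsub>?P\<^esub>i<m. ?t (u i) (Y j \<otimes> X j \<otimes> v i))"
    by (rule finsum_cong_P[OF P]) (auto simp: move m_assoc intro!: BB.TA.M.finsum_closed finsum_cong_P[OF P])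
  also have "\<dots> = (\<Oplus>\<^bsub>?P\<^esub>i<m. \<Oplus>\<^bsub>?P\<^esub>j<n. ?t (u i) (Y j \<otimes> X j \<otimes> v i))"
    by (intro finsum_swap[OF P]) auto
  also have "\<dots> = E"
    unfolding Euv
  proof (rule finsum_cong_P[OF P])
    fix i assume i: "i \<in> {..<m}"
    have "v i = (\<Oplus>j<n. Y j \<otimes> X j \<otimes> v i)"
      using i casimir_one' finsum_ldistr[of "{..<n}" "v i" "\<lambda>j. Y j \<otimes> X j"] by simp
    then have "?t (u i) (v i) = ?t (u i) (\<Oplus>j<n. Y j \<otimes> X j \<otimes> v i)" by simp
    also have "\<dots> = (\<Oplus>\<^bsub>?P\<^esub>j<n. ?t (u i) (Y j \<otimes> X j \<otimes> v i))"
      using i by (intro BB.tens_finsum_right) auto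
    finally show "(\<Oplus>\<^bsub>?P\<^esub>j<n. ?t (u i) (Y j \<otimes> X j \<otimes> v i)) = ?t (u i) (v i)" by (rule sym)
  qed auto
  finally show ?thesis using 1 by simp
qed

end

subsection \<open>The trace condition\<close>

lemma mat_trace_comm:
  assumes "P \<in> carrier_mat n n" "Q \<in> carrier_mat n n"
  shows "mat_trace (P * Q) = mat_trace (Q * P :: 'k::field mat)"
proof -
  have *: "mat_trace (P * Q) = (\<Sum>i<n. \<Sum>j<n. P $$ (i, j) * Q $$ (j, i))"
    if "P \<in> carrier_mat n n" "Q \<in> carrier_mat n n" for P Q :: "'k mat"
    using that by (auto simp: mat_trace_def scalar_prod_def lessThan_atLeast0 intro!: sum.cong)
  show ?thesis
    unfolding *[OF assms] *[OF assms(2,1)] by (subst sum.swap) (simp add: mult.commute)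
qed

lemma rep_trace:
  assumes "kalg B" and \<pi>: "matrix_representation B n \<pi>"
  shows "linfun B (\<lambda>x. mat_trace (\<pi> x))" "mat_trace (\<pi> \<one>\<^bsub>B\<^esub>) = of_nat n"
    "\<And>x y. x \<in> carrier B ==> y \<in> carrier B ==> mat_trace (\<pi> (x \<otimes>\<^bsub>B\<^esub> y)) = mat_trace (\<pi> (y \<otimes>\<^bsub>B\<^esub> x))"
proof -
  have c: "\<pi> x \<in> carrier_mat n n" if "x \<in> carrier B" for x
    using \<pi> that by (simp add: matrix_representation_def)
  have d: "dim_row (\<pi> x) = n" "dim_col (\<pi> x) = n" if "x \<in> carrier B" for x using c[OF that] by auto
  show "linfun B (\<lambda>x. mat_trace (\<pi> x))"
    using \<pi> unfolding linfun_def matrix_representation_def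
    by (auto simp: mat_trace_def d sum.distrib sum_distrib_left)
  show "mat_trace (\<pi> \<one>\<^bsub>B\<^esub>) = of_nat n"
    using \<pi> by (simp add: matrix_representation_def mat_trace_def)
  fix x y assume "x \<in> carrier B" "y \<in> carrier B"
  then show "mat_trace (\<pi> (x \<otimes>\<^bsub>B\<^esub> y)) = mat_trace (\<pi> (y \<otimes>\<^bsub>B\<^esub> x))"
    using \<pi> mat_trace_comm[OF c c] by (simp add: matrix_representation_def)
qed

context casimir
begin

text \<open>The projection of \<open>B\<close> onto its center given by the Casimir element.\<close>

definition avg where "avg g = (\<Oplus>i<n. X i \<otimes> (g \<otimes> Y i))"

lemma avg_balanced: "g \<in> carrier B ==> balanced class_ring B B B (\<lambda>x y. x \<otimes> (g \<otimes> y))"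
  by (rule balancedI) (simp_all add: l_distr r_distr)

lemma avg_closed: "g \<in> carrier B ==> avg g \<in> carrier B"
  unfolding avg_def by (intro finsum_closed) auto

lemma avg_central:
  assumes g: "g \<in> carrier B"
  shows "avg g \<in> ring_center B"
  unfolding ring_center_def
proof (intro CollectI conjI ballI avg_closed[OF g])
  fix x assume x: "x \<in> carrier B"
  have "x \<otimes> avg g = (\<Oplus>i<n. x \<otimes> (X i \<otimes> (g \<otimes> Y i)))"
    unfolding avg_def using g x by (intro finsum_rdistr) auto
  also have "\<dots> = (\<Oplus>i<n. (x \<otimes> X i) \<otimes> (g \<otimes> Y i))"
    using g x by (intro sum_cong) (auto simp: m_assoc)
  also have "\<dots> = (\<Oplus>i<n. X i \<otimes> (g \<otimes> (Y i \<otimes> x)))"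
    by (rule casimir_left[OF grp avg_balanced[OF g] x])
  also have "\<dots> = (\<Oplus>i<n. (X i \<otimes> (g \<otimes> Y i)) \<otimes> x)"
    using g x by (intro sum_cong) (auto simp: m_assoc)
  also have "\<dots> = avg g \<otimes> x"
    unfolding avg_def using g x by (intro finsum_ldistr[symmetric]) auto
  finally show "avg g \<otimes> x = x \<otimes> avg g" by simp
qed

lemma avg_trace:
  assumes g: "g \<in> carrier B" and l: "linfun B l"
    and comm: "\<And>x y. x \<in> carrier B ==> y \<in> carrier B ==> l (x \<otimes> y) = l (y \<otimes> x)"
  shows "l (avg g) = l g"
proof -
  have "l (avg g) = (\<Sum>i<n. l (X i \<otimes> (g \<otimes> Y i)))"
    unfolding avg_def by (rule linfun_finsum[OF grp l]) (use g in auto)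
  also have "\<dots> = (\<Sum>i<n. l (g \<otimes> (Y i \<otimes> X i)))"
  proof (rule sum.cong[OF refl])
    fix i assume "i \<in> {..<n}"
    then show "l (X i \<otimes> (g \<otimes> Y i)) = l (g \<otimes> (Y i \<otimes> X i))"
      using g comm[of "X i" "g \<otimes> Y i"] by (simp add: m_assoc)
  qed
  also have "\<dots> = l (\<Oplus>i<n. g \<otimes> (Y i \<otimes> X i))"
    by (rule linfun_finsum[OF grp l, symmetric]) (use g in auto)
  also have "(\<Oplus>i<n. g \<otimes> (Y i \<otimes> X i)) = g \<otimes> (\<Oplus>i<n. Y i \<otimes> X i)"
    using g by (intro finsum_rdistr[symmetric]) auto
  finally show ?thesis using casimir_one' g by simp
qed

text \<open>Traces of representations do not see the averaging, so \<open>tr \<pi>(g) = tr \<pi>(avg g) = tr \<pi>(1)\<close>.\<close>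

lemma avg_one_imp_trace:
  assumes g: "g \<in> carrier B" and "avg g = \<one>" and \<pi>: "matrix_representation B m \<pi>"
  shows "mat_trace (\<pi> g) = of_nat m"
  using avg_trace[OF g rep_trace(1)[OF kalg_axioms \<pi>] rep_trace(3)[OF kalg_axioms \<pi>]] assms(2)
    rep_trace(2)[OF kalg_axioms \<pi>] by simp

end

text \<open>A left ideal becomes a matrix representation once a basis adapted to it is chosen.\<close>

lemma (in fdalg) left_ideal_representation:
  assumes WI: "left_ideal W B" and w: "w \<in> W" "w \<noteq> \<zero>"
  shows "\<exists>m \<pi>. m > 0 \<and> matrix_representation B m \<pi> \<and>
    (\<forall>y a. y \<in> carrier B \<longrightarrow> (\<forall>w\<in>W. y \<otimes> w = a \<odot> w) \<longrightarrow> mat_trace (\<pi> y) = of_nat m * a)"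
proof -
  have W: "submodule class_ring W B" by (rule left_ideal_submodule[OF WI])
  interpret Wm: submodule class_ring W B by (rule W)
  obtain m k b co where *: "m \<le> k" "frame B {..<k::nat} b co"
     "\<forall>i<k. \<forall>j<k. co i (b j) = (if i = j then 1 else 0)"
     "\<forall>i<m. b i \<in> W" "\<forall>w\<in>W. \<forall>i<k. m \<le> i \<longrightarrow> co i w = 0"
    using adapted_frame[OF fd W] by metis
  have b: "b j \<in> carrier B" "linfun B (co j)" if "j < k" for j using *(2) that by (auto simp: frame_def)
  have Wexp: "co i (y \<otimes> x) = (\<Sum>j<m. co i (y \<otimes> b j) * co j x)" if x: "x \<in> W" and y: "y \<in> carrier B" and i: "i < k" for x y i
  proof -
    have lf: "linfun B (\<lambda>x. co i (y \<otimes> x))" using b(2)[OF i] y by (simp add: linfun_def r_distr)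
    have xc: "x \<in> carrier B" using x Wm.subset by blast
    have "x = (\<Oplus>j<k. co j x \<odot> b j)" using *(2) xc by (simp add: frame_def)
    then have "co i (y \<otimes> x) = co i (y \<otimes> (\<Oplus>j<k. co j x \<odot> b j))" by simp
    also have "\<dots> = (\<Sum>j\<in>{..<k}. co i (y \<otimes> (co j x \<odot> b j)))"
      by (rule linfun_finsum[OF grp lf]) (use b in simp)
    also have "\<dots> = (\<Sum>j\<in>{..<k}. co i (y \<otimes> b j) * co j x)"
      using b y by (intro sum.cong) (auto simp: linfun_smult[OF b(2)[OF i]])
    also have "\<dots> = (\<Sum>j<m. co i (y \<otimes> b j) * co j x)"
      using *(1,5) x by (intro sum.mono_neutral_cong_right) auto
    finally show ?thesis .
  qed
  have bm: "b j \<in> carrier B" "b j \<in> W" "j < k" if "j < m" for j using *(1,4) b that by auto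
  have yb: "y \<otimes> b j \<in> W" if "y \<in> carrier B" "j < m" for y j
    using WI *(4) that by (simp add: left_ideal_def)
  define \<pi> where "\<pi> y = mat m m (\<lambda>(i, j). co i (y \<otimes> b j))" for y
  have rep: "matrix_representation B m \<pi>"
    unfolding matrix_representation_def
  proof (intro conjI ballI allI)
    show "\<pi> \<one> = 1\<^sub>m m" unfolding \<pi>_def using *(1,3) b by (intro eq_matI) auto
  next
    fix x y assume x: "x \<in> carrier B" and y: "y \<in> carrier B"
    show "\<pi> (x \<oplus> y) = \<pi> x + \<pi> y"
      unfolding \<pi>_def using x y bm b *(1) by (intro eq_matI) (auto simp: l_distr linfun_add)
    show "\<pi> (x \<otimes> y) = \<pi> x * \<pi> y"
    proof (rule eq_matI)
      fix i j assume "i < dim_row (\<pi> x * \<pi> y)" "j < dim_col (\<pi> x * \<pi> y)"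
      then have ij: "i < m" "j < m" by (simp_all add: \<pi>_def)
      have "\<pi> (x \<otimes> y) $$ (i, j) = co i (x \<otimes> (y \<otimes> b j))"
        using ij x y bm by (simp add: \<pi>_def m_assoc)
      also have "\<dots> = (\<Sum>l<m. co i (x \<otimes> b l) * co l (y \<otimes> b j))"
        using Wexp[OF yb[OF y ij(2)] x] ij *(1) by simp
      also have "\<dots> = (\<pi> x * \<pi> y) $$ (i, j)"
        using ij by (simp add: \<pi>_def scalar_prod_def lessThan_atLeast0)
      finally show "\<pi> (x \<otimes> y) $$ (i, j) = (\<pi> x * \<pi> y) $$ (i, j)" .
    qed (simp_all add: \<pi>_def)
  next
    fix a x assume x: "x \<in> carrier B"
    show "\<pi> (a \<odot> x) = a \<cdot>\<^sub>m \<pi> x"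
      unfolding \<pi>_def using x bm b *(1) by (intro eq_matI) (auto simp: linfun_smult)
  qed (simp add: \<pi>_def)
  have "mat_trace (\<pi> y) = of_nat m * a" if "y \<in> carrier B" "\<forall>w\<in>W. y \<otimes> w = a \<odot> w" for y a
  proof -
    have "mat_trace (\<pi> y) = (\<Sum>i<m. a)"
      unfolding mat_trace_def
    proof (rule sum.cong)
      fix i assume "i \<in> {..<m}"
      then show "\<pi> y $$ (i, i) = a"
        using *(3) bm b that by (simp add: \<pi>_def linfun_smult)
    qed (simp add: \<pi>_def)
    then show ?thesis by simp
  qed
  moreover have "m > 0"
  proof (rule ccontr)
    assume "\<not> m > 0"
    then have "co i w = 0" if "i < k" for i using *(5) w(1) that by blast
    then have "(\<Oplus>j<k. co j w \<odot> b j) = \<zero>" using b by (intro add.finprod_one_eqI) simp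
    moreover have "w \<in> carrier B" using w(1) Wm.subset by blast
    ultimately show False using *(2) w(2) by (simp add: frame_def)
  qed
  ultimately show ?thesis using rep by blast
qed

text \<open>Let \<open>c = avg g\<close> and suppose that the central element \<open>d = c - 1\<close> is nonzero. Multiplication by
  \<open>c\<close> has an eigenvector in \<open>d B\<close>, and its eigenspace there is a left ideal, that is, a representation in
  which \<open>c\<close> is a scalar \<open>l\<close>. The trace condition forces \<open>l = 1\<close>, so \<open>d\<close> kills a
  nonzero element of \<open>d B\<close>, contrary to \<open>central_square_zero\<close>.\<close>

lemma trace_imp_avg_one:
  fixes B :: "('k::{alg_closed_field,field_char_0}, 'b, 'u) module_scheme" (structure)
  assumes "casimir B n X Y" and g: "g \<in> carrier B"
    and tr: "\<And>m \<pi>. matrix_representation B m \<pi> ==> mat_trace (\<pi> g) = of_nat m"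
  shows "casimir.avg B n X Y g = \<one>"
proof -
  interpret casimir B n X Y by fact
  define c where "c = avg g"
  have cz: "c \<in> ring_center B" and cc: "c \<in> carrier B"
    using avg_central[OF g] avg_closed[OF g] by (simp_all add: c_def)
  have comm: "c \<otimes> x = x \<otimes> c" if "x \<in> carrier B" for x using cz that by (simp add: ring_center_def)
  define d where "d = c \<ominus> \<one>"
  have dc: "d \<in> carrier B" using cc by (simp add: d_def)
  have dx: "d \<otimes> x = c \<otimes> x \<ominus> x" "x \<otimes> d = x \<otimes> c \<ominus> x" if "x \<in> carrier B" for x
    using that cc by (simp_all add: d_def minus_eq l_distr r_distr l_minus r_minus)
  have dz: "d \<in> ring_center B" using dc dx comm by (simp add: ring_center_def)
  define N where "N = (\<lambda>x. d \<otimes> x) ` carrier B"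
  have Nsub: "submodule class_ring N B"
    unfolding submodule_def N_def
  proof (intro conjI allI impI)
    fix v w assume "v \<in> (\<lambda>x. d \<otimes> x) ` carrier B" "w \<in> (\<lambda>x. d \<otimes> x) ` carrier B"
    then obtain x y where "v = d \<otimes> x" "w = d \<otimes> y" "x \<in> carrier B" "y \<in> carrier B" by blast
    then have "v \<oplus> w = d \<otimes> (x \<oplus> y)" "x \<oplus> y \<in> carrier B" using dc by (simp_all add: r_distr)
    then show "v \<oplus> w \<in> (\<lambda>x. d \<otimes> x) ` carrier B" by blast
  next
    show "\<zero> \<in> (\<lambda>x. d \<otimes> x) ` carrier B" using dc by (intro image_eqI[of _ _ \<zero>]) simp_all
  next
    fix a :: 'k and v assume "a \<in> carrier class_ring" "v \<in> (\<lambda>x. d \<otimes> x) ` carrier B"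
    then obtain x where "v = d \<otimes> x" "x \<in> carrier B" by blast
    then have "a \<odot> v = d \<otimes> (a \<odot> x)" "a \<odot> x \<in> carrier B" using dc by simp_all
    then show "a \<odot> v \<in> (\<lambda>x. d \<otimes> x) ` carrier B" by blast
  qed (use dc module_V in auto)
  interpret Ns: submodule class_ring N B by (rule Nsub)
  have NI: "x \<otimes> v \<in> N" if xv: "x \<in> carrier B" "v \<in> N" for x v
  proof -
    obtain y where y: "v = d \<otimes> y" "y \<in> carrier B" using xv(2) by (auto simp: N_def)
    have "x \<otimes> v = (x \<otimes> d) \<otimes> y" using y xv(1) dc by (simp add: m_assoc)
    also have "\<dots> = (d \<otimes> x) \<otimes> y" using dz xv(1) by (simp add: ring_center_def)
    also have "\<dots> = d \<otimes> (x \<otimes> y)" using y xv(1) dc by (simp add: m_assoc)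
    finally show ?thesis using y(2) xv(1) by (auto simp: N_def)
  qed
  have dzero: "d = \<zero>"
  proof (rule ccontr)
    assume d0: "d \<noteq> \<zero>"
    have "\<exists>a. \<exists>x\<in>carrier (B\<lparr>carrier := N\<rparr>). x \<noteq> \<zero>\<^bsub>B\<lparr>carrier := N\<rparr>\<^esub> \<and> c \<otimes> x = a \<odot>\<^bsub>B\<lparr>carrier := N\<rparr>\<^esub> x"
    proof (rule eigenvector_exists[OF subspace_kspace[OF Nsub] subspace_fin_dim[OF fd Nsub], where ?x0.0 = d])
      show "linend (B\<lparr>carrier := N\<rparr>) (\<lambda>x. c \<otimes> x)"
        using NI[OF cc] Ns.subset cc by (auto simp: linend_def r_distr subset_iff)
      show "d \<in> carrier (B\<lparr>carrier := N\<rparr>)" using dc by (auto simp: N_def intro: image_eqI[of _ _ \<one>])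
      show "d \<noteq> \<zero>\<^bsub>B\<lparr>carrier := N\<rparr>\<^esub>" using d0 by simp
    qed
    then obtain a w where w: "w \<in> N" "w \<noteq> \<zero>" "c \<otimes> w = a \<odot> w" by auto
    have wc: "w \<in> carrier B" using w(1) Ns.subset by blast
    let ?W = "{w \<in> N. c \<otimes> w = a \<odot> w}"
    have WI: "left_ideal ?W B"
    proof (rule left_idealI)
      show "?W \<subseteq> carrier B" using Ns.subset by blast
      show "\<zero> \<in> ?W" using Ns.zero_closed cc by simp
    next
      fix u v assume uv: "u \<in> ?W" "v \<in> ?W"
      then have "u \<in> carrier B" "v \<in> carrier B" using Ns.subset by auto
      then show "u \<oplus> v \<in> ?W" using uv cc Ns.m_closed by (simp add: r_distr smult_distr)
    next
      fix u v assume u: "u \<in> carrier B" and v: "v \<in> ?W"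
      have vc: "v \<in> carrier B" using v Ns.subset by auto
      have "c \<otimes> (u \<otimes> v) = (c \<otimes> u) \<otimes> v" using u vc cc by (simp add: m_assoc)
      also have "\<dots> = u \<otimes> (c \<otimes> v)" using u vc cc by (simp add: m_assoc comm)
      also have "\<dots> = a \<odot> (u \<otimes> v)" using u vc v by simp
      finally show "u \<otimes> v \<in> ?W" using NI[OF u] v by simp
    qed
    have "w \<in> ?W" using w by simp
    from left_ideal_representation[OF WI this w(2)]
    obtain m \<pi> where rep: "m > 0" "matrix_representation B m \<pi>"
      "\<forall>y a. y \<in> carrier B \<longrightarrow> (\<forall>w\<in>?W. y \<otimes> w = a \<odot> w) \<longrightarrow> mat_trace (\<pi> y) = of_nat m * a"
      by (elim exE conjE)
    have "mat_trace (\<pi> c) = of_nat m"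
      using avg_trace[OF g rep_trace(1)[OF kalg_axioms rep(2)] rep_trace(3)[OF kalg_axioms rep(2)]] tr[OF rep(2)]
      by (simp add: c_def)
    moreover have "mat_trace (\<pi> c) = of_nat m * a" using rep(3) cc by simp
    ultimately have "a = 1" using rep(1) by simp
    then have "d \<otimes> w = \<zero>" using dx[OF wc] w(3) wc by (simp add: minus_eq r_neg)
    moreover obtain x where "w = d \<otimes> x" "x \<in> carrier B" using w(1) by (auto simp: N_def)
    ultimately show False using central_square_zero[OF dz] w(2) by blast
  qed
  have "c = \<one>" using cc dzero by (simp add: d_def)
  then show ?thesis by (simp add: c_def)
qed

subsection \<open>Separable algebras are semisimple\<close>

text \<open>Averaging a linear projection onto a left ideal over a separability element makes it
  left linear; its kernel is the required complement.\<close>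

lemma (in fdalg) separable_semisimple:
  assumes uv: "\<And>i. i < m ==> u i \<in> carrier B" "\<And>i. i < m ==> v i \<in> carrier B"
    and sep: "\<And>a. a \<in> carrier B ==>
        (\<Oplus>\<^bsub>B \<otimes>\<^sub>k B\<^esub>i\<in>{..<m::nat}. tens class_ring B B (a \<otimes> u i) (v i))
      = (\<Oplus>\<^bsub>B \<otimes>\<^sub>k B\<^esub>i<m. tens class_ring B B (u i) (v i \<otimes> a))"
    and one: "(\<Oplus>i<m. u i \<otimes> v i) = \<one>"
  shows "semisimple_ring B"
  unfolding semisimple_ring_def
proof (intro allI impI)
  fix I assume I: "left_ideal I B"
  have Is: "submodule class_ring I B" by (rule left_ideal_submodule[OF I])
  interpret I: submodule class_ring I B by (rule Is)
  obtain k n b co where *: "k \<le> n" "frame B {..<n::nat} b co"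
     "\<forall>i<n. \<forall>j<n. co i (b j) = (if i = j then 1 else 0)"
     "\<forall>i<k. b i \<in> I" "\<forall>w\<in>I. \<forall>i<n. k \<le> i \<longrightarrow> co i w = 0"
    using adapted_frame[OF fd Is] by metis
  have b: "b j \<in> carrier B" "linfun B (co j)" if "j < n" for j using *(2) that by (auto simp: frame_def)
  have sumI: "(\<Oplus>i\<in>J. f i) \<in> I" if "finite J" "\<And>i. i \<in> J ==> f i \<in> I" for J f
    using that
  proof (induction J rule: finite_induct)
    case (insert j J)
    then show ?case using I.subset by (subst finsum_insert) auto
  qed simp
  define p where "p x = (\<Oplus>i<k. co i x \<odot> b i)" for x
  have bk: "b i \<in> carrier B" "linfun B (co i)" if "i < k" for i using b that *(1) by auto
  have pc: "p x \<in> carrier B" for x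
    unfolding p_def using bk by (intro finsum_closed) auto
  have pI: "p x \<in> I" for x unfolding p_def using *(4) by (intro sumI) auto
  have padd: "p (x \<oplus> y) = p x \<oplus> p y" if "x \<in> carrier B" "y \<in> carrier B" for x y
  proof -
    have "p (x \<oplus> y) = (\<Oplus>i<k. co i x \<odot> b i \<oplus> co i y \<odot> b i)"
      unfolding p_def using that bk by (intro sum_cong) (simp_all add: linfun_add smult_distr)
    also have "\<dots> = p x \<oplus> p y" unfolding p_def using bk by (intro finsum_addf) auto
    finally show ?thesis .
  qed
  have psmult: "p (c \<odot> x) = c \<odot> p x" if x: "x \<in> carrier B" for c x
    unfolding p_def using x bk
    by (subst finsum_smult_right) (auto intro!: sum_cong simp: linfun_smult smult_distr)
  have pid: "p x = x" if x: "x \<in> I" for x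
  proof -
    have xc: "x \<in> carrier B" using x I.subset by blast
    have "x = (\<Oplus>i<n. co i x \<odot> b i)" using *(2) xc by (simp add: frame_def)
    also have "\<dots> = p x"
      unfolding p_def
      by (rule add.finprod_mono_neutral_cong_right) (use *(1,5) x b in auto)
    finally show ?thesis by simp
  qed
  define q where "q x = (\<Oplus>i<m. u i \<otimes> p (v i \<otimes> x))" for x
  have qc: "q x \<in> carrier B" if "x \<in> carrier B" for x
    unfolding q_def using uv pc by (intro finsum_closed) auto
  have qI: "q x \<in> I" for x
    unfolding q_def using uv pI I by (intro sumI) (auto simp: left_ideal_def)
  have qadd: "q (x \<oplus> y) = q x \<oplus> q y" if "x \<in> carrier B" "y \<in> carrier B" for x y
  proof -
    have "q (x \<oplus> y) = (\<Oplus>i<m. u i \<otimes> p (v i \<otimes> x) \<oplus> u i \<otimes> p (v i \<otimes> y))"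
      unfolding q_def using that uv pc
      by (intro sum_cong) (simp_all add: r_distr padd)
    also have "\<dots> = q x \<oplus> q y" unfolding q_def using uv pc by (intro finsum_addf) auto
    finally show ?thesis .
  qed
  have qmult: "q (a \<otimes> x) = a \<otimes> q x" if a: "a \<in> carrier B" and x: "x \<in> carrier B" for a x
  proof -
    let ?\<beta> = "\<lambda>y z. y \<otimes> p (z \<otimes> x)"
    have \<beta>: "balanced class_ring B B B ?\<beta>"
      by (rule balancedI) (simp_all add: x pc l_distr r_distr padd psmult)
    have lift: "tensor_lift class_ring B B B ?\<beta> (\<Oplus>\<^bsub>B \<otimes>\<^sub>k B\<^esub>i<m. tens class_ring B B (y i) (z i))
        = (\<Oplus>i<m. ?\<beta> (y i) (z i))"
      if "\<And>i. i < m ==> y i \<in> carrier B" "\<And>i. i < m ==> z i \<in> carrier B" for y z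
      by (subst addmap_finsum[OF BB.TA_group grp BB.lift_addmap[OF grp \<beta>]])
        (use that x pc in \<open>auto intro!: BB.tens_closed sum_cong simp: BB.lift_tens[OF grp \<beta>]\<close>)
    have "q (a \<otimes> x) = (\<Oplus>i<m. ?\<beta> (u i) (v i \<otimes> a))"
      unfolding q_def using uv a x pc by (intro sum_cong) (auto simp: m_assoc)
    also have "\<dots> = (\<Oplus>i<m. ?\<beta> (a \<otimes> u i) (v i))"
      using arg_cong[OF sep[OF a], of "tensor_lift class_ring B B B ?\<beta>"] uv a by (simp add: lift)
    also have "\<dots> = (\<Oplus>i<m. a \<otimes> (u i \<otimes> p (v i \<otimes> x)))"
      using uv a x pc by (intro sum_cong) (auto simp: m_assoc)
    also have "\<dots> = a \<otimes> q x"
      unfolding q_def using uv a x pc by (intro finsum_rdistr[symmetric]) auto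
    finally show ?thesis .
  qed
  have qid: "q y = y" if y: "y \<in> I" for y
  proof -
    have yc: "y \<in> carrier B" using y I.subset by blast
    have "q y = (\<Oplus>i<m. (u i \<otimes> v i) \<otimes> y)"
      unfolding q_def using uv yc y I
      by (intro sum_cong) (auto simp: m_assoc pid left_ideal_def)
    also have "\<dots> = (\<Oplus>i<m. u i \<otimes> v i) \<otimes> y"
      using uv yc by (intro finsum_ldistr[symmetric]) auto
    finally show ?thesis using one yc by simp
  qed
  let ?J = "{x \<in> carrier B. q x = \<zero>}"
  have q0: "q \<zero> = \<zero>" using qid[of \<zero>] I.zero_closed by blast
  have "left_ideal ?J B"
    by (rule left_idealI) (auto simp: q0 qadd qmult)
  moreover have "I \<inter> ?J = {\<zero>}" using qid q0 I.subset I.zero_closed by auto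
  moreover have "I <+> ?J = carrier B"
  proof
    show "I <+> ?J \<subseteq> carrier B" using I.subset by (auto simp: set_add_def')
    show "carrier B \<subseteq> I <+> ?J"
    proof
      fix x assume x: "x \<in> carrier B"
      let ?y = "x \<oplus> (\<ominus> \<one>) \<otimes> q x"
      have "q ?y = q x \<oplus> (\<ominus> \<one>) \<otimes> q (q x)" using x qc by (simp add: qadd qmult del: l_minus)
      also have "\<dots> = \<zero>" using qid[OF qI] qc[OF x] by (simp add: l_minus r_neg)
      finally have "?y \<in> ?J" using x qc by simp
      moreover have "q x \<oplus> ?y = x" using x qc[OF x] by (simp add: l_minus a_lcomm r_neg)
      ultimately show "x \<in> I <+> ?J" using qI[of x] unfolding set_add_def' by force
    qed
  qed
  ultimately show "\<exists>J. left_ideal J B \<and> I \<inter> J = {\<zero>} \<and> I <+> J = carrier B" by blast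
qed

subsection \<open>Conditional expectation onto a central subalgebra\<close>

lemma (in kalg) subalgebra_submodule:
  assumes "subalgebra A B"
  shows "submodule class_ring A B"
proof -
  have "subring A B" using assms by (simp add: subalgebra_def)
  note sub = subringE[OF this]
  show ?thesis
    using assms module_V sub(1,2,7) by (simp add: submodule_def subalgebra_def)
qed

context ssalg
begin

text \<open>Multiplication by \<open>a\<close> is injective on \<open>a A\<close>, as there are no central nilpotents, and hence surjective.
  This produces \<open>z\<close> with \<open>a = a\<^sup>2 z\<close>, and \<open>a z\<close> is an idempotent of trace
  \<open>0\<close>.\<close>

lemma central_subalgebra_nondegenerate:
  assumes A: "subalgebra A B" and AZ: "A \<subseteq> ring_center B" and a: "a \<in> A"
    and tr: "\<And>x. x \<in> A ==> Tr (a \<otimes> x) = 0"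
  shows "a = \<zero>"
proof -
  have "subring A B" using A by (simp add: subalgebra_def)
  note sub = subringE[OF this]
  have Ac: "x \<in> carrier B" if "x \<in> A" for x using that sub(1) by blast
  have comm: "x \<otimes> y = y \<otimes> x" if "x \<in> A" "y \<in> carrier B" for x y using AZ that by (auto simp: ring_center_def)
  let ?W = "(\<lambda>x. a \<otimes> x) ` A"
  have W: "submodule class_ring ?W B"
    unfolding submodule_def
  proof (intro conjI allI impI)
    fix v w assume "v \<in> ?W" "w \<in> ?W"
    then obtain x y where xy: "v = a \<otimes> x" "w = a \<otimes> y" "x \<in> A" "y \<in> A" by blast
    then have "v \<oplus> w = a \<otimes> (x \<oplus> y)" "x \<oplus> y \<in> A" using Ac a sub(7) by (simp_all add: r_distr)
    then show "v \<oplus> w \<in> ?W" by blast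
  next
    show "\<zero> \<in> ?W" using Ac[OF a] sub(2) by (intro image_eqI[of _ _ \<zero>]) simp_all
  next
    fix c :: 'k and v assume "c \<in> carrier class_ring" "v \<in> ?W"
    then obtain x where x: "v = a \<otimes> x" "x \<in> A" by blast
    then have "c \<odot> v = a \<otimes> (c \<odot> x)" "c \<odot> x \<in> A" using Ac a A by (simp_all add: subalgebra_def)
    then show "c \<odot> v \<in> ?W" by blast
  qed (use Ac a module_V in auto)
  interpret WV: kspace "B\<lparr>carrier := ?W\<rparr>" by (rule subspace_kspace[OF W])
  have "\<exists>x\<in>carrier (B\<lparr>carrier := ?W\<rparr>). a \<otimes> x = a"
  proof (rule WV.linend_inj_surj[OF subspace_fin_dim[OF fd W]])
    show "linend (B\<lparr>carrier := ?W\<rparr>) (\<lambda>x. a \<otimes> x)"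
      using a Ac by (auto simp: linend_def r_distr intro!: imageI sub(6))
    show "x = \<zero>\<^bsub>B\<lparr>carrier := ?W\<rparr>\<^esub>" if "x \<in> carrier (B\<lparr>carrier := ?W\<rparr>)" "a \<otimes> x = \<zero>\<^bsub>B\<lparr>carrier := ?W\<rparr>\<^esub>" for x
      using that central_square_zero[of a] a AZ Ac by auto
    show "a \<in> carrier (B\<lparr>carrier := ?W\<rparr>)" using Ac[OF a] sub(3) by (auto intro!: image_eqI[of _ _ \<one>])
  qed
  then obtain z where z: "z \<in> A" "a \<otimes> (a \<otimes> z) = a" by auto
  let ?p = "a \<otimes> z"
  have zc: "z \<in> carrier B" "a \<in> carrier B" using z(1) a Ac by auto
  have pp: "?p \<otimes> ?p = ?p"
  proof -
    have "?p \<otimes> ?p = (a \<otimes> (z \<otimes> a)) \<otimes> z" using zc by (simp add: m_assoc)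
    also have "z \<otimes> a = a \<otimes> z" using comm[OF a zc(1)] by simp
    finally show ?thesis using z(2) by simp
  qed
  have "?p = \<zero>" using Tr_idempotent[OF _ pp] tr[OF z(1)] zc by simp
  then show ?thesis using z(2) zc by simp
qed

text \<open>The adjoint of the inclusion \<open>A \<subseteq> B\<close> for the trace form, which is nondegenerate on \<open>A\<close>:
  \<open>E b\<close> is the element of \<open>A\<close> with \<open>Tr (E b \<cdot> a) = Tr (b a)\<close> for \<open>a \<in>
  A\<close>.\<close>

lemma conditional_expectation:
  assumes A: "subalgebra A B" and AZ: "A \<subseteq> ring_center B"
  shows "\<exists>E. (\<forall>b\<in>carrier B. E b \<in> A) \<and> E \<one> = \<one> \<and>
     (\<forall>b\<in>carrier B. \<forall>b'\<in>carrier B. E (b \<oplus> b') = E b \<oplus> E b') \<and>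
     (\<forall>b\<in>carrier B. \<forall>a\<in>A. E (b \<otimes> a) = E b \<otimes> a)"
proof -
  have "subring A B" using A by (simp add: subalgebra_def)
  note sub = subringE[OF this]
  have As: "submodule class_ring A B" by (rule subalgebra_submodule[OF A])
  interpret Am: submodule class_ring A B by (rule As)
  have Ac: "x \<in> carrier B" if "x \<in> A" for x using that Am.subset by blast
  obtain k n b co where *: "k \<le> n" "frame B {..<n::nat} b co"
     "\<forall>i<n. \<forall>j<n. co i (b j) = (if i = j then 1 else 0)"
     "\<forall>i<k. b i \<in> A" "\<forall>w\<in>A. \<forall>i<n. k \<le> i \<longrightarrow> co i w = 0"
    using adapted_frame[OF fd As] by metis
  have b: "b j \<in> carrier B" "b j \<in> A" "linfun B (co j)" if "j < k" for j
    using *(1,2,4) that by (auto simp: frame_def)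
  interpret AV: kspace "B\<lparr>carrier := A\<rparr>" by (rule subspace_kspace[OF As])
  have FA: "frame (B\<lparr>carrier := A\<rparr>) {..<k} b co" by (rule subspace_frame[OF As *(2,1,4,5)])
  have sumA: "(\<Oplus>i<k. f i \<odot> b i) \<in> A" for f :: "nat \<Rightarrow> 'k"
  proof -
    have "finite J ==> J \<subseteq> {..<k} ==> (\<Oplus>i\<in>J. f i \<odot> b i) \<in> A" for J
    proof (induction J rule: finite_induct)
      case (insert j J)
      then show ?case using b by (subst finsum_insert) auto
    qed simp
    then show ?thesis by blast
  qed
  define f where "f x = (\<Oplus>i<k. Tr (x \<otimes> b i) \<odot> b i)" for x
  have cof: "co i (f x) = Tr (x \<otimes> b i)" if i: "i < k" for i x
  proof -
    have "co i (f x) = (\<Sum>j\<in>{..<k}. co i (Tr (x \<otimes> b j) \<odot> b j))"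
      unfolding f_def by (rule linfun_finsum[OF grp b(3)[OF i]]) (use b in simp)
    also have "\<dots> = (\<Sum>j\<in>{..<k}. if i = j then Tr (x \<otimes> b j) else 0)"
      using b *(1,3) i by (intro sum.cong) (auto simp: linfun_smult[OF b(3)[OF i]])
    finally show ?thesis using i by simp
  qed
  have fadd: "f (x \<oplus> y) = f x \<oplus> f y" if "x \<in> carrier B" "y \<in> carrier B" for x y
  proof -
    have "f (x \<oplus> y) = (\<Oplus>i<k. Tr (x \<otimes> b i) \<odot> b i \<oplus> Tr (y \<otimes> b i) \<odot> b i)"
      unfolding f_def using that b by (intro sum_cong) (simp_all add: l_distr Tr_add smult_distr)
    also have "\<dots> = f x \<oplus> f y" unfolding f_def using that b by (intro finsum_addf) auto
    finally show ?thesis .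
  qed
  have fsm: "f (c \<odot> x) = c \<odot> f x" if "x \<in> carrier B" for c x
    unfolding f_def using that b
    by (subst finsum_smult_right) (auto intro!: sum_cong simp: Tr_smult smult_distr)
  have trA: "Tr (x \<otimes> a) = Tr (y \<otimes> a)"
    if x: "x \<in> carrier B" and y: "y \<in> carrier B" and xy: "f x = f y" and a: "a \<in> A" for x y a
  proof -
    have "Tr (x \<otimes> a) = (\<Sum>i<k. co i a * Tr (x \<otimes> b i))" if x: "x \<in> carrier B" for x
    proof -
      have lf: "linfun B (\<lambda>y. Tr (x \<otimes> y))" using x by (simp add: linfun_def r_distr Tr_add Tr_smult)
      have "addmap (B\<lparr>carrier := A\<rparr>) B (\<lambda>x. x)" using Am.subset by (auto simp: addmap_def)
      from addmap_finsum[OF AV.grp grp this, of "{..<k}" "\<lambda>i. co i a \<odot> b i"]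
      have "a = (\<Oplus>i<k. co i a \<odot> b i)" using FA a b by (simp add: frame_def)
      then have "Tr (x \<otimes> a) = Tr (x \<otimes> (\<Oplus>i<k. co i a \<odot> b i))" by simp
      also have "\<dots> = (\<Sum>i\<in>{..<k}. Tr (x \<otimes> (co i a \<odot> b i)))"
        by (rule linfun_finsum[OF grp lf]) (use b in simp)
      finally show ?thesis using x b by (simp add: Tr_smult)
    qed
    moreover have "Tr (x \<otimes> b i) = Tr (y \<otimes> b i)" if "i < k" for i using cof[OF that] xy by metis
    ultimately show ?thesis using x y by simp
  qed
  have ex: "\<exists>e\<in>A. \<forall>a\<in>A. Tr (e \<otimes> a) = Tr (x \<otimes> a)" if x: "x \<in> carrier B" for x
  proof -
    have "\<exists>e\<in>carrier (B\<lparr>carrier := A\<rparr>). f e = f x"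
    proof (rule AV.linend_inj_surj[OF subspace_fin_dim[OF fd As]])
      show "linend (B\<lparr>carrier := A\<rparr>) f"
        using fadd fsm Ac by (simp add: linend_def) (simp add: f_def sumA)
      show "f x \<in> carrier (B\<lparr>carrier := A\<rparr>)" using sumA by (simp add: f_def)
      fix y assume "y \<in> carrier (B\<lparr>carrier := A\<rparr>)" "f y = \<zero>\<^bsub>B\<lparr>carrier := A\<rparr>\<^esub>"
      then have y: "y \<in> A" "f y = \<zero>" by auto
      have "f \<zero> = \<zero>"
        unfolding f_def by (intro add.finprod_one_eqI) (use b in simp)
      then have "Tr (y \<otimes> a) = 0" if "a \<in> A" for a
        using trA[of y \<zero> a] y that Ac by simp
      then show "y = \<zero>\<^bsub>B\<lparr>carrier := A\<rparr>\<^esub>" using central_subalgebra_nondegenerate[OF A AZ y(1)] by simp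
    qed
    then show ?thesis using trA[OF _ x] Ac by auto
  qed
  have uniq: "e = e'" if "e \<in> A" "e' \<in> A" "\<And>a. a \<in> A ==> Tr (e \<otimes> a) = Tr (e' \<otimes> a)" for e e'
  proof -
    have em: "e \<oplus> (-1) \<odot> e' \<in> A" using that Am.smult_closed[of "-1" e'] by simp
    have "e \<oplus> (-1) \<odot> e' = \<zero>"
      by (rule central_subalgebra_nondegenerate[OF A AZ em])
        (use that Ac in \<open>simp add: l_distr Tr_add Tr_smult\<close>)
    moreover have "e \<oplus> (-1) \<odot> e' \<oplus> e' = e \<oplus> ((-1) \<odot> e' \<oplus> 1 \<odot> e')" using that Ac by (simp add: a_assoc)
    moreover have "(-1) \<odot> e' \<oplus> 1 \<odot> e' = \<zero>" using that Ac by (subst smult_distr(2)[symmetric]) simp_all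
    ultimately show ?thesis using that Ac by simp
  qed
  define E where "E x = (SOME e. e \<in> A \<and> (\<forall>a\<in>A. Tr (e \<otimes> a) = Tr (x \<otimes> a)))" for x
  have E: "E x \<in> A" "\<And>a. a \<in> A ==> Tr (E x \<otimes> a) = Tr (x \<otimes> a)" if "x \<in> carrier B" for x
    using someI_ex[of "\<lambda>e. e \<in> A \<and> (\<forall>a\<in>A. Tr (e \<otimes> a) = Tr (x \<otimes> a))"] ex[OF that]
    unfolding E_def by blast+
  have "E \<one> = \<one>" using E[of \<one>] sub(3) by (intro uniq) auto
  moreover have "E (x \<oplus> y) = E x \<oplus> E y" if "x \<in> carrier B" "y \<in> carrier B" for x y
    using E that Ac sub(7) by (intro uniq) (auto simp: l_distr Tr_add)
  moreover have "E (x \<otimes> a) = E x \<otimes> a" if x: "x \<in> carrier B" and a: "a \<in> A" for x a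
  proof (rule uniq)
    fix a' assume a': "a' \<in> A"
    then show "Tr (E (x \<otimes> a) \<otimes> a') = Tr (E x \<otimes> a \<otimes> a')"
      using E[of "x \<otimes> a"] E(1)[OF x] E(2)[OF x, of "a \<otimes> a'"] x a Ac sub(6) by (simp add: m_assoc)
  qed (use E x a Ac sub(6) in auto)
  ultimately show ?thesis using E by blast
qed

end

section \<open>Linear maps between tensor products over the ground field\<close>

definition klin ::
  "('k::field, 'v, 'u) module_scheme \<Rightarrow> ('k, 'w, 'x) module_scheme \<Rightarrow> ('v \<Rightarrow> 'w) \<Rightarrow> bool" where
  "klin V W f \<longleftrightarrow> addmap V W f \<and> (\<forall>c. \<forall>x\<in>carrier V. f (c \<odot>\<^bsub>V\<^esub> x) = c \<odot>\<^bsub>W\<^esub> f x)"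

lemma klinI:
  assumes "\<And>x. x \<in> carrier V ==> f x \<in> carrier W"
    and "\<And>x y. x \<in> carrier V ==> y \<in> carrier V ==> f (x \<oplus>\<^bsub>V\<^esub> y) = f x \<oplus>\<^bsub>W\<^esub> f y"
    and "\<And>c x. x \<in> carrier V ==> f (c \<odot>\<^bsub>V\<^esub> x) = c \<odot>\<^bsub>W\<^esub> f x"
  shows "klin V W f"
  using assms by (simp add: klin_def addmap_def)

lemma klin_closed: "klin V W f ==> x \<in> carrier V ==> f x \<in> carrier W"
  and klin_add: "klin V W f ==> x \<in> carrier V ==> y \<in> carrier V ==> f (x \<oplus>\<^bsub>V\<^esub> y) = f x \<oplus>\<^bsub>W\<^esub> f y"
  and klin_smult: "klin V W f ==> x \<in> carrier V ==> f (c \<odot>\<^bsub>V\<^esub> x) = c \<odot>\<^bsub>W\<^esub> f x"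
  and klin_addmap: "klin V W f ==> addmap V W f"
  by (auto simp: klin_def addmap_def)

lemma klin_module_hom: "klin V W f \<longleftrightarrow> f \<in> LinearCombinations.module_hom class_ring V W"
  by (auto simp: klin_def addmap_def LinearCombinations.module_hom_def)

lemma klin_comp: "klin U V f ==> klin V W g ==> klin U W (\<lambda>x. g (f x))"
  by (simp add: klin_def addmap_def)

lemma klin_id: "klin V V (\<lambda>x. x)" by (simp add: klin_def addmap_def)

lemma tensor_algI: "kspace M ==> kspace N ==> tensor_alg class_ring M N"
  by (simp add: tensor_alg_def kspace_def)

lemma kspace_tensor: "kspace M ==> kspace N ==> kspace (M \<otimes>\<^sub>k N)"
  using tensor_alg.module[OF tensor_algI] by (simp add: kspace_def)

lemma lift_klin:
  assumes "kspace M" "kspace N" "kspace P" "balanced class_ring M N P \<beta>"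
    and sm: "\<And>c x y. x \<in> carrier M ==> y \<in> carrier N ==> \<beta> (c \<odot>\<^bsub>M\<^esub> x) y = c \<odot>\<^bsub>P\<^esub> \<beta> x y"
  shows "klin (M \<otimes>\<^sub>k N) P (tensor_lift class_ring M N P \<beta>)"
proof -
  interpret M: kspace M by fact
  interpret N: kspace N by fact
  interpret P: kspace P by fact
  interpret tensor_alg class_ring M N by (rule tensor_algI) fact+
  interpret T: kspace TA by (rule kspace_tensor) fact+
  have ad: "addmap TA P (tensor_lift class_ring M N P \<beta>)" by (rule lift_addmap[OF P.grp assms(4)])
  have "tensor_lift class_ring M N P \<beta> (c \<odot>\<^bsub>TA\<^esub> t) = c \<odot>\<^bsub>P\<^esub> tensor_lift class_ring M N P \<beta> t"
    if "t \<in> carrier TA" for c t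
    using that
  proof (induction rule: tensor_induct)
    case (pure x y)
    have "c \<odot>\<^bsub>TA\<^esub> tens class_ring M N x y = tens class_ring M N (c \<odot>\<^bsub>M\<^esub> x) y"
      using pure by (simp add: tens_smult_left)
    then show ?case using pure by (simp add: lift_tens[OF P.grp assms(4)] sm)
  next
    case (add s t)
    then show ?case by (simp add: T.smult_distr addmap_add[OF ad] addmap_closed[OF ad] P.smult_distr)
  qed
  then show ?thesis using ad by (simp add: klin_def)
qed

lemma balanced_klin:
  assumes "kspace M" "kspace N" "kspace M'" "kspace N'" "klin M M' f" "klin N N' f'"
  shows "balanced class_ring M N (M' \<otimes>\<^sub>k N') (\<lambda>x y. tens class_ring M' N' (f x) (f' y))"
proof -
  interpret T': tensor_alg class_ring M' N' by (rule tensor_algI) fact+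
  show ?thesis
    by (rule balancedI)
      (simp_all add: klin_closed[OF assms(5)] klin_closed[OF assms(6)] klin_add[OF assms(5)] klin_add[OF assms(6)]
       klin_smult[OF assms(5)] klin_smult[OF assms(6)] T'.tens_closed T'.tens_add_left T'.tens_add_right
       T'.tens_smult_left T'.tens_smult_right)
qed

lemma tensor_map_lift:
  "tensor_map class_ring M N M' N' f f'
     = tensor_lift class_ring M N (M' \<otimes>\<^sub>k N') (\<lambda>x y. tens class_ring M' N' (f x) (f' y))"
  unfolding tensor_map_def by (rule tensor_lift_cong) (simp_all add: tensor_algebra_simps)

lemma
  assumes "kspace M" "kspace N" "kspace M'" "kspace N'" "klin M M' f" "klin N N' f'"
  shows tensor_map_klin: "klin (M \<otimes>\<^sub>k N) (M' \<otimes>\<^sub>k N') (tensor_map class_ring M N M' N' f f')"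
    and tensor_map_tens: "x \<in> carrier M ==> y \<in> carrier N ==>
      tensor_map class_ring M N M' N' f f' (tens class_ring M N x y) = tens class_ring M' N' (f x) (f' y)"
proof -
  interpret T: tensor_alg class_ring M N by (rule tensor_algI) fact+
  interpret T': tensor_alg class_ring M' N' by (rule tensor_algI) fact+
  interpret K': kspace "M' \<otimes>\<^sub>k N'" by (rule kspace_tensor) fact+
  show "klin (M \<otimes>\<^sub>k N) (M' \<otimes>\<^sub>k N') (tensor_map class_ring M N M' N' f f')"
    unfolding tensor_map_lift
    by (rule lift_klin[OF assms(1,2) K'.ks balanced_klin[OF assms]])
      (simp add: klin_closed[OF assms(5)] klin_closed[OF assms(6)] klin_smult[OF assms(5)] T'.tens_smult_left)
  show "x \<in> carrier M ==> y \<in> carrier N ==>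
      tensor_map class_ring M N M' N' f f' (tens class_ring M N x y) = tens class_ring M' N' (f x) (f' y)"
    unfolding tensor_map_lift by (rule T.lift_tens[OF K'.grp balanced_klin[OF assms]])
qed

lemma
  assumes "kspace M" "kspace N" "kspace P"
  shows tensor_assoc_klin: "klin ((M \<otimes>\<^sub>k N) \<otimes>\<^sub>k P) (M \<otimes>\<^sub>k (N \<otimes>\<^sub>k P)) (tensor_assoc M N P)"
    and tensor_assoc_tens: "x \<in> carrier M ==> y \<in> carrier N ==> z \<in> carrier P ==>
      tensor_assoc M N P (tens class_ring (M \<otimes>\<^sub>k N) P (tens class_ring M N x y) z)
      = tens class_ring M (N \<otimes>\<^sub>k P) x (tens class_ring N P y z)"
proof -
  interpret M: kspace M by fact
  interpret N: kspace N by fact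
  interpret P: kspace P by fact
  interpret MN: tensor_alg class_ring M N by (rule tensor_algI) fact+
  interpret NP: tensor_alg class_ring N P by (rule tensor_algI) fact+
  interpret kMN: kspace "M \<otimes>\<^sub>k N" by (rule kspace_tensor) fact+
  interpret kNP: kspace "N \<otimes>\<^sub>k P" by (rule kspace_tensor) fact+
  interpret L: tensor_alg class_ring "M \<otimes>\<^sub>k N" P by (rule tensor_algI) (rule kMN.ks assms)+
  interpret R: tensor_alg class_ring M "N \<otimes>\<^sub>k P" by (rule tensor_algI) (rule kNP.ks assms)+
  interpret kR: kspace "M \<otimes>\<^sub>k (N \<otimes>\<^sub>k P)" by (rule kspace_tensor[OF assms(1) kNP.ks])
  let ?R = "M \<otimes>\<^sub>k (N \<otimes>\<^sub>k P)"
  let ?\<gamma> = "\<lambda>z x y. tens class_ring M (N \<otimes>\<^sub>k P) x (tens class_ring N P y z)"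
  have g: "balanced class_ring M N ?R (?\<gamma> z)" if z: "z \<in> carrier P" for z
    by (rule balancedI)
      (simp_all add: z NP.tens_closed NP.tens_add_left NP.tens_smult_left R.tens_closed R.tens_add_left
        R.tens_add_right R.tens_smult_left R.tens_smult_right)
  define in_l where "in_l t z = tensor_lift class_ring M N ?R (?\<gamma> z) t" for t z
  have in_klin: "klin (M \<otimes>\<^sub>k N) ?R (\<lambda>t. in_l t z)" if z: "z \<in> carrier P" for z
    unfolding in_l_def
    by (rule lift_klin[OF assms(1,2) kR.ks g[OF z]])
       (simp add: z NP.tens_closed R.tens_smult_left)
  have in_t: "in_l (tens class_ring M N x y) z = ?\<gamma> z x y"
    if "x \<in> carrier M" "y \<in> carrier N" "z \<in> carrier P" for x y z
    unfolding in_l_def using that by (intro MN.lift_tens[OF kR.grp g])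
  note cl = klin_closed[OF in_klin]
  have in_add: "in_l t (z \<oplus>\<^bsub>P\<^esub> z') = in_l t z \<oplus>\<^bsub>?R\<^esub> in_l t z'"
    if t: "t \<in> carrier (M \<otimes>\<^sub>k N)" and z: "z \<in> carrier P" "z' \<in> carrier P" for t z z'
    using t
  proof (induction rule: MN.tensor_induct)
    case (pure x y)
    then show ?case using z by (simp add: in_t NP.tens_add_right R.tens_add_right NP.tens_closed)
  next
    case (add s t)
    then show ?case using z cl by (simp add: klin_add[OF in_klin] kR.a_ac)
  qed
  have in_smult: "in_l t (c \<odot>\<^bsub>P\<^esub> z) = c \<odot>\<^bsub>?R\<^esub> in_l t z"
    if t: "t \<in> carrier (M \<otimes>\<^sub>k N)" and z: "z \<in> carrier P" for t z c
    using t
  proof (induction rule: MN.tensor_induct)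
    case (pure x y)
    then show ?case using z by (simp add: in_t NP.tens_smult_right R.tens_smult_right NP.tens_closed)
  next
    case (add s t)
    then show ?case using z cl by (simp add: klin_add[OF in_klin] kR.smult_distr)
  qed
  have bal: "balanced class_ring (M \<otimes>\<^sub>k N) P ?R in_l"
    by (rule balancedI) (simp_all add: cl in_add in_smult klin_add[OF in_klin] klin_smult[OF in_klin])
  have ta: "tensor_assoc M N P = tensor_lift class_ring (M \<otimes>\<^sub>k N) P ?R in_l"
    unfolding tensor_assoc_def in_l_def ..
  show "klin ((M \<otimes>\<^sub>k N) \<otimes>\<^sub>k P) ?R (tensor_assoc M N P)"
    unfolding ta
    by (rule lift_klin[OF kMN.ks assms(3) kR.ks bal]) (simp add: klin_smult[OF in_klin])
  show "x \<in> carrier M ==> y \<in> carrier N ==> z \<in> carrier P ==>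
      tensor_assoc M N P (tens class_ring (M \<otimes>\<^sub>k N) P (tens class_ring M N x y) z)
      = tens class_ring M (N \<otimes>\<^sub>k P) x (tens class_ring N P y z)"
    unfolding ta by (subst L.lift_tens[OF kR.grp bal]) (auto simp: in_t MN.tens_closed)
qed

lemma tensor_record_cong:
  assumes "carrier M = carrier M'" "add M = add M'" "module.smult M = module.smult M'" "monoid.mult M = monoid.mult M'" "one M = one M'"
    and "carrier N = carrier N'" "add N = add N'" "module.smult N = module.smult N'" "monoid.mult N = monoid.mult N'" "one N = one N'"
  shows "tensor_algebra R M N = tensor_algebra R M' N'" "tens R M N = tens R M' N'"
    "tensor_lift R M N = tensor_lift R M' N'"
proof -
  have p: "tensor_product R M N = tensor_product R M' N'"
    by (simp add: tensor_product_def tensor_relations_def Let_def assms)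
  show t: "tens R M N = tens R M' N'"
    by (intro ext) (simp add: tens_def tensor_relations_def Let_def assms)
  show l: "tensor_lift R M N = tensor_lift R M' N'"
    by (intro ext) (simp add: tensor_lift_def p t assms)
  show "tensor_algebra R M N = tensor_algebra R M' N'"
    by (simp add: tensor_algebra_def p t l assms)
qed

section \<open>The algebra underlying \<open>H\<^sub>m\<^sub>i\<^sub>n\<close>\<close>

locale central_sub = kalg B for B :: "('k::field, 'b) module" (structure) +
  fixes A
  assumes A: "subalgebra A B" and AZ: "A \<subseteq> ring_center B"
begin

abbreviation "RA \<equiv> B\<lparr>carrier := A\<rparr>"
abbreviation "BL \<equiv> regular_module B"
abbreviation "BR \<equiv> regular_module (opposite B)"
abbreviation "HA \<equiv> Hmin_algebra B A"
abbreviation "bb \<equiv> bbar B A"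

lemma A_sub: "A \<subseteq> carrier B" "\<zero> \<in> A" "\<one> \<in> A" "x \<in> A ==> y \<in> A ==> x \<otimes> y \<in> A"
    "x \<in> A ==> y \<in> A ==> x \<oplus> y \<in> A" "x \<in> A ==> c \<odot> x \<in> A"
  using A subringE[of A B] by (auto simp: subalgebra_def)

lemma A_carrier [simp]: "x \<in> A ==> x \<in> carrier B" using A_sub(1) by blast

lemma A_comm: "a \<in> A ==> x \<in> carrier B ==> a \<otimes> x = x \<otimes> a"
  using AZ by (auto simp: ring_center_def)

lemma RA_cring: "cring RA"
proof -
  interpret RA: ring RA using A by (intro subring_is_ring) (simp add: subalgebra_def)
  show ?thesis by unfold_locales (simp add: A_comm)
qed

lemma reg_simps [simp]:
  "carrier BL = carrier B" "carrier BR = carrier B" "add BL = add B" "add BR = add B"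
  "zero BL = zero B" "zero BR = zero B" "one BL = one B" "one BR = one B"
  "monoid.mult BL = monoid.mult B" "monoid.mult BR = (\<lambda>x y. y \<otimes> x)" "module.smult BL = monoid.mult B" "module.smult BR = (\<lambda>x y. y \<otimes> x)"
  by (simp_all add: regular_module_def opposite_def)

lemma a_inv_ex: "x \<in> carrier B ==> \<exists>y\<in>carrier B. x \<oplus> y = \<zero>"
  and a_inv_ex': "x \<in> carrier B ==> \<exists>y\<in>carrier B. y \<oplus> x = \<zero>"
  using r_neg l_neg a_inv_closed by blast+

lemma A_move: "a \<in> A ==> x \<in> carrier B ==> y \<in> carrier B ==> x \<otimes> (a \<otimes> y) = a \<otimes> (x \<otimes> y)"
  using A_comm[of a x] by (simp flip: m_assoc)

lemma A_move': "a \<in> A ==> x \<in> carrier B ==> y \<in> carrier B ==> x \<otimes> (y \<otimes> a) = a \<otimes> (x \<otimes> y)"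
  using A_comm[of a "x \<otimes> y"] by (simp add: m_assoc)

lemma BL_algebra: "algebra_over RA BL"
proof -
  have "Module.module RA BL"
    by (rule module_criteria[OF RA_cring])
      (simp_all add: a_ac m_assoc l_distr r_distr a_inv_ex A_comm)
  moreover have "ring BL"
    by (rule ringI[OF abelian_groupI monoidI])
      (simp_all add: a_ac m_assoc l_distr r_distr a_inv_ex')
  ultimately show ?thesis
    unfolding algebra_over_def
    by (auto simp: m_assoc A_move A_move')
qed

lemma BR_algebra: "algebra_over RA BR"
proof -
  have "Module.module RA BR"
    by (rule module_criteria[OF RA_cring])
      (simp_all add: a_ac m_assoc l_distr r_distr a_inv_ex A_comm)
  moreover have "ring BR"
    by (rule ringI[OF abelian_groupI monoidI])
      (simp_all add: a_ac m_assoc l_distr r_distr a_inv_ex')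
  ultimately show ?thesis
    unfolding algebra_over_def
    by (auto simp: m_assoc A_move A_move')
qed

sublocale TT: algebra_pair RA BL BR
  by (simp add: algebra_pair_def BL_algebra BR_algebra)

lemma HA_simps:
  "carrier HA = carrier TT.TA" "monoid.mult HA = monoid.mult TT.TA" "one HA = one TT.TA" "zero HA = zero TT.TA"
  "add HA = add TT.TA" "module.smult HA = (\<lambda>c t. (c \<odot> \<one>) \<odot>\<^bsub>TT.TA\<^esub> t)"
  by (simp_all add: Hmin_algebra_def Let_def)

lemma bb_def': "bb = TT.tt" by (simp add: bbar_def)

lemma HA_module: "Module.module class_ring HA"
proof (rule module_criteria[OF class_cring.is_cring], goal_cases)
  case 3
  show ?case unfolding HA_simps using TT.TA.a_inv_closed TT.TA.r_neg by auto
next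
  case 5
  show ?case unfolding HA_simps using TT.TA.a_comm by auto
next
  case 8
  show ?case
  proof (intro allI impI)
    fix a b :: 'k and v assume *: "a \<in> carrier class_ring \<and> b \<in> carrier class_ring \<and> v \<in> carrier HA"
    have "(a * b) \<odot> \<one> = (a \<odot> \<one>) \<otimes> (b \<odot> \<one>)" by (simp add: smult_distr mult.commute)
    then show "(a \<otimes>\<^bsub>class_ring\<^esub> b) \<odot>\<^bsub>HA\<^esub> v = a \<odot>\<^bsub>HA\<^esub> (b \<odot>\<^bsub>HA\<^esub> v)"
      using TT.TA.smult_assoc1[of "a \<odot> \<one>" "b \<odot> \<one>" v] * A_sub(3,6) by (simp add: HA_simps)
  qed
next
  case 9
  show ?case using TT.TA.smult_one by (simp add: HA_simps)
next
  case 10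
  show ?case
  proof (intro allI impI)
    fix a b :: 'k and v assume *: "a \<in> carrier class_ring \<and> b \<in> carrier class_ring \<and> v \<in> carrier HA"
    have "(a + b) \<odot> \<one> = (a \<odot> \<one>) \<oplus> (b \<odot> \<one>)" by (simp add: smult_distr)
    then show "(a \<oplus>\<^bsub>class_ring\<^esub> b) \<odot>\<^bsub>HA\<^esub> v = a \<odot>\<^bsub>HA\<^esub> v \<oplus>\<^bsub>HA\<^esub> b \<odot>\<^bsub>HA\<^esub> v"
      using TT.TA.smult_l_distr[of "a \<odot> \<one>" "b \<odot> \<one>" v] * A_sub(3,6) by (simp add: HA_simps)
  qed
qed (use A_sub in \<open>simp_all add: HA_simps TT.TA.a_assoc TT.TA.smult_r_distr\<close>)

lemma HA_ring: "ring HA"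
proof -
  interpret T: ring TT.TA by (rule TT.ring)
  show ?thesis
  proof (rule ringI[OF abelian_groupI monoidI], goal_cases)
    case 4
    then show ?case by (simp add: HA_simps TT.TA.M.a_comm)
  next
    case 6
    then show ?case using TT.TA.M.l_neg TT.TA.M.a_inv_closed by (auto simp: HA_simps)
  qed (simp_all add: HA_simps TT.TA.M.a_assoc T.m_assoc T.l_distr T.r_distr)
qed

lemma HA_kalg: "kalg HA"
proof -
  have "algebra_over class_ring HA"
    unfolding algebra_over_def using HA_module HA_ring A_sub(3,6) TT.smult_mult_left TT.smult_mult_right
    by (simp add: HA_simps)
  then show ?thesis by (simp add: kalg_def k_algebra_iff)
qed

sublocale HA: kalg HA by (rule HA_kalg)

lemma bb_closed [simp]: "b \<in> carrier B ==> c \<in> carrier B ==> bb b c \<in> carrier HA"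
  using TT.tens_closed[of b c] by (simp add: bb_def' HA_simps)

lemma bb_add_left:
  "b \<in> carrier B ==> b' \<in> carrier B ==> c \<in> carrier B ==> bb (b \<oplus> b') c = bb b c \<oplus>\<^bsub>HA\<^esub> bb b' c"
  using TT.tens_add_left[of b b' c] by (simp add: bb_def' HA_simps)

lemma bb_add_right:
  "b \<in> carrier B ==> c \<in> carrier B ==> c' \<in> carrier B ==> bb b (c \<oplus> c') = bb b c \<oplus>\<^bsub>HA\<^esub> bb b c'"
  using TT.tens_add_right[of b c c'] by (simp add: bb_def' HA_simps)

lemma bb_balanced: "a \<in> A ==> b \<in> carrier B ==> c \<in> carrier B ==> bb (b \<otimes> a) c = bb b (a \<otimes> c)"
  using TT.tens_smult_left[of a b c] TT.tens_smult_right[of a b c] A_comm[of a b] A_comm[of a c] by (simp add: bb_def')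

lemma bb_smult_left: "b \<in> carrier B ==> c \<in> carrier B ==> bb (k \<odot> b) c = k \<odot>\<^bsub>HA\<^esub> bb b c"
  using TT.tens_smult_left[of "k \<odot> \<one>" b c] A_sub(3,6) by (simp add: bb_def' HA_simps)

lemma bb_smult_right: "b \<in> carrier B ==> c \<in> carrier B ==> bb b (k \<odot> c) = k \<odot>\<^bsub>HA\<^esub> bb b c"
  using TT.tens_smult_right[of "k \<odot> \<one>" b c] A_sub(3,6) by (simp add: bb_def' HA_simps)

lemma bb_mult:
  "b \<in> carrier B ==> c \<in> carrier B ==> b' \<in> carrier B ==> c' \<in> carrier B ==>
    bb b c \<otimes>\<^bsub>HA\<^esub> bb b' c' = bb (b \<otimes> b') (c' \<otimes> c)"
  using TT.tens_mult[of b c b' c'] by (simp add: bb_def' HA_simps)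

lemma bb_one: "\<one>\<^bsub>HA\<^esub> = bb \<one> \<one>"
  using TT.one_TA by (simp add: bb_def' HA_simps)

lemma bb_induct [consumes 1, case_names pure add]:
  assumes "t \<in> carrier HA"
    and "\<And>b c. b \<in> carrier B ==> c \<in> carrier B ==> Q (bb b c)"
    and "\<And>s t. s \<in> carrier HA ==> t \<in> carrier HA ==> Q s ==> Q t ==> Q (s \<oplus>\<^bsub>HA\<^esub> t)"
  shows "Q t"
  using assms TT.tensor_induct[of t Q] by (simp add: bb_def' HA_simps)

lemma
  assumes P: "abelian_group P"
    and cl: "\<And>b c. b \<in> carrier B ==> c \<in> carrier B ==> \<beta> b c \<in> carrier P"
    and al: "\<And>b b' c. b \<in> carrier B ==> b' \<in> carrier B ==> c \<in> carrier B ==> \<beta> (b \<oplus> b') c = \<beta> b c \<oplus>\<^bsub>P\<^esub> \<beta> b' c"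
    and ar: "\<And>b c c'. b \<in> carrier B ==> c \<in> carrier B ==> c' \<in> carrier B ==> \<beta> b (c \<oplus> c') = \<beta> b c \<oplus>\<^bsub>P\<^esub> \<beta> b c'"
    and bal: "\<And>a b c. a \<in> A ==> b \<in> carrier B ==> c \<in> carrier B ==> \<beta> (b \<otimes> a) c = \<beta> b (a \<otimes> c)"
  shows bbar_lift_addmap: "addmap HA P (bbar_lift B A P \<beta>)"
    and bbar_lift_bb: "b \<in> carrier B ==> c \<in> carrier B ==> bbar_lift B A P \<beta> (bb b c) = \<beta> b c"
proof -
  have "balanced RA BL BR P \<beta>"
  proof (rule balancedI)
    fix r x y assume "r \<in> carrier RA" "x \<in> carrier BL" "y \<in> carrier BR"
    then show "\<beta> (r \<odot>\<^bsub>BL\<^esub> x) y = \<beta> x (r \<odot>\<^bsub>BR\<^esub> y)"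
      using bal[of r x y] A_comm[of r x] A_comm[of r y] by simp
  qed (simp_all add: cl al ar)
  note L = TT.lift_addmap[OF P this] TT.lift_tens[OF P this]
  show "addmap HA P (bbar_lift B A P \<beta>)"
    using L(1) by (simp add: bbar_lift_def addmap_def HA_simps)
  show "b \<in> carrier B ==> c \<in> carrier B ==> bbar_lift B A P \<beta> (bb b c) = \<beta> b c"
    using L(2)[of b c] by (simp add: bbar_lift_def bb_def')
qed

text \<open>Multiplying the two legs embeds \<open>B\<close> into \<open>H\<^sub>m\<^sub>i\<^sub>n\<close> as a retract.\<close>

lemma bb_left_injective:
  assumes "b \<in> carrier B" "b' \<in> carrier B" "bb b \<one> = bb b' \<one>"
  shows "b = b'"
proof -
  have "bbar_lift B A B (\<lambda>b c. b \<otimes> c) (bb x \<one>) = x" if "x \<in> carrier B" for x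
    using that by (subst bbar_lift_bb) (auto simp: grp l_distr r_distr m_assoc)
  then show ?thesis using assms by metis
qed

end

section \<open>The weak Hopf algebra of a triple\<close>

text \<open>The algebras compared here live in different record types; only the shared fields matter.\<close>

lemma kalg_record_cong:
  fixes M' :: "('k::field, 'b, 'u) module_scheme" and M :: "('k, 'b, 'w) module_scheme"
  assumes "kalg M" "carrier M' = carrier M" "add M' = add M" "zero M' = zero M"
    "module.smult M' = module.smult M" "monoid.mult M' = monoid.mult M" "one M' = one M"
  shows "kalg M'"
proof -
  interpret kalg M by fact
  have "Module.module class_ring M'"
    by (rule module_cong[OF module_V assms(2-5)])
  moreover have "ring M'"
  proof (rule ringI[OF abelian_groupI monoidI], goal_cases)
    case 6
    then show ?case using l_neg a_inv_closed by (auto simp: assms)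
  qed (simp_all add: assms a_ac m_assoc l_distr r_distr)
  ultimately show ?thesis
    by (simp add: kalg_def k_algebra_iff algebra_over_def assms)
qed

lemma (in ring) sum_mult_sum:
  assumes "finite I" "finite J" "\<And>i. i \<in> I ==> a i \<in> carrier R" "\<And>j. j \<in> J ==> b j \<in> carrier R"
  shows "(\<Oplus>i\<in>I. a i) \<otimes> (\<Oplus>j\<in>J. b j) = (\<Oplus>i\<in>I. \<Oplus>j\<in>J. a i \<otimes> b j)"
proof -
  have "(\<Oplus>i\<in>I. a i) \<otimes> (\<Oplus>j\<in>J. b j) = (\<Oplus>i\<in>I. a i \<otimes> (\<Oplus>j\<in>J. b j))"
    by (rule finsum_ldistr) (use assms in \<open>auto intro!: finsum_closed\<close>)
  also have "\<dots> = (\<Oplus>i\<in>I. \<Oplus>j\<in>J. a i \<otimes> b j)"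
    by (rule finsum_cong_P[OF abelian_group_axioms])
       (use assms in \<open>auto intro!: finsum_closed finsum_rdistr\<close>)
  finally show ?thesis .
qed

lemma finsum_closed_P:
  assumes "abelian_group P" "\<And>i. i \<in> I ==> a i \<in> carrier P"
  shows "(\<Oplus>\<^bsub>P\<^esub>i\<in>I. a i) \<in> carrier P"
proof -
  interpret P: abelian_group P by fact
  show ?thesis using assms by (intro P.finsum_closed) auto
qed

lemma finsum_addf_P:
  assumes "abelian_group P" "\<And>i. i \<in> I ==> a i \<in> carrier P" "\<And>i. i \<in> I ==> b i \<in> carrier P"
  shows "(\<Oplus>\<^bsub>P\<^esub>i\<in>I. a i \<oplus>\<^bsub>P\<^esub> b i) = (\<Oplus>\<^bsub>P\<^esub>i\<in>I. a i) \<oplus>\<^bsub>P\<^esub> (\<Oplus>\<^bsub>P\<^esub>i\<in>I. b i)"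
proof -
  interpret P: abelian_group P by fact
  show ?thesis using assms by (intro P.finsum_addf) auto
qed

lemma klin_finsum:
  assumes "kspace V" "kspace W" "klin V W f" "\<And>i. i \<in> I ==> a i \<in> carrier V"
  shows "f (\<Oplus>\<^bsub>V\<^esub>i\<in>I. a i) = (\<Oplus>\<^bsub>W\<^esub>i\<in>I. f (a i))"
  by (rule addmap_finsum[OF kspace.grp[OF assms(1)] kspace.grp[OF assms(2)] klin_addmap[OF assms(3)] assms(4)])

lemma klin_span:
  assumes "kspace V" "kspace W" "klin V W f" "X \<subseteq> carrier V" "submodule class_ring U W"
    and "\<And>x. x \<in> X ==> f x \<in> U" and v: "v \<in> LinearCombinations.module.span class_ring V X"
  shows "f v \<in> U"
proof -
  interpret V: kspace V by fact
  interpret W: kspace W by fact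
  interpret U: submodule class_ring U W by fact
  let ?K = "{v \<in> carrier V. f v \<in> U}"
  have f0: "f \<zero>\<^bsub>V\<^esub> = \<zero>\<^bsub>W\<^esub>" using addmap_zero[OF V.grp W.grp klin_addmap[OF assms(3)]] .
  have "submodule class_ring ?K V"
    using V.module_V
    by (simp add: submodule_def f0 klin_add[OF assms(3)] klin_smult[OF assms(3)] U.m_closed)
  then have "V.span X \<subseteq> ?K" using assms(4,6) by (intro V.span_is_subset) auto
  then show ?thesis using v by blast
qed

text \<open>The data of a triple in computational form: dual bases for the trace form, and the trace condition replaced by \<open>avg g =
  1\<close>.\<close>

locale hmin = casimir B n X Y + central_sub B A
  for B :: "('k::field_char_0, 'b) module" (structure) and n X Y and A +
  fixes g
  assumes g_unit: "g \<in> Units B" and g_avg: "avg g = \<one>"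
begin

abbreviation "gi \<equiv> inv g"

lemma g_closed [simp]: "g \<in> carrier B" "gi \<in> carrier B"
  using g_unit by (auto simp: Units_closed)

lemma g_inv [simp]: "gi \<otimes> g = \<one>" "g \<otimes> gi = \<one>"
  using g_unit by simp_all

lemma g_cancel [simp]:
  "x \<in> carrier B ==> gi \<otimes> (g \<otimes> x) = x" "x \<in> carrier B ==> g \<otimes> (gi \<otimes> x) = x"
  by (simp_all flip: m_assoc)

lemma g_avg': "(\<Oplus>i<n. Y i \<otimes> (g \<otimes> X i)) = \<one>"
  using casimir_sym[OF grp avg_balanced[of g]] g_avg by (simp add: avg_def)

text \<open>The counit on products of generators reduces to this contraction of the Casimir element with the trace form.\<close>

lemma trace_pair:
  assumes p: "p \<in> carrier B" and q: "q \<in> carrier B"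
  shows "(\<Sum>i<n. Tr (p \<otimes> X i) * Tr (q \<otimes> Y i)) = Tr (p \<otimes> q)"
proof -
  have lf: "linfun B (\<lambda>y. Tr (p \<otimes> y))" using p by (simp add: linfun_def r_distr Tr_add Tr_smult)
  have "Tr (p \<otimes> q) = Tr (p \<otimes> (\<Oplus>i<n. Tr (q \<otimes> Y i) \<odot> X i))" using expand_X[OF q] by simp
  also have "\<dots> = (\<Sum>i\<in>{..<n}. Tr (p \<otimes> (Tr (q \<otimes> Y i) \<odot> X i)))"
    by (rule linfun_finsum[OF grp lf]) simp
  finally show ?thesis using p by (simp add: Tr_smult mult.commute)
qed

abbreviation "W \<equiv> Hmin B A g"
abbreviation "WW \<equiv> W \<otimes>\<^sub>k W"
abbreviation "WWW \<equiv> W \<otimes>\<^sub>k WW"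
abbreviation "tW \<equiv> tens class_ring W W"
abbreviation "D \<equiv> comult W"
abbreviation "eps \<equiv> counit W"
abbreviation "S \<equiv> antipode W"

lemma the_sep: "(THE E. two_sided_separability_element B E) = casimir_elt"
  by (rule the_equality[where P = "two_sided_separability_element B", OF casimir_separability two_sided_separability_unique])

lemma W_simps:
  "carrier W = carrier HA" "monoid.mult W = monoid.mult HA" "one W = one HA" "zero W = zero HA"
  "add W = add HA" "module.smult W = module.smult HA"
  "D = bbar_lift B A (HA \<otimes>\<^sub>k HA) (Hmin_delta B A g casimir_elt)"
  "eps = bbar_lift B A class_ring (\<lambda>b c. Tr (gi \<otimes> c \<otimes> b))"
  "S = bbar_lift B A HA (\<lambda>b c. bb (gi \<otimes> c \<otimes> g) b)"
  by (simp_all add: Hmin_def Let_def the_sep)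

lemma W_kalg: "kalg W"
  by (rule kalg_record_cong[OF HA_kalg]) (simp_all add: W_simps)

sublocale W: kalg W by (rule W_kalg)

lemma WW_kalg: "kalg WW"
  using W.BB.algebra_over_TA by (simp add: kalg_def k_algebra_iff)

sublocale WW: kalg WW by (rule WW_kalg)
sublocale W3: algebra_pair class_ring W WW
  by (rule algebra_pairI[OF W.k_algebra_B WW.k_algebra_B])
sublocale W3': algebra_pair class_ring WW W
  by (rule algebra_pairI[OF WW.k_algebra_B W.k_algebra_B])

abbreviation "t3 \<equiv> tens class_ring W WW"

lemma W3_kalg: "kalg WWW"
  using W3.algebra_over_TA by (simp add: kalg_def k_algebra_iff)

sublocale W3k: kalg "WWW" by (rule W3_kalg)

lemma HA_WW: "HA \<otimes>\<^sub>k HA = WW" "tens class_ring HA HA = tW"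
  by (rule tensor_record_cong; simp add: W_simps)+

lemma wb_closed [simp]: "b \<in> carrier B ==> c \<in> carrier B ==> bb b c \<in> carrier W"
  by (simp add: W_simps)

lemma wb_add_left:
    "b \<in> carrier B ==> b' \<in> carrier B ==> c \<in> carrier B ==> bb (b \<oplus> b') c = bb b c \<oplus>\<^bsub>W\<^esub> bb b' c"
  and wb_add_right:
    "b \<in> carrier B ==> c \<in> carrier B ==> c' \<in> carrier B ==> bb b (c \<oplus> c') = bb b c \<oplus>\<^bsub>W\<^esub> bb b c'"
  and wb_smult_left: "b \<in> carrier B ==> c \<in> carrier B ==> bb (k \<odot> b) c = k \<odot>\<^bsub>W\<^esub> bb b c"
  and wb_smult_right: "b \<in> carrier B ==> c \<in> carrier B ==> bb b (k \<odot> c) = k \<odot>\<^bsub>W\<^esub> bb b c"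
  and wb_mult:
    "b \<in> carrier B ==> c \<in> carrier B ==> b' \<in> carrier B ==> c' \<in> carrier B ==>
      bb b c \<otimes>\<^bsub>W\<^esub> bb b' c' = bb (b \<otimes> b') (c' \<otimes> c)"
  and wb_one: "\<one>\<^bsub>W\<^esub> = bb \<one> \<one>"
  by (simp_all add: W_simps bb_add_left bb_add_right bb_smult_left bb_smult_right bb_mult bb_one)

lemmas wb_rules = wb_add_left wb_add_right wb_smult_left wb_smult_right

lemma wb_induct [consumes 1, case_names pure add]:
  assumes "t \<in> carrier W"
    and "\<And>b c. b \<in> carrier B ==> c \<in> carrier B ==> Q (bb b c)"
    and "\<And>s t. s \<in> carrier W ==> t \<in> carrier W ==> Q s ==> Q t ==> Q (s \<oplus>\<^bsub>W\<^esub> t)"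
  shows "Q t"
  using assms bb_induct[of t Q] by (simp add: W_simps)

lemma wb_finsum_left:
  assumes "\<And>i. i \<in> I ==> u i \<in> carrier B" "c \<in> carrier B"
  shows "bb (\<Oplus>i\<in>I. u i) c = (\<Oplus>\<^bsub>W\<^esub>i\<in>I. bb (u i) c)"
  by (rule addmap_finsum[OF grp W.grp, of "\<lambda>x. bb x c"])
    (auto intro!: addmapI simp: wb_rules assms)

lemma wb_finsum_right:
  assumes "\<And>i. i \<in> I ==> u i \<in> carrier B" "b \<in> carrier B"
  shows "bb b (\<Oplus>i\<in>I. u i) = (\<Oplus>\<^bsub>W\<^esub>i\<in>I. bb b (u i))"
  by (rule addmap_finsum[OF grp W.grp, of "\<lambda>x. bb b x"])
    (auto intro!: addmapI simp: wb_rules assms)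

text \<open>The comultiplication on generators, with the Casimir element written out.\<close>

definition delta where
  "delta b c = (\<Oplus>\<^bsub>WW\<^esub>i<n. tW (bb b (g \<otimes> X i)) (bb (Y i) c))"

lemma delta_balanced:
  assumes "b \<in> carrier B" "c \<in> carrier B"
  shows "balanced class_ring B B WW (\<lambda>x y. tW (bb b (g \<otimes> x)) (bb y c))"
  by (rule balancedI)
    (simp_all add: assms r_distr wb_rules W.BB.tens_rules)

lemma delta_closed: "b \<in> carrier B ==> c \<in> carrier B ==> delta b c \<in> carrier WW"
  unfolding delta_def by (intro finsum_closed_P[OF WW.grp]) (auto intro!: W.BB.tens_closed)

lemma Hmin_delta_eq:
  assumes "b \<in> carrier B" "c \<in> carrier B"
  shows "Hmin_delta B A g casimir_elt b c = delta b c"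
  unfolding Hmin_delta_def Let_def HA_WW delta_def
  by (rule casimir_lift[OF WW.grp delta_balanced[OF assms]])

lemma delta_add_left:
  assumes "b \<in> carrier B" "b' \<in> carrier B" "c \<in> carrier B"
  shows "delta (b \<oplus> b') c = delta b c \<oplus>\<^bsub>WW\<^esub> delta b' c"
proof -
  have "delta (b \<oplus> b') c = (\<Oplus>\<^bsub>WW\<^esub>i<n. tW (bb b (g \<otimes> X i)) (bb (Y i) c) \<oplus>\<^bsub>WW\<^esub> tW (bb b' (g \<otimes> X i)) (bb (Y i) c))"
    unfolding delta_def using assms
    by (intro WW.sum_cong) (auto simp: wb_rules W.BB.tens_rules)
  also have "\<dots> = delta b c \<oplus>\<^bsub>WW\<^esub> delta b' c"
    unfolding delta_def using assms by (intro finsum_addf_P[OF WW.grp]) (auto intro!: W.BB.tens_closed)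
  finally show ?thesis .
qed

lemma delta_add_right:
  assumes "b \<in> carrier B" "c \<in> carrier B" "c' \<in> carrier B"
  shows "delta b (c \<oplus> c') = delta b c \<oplus>\<^bsub>WW\<^esub> delta b c'"
proof -
  have "delta b (c \<oplus> c') = (\<Oplus>\<^bsub>WW\<^esub>i<n. tW (bb b (g \<otimes> X i)) (bb (Y i) c) \<oplus>\<^bsub>WW\<^esub> tW (bb b (g \<otimes> X i)) (bb (Y i) c'))"
    unfolding delta_def using assms
    by (intro WW.sum_cong) (auto simp: wb_rules W.BB.tens_rules)
  also have "\<dots> = delta b c \<oplus>\<^bsub>WW\<^esub> delta b c'"
    unfolding delta_def using assms by (intro finsum_addf_P[OF WW.grp]) (auto intro!: W.BB.tens_closed)
  finally show ?thesis .
qed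

lemma delta_smult:
  assumes "b \<in> carrier B" "c \<in> carrier B"
  shows "delta (k \<odot> b) c = k \<odot>\<^bsub>WW\<^esub> delta b c"
  unfolding delta_def using assms
  by (subst WW.finsum_smult_right)
    (auto intro!: WW.sum_cong W.BB.tens_closed WW.smult_simps(1) simp: wb_rules W.BB.tens_rules)

text \<open>An element of \<open>A\<close> between \<open>b\<close> and \<open>c\<close> is passed from the first factor to the second through
  the Casimir element.\<close>

lemma delta_bal:
  assumes "a \<in> A" "b \<in> carrier B" "c \<in> carrier B"
  shows "delta (b \<otimes> a) c = delta b (a \<otimes> c)"
proof -
  have a: "a \<in> carrier B" using assms by simp
  have "delta (b \<otimes> a) c = (\<Oplus>\<^bsub>WW\<^esub>i<n. tW (bb b (g \<otimes> (a \<otimes> X i))) (bb (Y i) c))"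
    unfolding delta_def using assms a
    by (intro WW.sum_cong) (auto simp: bb_balanced A_move intro!: W.BB.tens_closed)
  also have "\<dots> = (\<Oplus>\<^bsub>WW\<^esub>i<n. tW (bb b (g \<otimes> X i)) (bb (Y i \<otimes> a) c))"
    by (rule casimir_left[OF WW.grp delta_balanced[OF assms(2,3)] a])
  also have "\<dots> = delta b (a \<otimes> c)"
    unfolding delta_def using assms a
    by (intro WW.sum_cong) (auto simp: bb_balanced intro!: W.BB.tens_closed)
  finally show ?thesis .
qed

lemma D_addmap: "addmap W WW D" and D_bb: "b \<in> carrier B ==> c \<in> carrier B ==> D (bb b c) = delta b c"
proof -
  note L = bbar_lift_addmap[where P = WW and \<beta> = "Hmin_delta B A g casimir_elt", OF WW.grp]
    bbar_lift_bb[where P = WW and \<beta> = "Hmin_delta B A g casimir_elt", OF WW.grp]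
  have D: "D = bbar_lift B A WW (Hmin_delta B A g casimir_elt)" by (simp add: W_simps(7) HA_WW)
  have "addmap HA WW D"
    unfolding D by (rule L(1)) (simp_all add: Hmin_delta_eq delta_closed delta_add_left delta_add_right delta_bal)
  then show "addmap W WW D" by (simp add: addmap_def W_simps(1,5))
  show "b \<in> carrier B ==> c \<in> carrier B ==> D (bb b c) = delta b c"
    unfolding D
    by (subst L(2)) (simp_all add: Hmin_delta_eq delta_closed delta_add_left delta_add_right delta_bal)
qed

lemma D_klin: "klin W WW D"
proof -
  have "D (k \<odot>\<^bsub>W\<^esub> h) = k \<odot>\<^bsub>WW\<^esub> D h" if "h \<in> carrier W" for k h
    using that
  proof (induction rule: wb_induct)
    case (pure b c)
    then have "k \<odot>\<^bsub>W\<^esub> bb b c = bb (k \<odot> b) c" by (simp add: wb_rules)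
    then show ?case using pure by (simp add: D_bb delta_smult)
  next
    case (add s t)
    then show ?case
      by (simp add: W.smult_distr addmap_add[OF D_addmap] addmap_closed[OF D_addmap] WW.smult_distr)
  qed
  then show ?thesis using D_addmap by (simp add: klin_def)
qed

lemma eps_addmap: "addmap W class_ring eps"
  and eps_bb: "b \<in> carrier B ==> c \<in> carrier B ==> eps (bb b c) = Tr (gi \<otimes> c \<otimes> b)"
proof -
  have bal: "Tr (gi \<otimes> c \<otimes> (b \<otimes> a)) = Tr (gi \<otimes> (a \<otimes> c) \<otimes> b)"
    if "a \<in> A" "b \<in> carrier B" "c \<in> carrier B" for a b c
    using that A_comm[of a "gi \<otimes> c \<otimes> b"] by (simp add: m_assoc A_move)
  note L = bbar_lift_addmap[where P = class_ring and \<beta> = "\<lambda>b c. Tr (gi \<otimes> c \<otimes> b)", OF class_ring_abelian_group]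
    bbar_lift_bb[where P = class_ring and \<beta> = "\<lambda>b c. Tr (gi \<otimes> c \<otimes> b)", OF class_ring_abelian_group]
  have "addmap HA class_ring eps"
    unfolding W_simps(8) by (rule L(1)) (simp_all add: bal l_distr r_distr Tr_add)
  then show "addmap W class_ring eps" by (simp add: addmap_def W_simps(1,5))
  show "b \<in> carrier B ==> c \<in> carrier B ==> eps (bb b c) = Tr (gi \<otimes> c \<otimes> b)"
    unfolding W_simps(8) by (subst L(2)) (simp_all add: bal l_distr r_distr Tr_add)
qed

lemma eps_add: "x \<in> carrier W ==> y \<in> carrier W ==> eps (x \<oplus>\<^bsub>W\<^esub> y) = eps x + eps y"
  using addmap_add[OF eps_addmap] by simp

lemma eps_smult: "h \<in> carrier W ==> eps (k \<odot>\<^bsub>W\<^esub> h) = k * eps h"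
proof (induction rule: wb_induct)
  case (pure b c)
  then have "k \<odot>\<^bsub>W\<^esub> bb b c = bb (k \<odot> b) c" by (simp add: wb_rules)
  then show ?case using pure by (simp add: eps_bb Tr_smult)
next
  case (add s t)
  then show ?case by (simp add: W.smult_distr eps_add distrib_left)
qed

lemma eps_linfun: "linfun W eps"
  by (simp add: linfun_def eps_add eps_smult)

lemma S_addmap: "addmap W W S"
  and S_bb: "b \<in> carrier B ==> c \<in> carrier B ==> S (bb b c) = bb (gi \<otimes> c \<otimes> g) b"
proof -
  have bal: "bb (gi \<otimes> c \<otimes> g) (b \<otimes> a) = bb (gi \<otimes> (a \<otimes> c) \<otimes> g) b"
    if "a \<in> A" "b \<in> carrier B" "c \<in> carrier B" for a b c
  proof -
    have "gi \<otimes> (a \<otimes> c) \<otimes> g = gi \<otimes> c \<otimes> g \<otimes> a"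
      using that A_comm[of a "gi \<otimes> c \<otimes> g"] by (simp add: m_assoc A_move)
    moreover have "b \<otimes> a = a \<otimes> b" using that A_comm[of a b] by simp
    ultimately show ?thesis using that by (simp add: bb_balanced)
  qed
  note L = bbar_lift_addmap[where P = HA and \<beta> = "\<lambda>b c. bb (gi \<otimes> c \<otimes> g) b", OF HA.grp]
    bbar_lift_bb[where P = HA and \<beta> = "\<lambda>b c. bb (gi \<otimes> c \<otimes> g) b", OF HA.grp]
  have "addmap HA HA S"
    unfolding W_simps(9) by (rule L(1)) (simp_all add: bal l_distr r_distr bb_add_left bb_add_right)
  then show "addmap W W S" by (simp add: addmap_def W_simps(1,5))
  show "b \<in> carrier B ==> c \<in> carrier B ==> S (bb b c) = bb (gi \<otimes> c \<otimes> g) b"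
    unfolding W_simps(9) by (subst L(2)) (simp_all add: bal l_distr r_distr bb_add_left bb_add_right)
qed

lemma S_klin: "klin W W S"
proof -
  have "S (k \<odot>\<^bsub>W\<^esub> h) = k \<odot>\<^bsub>W\<^esub> S h" if "h \<in> carrier W" for k h
    using that
  proof (induction rule: wb_induct)
    case (pure b c)
    then have "S (k \<odot>\<^bsub>W\<^esub> bb b c) = S (bb (k \<odot> b) c)" by (simp add: wb_smult_left)
    also have "\<dots> = k \<odot>\<^bsub>W\<^esub> S (bb b c)" using pure by (simp add: S_bb wb_smult_right)
    finally show ?case .
  next
    case (add s t)
    then show ?case
      by (simp add: W.smult_distr addmap_add[OF S_addmap] addmap_closed[OF S_addmap])
  qed
  then show ?thesis using S_addmap by (simp add: klin_def)
qed

lemmas S_closed [simp] = klin_closed[OF S_klin]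
lemmas D_closed [simp] = klin_closed[OF D_klin]
lemmas D_add = klin_add[OF D_klin]
lemmas S_add = klin_add[OF S_klin]

subsection \<open>Coalgebra axioms\<close>

lemma slice1_balanced: "balanced class_ring W W W (\<lambda>x y. eps x \<odot>\<^bsub>W\<^esub> y)"
  by (rule balancedI) (simp_all add: eps_add eps_smult W.smult_distr mult.commute)

lemma slice2_balanced: "balanced class_ring W W W (\<lambda>x y. eps y \<odot>\<^bsub>W\<^esub> x)"
  by (rule balancedI) (simp_all add: eps_add eps_smult W.smult_distr mult.commute)

lemma slice1_delta:
  assumes "p \<in> carrier B" "c \<in> carrier B"
  shows "(\<Oplus>\<^bsub>W\<^esub>i<n. Tr (p \<otimes> X i) \<odot>\<^bsub>W\<^esub> bb (Y i) c) = bb p c"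
proof -
  have "bb p c = bb (\<Oplus>i<n. Tr (p \<otimes> X i) \<odot> Y i) c" using expand_Y[OF assms(1)] by simp
  also have "\<dots> = (\<Oplus>\<^bsub>W\<^esub>i<n. bb (Tr (p \<otimes> X i) \<odot> Y i) c)"
    by (rule wb_finsum_left) (use assms in auto)
  also have "\<dots> = (\<Oplus>\<^bsub>W\<^esub>i<n. Tr (p \<otimes> X i) \<odot>\<^bsub>W\<^esub> bb (Y i) c)"
    using assms by (intro W.sum_cong) (auto simp: wb_rules)
  finally show ?thesis by simp
qed

lemma slice2_delta:
  assumes "p \<in> carrier B" "b \<in> carrier B"
  shows "(\<Oplus>\<^bsub>W\<^esub>i<n. Tr (p \<otimes> Y i) \<odot>\<^bsub>W\<^esub> bb b (g \<otimes> X i)) = bb b (g \<otimes> p)"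
proof -
  have "g \<otimes> p = g \<otimes> (\<Oplus>i<n. Tr (p \<otimes> Y i) \<odot> X i)" using expand_X[OF assms(1)] by simp
  also have "\<dots> = (\<Oplus>i<n. g \<otimes> (Tr (p \<otimes> Y i) \<odot> X i))"
    by (rule finsum_rdistr) (use assms in auto)
  finally have "bb b (g \<otimes> p) = bb b (\<Oplus>i<n. g \<otimes> (Tr (p \<otimes> Y i) \<odot> X i))" by simp
  also have "\<dots> = (\<Oplus>\<^bsub>W\<^esub>i<n. bb b (g \<otimes> (Tr (p \<otimes> Y i) \<odot> X i)))"
    by (rule wb_finsum_right) (use assms in auto)
  also have "\<dots> = (\<Oplus>\<^bsub>W\<^esub>i<n. Tr (p \<otimes> Y i) \<odot>\<^bsub>W\<^esub> bb b (g \<otimes> X i))"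
    using assms by (intro W.sum_cong) (auto simp: wb_rules)
  finally show ?thesis by simp
qed

lemma eps_gX: "b \<in> carrier B ==> c \<in> carrier B ==> i < n ==> eps (bb b (g \<otimes> X i)) = Tr (b \<otimes> X i)"
  by (simp add: eps_bb Tr_comm[of "X i" b])

lemma eps_Y: "c \<in> carrier B ==> b \<in> carrier B ==> i < n ==> eps (bb (b \<otimes> Y i) c) = Tr (gi \<otimes> c \<otimes> b \<otimes> Y i)"
  by (simp add: eps_bb m_assoc)

lemma counit_left:
  assumes "h \<in> carrier W"
  shows "tensor_lift class_ring W W W (\<lambda>x y. eps x \<odot>\<^bsub>W\<^esub> y) (D h) = h"
  using assms
proof (induction rule: wb_induct)
  case (pure b c)
  then have "tensor_lift class_ring W W W (\<lambda>x y. eps x \<odot>\<^bsub>W\<^esub> y) (D (bb b c))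
      = (\<Oplus>\<^bsub>W\<^esub>i<n. eps (bb b (g \<otimes> X i)) \<odot>\<^bsub>W\<^esub> bb (Y i) c)"
    unfolding D_bb[OF pure] delta_def by (intro W.BB.lift_finsum[OF W.grp slice1_balanced]) auto
  also have "\<dots> = (\<Oplus>\<^bsub>W\<^esub>i<n. Tr (b \<otimes> X i) \<odot>\<^bsub>W\<^esub> bb (Y i) c)"
    using pure by (intro W.sum_cong) (auto simp: eps_gX)
  finally show ?case using slice1_delta[OF pure] by simp
next
  case (add s t)
  then show ?case by (simp add: D_add addmap_add[OF W.BB.lift_addmap[OF W.grp slice1_balanced]])
qed

lemma counit_right:
  assumes "h \<in> carrier W"
  shows "tensor_lift class_ring W W W (\<lambda>x y. eps y \<odot>\<^bsub>W\<^esub> x) (D h) = h"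
  using assms
proof (induction rule: wb_induct)
  case (pure b c)
  then have "tensor_lift class_ring W W W (\<lambda>x y. eps y \<odot>\<^bsub>W\<^esub> x) (D (bb b c))
      = (\<Oplus>\<^bsub>W\<^esub>i<n. eps (bb (Y i) c) \<odot>\<^bsub>W\<^esub> bb b (g \<otimes> X i))"
    unfolding D_bb[OF pure] delta_def by (intro W.BB.lift_finsum[OF W.grp slice2_balanced]) auto
  also have "\<dots> = (\<Oplus>\<^bsub>W\<^esub>i<n. Tr (gi \<otimes> c \<otimes> Y i) \<odot>\<^bsub>W\<^esub> bb b (g \<otimes> X i))"
    using pure by (intro W.sum_cong) (auto simp: eps_bb)
  finally show ?case using slice2_delta[of "gi \<otimes> c" b] pure by simp
next
  case (add s t)
  then show ?case by (simp add: D_add addmap_add[OF W.BB.lift_addmap[OF W.grp slice2_balanced]])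
qed

abbreviation "Did \<equiv> tensor_map class_ring W W WW W D (\<lambda>x. x)"
abbreviation "idD \<equiv> tensor_map class_ring W W W WW (\<lambda>x. x) D"
abbreviation "assocW \<equiv> tensor_assoc W W W"

lemmas Did_klin = tensor_map_klin[OF W.ks W.ks WW.ks W.ks D_klin klin_id]
lemmas Did_tens = tensor_map_tens[OF W.ks W.ks WW.ks W.ks D_klin klin_id]
lemmas idD_klin = tensor_map_klin[OF W.ks W.ks W.ks WW.ks klin_id D_klin]
lemmas idD_tens = tensor_map_tens[OF W.ks W.ks W.ks WW.ks klin_id D_klin]
lemmas assocW_klin = tensor_assoc_klin[OF W.ks W.ks W.ks]
lemmas assocW_tens = tensor_assoc_tens[OF W.ks W.ks W.ks]

lemma W3'_kspace: "kspace (WW \<otimes>\<^sub>k W)" by (rule kspace_tensor) (rule WW.ks W.ks)+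

text \<open>The common value of \<open>(\<Delta> \<otimes> id) \<Delta>\<close> and \<open>(id \<otimes> \<Delta>) \<Delta>\<close> on
  generators: a Casimir element in each of the two gaps.\<close>

definition delta2 where
  "delta2 b c = (\<Oplus>\<^bsub>WWW\<^esub>i<n. \<Oplus>\<^bsub>WWW\<^esub>j<n.
     t3 (bb b (g \<otimes> X i)) (tW (bb (Y i) (g \<otimes> X j)) (bb (Y j) c)))"

lemma Did_delta:
  assumes "b \<in> carrier B" "c \<in> carrier B"
  shows "Did (delta b c) = (\<Oplus>\<^bsub>WW \<otimes>\<^sub>k W\<^esub>i<n. tens class_ring WW W (delta b (g \<otimes> X i)) (bb (Y i) c))"
proof -
  have "Did (delta b c) = (\<Oplus>\<^bsub>WW \<otimes>\<^sub>k W\<^esub>i<n. Did (tW (bb b (g \<otimes> X i)) (bb (Y i) c)))"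
    unfolding delta_def
    by (rule klin_finsum[OF WW.ks W3'_kspace Did_klin]) (use assms in \<open>auto intro!: W.BB.tens_closed\<close>)
  also have "\<dots> = (\<Oplus>\<^bsub>WW \<otimes>\<^sub>k W\<^esub>i<n. tens class_ring WW W (delta b (g \<otimes> X i)) (bb (Y i) c))"
    using assms by (intro finsum_cong_P[OF kspace.grp[OF W3'_kspace]])
      (auto simp: Did_tens D_bb delta_closed intro!: W3'.tens_closed)
  finally show ?thesis .
qed

lemma assoc_Did:
  assumes "b \<in> carrier B" "c \<in> carrier B"
  shows "assocW (Did (D (bb b c))) = delta2 b c"
proof -
  have "assocW (Did (D (bb b c)))
     = (\<Oplus>\<^bsub>WWW\<^esub>i<n. assocW (tens class_ring WW W (delta b (g \<otimes> X i)) (bb (Y i) c)))"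
    unfolding D_bb[OF assms] Did_delta[OF assms]
    by (rule klin_finsum[OF W3'_kspace W3k.ks assocW_klin])
      (use assms in \<open>auto intro!: W3'.tens_closed delta_closed\<close>)
  also have "\<dots> = (\<Oplus>\<^bsub>WWW\<^esub>i<n. \<Oplus>\<^bsub>WWW\<^esub>j<n.
       t3 (bb b (g \<otimes> X j)) (tW (bb (Y j) (g \<otimes> X i)) (bb (Y i) c)))"
  proof (rule W3k.sum_cong)
    fix i assume i: "i \<in> {..<n}"
    have "tens class_ring WW W (delta b (g \<otimes> X i)) (bb (Y i) c)
        = (\<Oplus>\<^bsub>WW \<otimes>\<^sub>k W\<^esub>j<n. tens class_ring WW W (tW (bb b (g \<otimes> X j)) (bb (Y j) (g \<otimes> X i))) (bb (Y i) c))"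
      unfolding delta_def by (rule W3'.tens_finsum_left) (use assms i in \<open>auto intro!: W.BB.tens_closed\<close>)
    then have "assocW (tens class_ring WW W (delta b (g \<otimes> X i)) (bb (Y i) c))
        = (\<Oplus>\<^bsub>WWW\<^esub>j<n. assocW (tens class_ring WW W (tW (bb b (g \<otimes> X j)) (bb (Y j) (g \<otimes> X i))) (bb (Y i) c)))"
      using i assms
      by (simp only:, intro klin_finsum[OF W3'_kspace W3k.ks assocW_klin])
        (auto intro!: W3'.tens_closed W.BB.tens_closed)
    also have "\<dots> = (\<Oplus>\<^bsub>WWW\<^esub>j<n.
       t3 (bb b (g \<otimes> X j)) (tW (bb (Y j) (g \<otimes> X i)) (bb (Y i) c)))"
      using i assms by (intro W3k.sum_cong) (auto simp: assocW_tens intro!: W3.tens_closed W.BB.tens_closed)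
    finally show "assocW (tens class_ring WW W (delta b (g \<otimes> X i)) (bb (Y i) c)) = \<dots>" .
  qed (use assms in \<open>auto intro!: finsum_closed_P[OF W3k.grp] W3.tens_closed W.BB.tens_closed\<close>)
  also have "\<dots> = delta2 b c"
    unfolding delta2_def
    by (rule finsum_swap[OF W3k.grp]) (use assms in \<open>auto intro!: W3.tens_closed W.BB.tens_closed\<close>)
  finally show ?thesis .
qed

lemma idD_delta2:
  assumes "b \<in> carrier B" "c \<in> carrier B"
  shows "idD (D (bb b c)) = delta2 b c"
proof -
  have "idD (D (bb b c)) = (\<Oplus>\<^bsub>WWW\<^esub>i<n. idD (tW (bb b (g \<otimes> X i)) (bb (Y i) c)))"
    unfolding D_bb[OF assms] delta_def
    by (rule klin_finsum[OF WW.ks W3k.ks idD_klin]) (use assms in \<open>auto intro!: W.BB.tens_closed\<close>)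
  also have "\<dots> = delta2 b c"
    unfolding delta2_def
  proof (rule W3k.sum_cong)
    fix i assume i: "i \<in> {..<n}"
    have "idD (tW (bb b (g \<otimes> X i)) (bb (Y i) c)) = t3 (bb b (g \<otimes> X i)) (delta (Y i) c)"
      using i assms by (simp add: idD_tens D_bb)
    also have "\<dots> = (\<Oplus>\<^bsub>WWW\<^esub>j<n. t3 (bb b (g \<otimes> X i)) (tW (bb (Y i) (g \<otimes> X j)) (bb (Y j) c)))"
      unfolding delta_def by (rule W3.tens_finsum_right) (use assms i in \<open>auto intro!: W.BB.tens_closed\<close>)
    finally show "idD (tW (bb b (g \<otimes> X i)) (bb (Y i) c)) = \<dots>" .
  qed (use assms in \<open>auto intro!: finsum_closed_P[OF W3k.grp] W3.tens_closed W.BB.tens_closed\<close>)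
  finally show ?thesis .
qed

lemma coassoc:
  assumes "h \<in> carrier W"
  shows "assocW (Did (D h)) = idD (D h)"
  using assms
proof (induction rule: wb_induct)
  case (pure b c)
  then show ?case by (simp add: assoc_Did idD_delta2)
next
  case (add s t)
  then show ?case
    by (simp add: D_add klin_add[OF Did_klin] klin_add[OF assocW_klin] klin_add[OF idD_klin]
        klin_closed[OF Did_klin])
qed

lemma W_coalgebra: "coalgebra W"
  unfolding coalgebra_def Let_def id_def
  using W.vs.vectorspace_axioms D_klin coassoc counit_left counit_right
  by (simp add: eps_add eps_smult klin_module_hom)

subsection \<open>Bialgebra axioms\<close>

text \<open>Here the trace condition is indispensable: contracting one of the two Casimir elements in the product leaves the factor \<open>avg
  g\<close>, which must be \<open>1\<close>.\<close>

lemma D_mult: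
  assumes "h \<in> carrier W" "k \<in> carrier W"
  shows "D (h \<otimes>\<^bsub>W\<^esub> k) = D h \<otimes>\<^bsub>WW\<^esub> D k"
  using assms
proof (induction rule: wb_induct)
  case (pure b c)
  from pure(3,1,2) show ?case
  proof (induction rule: wb_induct)
    case (pure b' c')
    note cl = pure
    let ?t = "\<lambda>x y. tW (bb (b \<otimes> b') x) (bb y (c' \<otimes> c))"
    have "D (bb b c) \<otimes>\<^bsub>WW\<^esub> D (bb b' c')
       = (\<Oplus>\<^bsub>WW\<^esub>i<n. \<Oplus>\<^bsub>WW\<^esub>j<n. tW (bb b (g \<otimes> X i)) (bb (Y i) c) \<otimes>\<^bsub>WW\<^esub> tW (bb b' (g \<otimes> X j)) (bb (Y j) c'))"
      using cl unfolding D_bb[OF cl(3,4)] D_bb[OF cl(1,2)] delta_def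
      by (intro WW.sum_mult_sum) (auto intro!: W.BB.tens_closed)
    also have "\<dots> = (\<Oplus>\<^bsub>WW\<^esub>i<n. \<Oplus>\<^bsub>WW\<^esub>j<n. ?t (g \<otimes> X j \<otimes> (g \<otimes> X i)) (Y i \<otimes> Y j))"
    proof (rule WW.sum_cong)
      fix i assume i: "i \<in> {..<n}"
      show "(\<Oplus>\<^bsub>WW\<^esub>j<n. tW (bb b (g \<otimes> X i)) (bb (Y i) c) \<otimes>\<^bsub>WW\<^esub> tW (bb b' (g \<otimes> X j)) (bb (Y j) c'))
         = (\<Oplus>\<^bsub>WW\<^esub>j<n. ?t (g \<otimes> X j \<otimes> (g \<otimes> X i)) (Y i \<otimes> Y j))"
        using cl i by (intro WW.sum_cong) (auto simp: W.BB.tens_mult wb_mult intro!: W.BB.tens_closed)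
    qed (use cl in \<open>auto intro!: finsum_closed_P[OF WW.grp] W.BB.tens_closed\<close>)
    also have "\<dots> = (\<Oplus>\<^bsub>WW\<^esub>j<n. \<Oplus>\<^bsub>WW\<^esub>i<n. ?t (g \<otimes> X j \<otimes> (g \<otimes> X i)) (Y i \<otimes> Y j))"
      by (rule finsum_swap[OF WW.grp]) (use cl in \<open>auto intro!: W.BB.tens_closed\<close>)
    also have "\<dots> = (\<Oplus>\<^bsub>WW\<^esub>j<n. \<Oplus>\<^bsub>WW\<^esub>i<n. ?t (g \<otimes> X j \<otimes> (g \<otimes> (Y j \<otimes> X i))) (Y i))"
    proof (rule WW.sum_cong)
      fix j assume j: "j \<in> {..<n}"
      have bal: "balanced class_ring B B WW (\<lambda>x y. ?t (g \<otimes> X j \<otimes> (g \<otimes> x)) y)"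
        by (rule balancedI) (use cl j in \<open>simp_all add: r_distr wb_rules W.BB.tens_rules\<close>)
      show "(\<Oplus>\<^bsub>WW\<^esub>i<n. ?t (g \<otimes> X j \<otimes> (g \<otimes> X i)) (Y i \<otimes> Y j))
         = (\<Oplus>\<^bsub>WW\<^esub>i<n. ?t (g \<otimes> X j \<otimes> (g \<otimes> (Y j \<otimes> X i))) (Y i))"
        using casimir_left[OF WW.grp bal, of "Y j"] j by simp
    qed (use cl in \<open>auto intro!: finsum_closed_P[OF WW.grp] W.BB.tens_closed\<close>)
    also have "\<dots> = (\<Oplus>\<^bsub>WW\<^esub>i<n. \<Oplus>\<^bsub>WW\<^esub>j<n. ?t (g \<otimes> X j \<otimes> (g \<otimes> (Y j \<otimes> X i))) (Y i))"
      by (rule finsum_swap[OF WW.grp]) (use cl in \<open>auto intro!: W.BB.tens_closed\<close>)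
    also have "\<dots> = (\<Oplus>\<^bsub>WW\<^esub>i<n. ?t (g \<otimes> X i) (Y i))"
    proof (rule WW.sum_cong)
      fix i assume i: "i \<in> {..<n}"
      have am: "addmap B WW (\<lambda>x. ?t (g \<otimes> (x \<otimes> X i)) (Y i))"
        by (rule addmapI) (use cl i in \<open>simp_all add: l_distr r_distr wb_rules W.BB.tens_rules\<close>)
      have "(\<Oplus>\<^bsub>WW\<^esub>j<n. ?t (g \<otimes> X j \<otimes> (g \<otimes> (Y j \<otimes> X i))) (Y i))
          = (\<Oplus>\<^bsub>WW\<^esub>j<n. ?t (g \<otimes> ((X j \<otimes> (g \<otimes> Y j)) \<otimes> X i)) (Y i))"
        using cl i by (intro WW.sum_cong) (auto simp: m_assoc intro!: W.BB.tens_closed)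
      also have "\<dots> = ?t (g \<otimes> ((\<Oplus>j<n. X j \<otimes> (g \<otimes> Y j)) \<otimes> X i)) (Y i)"
        by (rule addmap_finsum[OF grp WW.grp am, symmetric]) simp
      also have "\<dots> = ?t (g \<otimes> X i) (Y i)" using g_avg i by (simp add: avg_def)
      finally show "(\<Oplus>\<^bsub>WW\<^esub>j<n. ?t (g \<otimes> X j \<otimes> (g \<otimes> (Y j \<otimes> X i))) (Y i)) = ?t (g \<otimes> X i) (Y i)" .
    qed (use cl in \<open>auto intro!: W.BB.tens_closed\<close>)
    also have "\<dots> = D (bb b c \<otimes>\<^bsub>W\<^esub> bb b' c')" using cl by (simp add: wb_mult D_bb delta_def)
    finally show ?case by simp
  next
    case (add s t)
    then show ?case by (simp add: W.r_distr D_add WW.r_distr)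
  qed
next
  case (add s t)
  then show ?case by (simp add: W.l_distr D_add WW.l_distr)
qed

lemma D_one: "D \<one>\<^bsub>W\<^esub> = delta \<one> \<one>"
  by (simp add: wb_one D_bb)

lemma D1_left_eq:
  "assocW (tens class_ring WW W (D \<one>\<^bsub>W\<^esub>) \<one>\<^bsub>W\<^esub>)
    = (\<Oplus>\<^bsub>WWW\<^esub>i<n. t3 (bb \<one> (g \<otimes> X i)) (tW (bb (Y i) \<one>) (bb \<one> \<one>)))"
proof -
  have "tens class_ring WW W (D \<one>\<^bsub>W\<^esub>) \<one>\<^bsub>W\<^esub>
     = (\<Oplus>\<^bsub>WW \<otimes>\<^sub>k W\<^esub>i<n. tens class_ring WW W (tW (bb \<one> (g \<otimes> X i)) (bb (Y i) \<one>)) (bb \<one> \<one>))"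
    unfolding D_one unfolding delta_def wb_one by (rule W3'.tens_finsum_left) (auto intro!: W.BB.tens_closed)
  then have "assocW (tens class_ring WW W (D \<one>\<^bsub>W\<^esub>) \<one>\<^bsub>W\<^esub>)
     = (\<Oplus>\<^bsub>WWW\<^esub>i<n. assocW (tens class_ring WW W (tW (bb \<one> (g \<otimes> X i)) (bb (Y i) \<one>)) (bb \<one> \<one>)))"
    by (simp only:, intro klin_finsum[OF W3'_kspace W3k.ks assocW_klin])
      (auto intro!: W3'.tens_closed W.BB.tens_closed)
  also have "\<dots> = (\<Oplus>\<^bsub>WWW\<^esub>i<n. t3 (bb \<one> (g \<otimes> X i)) (tW (bb (Y i) \<one>) (bb \<one> \<one>)))"
    by (intro W3k.sum_cong) (auto simp: assocW_tens intro!: W3.tens_closed W.BB.tens_closed)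
  finally show ?thesis .
qed

lemma D1_right_eq:
  "t3 \<one>\<^bsub>W\<^esub> (D \<one>\<^bsub>W\<^esub>)
    = (\<Oplus>\<^bsub>WWW\<^esub>j<n. t3 (bb \<one> \<one>) (tW (bb \<one> (g \<otimes> X j)) (bb (Y j) \<one>)))"
  unfolding D_one unfolding delta_def wb_one by (rule W3.tens_finsum_right) (auto intro!: W.BB.tens_closed)

lemma D_unit:
  shows "assocW (Did (D \<one>\<^bsub>W\<^esub>)) = assocW (tens class_ring WW W (D \<one>\<^bsub>W\<^esub>) \<one>\<^bsub>W\<^esub>) \<otimes>\<^bsub>WWW\<^esub> t3 \<one>\<^bsub>W\<^esub> (D \<one>\<^bsub>W\<^esub>)"
    and "assocW (Did (D \<one>\<^bsub>W\<^esub>)) = t3 \<one>\<^bsub>W\<^esub> (D \<one>\<^bsub>W\<^esub>) \<otimes>\<^bsub>WWW\<^esub> assocW (tens class_ring WW W (D \<one>\<^bsub>W\<^esub>) \<one>\<^bsub>W\<^esub>)"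
proof -
  have L: "assocW (Did (D \<one>\<^bsub>W\<^esub>)) = delta2 \<one> \<one>" unfolding wb_one by (rule assoc_Did) auto
  have "assocW (tens class_ring WW W (D \<one>\<^bsub>W\<^esub>) \<one>\<^bsub>W\<^esub>) \<otimes>\<^bsub>WWW\<^esub> t3 \<one>\<^bsub>W\<^esub> (D \<one>\<^bsub>W\<^esub>)
     = (\<Oplus>\<^bsub>WWW\<^esub>i<n. \<Oplus>\<^bsub>WWW\<^esub>j<n. t3 (bb \<one> (g \<otimes> X i)) (tW (bb (Y i) \<one>) (bb \<one> \<one>))
         \<otimes>\<^bsub>WWW\<^esub> t3 (bb \<one> \<one>) (tW (bb \<one> (g \<otimes> X j)) (bb (Y j) \<one>)))"
    unfolding D1_left_eq D1_right_eq by (rule W3k.sum_mult_sum) (auto intro!: W3.tens_closed W.BB.tens_closed)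
  also have "\<dots> = delta2 \<one> \<one>"
    unfolding delta2_def
  proof (rule W3k.sum_cong)
    fix i assume i: "i \<in> {..<n}"
    show "(\<Oplus>\<^bsub>WWW\<^esub>j<n. t3 (bb \<one> (g \<otimes> X i)) (tW (bb (Y i) \<one>) (bb \<one> \<one>))
         \<otimes>\<^bsub>WWW\<^esub> t3 (bb \<one> \<one>) (tW (bb \<one> (g \<otimes> X j)) (bb (Y j) \<one>)))
      = (\<Oplus>\<^bsub>WWW\<^esub>j<n. t3 (bb \<one> (g \<otimes> X i)) (tW (bb (Y i) (g \<otimes> X j)) (bb (Y j) \<one>)))"
      using i by (intro W3k.sum_cong)
        (auto simp: W3.tens_mult W.BB.tens_mult W.BB.tens_closed wb_mult intro!: W3.tens_closed W.BB.tens_closed)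
  qed (auto intro!: finsum_closed_P[OF W3k.grp] W3.tens_closed W.BB.tens_closed)
  finally show "assocW (Did (D \<one>\<^bsub>W\<^esub>)) = assocW (tens class_ring WW W (D \<one>\<^bsub>W\<^esub>) \<one>\<^bsub>W\<^esub>) \<otimes>\<^bsub>WWW\<^esub> t3 \<one>\<^bsub>W\<^esub> (D \<one>\<^bsub>W\<^esub>)"
    using L by simp
  have "t3 \<one>\<^bsub>W\<^esub> (D \<one>\<^bsub>W\<^esub>) \<otimes>\<^bsub>WWW\<^esub> assocW (tens class_ring WW W (D \<one>\<^bsub>W\<^esub>) \<one>\<^bsub>W\<^esub>)
     = (\<Oplus>\<^bsub>WWW\<^esub>j<n. \<Oplus>\<^bsub>WWW\<^esub>i<n. t3 (bb \<one> \<one>) (tW (bb \<one> (g \<otimes> X j)) (bb (Y j) \<one>))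
         \<otimes>\<^bsub>WWW\<^esub> t3 (bb \<one> (g \<otimes> X i)) (tW (bb (Y i) \<one>) (bb \<one> \<one>)))"
    unfolding D1_left_eq D1_right_eq by (rule W3k.sum_mult_sum) (auto intro!: W3.tens_closed W.BB.tens_closed)
  also have "\<dots> = (\<Oplus>\<^bsub>WWW\<^esub>i<n. \<Oplus>\<^bsub>WWW\<^esub>j<n. t3 (bb \<one> \<one>) (tW (bb \<one> (g \<otimes> X j)) (bb (Y j) \<one>))
         \<otimes>\<^bsub>WWW\<^esub> t3 (bb \<one> (g \<otimes> X i)) (tW (bb (Y i) \<one>) (bb \<one> \<one>)))"
    by (rule finsum_swap[OF W3k.grp]) (auto intro!: W3k.m_closed W3.tens_closed W.BB.tens_closed)
  also have "\<dots> = delta2 \<one> \<one>"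
    unfolding delta2_def
  proof (rule W3k.sum_cong)
    fix i assume i: "i \<in> {..<n}"
    show "(\<Oplus>\<^bsub>WWW\<^esub>j<n. t3 (bb \<one> \<one>) (tW (bb \<one> (g \<otimes> X j)) (bb (Y j) \<one>))
         \<otimes>\<^bsub>WWW\<^esub> t3 (bb \<one> (g \<otimes> X i)) (tW (bb (Y i) \<one>) (bb \<one> \<one>)))
      = (\<Oplus>\<^bsub>WWW\<^esub>j<n. t3 (bb \<one> (g \<otimes> X i)) (tW (bb (Y i) (g \<otimes> X j)) (bb (Y j) \<one>)))"
      using i by (intro W3k.sum_cong)
        (auto simp: W3.tens_mult W.BB.tens_mult W.BB.tens_closed wb_mult intro!: W3.tens_closed W.BB.tens_closed)
  qed (auto intro!: finsum_closed_P[OF W3k.grp] W3.tens_closed W.BB.tens_closed)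
  finally show "assocW (Did (D \<one>\<^bsub>W\<^esub>)) = t3 \<one>\<^bsub>W\<^esub> (D \<one>\<^bsub>W\<^esub>) \<otimes>\<^bsub>WWW\<^esub> assocW (tens class_ring WW W (D \<one>\<^bsub>W\<^esub>) \<one>\<^bsub>W\<^esub>)"
    using L by simp
qed

lemma eps_mult_left:
  assumes f: "f \<in> carrier W" and b: "b \<in> carrier B" and c: "c \<in> carrier B" and h: "h \<in> carrier W"
  shows "eps (f \<otimes>\<^bsub>W\<^esub> bb b c \<otimes>\<^bsub>W\<^esub> h) = (\<Sum>i<n. eps (f \<otimes>\<^bsub>W\<^esub> bb b (g \<otimes> X i)) * eps (bb (Y i) c \<otimes>\<^bsub>W\<^esub> h))"
  using f
proof (induction rule: wb_induct)
  case (pure b1 c1)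
  from h pure show ?case
  proof (induction rule: wb_induct)
    case (pure b2 c2)
    note cl = pure b c
    have 1: "eps (bb b1 c1 \<otimes>\<^bsub>W\<^esub> bb b (g \<otimes> X i)) = Tr (c1 \<otimes> b1 \<otimes> b \<otimes> X i)" if "i < n" for i
      using cl that Tr_comm[of "X i" "c1 \<otimes> (b1 \<otimes> b)"] by (simp add: wb_mult eps_bb m_assoc)
    have 2: "eps (bb (Y i) c \<otimes>\<^bsub>W\<^esub> bb b2 c2) = Tr (b2 \<otimes> gi \<otimes> c2 \<otimes> c \<otimes> Y i)" if "i < n" for i
      using cl that Tr_comm[of "gi \<otimes> (c2 \<otimes> (c \<otimes> Y i))" b2] by (simp add: wb_mult eps_bb m_assoc)
    have "(\<Sum>i<n. eps (bb b1 c1 \<otimes>\<^bsub>W\<^esub> bb b (g \<otimes> X i)) * eps (bb (Y i) c \<otimes>\<^bsub>W\<^esub> bb b2 c2))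
        = Tr (c1 \<otimes> b1 \<otimes> b \<otimes> (b2 \<otimes> gi \<otimes> c2 \<otimes> c))"
      using cl by (simp add: 1 2 trace_pair)
    also have "\<dots> = eps (bb b1 c1 \<otimes>\<^bsub>W\<^esub> bb b c \<otimes>\<^bsub>W\<^esub> bb b2 c2)"
      using cl Tr_comm[of "c1 \<otimes> (b1 \<otimes> (b \<otimes> b2))" "gi \<otimes> (c2 \<otimes> c)"] by (simp add: wb_mult eps_bb m_assoc)
    finally show ?case by simp
  next
    case (add s t)
    then show ?case using b c by (simp add: W.r_distr eps_add distrib_left sum.distrib)
  qed
next
  case (add s t)
  then show ?case using b c h by (simp add: W.l_distr eps_add distrib_right sum.distrib)
qed

lemma eps_mult_right:
  assumes f: "f \<in> carrier W" and b: "b \<in> carrier B" and c: "c \<in> carrier B" and h: "h \<in> carrier W"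
  shows "eps (f \<otimes>\<^bsub>W\<^esub> bb b c \<otimes>\<^bsub>W\<^esub> h) = (\<Sum>i<n. eps (f \<otimes>\<^bsub>W\<^esub> bb (Y i) c) * eps (bb b (g \<otimes> X i) \<otimes>\<^bsub>W\<^esub> h))"
  using f
proof (induction rule: wb_induct)
  case (pure b1 c1)
  from h pure show ?case
  proof (induction rule: wb_induct)
    case (pure b2 c2)
    note cl = pure b c
    have 1: "eps (bb b1 c1 \<otimes>\<^bsub>W\<^esub> bb (Y i) c) = Tr (gi \<otimes> c \<otimes> c1 \<otimes> b1 \<otimes> Y i)" if "i < n" for i
      using cl that by (simp add: wb_mult eps_bb m_assoc)
    have 2: "eps (bb b (g \<otimes> X i) \<otimes>\<^bsub>W\<^esub> bb b2 c2) = Tr (b \<otimes> b2 \<otimes> gi \<otimes> c2 \<otimes> g \<otimes> X i)" if "i < n" for i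
      using cl that Tr_comm[of "gi \<otimes> (c2 \<otimes> (g \<otimes> X i))" "b \<otimes> b2"] by (simp add: wb_mult eps_bb m_assoc)
    have "(\<Sum>i<n. eps (bb b1 c1 \<otimes>\<^bsub>W\<^esub> bb (Y i) c) * eps (bb b (g \<otimes> X i) \<otimes>\<^bsub>W\<^esub> bb b2 c2))
        = (\<Sum>i<n. Tr (b \<otimes> b2 \<otimes> gi \<otimes> c2 \<otimes> g \<otimes> X i) * Tr (gi \<otimes> c \<otimes> c1 \<otimes> b1 \<otimes> Y i))"
      by (intro sum.cong) (auto simp: 1 2 mult.commute)
    also have "\<dots> = Tr (b \<otimes> b2 \<otimes> gi \<otimes> c2 \<otimes> g \<otimes> (gi \<otimes> c \<otimes> c1 \<otimes> b1))"
      using cl by (intro trace_pair) auto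
    also have "\<dots> = Tr (b \<otimes> (b2 \<otimes> (gi \<otimes> (c2 \<otimes> (c \<otimes> (c1 \<otimes> b1))))))"
      using cl by (simp add: m_assoc)
    also have "\<dots> = eps (bb b1 c1 \<otimes>\<^bsub>W\<^esub> bb b c \<otimes>\<^bsub>W\<^esub> bb b2 c2)"
      using cl Tr_comm[of "b \<otimes> b2" "gi \<otimes> (c2 \<otimes> (c \<otimes> (c1 \<otimes> b1)))"] by (simp add: wb_mult eps_bb m_assoc)
    finally show ?case by simp
  next
    case (add s t)
    then show ?case using b c by (simp add: W.r_distr eps_add distrib_left sum.distrib)
  qed
next
  case (add s t)
  then show ?case using b c h by (simp add: W.l_distr eps_add distrib_right sum.distrib)
qed

lemma eps_weak_mult:
  assumes "f \<in> carrier W" "k \<in> carrier W" "h \<in> carrier W"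
  shows "eps (f \<otimes>\<^bsub>W\<^esub> k \<otimes>\<^bsub>W\<^esub> h)
      = tensor_lift class_ring W W (class_ring :: 'k ring) (\<lambda>k1 k2. eps (f \<otimes>\<^bsub>W\<^esub> k1) * eps (k2 \<otimes>\<^bsub>W\<^esub> h)) (D k)"
    and "eps (f \<otimes>\<^bsub>W\<^esub> k \<otimes>\<^bsub>W\<^esub> h)
      = tensor_lift class_ring W W (class_ring :: 'k ring) (\<lambda>k1 k2. eps (f \<otimes>\<^bsub>W\<^esub> k2) * eps (k1 \<otimes>\<^bsub>W\<^esub> h)) (D k)"
proof -
  have b1: "balanced class_ring W W (class_ring :: 'k ring) (\<lambda>k1 k2. eps (f \<otimes>\<^bsub>W\<^esub> k1) * eps (k2 \<otimes>\<^bsub>W\<^esub> h))"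
    by (rule balancedI) (use assms in \<open>simp_all add: W.l_distr W.r_distr eps_add eps_smult algebra_simps\<close>)
  have b2: "balanced class_ring W W (class_ring :: 'k ring) (\<lambda>k1 k2. eps (f \<otimes>\<^bsub>W\<^esub> k2) * eps (k1 \<otimes>\<^bsub>W\<^esub> h))"
    by (rule balancedI) (use assms in \<open>simp_all add: W.l_distr W.r_distr eps_add eps_smult algebra_simps\<close>)
  show "eps (f \<otimes>\<^bsub>W\<^esub> k \<otimes>\<^bsub>W\<^esub> h)
      = tensor_lift class_ring W W (class_ring :: 'k ring) (\<lambda>k1 k2. eps (f \<otimes>\<^bsub>W\<^esub> k1) * eps (k2 \<otimes>\<^bsub>W\<^esub> h)) (D k)"
    using assms(2)
  proof (induction rule: wb_induct)
    case (pure b c)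
    show ?case
      unfolding D_bb[OF pure] delta_def using assms pure
      by (subst W.BB.lift_finsum[OF class_ring_abelian_group b1]) (auto simp: eps_mult_left class_ring_simps)
  next
    case (add s t)
    then show ?case using assms addmap_add[OF W.BB.lift_addmap[OF class_ring_abelian_group b1]]
      by (simp add: W.l_distr W.r_distr eps_add D_add)
  qed
  show "eps (f \<otimes>\<^bsub>W\<^esub> k \<otimes>\<^bsub>W\<^esub> h)
      = tensor_lift class_ring W W (class_ring :: 'k ring) (\<lambda>k1 k2. eps (f \<otimes>\<^bsub>W\<^esub> k2) * eps (k1 \<otimes>\<^bsub>W\<^esub> h)) (D k)"
    using assms(2)
  proof (induction rule: wb_induct)
    case (pure b c)
    show ?case
      unfolding D_bb[OF pure] delta_def using assms pure
      by (subst W.BB.lift_finsum[OF class_ring_abelian_group b2]) (auto simp: eps_mult_right class_ring_simps)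
  next
    case (add s t)
    then show ?case using assms addmap_add[OF W.BB.lift_addmap[OF class_ring_abelian_group b2]]
      by (simp add: W.l_distr W.r_distr eps_add D_add)
  qed
qed

subsection \<open>Antipode axioms\<close>

lemma idS_balanced: "balanced class_ring W W W (\<lambda>h1 h2. h1 \<otimes>\<^bsub>W\<^esub> S h2)"
  by (rule balancedI) (simp_all add: W.l_distr W.r_distr S_add klin_smult[OF S_klin])

lemma Sid_balanced: "balanced class_ring W W W (\<lambda>h1 h2. S h1 \<otimes>\<^bsub>W\<^esub> h2)"
  by (rule balancedI) (simp_all add: W.l_distr W.r_distr S_add klin_smult[OF S_klin])

lemma idS_bb:
  assumes "b \<in> carrier B" "c \<in> carrier B"
  shows "tensor_lift class_ring W W W (\<lambda>h1 h2. h1 \<otimes>\<^bsub>W\<^esub> S h2) (D (bb b c)) = bb (b \<otimes> gi \<otimes> c \<otimes> g) \<one>"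
proof -
  have "tensor_lift class_ring W W W (\<lambda>h1 h2. h1 \<otimes>\<^bsub>W\<^esub> S h2) (D (bb b c))
     = (\<Oplus>\<^bsub>W\<^esub>i<n. bb b (g \<otimes> X i) \<otimes>\<^bsub>W\<^esub> S (bb (Y i) c))"
    unfolding D_bb[OF assms] delta_def using assms by (intro W.BB.lift_finsum[OF W.grp idS_balanced]) auto
  also have "\<dots> = (\<Oplus>\<^bsub>W\<^esub>i<n. bb (b \<otimes> gi \<otimes> c \<otimes> g) (Y i \<otimes> (g \<otimes> X i)))"
    using assms by (intro W.sum_cong) (auto simp: S_bb wb_mult m_assoc)
  also have "\<dots> = bb (b \<otimes> gi \<otimes> c \<otimes> g) (\<Oplus>i<n. Y i \<otimes> (g \<otimes> X i))"
    by (rule wb_finsum_right[symmetric]) (use assms in auto)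
  finally show ?thesis using g_avg' by simp
qed

lemma Sid_bb:
  assumes "b \<in> carrier B" "c \<in> carrier B"
  shows "tensor_lift class_ring W W W (\<lambda>h1 h2. S h1 \<otimes>\<^bsub>W\<^esub> h2) (D (bb b c)) = bb \<one> (c \<otimes> b)"
proof -
  have "tensor_lift class_ring W W W (\<lambda>h1 h2. S h1 \<otimes>\<^bsub>W\<^esub> h2) (D (bb b c))
     = (\<Oplus>\<^bsub>W\<^esub>i<n. S (bb b (g \<otimes> X i)) \<otimes>\<^bsub>W\<^esub> bb (Y i) c)"
    unfolding D_bb[OF assms] delta_def using assms by (intro W.BB.lift_finsum[OF W.grp Sid_balanced]) auto
  also have "\<dots> = (\<Oplus>\<^bsub>W\<^esub>i<n. bb (X i \<otimes> (g \<otimes> Y i)) (c \<otimes> b))"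
    using assms by (intro W.sum_cong) (auto simp: S_bb wb_mult m_assoc)
  also have "\<dots> = bb (\<Oplus>i<n. X i \<otimes> (g \<otimes> Y i)) (c \<otimes> b)"
    by (rule wb_finsum_left[symmetric]) (use assms in auto)
  finally show ?thesis using g_avg by (simp add: avg_def)
qed

lemma delta_mult_right:
  assumes "h \<in> carrier W" "k \<in> carrier W"
  shows "D \<one>\<^bsub>W\<^esub> \<otimes>\<^bsub>WW\<^esub> tW h k = (\<Oplus>\<^bsub>WW\<^esub>i<n. tW (bb \<one> (g \<otimes> X i) \<otimes>\<^bsub>W\<^esub> h) (bb (Y i) \<one> \<otimes>\<^bsub>W\<^esub> k))"
proof -
  have "D \<one>\<^bsub>W\<^esub> \<otimes>\<^bsub>WW\<^esub> tW h k = (\<Oplus>\<^bsub>WW\<^esub>i<n. tW (bb \<one> (g \<otimes> X i)) (bb (Y i) \<one>) \<otimes>\<^bsub>WW\<^esub> tW h k)"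
    unfolding D_one delta_def by (rule WW.finsum_ldistr) (use assms in \<open>auto intro!: W.BB.tens_closed\<close>)
  also have "\<dots> = (\<Oplus>\<^bsub>WW\<^esub>i<n. tW (bb \<one> (g \<otimes> X i) \<otimes>\<^bsub>W\<^esub> h) (bb (Y i) \<one> \<otimes>\<^bsub>W\<^esub> k))"
    using assms by (intro WW.sum_cong) (auto simp: W.BB.tens_mult intro!: W.BB.tens_closed)
  finally show ?thesis .
qed

lemma delta_mult_left:
  assumes "h \<in> carrier W" "k \<in> carrier W"
  shows "tW h k \<otimes>\<^bsub>WW\<^esub> D \<one>\<^bsub>W\<^esub> = (\<Oplus>\<^bsub>WW\<^esub>i<n. tW (h \<otimes>\<^bsub>W\<^esub> bb \<one> (g \<otimes> X i)) (k \<otimes>\<^bsub>W\<^esub> bb (Y i) \<one>))"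
proof -
  have "tW h k \<otimes>\<^bsub>WW\<^esub> D \<one>\<^bsub>W\<^esub> = (\<Oplus>\<^bsub>WW\<^esub>i<n. tW h k \<otimes>\<^bsub>WW\<^esub> tW (bb \<one> (g \<otimes> X i)) (bb (Y i) \<one>))"
    unfolding D_one delta_def by (rule WW.finsum_rdistr) (use assms in \<open>auto intro!: W.BB.tens_closed\<close>)
  also have "\<dots> = (\<Oplus>\<^bsub>WW\<^esub>i<n. tW (h \<otimes>\<^bsub>W\<^esub> bb \<one> (g \<otimes> X i)) (k \<otimes>\<^bsub>W\<^esub> bb (Y i) \<one>))"
    using assms by (intro WW.sum_cong) (auto simp: W.BB.tens_mult intro!: W.BB.tens_closed)
  finally show ?thesis .
qed

lemma target_axiom:
  assumes "h \<in> carrier W"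
  shows "tensor_lift class_ring W W W (\<lambda>h1 h2. h1 \<otimes>\<^bsub>W\<^esub> S h2) (D h)
       = tensor_lift class_ring W W W (\<lambda>x y. eps x \<odot>\<^bsub>W\<^esub> y) (D \<one>\<^bsub>W\<^esub> \<otimes>\<^bsub>WW\<^esub> tW h \<one>\<^bsub>W\<^esub>)"
  using assms
proof (induction rule: wb_induct)
  case (pure b c)
  have "tensor_lift class_ring W W W (\<lambda>x y. eps x \<odot>\<^bsub>W\<^esub> y) (D \<one>\<^bsub>W\<^esub> \<otimes>\<^bsub>WW\<^esub> tW (bb b c) \<one>\<^bsub>W\<^esub>)
    = (\<Oplus>\<^bsub>W\<^esub>i<n. eps (bb \<one> (g \<otimes> X i) \<otimes>\<^bsub>W\<^esub> bb b c) \<odot>\<^bsub>W\<^esub> (bb (Y i) \<one> \<otimes>\<^bsub>W\<^esub> \<one>\<^bsub>W\<^esub>))"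
    using pure by (subst delta_mult_right) (auto intro!: W.BB.lift_finsum[OF W.grp slice1_balanced])
  also have "\<dots> = (\<Oplus>\<^bsub>W\<^esub>i<n. Tr (b \<otimes> gi \<otimes> c \<otimes> g \<otimes> X i) \<odot>\<^bsub>W\<^esub> bb (Y i) \<one>)"
  proof (rule W.sum_cong)
    fix i assume i: "i \<in> {..<n}"
    have "eps (bb \<one> (g \<otimes> X i) \<otimes>\<^bsub>W\<^esub> bb b c) = Tr (b \<otimes> gi \<otimes> c \<otimes> g \<otimes> X i)"
      using i pure Tr_comm[of "gi \<otimes> (c \<otimes> (g \<otimes> X i))" b] by (simp add: wb_mult eps_bb m_assoc)
    then show "eps (bb \<one> (g \<otimes> X i) \<otimes>\<^bsub>W\<^esub> bb b c) \<odot>\<^bsub>W\<^esub> (bb (Y i) \<one> \<otimes>\<^bsub>W\<^esub> \<one>\<^bsub>W\<^esub>)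
      = Tr (b \<otimes> gi \<otimes> c \<otimes> g \<otimes> X i) \<odot>\<^bsub>W\<^esub> bb (Y i) \<one>" using i by simp
  qed (use pure in auto)
  also have "\<dots> = bb (b \<otimes> gi \<otimes> c \<otimes> g) \<one>" by (rule slice1_delta) (use pure in auto)
  finally show ?case using idS_bb[OF pure] by simp
next
  case (add s t)
  then show ?case
    by (simp add: D_add W.BB.tens_add_left WW.r_distr W.BB.tens_closed
        addmap_add[OF W.BB.lift_addmap[OF W.grp slice1_balanced]] addmap_add[OF W.BB.lift_addmap[OF W.grp idS_balanced]])
qed

lemma source_axiom:
  assumes "h \<in> carrier W"
  shows "tensor_lift class_ring W W W (\<lambda>h1 h2. S h1 \<otimes>\<^bsub>W\<^esub> h2) (D h)
       = tensor_lift class_ring W W W (\<lambda>x y. eps y \<odot>\<^bsub>W\<^esub> x) (tW \<one>\<^bsub>W\<^esub> h \<otimes>\<^bsub>WW\<^esub> D \<one>\<^bsub>W\<^esub>)"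
  using assms
proof (induction rule: wb_induct)
  case (pure b c)
  have "tensor_lift class_ring W W W (\<lambda>x y. eps y \<odot>\<^bsub>W\<^esub> x) (tW \<one>\<^bsub>W\<^esub> (bb b c) \<otimes>\<^bsub>WW\<^esub> D \<one>\<^bsub>W\<^esub>)
    = (\<Oplus>\<^bsub>W\<^esub>i<n. eps (bb b c \<otimes>\<^bsub>W\<^esub> bb (Y i) \<one>) \<odot>\<^bsub>W\<^esub> (\<one>\<^bsub>W\<^esub> \<otimes>\<^bsub>W\<^esub> bb \<one> (g \<otimes> X i)))"
    using pure by (subst delta_mult_left) (auto intro!: W.BB.lift_finsum[OF W.grp slice2_balanced])
  also have "\<dots> = (\<Oplus>\<^bsub>W\<^esub>i<n. Tr (gi \<otimes> c \<otimes> b \<otimes> Y i) \<odot>\<^bsub>W\<^esub> bb \<one> (g \<otimes> X i))"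
    using pure by (intro W.sum_cong) (auto simp: wb_mult eps_Y)
  also have "\<dots> = bb \<one> (g \<otimes> (gi \<otimes> c \<otimes> b))" by (rule slice2_delta) (use pure in auto)
  also have "\<dots> = bb \<one> (c \<otimes> b)" using pure by (simp add: m_assoc)
  finally show ?case using Sid_bb[OF pure] by simp
next
  case (add s t)
  then show ?case
    by (simp add: D_add W.BB.tens_add_right WW.l_distr W.BB.tens_closed
        addmap_add[OF W.BB.lift_addmap[OF W.grp slice2_balanced]] addmap_add[OF W.BB.lift_addmap[OF W.grp Sid_balanced]])
qed

lemma antipode_axiom:
  assumes "h \<in> carrier W"
  shows "S h = tensor_lift class_ring WW W W
      (\<lambda>t h3. tensor_lift class_ring W W W (\<lambda>h1 h2. S h1 \<otimes>\<^bsub>W\<^esub> h2) t \<otimes>\<^bsub>W\<^esub> S h3) (Did (D h))"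
proof -
  let ?m = "tensor_lift class_ring W W W (\<lambda>h1 h2. S h1 \<otimes>\<^bsub>W\<^esub> h2)"
  have m: "klin WW W ?m"
    by (rule lift_klin[OF W.ks W.ks W.ks Sid_balanced])
      (simp add: klin_smult[OF S_klin])
  have bal: "balanced class_ring WW W W (\<lambda>t h3. ?m t \<otimes>\<^bsub>W\<^esub> S h3)"
    by (rule balancedI)
      (simp_all add: klin_closed[OF m] klin_add[OF m] klin_smult[OF m] W.l_distr W.r_distr S_add klin_smult[OF S_klin])
  show ?thesis
    using assms
  proof (induction rule: wb_induct)
    case (pure b c)
    have "tensor_lift class_ring WW W W (\<lambda>t h3. ?m t \<otimes>\<^bsub>W\<^esub> S h3) (Did (D (bb b c)))
        = (\<Oplus>\<^bsub>W\<^esub>i<n. ?m (delta b (g \<otimes> X i)) \<otimes>\<^bsub>W\<^esub> S (bb (Y i) c))"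
      unfolding D_bb[OF pure] Did_delta[OF pure]
      using pure by (intro W3'.lift_finsum[OF W.grp bal]) (auto intro!: delta_closed)
    also have "\<dots> = (\<Oplus>\<^bsub>W\<^esub>i<n. bb (gi \<otimes> c \<otimes> g) ((Y i \<otimes> (g \<otimes> X i)) \<otimes> b))"
      using pure Sid_bb[of b] by (intro W.sum_cong) (auto simp: S_bb wb_mult m_assoc D_bb)
    also have "\<dots> = bb (gi \<otimes> c \<otimes> g) (\<Oplus>i<n. (Y i \<otimes> (g \<otimes> X i)) \<otimes> b)"
      by (rule wb_finsum_right[symmetric]) (use pure in auto)
    also have "(\<Oplus>i<n. (Y i \<otimes> (g \<otimes> X i)) \<otimes> b) = (\<Oplus>i<n. Y i \<otimes> (g \<otimes> X i)) \<otimes> b"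
      by (rule finsum_ldistr[symmetric]) (use pure in auto)
    finally show ?case using g_avg' pure by (simp add: S_bb)
  next
    case (add s t)
    then show ?case
      using addmap_add[OF W3'.lift_addmap[OF W.grp bal]]
      by (simp add: D_add S_add klin_add[OF Did_klin] klin_closed[OF Did_klin])
  qed
qed

lemma W_weak_hopf: "weak_hopf_algebra W"
  unfolding weak_hopf_algebra_def Let_def id_def
  using W.k_algebra_B W_coalgebra S_klin D_mult D_unit eps_weak_mult target_axiom source_axiom antipode_axiom
  by (simp add: klin_module_hom)

subsection \<open>Minimality\<close>

text \<open>For a weak Hopf subalgebra \<open>U\<close> the element \<open>\<Delta>(1)\<close> lies in the span of \<open>U \<otimes>
  U\<close>. Applying \<open>\<epsilon>(b \<cdot>)\<close> to the first leg returns the left copy of \<open>b\<close>, and applying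
  \<open>\<epsilon>(\<cdot> c)\<close> to the second returns the right copy of \<open>c\<close>.\<close>

lemma W_minimal: "minimal_weak_hopf_algebra W"
  unfolding minimal_weak_hopf_algebra_def
proof (intro conjI allI impI W_weak_hopf)
  fix U assume U: "weak_hopf_subalgebra U W"
  then have Usub: "subalgebra U W" by (simp add: weak_hopf_subalgebra_def)
  then have sr: "subring U W" by (simp add: subalgebra_def)
  note sub = subringE[OF sr]
  have Um: "submodule class_ring U W" by (rule W.subalgebra_submodule[OF Usub])
  have UW: "x \<in> carrier W" if "x \<in> U" for x using sub(1) that by blast
  let ?T = "{tW x y | x y. x \<in> U \<and> y \<in> U}"
  have TW: "?T \<subseteq> carrier WW" using UW by (auto intro!: W.BB.tens_closed)
  have D1: "D \<one>\<^bsub>W\<^esub> \<in> LinearCombinations.module.span class_ring WW ?T"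
    using U sub(3) by (simp add: weak_hopf_subalgebra_def)
  have left: "bb b \<one> \<in> U" if b: "b \<in> carrier B" for b
  proof -
    let ?\<beta> = "\<lambda>x y. eps (bb b \<one> \<otimes>\<^bsub>W\<^esub> x) \<odot>\<^bsub>W\<^esub> y"
    have bal: "balanced class_ring W W W ?\<beta>"
      by (rule balancedI) (use b in \<open>simp_all add: W.r_distr eps_add eps_smult W.smult_distr mult.commute\<close>)
    have kl: "klin WW W (tensor_lift class_ring W W W ?\<beta>)"
      by (rule lift_klin[OF W.ks W.ks W.ks bal])
        (use b in \<open>simp add: eps_smult W.smult_distr\<close>)
    have "tensor_lift class_ring W W W ?\<beta> (D \<one>\<^bsub>W\<^esub>) \<in> U"
      by (rule klin_span[OF WW.ks W.ks kl TW Um _ D1])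
        (use UW b Usub in \<open>auto simp: W.BB.lift_tens[OF W.grp bal] subalgebra_def\<close>)
    also have "tensor_lift class_ring W W W ?\<beta> (D \<one>\<^bsub>W\<^esub>)
        = (\<Oplus>\<^bsub>W\<^esub>i<n. eps (bb b \<one> \<otimes>\<^bsub>W\<^esub> bb \<one> (g \<otimes> X i)) \<odot>\<^bsub>W\<^esub> bb (Y i) \<one>)"
      unfolding D_one delta_def by (rule W.BB.lift_finsum[OF W.grp bal]) auto
    also have "\<dots> = (\<Oplus>\<^bsub>W\<^esub>i<n. Tr (b \<otimes> X i) \<odot>\<^bsub>W\<^esub> bb (Y i) \<one>)"
      using b by (intro W.sum_cong) (auto simp: wb_mult eps_gX)
    also have "\<dots> = bb b \<one>" by (rule slice1_delta) (use b in auto)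
    finally show ?thesis .
  qed
  have right: "bb \<one> c \<in> U" if c: "c \<in> carrier B" for c
  proof -
    let ?\<beta> = "\<lambda>x y. eps (y \<otimes>\<^bsub>W\<^esub> bb \<one> c) \<odot>\<^bsub>W\<^esub> x"
    have bal: "balanced class_ring W W W ?\<beta>"
      by (rule balancedI) (use c in \<open>simp_all add: W.l_distr eps_add eps_smult W.smult_distr mult.commute\<close>)
    have kl: "klin WW W (tensor_lift class_ring W W W ?\<beta>)"
      by (rule lift_klin[OF W.ks W.ks W.ks bal])
        (use c in \<open>simp add: W.smult_distr mult.commute\<close>)
    have "tensor_lift class_ring W W W ?\<beta> (D \<one>\<^bsub>W\<^esub>) \<in> U"
      by (rule klin_span[OF WW.ks W.ks kl TW Um _ D1])
        (use UW c Usub in \<open>auto simp: W.BB.lift_tens[OF W.grp bal] subalgebra_def\<close>)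
    also have "tensor_lift class_ring W W W ?\<beta> (D \<one>\<^bsub>W\<^esub>)
        = (\<Oplus>\<^bsub>W\<^esub>i<n. eps (bb (Y i) \<one> \<otimes>\<^bsub>W\<^esub> bb \<one> c) \<odot>\<^bsub>W\<^esub> bb \<one> (g \<otimes> X i))"
      unfolding D_one delta_def by (rule W.BB.lift_finsum[OF W.grp bal]) auto
    also have "\<dots> = (\<Oplus>\<^bsub>W\<^esub>i<n. Tr (gi \<otimes> c \<otimes> Y i) \<odot>\<^bsub>W\<^esub> bb \<one> (g \<otimes> X i))"
      using c by (intro W.sum_cong) (auto simp: wb_mult eps_bb)
    also have "\<dots> = bb \<one> (g \<otimes> (gi \<otimes> c))" by (rule slice2_delta) (use c in auto)
    finally show ?thesis using c by simp
  qed
  have "h \<in> U" if "h \<in> carrier W" for h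
    using that
  proof (induction rule: wb_induct)
    case (pure b c)
    then have "bb b c = bb b \<one> \<otimes>\<^bsub>W\<^esub> bb \<one> c" by (simp add: wb_mult)
    then show ?case using left right pure sub(6) by simp
  next
    case (add s t)
    then show ?case using sub(7) by simp
  qed
  then show "U = carrier W" using sub(1) by blast
qed

end

text \<open>Every admissible triple provides the data of \<open>hmin\<close>; algebraic closedness enters only through the trace condition.\<close>

lemma admissible_triple_hmin:
  fixes B :: "('k::{alg_closed_field,field_char_0}, 'b) module"
  assumes "admissible_triple B A g"
  obtains n X Y where "hmin B n X Y A g"
proof -
  interpret ssalg B
    using assms unfolding admissible_triple_def
    by unfold_locales auto
  obtain n :: nat and X Y where "(\<forall>i<n. X i \<in> carrier B \<and> Y i \<in> carrier B) \<and>
     frame B {..<n} X (\<lambda>i x. Tr (x \<otimes>\<^bsub>B\<^esub> Y i))"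
    using dual_frame_exists by blast
  then interpret casimir B n X Y by unfold_locales auto
  interpret central_sub B A
    using assms unfolding admissible_triple_def by unfold_locales auto
  have g: "g \<in> Units B" using assms by (simp add: admissible_triple_def)
  then have gc: "g \<in> carrier B" by auto
  have "avg g = \<one>\<^bsub>B\<^esub>"
    by (rule trace_imp_avg_one[OF casimir_axioms gc]) (use assms in \<open>auto simp: admissible_triple_def\<close>)
  then have "hmin B n X Y A g" using g by unfold_locales auto
  then show ?thesis by (rule that)
qed

section \<open>Isomorphisms\<close>

lemma algebra_homD:
  assumes "f \<in> algebra_hom B C"
  shows "x \<in> carrier B ==> f x \<in> carrier C"
    "x \<in> carrier B ==> y \<in> carrier B ==> f (x \<otimes>\<^bsub>B\<^esub> y) = f x \<otimes>\<^bsub>C\<^esub> f y"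
    "x \<in> carrier B ==> y \<in> carrier B ==> f (x \<oplus>\<^bsub>B\<^esub> y) = f x \<oplus>\<^bsub>C\<^esub> f y"
    "f \<one>\<^bsub>B\<^esub> = \<one>\<^bsub>C\<^esub>"
    "x \<in> carrier B ==> f (c \<odot>\<^bsub>B\<^esub> x) = c \<odot>\<^bsub>C\<^esub> f x"
  using assms by (auto simp: algebra_hom_def Ring.ring_hom_def)

lemma algebra_homI:
  assumes "\<And>x. x \<in> carrier B ==> f x \<in> carrier C"
    "\<And>x y. x \<in> carrier B ==> y \<in> carrier B ==> f (x \<otimes>\<^bsub>B\<^esub> y) = f x \<otimes>\<^bsub>C\<^esub> f y"
    "\<And>x y. x \<in> carrier B ==> y \<in> carrier B ==> f (x \<oplus>\<^bsub>B\<^esub> y) = f x \<oplus>\<^bsub>C\<^esub> f y"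
    "f \<one>\<^bsub>B\<^esub> = \<one>\<^bsub>C\<^esub>"
    "\<And>c x. x \<in> carrier B ==> f (c \<odot>\<^bsub>B\<^esub> x) = c \<odot>\<^bsub>C\<^esub> f x"
  shows "f \<in> algebra_hom B C"
  using assms by (auto simp: algebra_hom_def Ring.ring_hom_def)

lemma algebra_hom_klin: "f \<in> algebra_hom B C ==> klin B C f"
  by (rule klinI) (simp_all add: algebra_homD)

lemma algebra_iso_inverse:
  assumes "kalg B" "f \<in> algebra_hom B C" "bij_betw f (carrier B) (carrier C)"
  shows "inv_into (carrier B) f \<in> algebra_hom C B"
    and "bij_betw (inv_into (carrier B) f) (carrier C) (carrier B)"
    and "x \<in> carrier B ==> inv_into (carrier B) f (f x) = x"
    and "y \<in> carrier C ==> f (inv_into (carrier B) f y) = y"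
proof -
  interpret kalg B by fact
  note hom = algebra_homD[OF assms(2)]
  show b: "bij_betw (inv_into (carrier B) f) (carrier C) (carrier B)"
    by (rule bij_betw_inv_into[OF assms(3)])
  have l: "inv_into (carrier B) f (f x) = x" if "x \<in> carrier B" for x
    using bij_betw_inv_into_left[OF assms(3) that] .
  have r: "f (inv_into (carrier B) f y) = y" if "y \<in> carrier C" for y
    using bij_betw_inv_into_right[OF assms(3) that] .
  have c: "inv_into (carrier B) f y \<in> carrier B" if "y \<in> carrier C" for y
    using bij_betwE[OF b] that by blast
  have eq: "inv_into (carrier B) f y = x" if "x \<in> carrier B" "f x = y" for x y
    using l that by blast
  show "inv_into (carrier B) f \<in> algebra_hom C B"
    by (rule algebra_homI) (auto intro!: eq c simp: hom c r)
  show "x \<in> carrier B ==> inv_into (carrier B) f (f x) = x" by (rule l)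
  show "y \<in> carrier C ==> f (inv_into (carrier B) f y) = y" by (rule r)
qed

lemma weak_hopf_isomorphic_inverse:
  assumes "kalg L" "kalg H" "klin L (L \<otimes>\<^sub>k L) (comult L)" "klin H (H \<otimes>\<^sub>k H) (comult H)"
    and S: "\<And>x. x \<in> carrier L ==> antipode L x \<in> carrier L"
    and f: "f \<in> weak_hopf_hom L H" "bij_betw f (carrier L) (carrier H)"
  shows "weak_hopf_isomorphic H L"
proof -
  interpret L: kalg L by fact
  interpret H: kalg H by fact
  let ?g = "inv_into (carrier L) f"
  have fa: "f \<in> algebra_hom L H" using f(1) by (simp add: weak_hopf_hom_def)
  note inv = algebra_iso_inverse[OF assms(1) fa f(2)]
  note fk = algebra_hom_klin[OF fa]
  note gk = algebra_hom_klin[OF inv(1)]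
  note ff = tensor_map_klin[OF L.ks L.ks H.ks H.ks fk fk]
    tensor_map_tens[OF L.ks L.ks H.ks H.ks fk fk]
  note gg = tensor_map_klin[OF H.ks H.ks L.ks L.ks gk gk]
    tensor_map_tens[OF H.ks H.ks L.ks L.ks gk gk]
  have id: "tensor_map class_ring H H L L ?g ?g (tensor_map class_ring L L H H f f t) = t"
    if "t \<in> carrier (L \<otimes>\<^sub>k L)" for t
    using that
  proof (induction rule: L.BB.tensor_induct)
    case (pure x y)
    then show ?case by (simp add: ff(2) gg(2) algebra_homD(1)[OF fa] inv(3))
  next
    case (add s t)
    then show ?case by (simp add: klin_add[OF ff(1)] klin_add[OF gg(1)] klin_closed[OF ff(1)])
  qed
  have "?g \<in> weak_hopf_hom H L"
    unfolding weak_hopf_hom_def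
  proof (intro CollectI conjI ballI inv(1))
    fix h assume h: "h \<in> carrier H"
    define l where "l = ?g h"
    have l: "l \<in> carrier L" "f l = h" using h inv(4) algebra_homD(1)[OF inv(1)] by (auto simp: l_def)
    have Dl: "comult L l \<in> carrier (L \<otimes>\<^sub>k L)" using klin_closed[OF assms(3) l(1)] .
    have ax: "comult H (f l) = tensor_map class_ring L L H H f f (comult L l)"
      "counit H (f l) = counit L l" "antipode H (f l) = f (antipode L l)"
      using f(1) l(1) by (auto simp: weak_hopf_hom_def)
    show "comult L (?g h) = tensor_map class_ring H H L L ?g ?g (comult H h)"
      using ax(1) id[OF Dl] l by (simp add: l_def)
    show "counit L (?g h) = counit H h" using ax(2) l by (simp add: l_def)
    show "antipode L (?g h) = ?g (antipode H h)" using ax(3) l S[OF l(1)] inv(3) by (simp add: l_def)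
  qed
  then show ?thesis using inv(2) by (auto simp: weak_hopf_isomorphic_def)
qed

subsection \<open>Isomorphic algebras have the same trace form\<close>

locale algebra_iso_pair = C: casimir B n X Y + C': casimir B' n' X' Y'
  for B :: "('k::field_char_0, 'b) module" (structure) and n X Y
    and B' :: "('k, 'c) module" and n' X' Y' +
  fixes \<tau>
  assumes iso: "\<tau> \<in> algebra_iso B B'"
begin

lemma \<tau>: "\<tau> \<in> algebra_hom B B'" "bij_betw \<tau> (carrier B) (carrier B')"
  using iso by (auto simp: algebra_iso_def)

abbreviation "\<sigma> \<equiv> inv_into (carrier B) \<tau>"

lemmas \<tau>_hom [simp] = algebra_homD[OF \<tau>(1)]
lemmas \<sigma>_hom [simp] = algebra_homD[OF algebra_iso_inverse(1)[OF C.kalg_axioms \<tau>]]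
lemmas \<sigma>\<tau> [simp] = algebra_iso_inverse(3)[OF C.kalg_axioms \<tau>]
lemmas \<tau>\<sigma> [simp] = algebra_iso_inverse(4)[OF C.kalg_axioms \<tau>]

lemma iso_inverse: "\<sigma> \<in> algebra_iso B' B"
  using algebra_iso_inverse(1,2)[OF C.kalg_axioms \<tau>] by (simp add: algebra_iso_def)

lemma frame_transport:
  assumes F: "frame B I b co"
  shows "frame B' I (\<lambda>i. \<tau> (b i)) (\<lambda>i y. co i (\<sigma> y))"
  unfolding frame_def
proof (intro conjI ballI)
  fix y assume y: "y \<in> carrier B'"
  have b: "i \<in> I ==> b i \<in> carrier B" for i using F by (simp add: frame_def)
  have "\<sigma> y = (\<Oplus>i\<in>I. co i (\<sigma> y) \<odot> b i)" using F y by (simp add: frame_def)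
  then have "y = \<tau> (\<Oplus>i\<in>I. co i (\<sigma> y) \<odot> b i)" using y by (metis \<tau>\<sigma>)
  also have "\<dots> = (\<Oplus>\<^bsub>B'\<^esub>i\<in>I. \<tau> (co i (\<sigma> y) \<odot> b i))"
    by (rule klin_finsum[OF C.ks C'.ks algebra_hom_klin[OF \<tau>(1)]]) (use b in simp)
  also have "\<dots> = (\<Oplus>\<^bsub>B'\<^esub>i\<in>I. co i (\<sigma> y) \<odot>\<^bsub>B'\<^esub> \<tau> (b i))"
    using b by (intro C'.sum_cong) auto
  finally show "y = (\<Oplus>\<^bsub>B'\<^esub>i\<in>I. co i (\<sigma> y) \<odot>\<^bsub>B'\<^esub> \<tau> (b i))" .
next
  fix i assume "i \<in> I"
  then have "linfun B (co i)" using F by (simp add: frame_def)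
  then show "linfun B' (\<lambda>y. co i (\<sigma> y))" by (simp add: linfun_def)
qed (use F in \<open>auto simp: frame_def\<close>)

lemma trace_transport:
  assumes x: "x \<in> carrier B"
  shows "reg_trace B' (\<tau> x) = reg_trace B x"
proof -
  have "reg_trace B' (\<tau> x) = (\<Sum>i\<in>{..<n}. reg_trace B (\<sigma> (\<tau> x \<otimes>\<^bsub>B'\<^esub> \<tau> (X i)) \<otimes> Y i))"
    using C'.Tr_frame[OF frame_transport[OF C.XY]] x by simp
  also have "\<dots> = (\<Sum>i\<in>{..<n}. reg_trace B (x \<otimes> X i \<otimes> Y i))"
    using x by (intro sum.cong) auto
  also have "\<dots> = reg_trace B x" using C.Tr_frame[OF C.XY x] by simp
  finally show ?thesis .
qed

lemma casimir_transport: "casimir B' n (\<lambda>i. \<tau> (X i)) (\<lambda>i. \<tau> (Y i))"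
proof -
  have "frame B' {..<n} (\<lambda>i. \<tau> (X i)) (\<lambda>i x. reg_trace B' (x \<otimes>\<^bsub>B'\<^esub> \<tau> (Y i)))"
    unfolding frame_def
  proof (intro conjI ballI)
    fix y assume y: "y \<in> carrier B'"
    have "y = (\<Oplus>\<^bsub>B'\<^esub>i<n. reg_trace B (\<sigma> y \<otimes> Y i) \<odot>\<^bsub>B'\<^esub> \<tau> (X i))"
      using frame_transport[OF C.XY] y by (simp add: frame_def)
    also have "\<dots> = (\<Oplus>\<^bsub>B'\<^esub>i<n. reg_trace B' (y \<otimes>\<^bsub>B'\<^esub> \<tau> (Y i)) \<odot>\<^bsub>B'\<^esub> \<tau> (X i))"
    proof (rule C'.sum_cong)
      fix i assume i: "i \<in> {..<n}"
      have "reg_trace B (\<sigma> y \<otimes> Y i) = reg_trace B' (\<tau> (\<sigma> y \<otimes> Y i))"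
        using y i by (intro trace_transport[symmetric]) auto
      also have "\<dots> = reg_trace B' (y \<otimes>\<^bsub>B'\<^esub> \<tau> (Y i))" using y i by simp
      finally show "reg_trace B (\<sigma> y \<otimes> Y i) \<odot>\<^bsub>B'\<^esub> \<tau> (X i)
        = reg_trace B' (y \<otimes>\<^bsub>B'\<^esub> \<tau> (Y i)) \<odot>\<^bsub>B'\<^esub> \<tau> (X i)" by simp
    qed auto
    finally show "y = (\<Oplus>\<^bsub>B'\<^esub>i<n. reg_trace B' (y \<otimes>\<^bsub>B'\<^esub> \<tau> (Y i)) \<odot>\<^bsub>B'\<^esub> \<tau> (X i))" .
  next
    fix i assume "i \<in> {..<n}"
    then show "linfun B' (\<lambda>x. reg_trace B' (x \<otimes>\<^bsub>B'\<^esub> \<tau> (Y i)))"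
      by (simp add: linfun_def C'.l_distr C'.Tr_add C'.Tr_smult)
  qed auto
  then show ?thesis by unfold_locales auto
qed

text \<open>Both families are dual bases for the trace form, so they have the same Casimir element.\<close>

lemma casimir_sum_transport:
  assumes "abelian_group P" "balanced class_ring B' B' P \<beta>"
  shows "(\<Oplus>\<^bsub>P\<^esub>i<n'. \<beta> (X' i) (Y' i)) = (\<Oplus>\<^bsub>P\<^esub>i<n. \<beta> (\<tau> (X i)) (\<tau> (Y i)))"
proof -
  interpret T: casimir B' n "\<lambda>i. \<tau> (X i)" "\<lambda>i. \<tau> (Y i)" by (rule casimir_transport)
  have "T.casimir_elt = C'.casimir_elt"
    by (rule C'.two_sided_separability_unique[OF T.casimir_separability])
  then show ?thesis using T.casimir_lift[OF assms] C'.casimir_lift[OF assms] by simp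
qed

end

subsection \<open>Isomorphic triples give isomorphic weak Hopf algebras\<close>

locale hmin_pair = H: hmin B n X Y A g + H': hmin B' n' X' Y' A' g'
  for B :: "('k::field_char_0, 'b) module" (structure) and n X Y A g
    and B' :: "('k, 'c) module" and n' X' Y' A' g'

locale triple_iso = hmin_pair + algebra_iso_pair +
  assumes \<tau>A: "\<tau> ` A = A'" and \<tau>g: "\<tau> g = g'"
begin

lemma triple_iso_inverse: "triple_iso B' n' X' Y' A' g' B n X Y A g \<sigma>"
proof -
  have "\<sigma> ` A' = A"
  proof -
    have "\<sigma> ` \<tau> ` A = (\<lambda>x. x) ` A" unfolding image_image by (intro image_cong) auto
    then show ?thesis using \<tau>A by simp
  qed
  moreover have "\<sigma> g' = g" using \<tau>g by auto
  ultimately show ?thesis using iso_inverse by unfold_locales auto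
qed

lemma \<tau>gi: "\<tau> H.gi = H'.gi"
proof -
  have "\<tau> H.gi \<otimes>\<^bsub>B'\<^esub> g' = \<one>\<^bsub>B'\<^esub>"
    using \<tau>_hom(2)[of H.gi g] \<tau>g by simp
  moreover have "\<tau> H.gi \<otimes>\<^bsub>B'\<^esub> g' \<otimes>\<^bsub>B'\<^esub> H'.gi = \<tau> H.gi" by (simp add: H'.m_assoc)
  ultimately show ?thesis by simp
qed

definition F where "F = bbar_lift B A H'.W (\<lambda>b c. H'.bb (\<tau> b) (\<tau> c))"

lemma F_addmap: "addmap H.W H'.W F"
  and F_bb: "b \<in> carrier B ==> c \<in> carrier B ==> F (H.bb b c) = H'.bb (\<tau> b) (\<tau> c)"
proof -
  have bal: "H'.bb (\<tau> b \<otimes>\<^bsub>B'\<^esub> \<tau> a) (\<tau> c) = H'.bb (\<tau> b) (\<tau> a \<otimes>\<^bsub>B'\<^esub> \<tau> c)"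
    if "a \<in> A" "b \<in> carrier B" "c \<in> carrier B" for a b c
    using that \<tau>A by (intro H'.bb_balanced) auto
  note L = H.bbar_lift_addmap[where P = H'.W and \<beta> = "\<lambda>b c. H'.bb (\<tau> b) (\<tau> c)", OF H'.W.grp]
    H.bbar_lift_bb[where P = H'.W and \<beta> = "\<lambda>b c. H'.bb (\<tau> b) (\<tau> c)", OF H'.W.grp]
  have "addmap H.HA H'.W F"
    unfolding F_def by (rule L(1)) (simp_all add: bal H'.wb_rules)
  then show "addmap H.W H'.W F" by (simp add: addmap_def H.W_simps(1,5))
  show "b \<in> carrier B ==> c \<in> carrier B ==> F (H.bb b c) = H'.bb (\<tau> b) (\<tau> c)"
    unfolding F_def by (subst L(2)) (simp_all add: bal H'.wb_rules)
qed

lemmas F_closed [simp] = addmap_closed[OF F_addmap]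
lemmas F_add = addmap_add[OF F_addmap]

lemma F_smult: "h \<in> carrier H.W ==> F (k \<odot>\<^bsub>H.W\<^esub> h) = k \<odot>\<^bsub>H'.W\<^esub> F h"
proof (induction rule: H.wb_induct)
  case (pure b c)
  then have "F (k \<odot>\<^bsub>H.W\<^esub> H.bb b c) = F (H.bb (k \<odot> b) c)" by (simp add: H.wb_smult_left)
  also have "\<dots> = k \<odot>\<^bsub>H'.W\<^esub> F (H.bb b c)" using pure by (simp add: F_bb H'.wb_smult_left)
  finally show ?case .
next
  case (add s t)
  then show ?case by (simp add: H.W.smult_distr H'.W.smult_distr F_add)
qed

lemma F_algebra_hom: "F \<in> algebra_hom H.W H'.W"
proof (rule algebra_homI)
  show "F (h \<otimes>\<^bsub>H.W\<^esub> k) = F h \<otimes>\<^bsub>H'.W\<^esub> F k" if "h \<in> carrier H.W" "k \<in> carrier H.W" for h k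
    using that
  proof (induction rule: H.wb_induct)
    case (pure b c)
    from pure(3,1,2) show ?case
    proof (induction rule: H.wb_induct)
      case (pure b' c')
      then show ?case by (simp add: H.wb_mult H'.wb_mult F_bb)
    next
      case (add s t)
      then show ?case by (simp add: H.W.r_distr H'.W.r_distr F_add)
    qed
  next
    case (add s t)
    then show ?case by (simp add: H.W.l_distr H'.W.l_distr F_add)
  qed
  show "F \<one>\<^bsub>H.W\<^esub> = \<one>\<^bsub>H'.W\<^esub>" by (simp add: H.wb_one H'.wb_one F_bb)
qed (simp_all add: F_add F_smult)

lemmas F_klin = algebra_hom_klin[OF F_algebra_hom]
lemmas FF_klin = tensor_map_klin[OF H.W.ks H.W.ks H'.W.ks H'.W.ks F_klin F_klin]
lemmas FF_tens = tensor_map_tens[OF H.W.ks H.W.ks H'.W.ks H'.W.ks F_klin F_klin]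

lemma F_comult:
  assumes "h \<in> carrier H.W"
  shows "H'.D (F h) = tensor_map class_ring H.W H.W H'.W H'.W F F (H.D h)"
  using assms
proof (induction rule: H.wb_induct)
  case (pure b c)
  have "tensor_map class_ring H.W H.W H'.W H'.W F F (H.D (H.bb b c))
     = (\<Oplus>\<^bsub>H'.WW\<^esub>i<n. tensor_map class_ring H.W H.W H'.W H'.W F F (H.tW (H.bb b (g \<otimes> X i)) (H.bb (Y i) c)))"
    unfolding H.D_bb[OF pure] H.delta_def
    by (rule klin_finsum[OF H.WW.ks H'.WW.ks FF_klin])
      (use pure in \<open>auto intro!: H.W.BB.tens_closed\<close>)
  also have "\<dots> = (\<Oplus>\<^bsub>H'.WW\<^esub>i<n. H'.tW (H'.bb (\<tau> b) (g' \<otimes>\<^bsub>B'\<^esub> \<tau> (X i))) (H'.bb (\<tau> (Y i)) (\<tau> c)))"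
    using pure by (intro H'.WW.sum_cong) (auto simp: FF_tens F_bb \<tau>g intro!: H'.W.BB.tens_closed)
  also have "\<dots> = (\<Oplus>\<^bsub>H'.WW\<^esub>i<n'. H'.tW (H'.bb (\<tau> b) (g' \<otimes>\<^bsub>B'\<^esub> X' i)) (H'.bb (Y' i) (\<tau> c)))"
    using pure by (intro casimir_sum_transport[OF H'.WW.grp H'.delta_balanced, symmetric]) auto
  also have "\<dots> = H'.D (F (H.bb b c))" using pure by (simp add: F_bb H'.D_bb H'.delta_def)
  finally show ?case by simp
next
  case (add s t)
  then show ?case by (simp add: F_add H.D_add H'.D_add klin_add[OF FF_klin])
qed

lemma F_counit: "h \<in> carrier H.W ==> H'.eps (F h) = H.eps h"
proof (induction rule: H.wb_induct)
  case (pure b c)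
  have "H'.eps (F (H.bb b c)) = reg_trace B' (\<tau> (H.gi \<otimes> c \<otimes> b))"
    using pure by (simp add: F_bb H'.eps_bb \<tau>gi)
  also have "\<dots> = H.eps (H.bb b c)" using pure by (subst trace_transport) (auto simp: H.eps_bb)
  finally show ?case .
next
  case (add s t)
  then show ?case by (simp add: F_add H.eps_add H'.eps_add)
qed

lemma F_antipode: "h \<in> carrier H.W ==> H'.S (F h) = F (H.S h)"
proof (induction rule: H.wb_induct)
  case (pure b c)
  then show ?case by (simp add: F_bb H.S_bb H'.S_bb \<tau>gi \<tau>g)
next
  case (add s t)
  then show ?case by (simp add: F_add H.S_add H'.S_add)
qed

lemma F_weak_hopf_hom: "F \<in> weak_hopf_hom H.W H'.W"
  unfolding weak_hopf_hom_def using F_algebra_hom F_comult F_counit F_antipode by simp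

lemma F_isomorphic: "weak_hopf_isomorphic H.W H'.W"
proof -
  interpret I: triple_iso B' n' X' Y' A' g' B n X Y A g \<sigma> by (rule triple_iso_inverse)
  have 1: "I.F (F h) = h" if "h \<in> carrier H.W" for h
    using that by (induction rule: H.wb_induct) (simp_all add: F_bb I.F_bb F_add I.F_add)
  have 2: "F (I.F h) = h" if "h \<in> carrier H'.W" for h
    using that by (induction rule: H'.wb_induct) (simp_all add: F_bb I.F_bb F_add I.F_add)
  have "bij_betw F (carrier H.W) (carrier H'.W)"
    by (rule bij_betw_byWitness[where f' = I.F]) (auto simp: 1 2)
  then show ?thesis using F_weak_hopf_hom by (auto simp: weak_hopf_isomorphic_def)
qed

end

subsection \<open>The triple can be recovered from the weak Hopf algebra\<close>

text \<open>Multiplying the legs after applying the conditional expectation to the first one sends \<open>b \<otimes> 1\<close> to \<open>E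
  b\<close> and \<open>1 \<otimes> b\<close> to \<open>b\<close>.\<close>

lemma (in hmin) A_characterization:
  assumes b: "b \<in> carrier B" and eq: "bb b \<one> = bb \<one> b"
  shows "b \<in> A"
proof -
  obtain E where E: "\<forall>b\<in>carrier B. E b \<in> A" "E \<one> = \<one>"
     "\<forall>b\<in>carrier B. \<forall>b'\<in>carrier B. E (b \<oplus> b') = E b \<oplus> E b'"
     "\<forall>b\<in>carrier B. \<forall>a\<in>A. E (b \<otimes> a) = E b \<otimes> a"
    using conditional_expectation[OF A AZ] by blast
  have L: "bbar_lift B A B (\<lambda>b c. E b \<otimes> c) (bb x y) = E x \<otimes> y"
    if "x \<in> carrier B" "y \<in> carrier B" for x y
    using that E by (subst bbar_lift_bb) (auto simp: grp l_distr r_distr m_assoc)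
  have "E b \<otimes> \<one> = E \<one> \<otimes> b" using L[OF b one_closed] L[OF one_closed b] eq by simp
  then have "E b = b" using b E by simp
  then show ?thesis using E(1) b by metis
qed

locale weak_hopf_iso_pair = hmin_pair +
  fixes f
  assumes f: "f \<in> weak_hopf_hom (Hmin B A g) (Hmin B' A' g')"
    and f_bij: "bij_betw f (carrier (Hmin B A g)) (carrier (Hmin B' A' g'))"
begin

lemma f_alg: "f \<in> algebra_hom H.W H'.W" using f by (simp add: weak_hopf_hom_def)

lemmas f_hom [simp] = algebra_homD[OF f_alg]
lemmas f_klin = algebra_hom_klin[OF f_alg]
lemmas ff_klin = tensor_map_klin[OF H.W.ks H.W.ks H'.W.ks H'.W.ks f_klin f_klin]
lemmas ff_tens = tensor_map_tens[OF H.W.ks H.W.ks H'.W.ks H'.W.ks f_klin f_klin]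

lemma f_struct:
  assumes "h \<in> carrier H.W"
  shows "H'.D (f h) = tensor_map class_ring H.W H.W H'.W H'.W f f (H.D h)"
    "H'.eps (f h) = H.eps h" "H'.S (f h) = f (H.S h)"
  using f assms by (auto simp: weak_hopf_hom_def)

lemma f_inj: "x \<in> carrier H.W ==> y \<in> carrier H.W ==> f x = f y ==> x = y"
  using f_bij by (auto simp: bij_betw_def inj_on_def)

text \<open>The target counital map, written through the antipode so that it is visibly preserved by morphisms.\<close>

definition "tgt h = tensor_lift class_ring H.W H.W H.W (\<lambda>h1 h2. h1 \<otimes>\<^bsub>H.W\<^esub> H.S h2) (H.D h)"
definition "tgt' h = tensor_lift class_ring H'.W H'.W H'.W (\<lambda>h1 h2. h1 \<otimes>\<^bsub>H'.W\<^esub> H'.S h2) (H'.D h)"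

lemma tgt_range: "h \<in> carrier H.W ==> \<exists>b\<in>carrier B. tgt h = H.bb b \<one>"
proof (induction rule: H.wb_induct)
  case (pure b c)
  then show ?case unfolding tgt_def by (subst H.idS_bb) auto
next
  case (add s t)
  then obtain b b' where "b \<in> carrier B" "b' \<in> carrier B" "tgt s = H.bb b \<one>" "tgt t = H.bb b' \<one>" by blast
  then have "tgt (s \<oplus>\<^bsub>H.W\<^esub> t) = H.bb (b \<oplus> b') \<one>"
    using add(1,2) addmap_add[OF H.W.BB.lift_addmap[OF H.W.grp H.idS_balanced]]
    by (simp add: tgt_def H.D_add H.wb_add_left)
  then show ?case using \<open>b \<in> carrier B\<close> \<open>b' \<in> carrier B\<close> by blast
qed

lemma tgt'_range: "h \<in> carrier H'.W ==> \<exists>b\<in>carrier B'. tgt' h = H'.bb b \<one>\<^bsub>B'\<^esub>"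
proof (induction rule: H'.wb_induct)
  case (pure b c)
  then show ?case unfolding tgt'_def by (subst H'.idS_bb) auto
next
  case (add s t)
  then obtain b b' where "b \<in> carrier B'" "b' \<in> carrier B'" "tgt' s = H'.bb b \<one>\<^bsub>B'\<^esub>" "tgt' t = H'.bb b' \<one>\<^bsub>B'\<^esub>" by blast
  then have "tgt' (s \<oplus>\<^bsub>H'.W\<^esub> t) = H'.bb (b \<oplus>\<^bsub>B'\<^esub> b') \<one>\<^bsub>B'\<^esub>"
    using add(1,2) addmap_add[OF H'.W.BB.lift_addmap[OF H'.W.grp H'.idS_balanced]]
    by (simp add: tgt'_def H'.D_add H'.wb_add_left)
  then show ?case using \<open>b \<in> carrier B'\<close> \<open>b' \<in> carrier B'\<close> by blast
qed

lemma tgt_bb: "b \<in> carrier B ==> tgt (H.bb b \<one>) = H.bb b \<one>"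
  unfolding tgt_def by (subst H.idS_bb) (auto simp: H.m_assoc)

lemma tgt'_bb: "b \<in> carrier B' ==> tgt' (H'.bb b \<one>\<^bsub>B'\<^esub>) = H'.bb b \<one>\<^bsub>B'\<^esub>"
  unfolding tgt'_def by (subst H'.idS_bb) (auto simp: H'.m_assoc)

lemma f_tgt:
  assumes h: "h \<in> carrier H.W"
  shows "tgt' (f h) = f (tgt h)"
proof -
  note l = H.W.BB.lift_addmap[OF H.W.grp H.idS_balanced]
  note l' = H'.W.BB.lift_addmap[OF H'.W.grp H'.idS_balanced]
  have "tensor_lift class_ring H'.W H'.W H'.W (\<lambda>h1 h2. h1 \<otimes>\<^bsub>H'.W\<^esub> H'.S h2)
      (tensor_map class_ring H.W H.W H'.W H'.W f f t)
    = f (tensor_lift class_ring H.W H.W H.W (\<lambda>h1 h2. h1 \<otimes>\<^bsub>H.W\<^esub> H.S h2) t)" if "t \<in> carrier H.WW" for t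
    using that
  proof (induction rule: H.W.BB.tensor_induct)
    case (pure x y)
    then show ?case
      by (simp add: ff_tens H.W.BB.lift_tens[OF H.W.grp H.idS_balanced] f_struct(3)
          H'.W.BB.lift_tens[OF H'.W.grp H'.idS_balanced])
  next
    case (add s t)
    then show ?case
      by (simp add: klin_add[OF ff_klin] klin_closed[OF ff_klin] addmap_add[OF l] addmap_add[OF l'] addmap_closed[OF l])
  qed
  then show ?thesis using h by (simp add: tgt_def tgt'_def f_struct(1))
qed

definition "\<tau> b = (SOME b'. b' \<in> carrier B' \<and> f (H.bb b \<one>) = H'.bb b' \<one>\<^bsub>B'\<^esub>)"

lemma \<tau>_prop:
  assumes "b \<in> carrier B"
  shows "\<tau> b \<in> carrier B'" "f (H.bb b \<one>) = H'.bb (\<tau> b) \<one>\<^bsub>B'\<^esub>"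
proof -
  have "f (H.bb b \<one>) = tgt' (f (H.bb b \<one>))" using assms by (simp add: f_tgt tgt_bb)
  moreover have "f (H.bb b \<one>) \<in> carrier H'.W" using assms by simp
  ultimately have "\<exists>b'. b' \<in> carrier B' \<and> f (H.bb b \<one>) = H'.bb b' \<one>\<^bsub>B'\<^esub>" using tgt'_range by metis
  from someI_ex[OF this] show "\<tau> b \<in> carrier B'" "f (H.bb b \<one>) = H'.bb (\<tau> b) \<one>\<^bsub>B'\<^esub>"
    by (simp_all add: \<tau>_def)
qed

lemma \<tau>_eqI:
  assumes "b \<in> carrier B" "b' \<in> carrier B'" "f (H.bb b \<one>) = H'.bb b' \<one>\<^bsub>B'\<^esub>"
  shows "\<tau> b = b'"
  using \<tau>_prop[OF assms(1)] assms H'.bb_left_injective by metis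

lemma \<tau>_alg: "\<tau> \<in> algebra_hom B B'"
proof (rule algebra_homI)
  fix x y assume xy: "x \<in> carrier B" "y \<in> carrier B"
  note p = \<tau>_prop[OF xy(1)] \<tau>_prop[OF xy(2)]
  have "H.bb (x \<otimes> y) \<one> = H.bb x \<one> \<otimes>\<^bsub>H.W\<^esub> H.bb y \<one>" using xy by (simp add: H.wb_mult)
  then show "\<tau> (x \<otimes> y) = \<tau> x \<otimes>\<^bsub>B'\<^esub> \<tau> y" using xy p by (intro \<tau>_eqI) (simp_all add: H'.wb_mult)
  show "\<tau> (x \<oplus> y) = \<tau> x \<oplus>\<^bsub>B'\<^esub> \<tau> y" using xy p by (intro \<tau>_eqI) (simp_all add: H.wb_add_left H'.wb_add_left)
next
  show "\<tau> \<one> = \<one>\<^bsub>B'\<^esub>" using f_hom(4) by (intro \<tau>_eqI) (simp_all add: H.wb_one H'.wb_one)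
next
  fix c x assume x: "x \<in> carrier B"
  show "\<tau> (c \<odot> x) = c \<odot>\<^bsub>B'\<^esub> \<tau> x"
    using x \<tau>_prop[OF x] by (intro \<tau>_eqI) (simp_all add: H.wb_smult_left H'.wb_smult_left)
qed (rule \<tau>_prop)

lemma \<tau>_iso: "\<tau> \<in> algebra_iso B B'"
proof -
  have "inj_on \<tau> (carrier B)"
  proof (rule inj_onI)
    fix x y assume xy: "x \<in> carrier B" "y \<in> carrier B" "\<tau> x = \<tau> y"
    then have "f (H.bb x \<one>) = f (H.bb y \<one>)" by (simp add: \<tau>_prop)
    then have "H.bb x \<one> = H.bb y \<one>" using xy by (intro f_inj) auto
    then show "x = y" using H.bb_left_injective xy by blast
  qed
  moreover have "\<tau> ` carrier B = carrier B'"
  proof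
    show "\<tau> ` carrier B \<subseteq> carrier B'" using \<tau>_prop(1) by auto
    show "carrier B' \<subseteq> \<tau> ` carrier B"
    proof
      fix b' assume b': "b' \<in> carrier B'"
      then have "H'.bb b' \<one>\<^bsub>B'\<^esub> \<in> f ` carrier H.W" using f_bij by (simp add: bij_betw_def)
      then obtain h where h: "h \<in> carrier H.W" "f h = H'.bb b' \<one>\<^bsub>B'\<^esub>" by auto
      obtain b where b: "b \<in> carrier B" "tgt h = H.bb b \<one>" using tgt_range[OF h(1)] by blast
      have "f (tgt h) = f h" using f_tgt[OF h(1)] h(2) tgt'_bb[OF b'] by simp
      then have "\<tau> b = b'" using b b' h(2) by (intro \<tau>_eqI) simp_all
      then show "b' \<in> \<tau> ` carrier B" using b by blast
    qed
  qed
  ultimately show ?thesis using \<tau>_alg by (simp add: algebra_iso_def bij_betw_def)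
qed

lemma f_right:
  assumes c: "c \<in> carrier B"
  shows "f (H.bb \<one> c) = H'.bb \<one>\<^bsub>B'\<^esub> (\<tau> c)"
proof -
  have "H.bb \<one> c = H.S (H.bb c \<one>)" using c by (simp add: H.S_bb)
  then have "f (H.bb \<one> c) = H'.S (f (H.bb c \<one>))" using c by (simp add: f_struct(3))
  then show ?thesis using c \<tau>_prop[OF c] by (simp add: H'.S_bb)
qed

text \<open>The relation that the left and right copies of \<open>b\<close> agree is preserved by \<open>f\<close>.\<close>

lemma \<tau>_subalgebra: "\<tau> ` A = A'"
proof (intro equalityI subsetI)
  fix x assume "x \<in> \<tau> ` A"
  then obtain a where a: "a \<in> A" "x = \<tau> a" by blast
  have "H.bb a \<one> = H.bb \<one> a" using H.bb_balanced[of a \<one> \<one>] a by simp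
  then have "H'.bb (\<tau> a) \<one>\<^bsub>B'\<^esub> = H'.bb \<one>\<^bsub>B'\<^esub> (\<tau> a)" using \<tau>_prop(2)[of a] f_right[of a] a(1) by simp
  then show "x \<in> A'" using H'.A_characterization[of "\<tau> a"] \<tau>_prop(1)[of a] a by simp
next
  fix a' assume a': "a' \<in> A'"
  then have "a' \<in> carrier B'" by simp
  then have "a' \<in> \<tau> ` carrier B" using \<tau>_iso by (simp add: algebra_iso_def bij_betw_def)
  then obtain b where b: "b \<in> carrier B" "\<tau> b = a'" by auto
  have "H'.bb a' \<one>\<^bsub>B'\<^esub> = H'.bb \<one>\<^bsub>B'\<^esub> a'" using H'.bb_balanced[of a' "\<one>\<^bsub>B'\<^esub>" "\<one>\<^bsub>B'\<^esub>"] a' by simp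
  then have "f (H.bb b \<one>) = f (H.bb \<one> b)" using b \<tau>_prop(2)[OF b(1)] f_right[OF b(1)] by simp
  then have "H.bb b \<one> = H.bb \<one> b" using b(1) by (intro f_inj) auto
  then show "a' \<in> \<tau> ` A" using H.A_characterization[OF b(1)] b(2) by blast
qed

text \<open>Both counits are trace forms twisted by \<open>g\<^sup>-\<^sup>1\<close> and \<open>g'\<^sup>-\<^sup>1\<close>; as
  \<open>\<tau>\<close> preserves the traces, nondegeneracy gives \<open>\<tau>(g)\<^sup>-\<^sup>1 = g'\<^sup>-\<^sup>1\<close>.\<close>

lemma \<tau>_g: "\<tau> g = g'"
proof -
  interpret I: algebra_iso_pair B n X Y B' n' X' Y' \<tau> using \<tau>_iso by unfold_locales
  have "H'.gi = \<tau> H.gi"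
  proof (rule H'.Tr_eqI)
    fix z assume z: "z \<in> carrier B'"
    let ?y = "inv_into (carrier B) \<tau> z"
    have y: "?y \<in> carrier B" "\<tau> ?y = z" using z by auto
    have "reg_trace B' (H'.gi \<otimes>\<^bsub>B'\<^esub> z) = H'.eps (H'.bb z \<one>\<^bsub>B'\<^esub>)" using z by (simp add: H'.eps_bb)
    also have "\<dots> = H'.eps (f (H.bb ?y \<one>))" using \<tau>_prop(2)[OF y(1)] y(2) by simp
    also have "\<dots> = H.eps (H.bb ?y \<one>)" using y(1) by (intro f_struct(2)) simp
    also have "\<dots> = reg_trace B (H.gi \<otimes> ?y)" using y(1) by (simp add: H.eps_bb)
    also have "\<dots> = reg_trace B' (\<tau> (H.gi \<otimes> ?y))" using y(1) by (intro I.trace_transport[symmetric]) simp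
    also have "\<dots> = reg_trace B' (\<tau> H.gi \<otimes>\<^bsub>B'\<^esub> z)" using y by simp
    finally show "reg_trace B' (H'.gi \<otimes>\<^bsub>B'\<^esub> z) = reg_trace B' (\<tau> H.gi \<otimes>\<^bsub>B'\<^esub> z)" .
  qed simp_all
  then have "\<tau> g \<otimes>\<^bsub>B'\<^esub> H'.gi = \<one>\<^bsub>B'\<^esub>" using I.\<tau>_hom(2)[of g H.gi] by simp
  moreover have "\<tau> g \<otimes>\<^bsub>B'\<^esub> H'.gi \<otimes>\<^bsub>B'\<^esub> g' = \<tau> g" by (simp add: H'.m_assoc)
  ultimately show ?thesis by simp
qed

end

lemma Hmin_isomorphic_iff:
  assumes "hmin B n X Y A g" "hmin B' n' X' Y' A' g'"
  shows "weak_hopf_isomorphic (Hmin B A g) (Hmin B' A' g') \<longleftrightarrow>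
    (\<exists>\<tau>\<in>algebra_iso B B'. \<tau> ` A = A' \<and> \<tau> g = g')"
proof
  interpret H: hmin B n X Y A g by fact
  interpret H': hmin B' n' X' Y' A' g' by fact
  interpret P: hmin_pair B n X Y A g B' n' X' Y' A' g' ..
  {
    assume "weak_hopf_isomorphic (Hmin B A g) (Hmin B' A' g')"
    then obtain f where "f \<in> weak_hopf_hom (Hmin B A g) (Hmin B' A' g')"
      "bij_betw f (carrier (Hmin B A g)) (carrier (Hmin B' A' g'))"
      by (auto simp: weak_hopf_isomorphic_def)
    then interpret I: weak_hopf_iso_pair B n X Y A g B' n' X' Y' A' g' f by unfold_locales
    show "\<exists>\<tau>\<in>algebra_iso B B'. \<tau> ` A = A' \<and> \<tau> g = g'"
      using I.\<tau>_iso I.\<tau>_subalgebra I.\<tau>_g by blast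
  next
    assume "\<exists>\<tau>\<in>algebra_iso B B'. \<tau> ` A = A' \<and> \<tau> g = g'"
    then obtain \<tau> where "\<tau> \<in> algebra_iso B B'" "\<tau> ` A = A'" "\<tau> g = g'" by blast
    then interpret I: triple_iso B n X Y A g B' n' X' Y' A' g' \<tau> by unfold_locales
    show "weak_hopf_isomorphic (Hmin B A g) (Hmin B' A' g')" by (rule I.F_isomorphic)
  }
qed

lemma admissible_triple_Hmin:
  fixes B :: "('k::{alg_closed_field,field_char_0}, 'b) module"
  assumes "admissible_triple B A g"
  shows "(\<exists>!E. two_sided_separability_element B E) \<and>
          minimal_weak_hopf_algebra (Hmin B A g) \<and>
          (\<forall>E. two_sided_separability_element B E \<longrightarrow>
             (\<forall>b\<in>carrier B. \<forall>c\<in>carrier B.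
                comult (Hmin B A g) (bbar B A b c) = Hmin_delta B A g E b c \<and>
                counit (Hmin B A g) (bbar B A b c)
                  = reg_trace B (inv\<^bsub>B\<^esub> g \<otimes>\<^bsub>B\<^esub> c \<otimes>\<^bsub>B\<^esub> b) \<and>
                antipode (Hmin B A g) (bbar B A b c)
                  = bbar B A (inv\<^bsub>B\<^esub> g \<otimes>\<^bsub>B\<^esub> c \<otimes>\<^bsub>B\<^esub> g) b))"
proof -
  obtain n X Y where "hmin B n X Y A g" by (rule admissible_triple_hmin[OF assms])
  then interpret H: hmin B n X Y A g .
  show ?thesis
  proof (intro conjI allI impI ballI H.W_minimal)
    show "\<exists>!E. two_sided_separability_element B E"
      by (rule ex1I[of "two_sided_separability_element B", OF H.casimir_separability
            H.two_sided_separability_unique])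
    fix E b c assume E: "two_sided_separability_element B E" and bc: "b \<in> carrier B" "c \<in> carrier B"
    show "comult (Hmin B A g) (bbar B A b c) = Hmin_delta B A g E b c"
      using H.two_sided_separability_unique[OF E] H.D_bb[OF bc] H.Hmin_delta_eq[OF bc] by simp
    show "counit (Hmin B A g) (bbar B A b c) = reg_trace B (inv\<^bsub>B\<^esub> g \<otimes>\<^bsub>B\<^esub> c \<otimes>\<^bsub>B\<^esub> b)"
      by (rule H.eps_bb[OF bc])
    show "antipode (Hmin B A g) (bbar B A b c) = bbar B A (inv\<^bsub>B\<^esub> g \<otimes>\<^bsub>B\<^esub> c \<otimes>\<^bsub>B\<^esub> g) b"
      by (rule H.S_bb[OF bc])
  qed
qed

section \<open>The counital subalgebras of a weak Hopf algebra\<close>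

text \<open>The maps \<open>et\<close> and \<open>es\<close> are the target and source counital maps, \<open>sl1\<close> and
  \<open>sl2\<close> apply the counit to one leg, and \<open>m1\<close>, \<open>m2\<close> are the two convolutions \<open>id *
  S\<close> and \<open>S * id\<close>.\<close>

locale whopf =
  fixes H :: "('k::field, 'h) weak_hopf" (structure)
  assumes weak_hopf: "weak_hopf_algebra H"
begin

sublocale kalg H
  using weak_hopf by (simp add: weak_hopf_algebra_def Let_def kalg_def)

abbreviation "HH \<equiv> H \<otimes>\<^sub>k H"
abbreviation "HHH \<equiv> H \<otimes>\<^sub>k HH"
abbreviation "tH \<equiv> tens class_ring H H"
abbreviation "D \<equiv> comult H"
abbreviation "eps \<equiv> counit H"
abbreviation "S \<equiv> antipode H"

lemma HH_kalg: "kalg HH"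
  using BB.algebra_over_TA by (simp add: kalg_def k_algebra_iff)

sublocale HH: kalg HH by (rule HH_kalg)
sublocale H3: algebra_pair class_ring H HH
  by (rule algebra_pairI[OF k_algebra_B HH.k_algebra_B])
sublocale H3': algebra_pair class_ring HH H
  by (rule algebra_pairI[OF HH.k_algebra_B k_algebra_B])

abbreviation "t3 \<equiv> tens class_ring H HH"

lemma H3_kspace: "kspace HHH" and H3'_kspace: "kspace (HH \<otimes>\<^sub>k H)"
  by (rule kspace_tensor; rule ks HH.ks)+

lemmas H3_grp = kspace.grp[OF H3_kspace]
lemmas H3'_grp = kspace.grp[OF H3'_kspace]

abbreviation "Did \<equiv> tensor_map class_ring H H HH H D (\<lambda>x. x)"
abbreviation "idD \<equiv> tensor_map class_ring H H H HH (\<lambda>x. x) D"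
abbreviation "assocH \<equiv> tensor_assoc H H H"

lemmas wh = weak_hopf[unfolded weak_hopf_algebra_def coalgebra_def Let_def id_def]

lemma D_klin: "klin H HH D" using wh by (simp add: klin_module_hom)
lemma S_klin: "klin H H S" using wh by (simp add: klin_module_hom)
lemma eps_linfun: "linfun H eps" using wh by (simp add: linfun_def)

lemmas D_closed [simp] = klin_closed[OF D_klin]
lemmas S_closed [simp] = klin_closed[OF S_klin]
lemmas S_add = klin_add[OF S_klin]
lemmas S_smult = klin_smult[OF S_klin]
lemmas D_add = klin_add[OF D_klin]
lemmas eps_add = linfun_add[OF eps_linfun]
lemmas eps_smult = linfun_smult[OF eps_linfun]

lemma coassoc: "h \<in> carrier H ==> assocH (Did (D h)) = idD (D h)" using wh by simp

definition "sl1 = tensor_lift class_ring H H H (\<lambda>x y. eps x \<odot> y)"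
definition "sl2 = tensor_lift class_ring H H H (\<lambda>x y. eps y \<odot> x)"
definition "m1 = tensor_lift class_ring H H H (\<lambda>x y. x \<otimes> S y)"
definition "m2 = tensor_lift class_ring H H H (\<lambda>x y. S x \<otimes> y)"

lemma balanced_basic:
  "balanced class_ring H H H (\<lambda>x y. eps x \<odot> y)" "balanced class_ring H H H (\<lambda>x y. eps y \<odot> x)"
  "balanced class_ring H H H (\<lambda>x y. x \<otimes> S y)" "balanced class_ring H H H (\<lambda>x y. S x \<otimes> y)"
  by (rule balancedI; simp add: eps_add eps_smult smult_distr mult.commute l_distr r_distr S_add S_smult)+

lemma sl1_klin: "klin HH H sl1" and sl2_klin: "klin HH H sl2" and m1_klin: "klin HH H m1" and m2_klin: "klin HH H m2"
  unfolding sl1_def sl2_def m1_def m2_def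
  by (rule lift_klin[OF ks ks ks];
      simp add: balanced_basic eps_smult smult_distr S_smult mult.commute)+

lemma sl1_t: "x \<in> carrier H ==> y \<in> carrier H ==> sl1 (tH x y) = eps x \<odot> y"
  and sl2_t: "x \<in> carrier H ==> y \<in> carrier H ==> sl2 (tH x y) = eps y \<odot> x"
  and m1_t: "x \<in> carrier H ==> y \<in> carrier H ==> m1 (tH x y) = x \<otimes> S y"
  and m2_t: "x \<in> carrier H ==> y \<in> carrier H ==> m2 (tH x y) = S x \<otimes> y"
  unfolding sl1_def sl2_def m1_def m2_def
  by (rule BB.lift_tens[OF grp]; simp add: balanced_basic)+

lemma counit1: "h \<in> carrier H ==> sl1 (D h) = h" and counit2: "h \<in> carrier H ==> sl2 (D h) = h"
  using wh by (simp_all add: sl1_def sl2_def)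

lemma D_mult: "h \<in> carrier H ==> k \<in> carrier H ==> D (h \<otimes> k) = D h \<otimes>\<^bsub>HH\<^esub> D k"
  using wh by simp

abbreviation "D1 \<equiv> D \<one>"

lemma D1_unit [simp]:
  "h \<in> carrier H ==> D1 \<otimes>\<^bsub>HH\<^esub> D h = D h" "h \<in> carrier H ==> D h \<otimes>\<^bsub>HH\<^esub> D1 = D h"
  by (simp_all flip: D_mult)

lemma D_unit:
  "assocH (Did D1) = assocH (tens class_ring HH H D1 \<one>) \<otimes>\<^bsub>HHH\<^esub> t3 \<one> D1"
  "assocH (Did D1) = t3 \<one> D1 \<otimes>\<^bsub>HHH\<^esub> assocH (tens class_ring HH H D1 \<one>)"
proof -
  show "assocH (Did D1) = assocH (tens class_ring HH H D1 \<one>) \<otimes>\<^bsub>HHH\<^esub> t3 \<one> D1"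
    using wh by (elim conjE) assumption
  show "assocH (Did D1) = t3 \<one> D1 \<otimes>\<^bsub>HHH\<^esub> assocH (tens class_ring HH H D1 \<one>)"
    using wh by (elim conjE) assumption
qed

definition "et h = sl1 (D1 \<otimes>\<^bsub>HH\<^esub> tH h \<one>)"
definition "es h = sl2 (tH \<one> h \<otimes>\<^bsub>HH\<^esub> D1)"

lemma et_m1: "h \<in> carrier H ==> m1 (D h) = et h" and es_m2: "h \<in> carrier H ==> m2 (D h) = es h"
  using wh by (simp_all add: et_def es_def m1_def m2_def sl1_def sl2_def)

lemmas tH_closed [simp] = BB.tens_closed
lemmas tH_rules = BB.tens_add_left BB.tens_add_right BB.tens_smult_left BB.tens_smult_right

lemma et_klin: "klin H H et"
  by (rule klinI) (simp_all add: et_def klin_closed[OF sl1_klin] klin_add[OF sl1_klin] klin_smult[OF sl1_klin]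
      tH_rules HH.r_distr)

lemma es_klin: "klin H H es"
  by (rule klinI) (simp_all add: es_def klin_closed[OF sl2_klin] klin_add[OF sl2_klin] klin_smult[OF sl2_klin]
      tH_rules HH.l_distr)

lemmas et_closed [simp] = klin_closed[OF et_klin]
lemmas es_closed [simp] = klin_closed[OF es_klin]

definition "Ht = et ` carrier H"
definition "Hs = es ` carrier H"

lemma HtE: "z \<in> Ht ==> \<exists>h\<in>carrier H. z = et h" and HsE: "y \<in> Hs ==> \<exists>h\<in>carrier H. y = es h"
  by (auto simp: Ht_def Hs_def)

lemma Ht_closed [simp]: "z \<in> Ht ==> z \<in> carrier H" and Hs_closed [simp]: "y \<in> Hs ==> y \<in> carrier H"
  by (auto simp: Ht_def Hs_def)

lemma et_in [simp]: "h \<in> carrier H ==> et h \<in> Ht" and es_in [simp]: "h \<in> carrier H ==> es h \<in> Hs"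
  unfolding Ht_def Hs_def by (erule imageI)+

lemma eps_weak1_balanced:
  assumes "f \<in> carrier H" "h \<in> carrier H"
  shows "balanced class_ring H H (class_ring :: 'k ring) (\<lambda>x y. eps (f \<otimes> x) * eps (y \<otimes> h))"
    and "balanced class_ring H H (class_ring :: 'k ring) (\<lambda>x y. eps (f \<otimes> y) * eps (x \<otimes> h))"
  by (rule balancedI; use assms in \<open>simp add: l_distr r_distr eps_add eps_smult algebra_simps\<close>)+

lemma eps_weak:
  assumes "f \<in> carrier H" "h \<in> carrier H"
  shows "eps (f \<otimes> h) = tensor_lift class_ring H H (class_ring :: 'k ring) (\<lambda>x y. eps (f \<otimes> x) * eps (y \<otimes> h)) D1"
    and "eps (f \<otimes> h) = tensor_lift class_ring H H (class_ring :: 'k ring) (\<lambda>x y. eps (f \<otimes> y) * eps (x \<otimes> h)) D1"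
proof -
  have "\<forall>f\<in>carrier H. \<forall>g\<in>carrier H. \<forall>h\<in>carrier H.
      eps (f \<otimes> g \<otimes> h) = tensor_lift class_ring H H (class_ring :: 'k ring) (\<lambda>x y. eps (f \<otimes> x) * eps (y \<otimes> h)) (D g)
      \<and> eps (f \<otimes> g \<otimes> h) = tensor_lift class_ring H H (class_ring :: 'k ring) (\<lambda>x y. eps (f \<otimes> y) * eps (x \<otimes> h)) (D g)"
    using wh by (elim conjE) assumption
  then show "eps (f \<otimes> h) = tensor_lift class_ring H H (class_ring :: 'k ring) (\<lambda>x y. eps (f \<otimes> x) * eps (y \<otimes> h)) D1"
    and "eps (f \<otimes> h) = tensor_lift class_ring H H (class_ring :: 'k ring) (\<lambda>x y. eps (f \<otimes> y) * eps (x \<otimes> h)) D1"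
    using assms one_closed r_one by metis+
qed

lemma D_kfinsum: "(\<And>i. i \<in> I ==> a i \<in> carrier H) ==> D (\<Oplus>i\<in>I. a i) = (\<Oplus>\<^bsub>HH\<^esub>i\<in>I. D (a i))"
  by (rule klin_finsum[OF ks HH.ks D_klin])

lemmas Did_klin = tensor_map_klin[OF ks ks HH.ks ks D_klin klin_id]
lemmas Did_tens = tensor_map_tens[OF ks ks HH.ks ks D_klin klin_id]
lemmas idD_klin = tensor_map_klin[OF ks ks ks HH.ks klin_id D_klin]
lemmas idD_tens = tensor_map_tens[OF ks ks ks HH.ks klin_id D_klin]
lemmas assocH_klin = tensor_assoc_klin[OF ks ks ks]
lemmas assocH_tens = tensor_assoc_tens[OF ks ks ks]

text \<open>The last antipode axiom, with its first convolution \<open>S * id\<close> replaced by the source counital map.\<close>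

lemma antipode_es:
  assumes h: "h \<in> carrier H"
  shows "S h = tensor_lift class_ring H H H (\<lambda>x y. es x \<otimes> S y) (D h)"
proof -
  have b: "balanced class_ring H H H (\<lambda>x y. es x \<otimes> S y)"
    by (rule balancedI) (simp_all add: klin_add[OF es_klin] klin_smult[OF es_klin] l_distr r_distr S_add S_smult)
  have b': "balanced class_ring HH H H (\<lambda>t h3. m2 t \<otimes> S h3)"
    by (rule balancedI)
      (simp_all add: klin_closed[OF m2_klin] klin_add[OF m2_klin] klin_smult[OF m2_klin] l_distr r_distr S_add S_smult)
  have eq: "tensor_lift class_ring HH H H (\<lambda>t h3. m2 t \<otimes> S h3) (Did t)
      = tensor_lift class_ring H H H (\<lambda>x y. es x \<otimes> S y) t" if "t \<in> carrier HH" for t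
    using that
  proof (induction rule: BB.tensor_induct)
    case (pure x y)
    then show ?case by (simp add: Did_tens H3'.lift_tens[OF grp b'] BB.lift_tens[OF grp b] es_m2)
  next
    case (add s t)
    then show ?case
      by (simp add: klin_add[OF Did_klin] klin_closed[OF Did_klin] addmap_add[OF BB.lift_addmap[OF grp b]]
          addmap_add[OF H3'.lift_addmap[OF grp b']])
  qed
  have "\<forall>h\<in>carrier H. S h = tensor_lift class_ring HH H H (\<lambda>t h3. m2 t \<otimes> S h3) (Did (D h))"
    using wh by (simp add: m2_def)
  then show ?thesis using eq[of "D h"] h by simp
qed

end

text \<open>A presentation \<open>\<Sum> w \<otimes> z\<close> of \<open>\<Delta>(1)\<close>.\<close>

locale whopf_pres = whopf +
  fixes N :: nat and w z
  assumes w [simp]: "\<And>i. i < N ==> w i \<in> carrier H" and z [simp]: "\<And>i. i < N ==> z i \<in> carrier H"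
    and D1_pres: "comult H \<one> = (\<Oplus>\<^bsub>H \<otimes>\<^sub>k H\<^esub>i<N. tens class_ring H H (w i) (z i))"
begin

lemma D1_right: "h \<in> carrier H ==> k \<in> carrier H ==> D1 \<otimes>\<^bsub>HH\<^esub> tH h k = (\<Oplus>\<^bsub>HH\<^esub>i<N. tH (w i \<otimes> h) (z i \<otimes> k))"
proof -
  assume hk: "h \<in> carrier H" "k \<in> carrier H"
  have "D1 \<otimes>\<^bsub>HH\<^esub> tH h k = (\<Oplus>\<^bsub>HH\<^esub>i<N. tH (w i) (z i) \<otimes>\<^bsub>HH\<^esub> tH h k)"
    unfolding D1_pres by (rule HH.finsum_ldistr) (use hk in auto)
  also have "\<dots> = (\<Oplus>\<^bsub>HH\<^esub>i<N. tH (w i \<otimes> h) (z i \<otimes> k))"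
    using hk by (intro HH.sum_cong) (auto simp: BB.tens_mult)
  finally show ?thesis .
qed

lemma D1_left: "h \<in> carrier H ==> k \<in> carrier H ==> tH h k \<otimes>\<^bsub>HH\<^esub> D1 = (\<Oplus>\<^bsub>HH\<^esub>i<N. tH (h \<otimes> w i) (k \<otimes> z i))"
proof -
  assume hk: "h \<in> carrier H" "k \<in> carrier H"
  have "tH h k \<otimes>\<^bsub>HH\<^esub> D1 = (\<Oplus>\<^bsub>HH\<^esub>i<N. tH h k \<otimes>\<^bsub>HH\<^esub> tH (w i) (z i))"
    unfolding D1_pres by (rule HH.finsum_rdistr) (use hk in auto)
  also have "\<dots> = (\<Oplus>\<^bsub>HH\<^esub>i<N. tH (h \<otimes> w i) (k \<otimes> z i))"
    using hk by (intro HH.sum_cong) (auto simp: BB.tens_mult)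
  finally show ?thesis .
qed

lemma et_eq:
  assumes h: "h \<in> carrier H"
  shows "et h = (\<Oplus>i<N. eps (w i \<otimes> h) \<odot> z i)"
proof -
  have "et h = (\<Oplus>i<N. sl1 (tH (w i \<otimes> h) (z i \<otimes> \<one>)))"
    unfolding et_def D1_right[OF h one_closed]
    by (rule klin_finsum[OF HH.ks ks sl1_klin]) (use h in auto)
  also have "\<dots> = (\<Oplus>i<N. eps (w i \<otimes> h) \<odot> z i)"
    using h by (intro sum_cong) (auto simp: sl1_t)
  finally show ?thesis .
qed

lemma es_eq:
  assumes h: "h \<in> carrier H"
  shows "es h = (\<Oplus>i<N. eps (h \<otimes> z i) \<odot> w i)"
proof -
  have "es h = (\<Oplus>i<N. sl2 (tH (\<one> \<otimes> w i) (h \<otimes> z i)))"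
    unfolding es_def D1_left[OF one_closed h]
    by (rule klin_finsum[OF HH.ks ks sl2_klin]) (use h in auto)
  also have "\<dots> = (\<Oplus>i<N. eps (h \<otimes> z i) \<odot> w i)"
    using h by (intro sum_cong) (auto simp: sl2_t)
  finally show ?thesis .
qed

lemma eps1: "f \<in> carrier H ==> h \<in> carrier H ==> eps (f \<otimes> h) = (\<Sum>i<N. eps (f \<otimes> w i) * eps (z i \<otimes> h))"
  unfolding eps_weak(1)[of f h] D1_pres
  by (subst BB.lift_finsum[OF class_ring_abelian_group eps_weak1_balanced(1)]) (auto simp: class_ring_simps)

lemma eps2: "f \<in> carrier H ==> h \<in> carrier H ==> eps (f \<otimes> h) = (\<Sum>i<N. eps (f \<otimes> z i) * eps (w i \<otimes> h))"
  unfolding eps_weak(2)[of f h] D1_pres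
  by (subst BB.lift_finsum[OF class_ring_abelian_group eps_weak1_balanced(2)]) (auto simp: class_ring_simps)

lemma eps_sum: "(\<And>i. i \<in> I ==> a i \<in> carrier H) ==> eps (\<Oplus>i\<in>I. a i) = (\<Sum>i\<in>I. eps (a i))"
  by (rule linfun_finsum[OF grp eps_linfun])

text \<open>This is the second form of weak multiplicativity of the counit.\<close>

lemma eps_et [simp]: "f \<in> carrier H ==> h \<in> carrier H ==> eps (f \<otimes> et h) = eps (f \<otimes> h)"
proof -
  assume fh: "f \<in> carrier H" "h \<in> carrier H"
  have "f \<otimes> et h = (\<Oplus>i<N. f \<otimes> (eps (w i \<otimes> h) \<odot> z i))"
    unfolding et_eq[OF fh(2)] by (rule finsum_rdistr) (use fh in auto)
  then have "eps (f \<otimes> et h) = (\<Sum>i<N. eps (f \<otimes> (eps (w i \<otimes> h) \<odot> z i)))"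
    by (simp only:) (rule eps_sum, use fh in auto)
  also have "\<dots> = (\<Sum>i<N. eps (f \<otimes> z i) * eps (w i \<otimes> h))"
    using fh by (intro sum.cong) (auto simp: eps_smult)
  finally show ?thesis using eps2[OF fh] by simp
qed

lemma eps_es [simp]: "f \<in> carrier H ==> h \<in> carrier H ==> eps (es f \<otimes> h) = eps (f \<otimes> h)"
proof -
  assume fh: "f \<in> carrier H" "h \<in> carrier H"
  have "es f \<otimes> h = (\<Oplus>i<N. (eps (f \<otimes> z i) \<odot> w i) \<otimes> h)"
    unfolding es_eq[OF fh(1)] by (rule finsum_ldistr) (use fh in auto)
  then have "eps (es f \<otimes> h) = (\<Sum>i<N. eps ((eps (f \<otimes> z i) \<odot> w i) \<otimes> h))"
    by (simp only:) (rule eps_sum, use fh in auto)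
  also have "\<dots> = (\<Sum>i<N. eps (f \<otimes> z i) * eps (w i \<otimes> h))"
    using fh by (intro sum.cong) (auto simp: eps_smult)
  finally show ?thesis using eps2[OF fh] by simp
qed

lemma et_et [simp]: "f \<in> carrier H ==> h \<in> carrier H ==> et (f \<otimes> et h) = et (f \<otimes> h)"
proof -
  assume fh: "f \<in> carrier H" "h \<in> carrier H"
  have "eps (w i \<otimes> (f \<otimes> et h)) = eps (w i \<otimes> (f \<otimes> h))" if "i < N" for i
    using that fh by (simp flip: m_assoc)
  then show ?thesis using fh unfolding et_eq[OF m_closed[OF fh]] et_eq[OF m_closed[OF fh(1) et_closed[OF fh(2)]]]
    by (intro sum_cong) auto
qed

lemma es_es [simp]: "f \<in> carrier H ==> h \<in> carrier H ==> es (es f \<otimes> h) = es (f \<otimes> h)"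
proof -
  assume fh: "f \<in> carrier H" "h \<in> carrier H"
  have "eps (es f \<otimes> h \<otimes> z i) = eps (f \<otimes> h \<otimes> z i)" if "i < N" for i
    using that fh by (simp add: m_assoc)
  then show ?thesis using fh unfolding es_eq[OF m_closed[OF fh]] es_eq[OF m_closed[OF es_closed[OF fh(1)] fh(2)]]
    by (intro sum_cong) auto
qed

lemma et_Ht: "x \<in> Ht ==> et x = x"
proof -
  assume "x \<in> Ht"
  then obtain h where h: "h \<in> carrier H" "x = et h" using HtE by blast
  then show ?thesis using et_et[of \<one> h] by simp
qed

lemma es_Hs: "y \<in> Hs ==> es y = y"
proof -
  assume "y \<in> Hs"
  then obtain h where h: "h \<in> carrier H" "y = es h" using HsE by blast
  then show ?thesis using es_es[of h \<one>] by simp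
qed

lemma H3_sum_closed: "x \<in> carrier H ==> t \<in> carrier HH ==> t3 x t \<in> carrier HHH"
  by (rule H3.tens_closed)

lemma D1l_eq: "assocH (tens class_ring HH H D1 \<one>) = (\<Oplus>\<^bsub>HHH\<^esub>i<N. t3 (w i) (tH (z i) \<one>))"
proof -
  have "tens class_ring HH H D1 \<one> = (\<Oplus>\<^bsub>HH \<otimes>\<^sub>k H\<^esub>i<N. tens class_ring HH H (tH (w i) (z i)) \<one>)"
    unfolding D1_pres by (rule H3'.tens_finsum_left) auto
  then have "assocH (tens class_ring HH H D1 \<one>)
      = (\<Oplus>\<^bsub>HHH\<^esub>i<N. assocH (tens class_ring HH H (tH (w i) (z i)) \<one>))"
    by (simp only:, intro klin_finsum[OF H3'_kspace H3_kspace assocH_klin]) (auto intro!: H3'.tens_closed)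
  also have "\<dots> = (\<Oplus>\<^bsub>HHH\<^esub>i<N. t3 (w i) (tH (z i) \<one>))"
    by (intro finsum_cong_P[OF H3_grp]) (auto simp: assocH_tens intro!: H3_sum_closed)
  finally show ?thesis .
qed

lemma D1r_eq: "t3 \<one> D1 = (\<Oplus>\<^bsub>HHH\<^esub>j<N. t3 \<one> (tH (w j) (z j)))"
  unfolding D1_pres by (rule H3.tens_finsum_right) auto

lemma triple1:
  "assocH (Did D1) = (\<Oplus>\<^bsub>HHH\<^esub>i<N. \<Oplus>\<^bsub>HHH\<^esub>j<N. t3 (w i) (tH (z i \<otimes> w j) (z j)))"
proof -
  have "assocH (Did D1) = (\<Oplus>\<^bsub>HHH\<^esub>i<N. \<Oplus>\<^bsub>HHH\<^esub>j<N.
      t3 (w i) (tH (z i) \<one>) \<otimes>\<^bsub>HHH\<^esub> t3 \<one> (tH (w j) (z j)))"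
    unfolding D_unit(1) D1l_eq D1r_eq by (rule ring.sum_mult_sum[OF H3.ring]) (auto intro!: H3_sum_closed)
  also have "\<dots> = (\<Oplus>\<^bsub>HHH\<^esub>i<N. \<Oplus>\<^bsub>HHH\<^esub>j<N. t3 (w i) (tH (z i \<otimes> w j) (z j)))"
  proof (rule finsum_cong_P[OF H3_grp])
    fix i assume i: "i \<in> {..<N}"
    then show "(\<Oplus>\<^bsub>HHH\<^esub>j<N. t3 (w i) (tH (z i) \<one>) \<otimes>\<^bsub>HHH\<^esub> t3 \<one> (tH (w j) (z j)))
      = (\<Oplus>\<^bsub>HHH\<^esub>j<N. t3 (w i) (tH (z i \<otimes> w j) (z j)))"
      by (intro finsum_cong_P[OF H3_grp]) (auto simp: H3.tens_mult BB.tens_mult intro!: H3_sum_closed)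
  qed (auto intro!: finsum_closed_P[OF H3_grp] H3_sum_closed)
  finally show ?thesis .
qed

lemma triple2:
  "assocH (Did D1) = (\<Oplus>\<^bsub>HHH\<^esub>j<N. \<Oplus>\<^bsub>HHH\<^esub>i<N. t3 (w i) (tH (w j \<otimes> z i) (z j)))"
proof -
  have "assocH (Did D1) = (\<Oplus>\<^bsub>HHH\<^esub>j<N. \<Oplus>\<^bsub>HHH\<^esub>i<N.
      t3 \<one> (tH (w j) (z j)) \<otimes>\<^bsub>HHH\<^esub> t3 (w i) (tH (z i) \<one>))"
    unfolding D_unit(2) D1l_eq D1r_eq by (rule ring.sum_mult_sum[OF H3.ring]) (auto intro!: H3_sum_closed)
  also have "\<dots> = (\<Oplus>\<^bsub>HHH\<^esub>j<N. \<Oplus>\<^bsub>HHH\<^esub>i<N. t3 (w i) (tH (w j \<otimes> z i) (z j)))"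
  proof (rule finsum_cong_P[OF H3_grp])
    fix j assume j: "j \<in> {..<N}"
    then show "(\<Oplus>\<^bsub>HHH\<^esub>i<N. t3 \<one> (tH (w j) (z j)) \<otimes>\<^bsub>HHH\<^esub> t3 (w i) (tH (z i) \<one>))
      = (\<Oplus>\<^bsub>HHH\<^esub>i<N. t3 (w i) (tH (w j \<otimes> z i) (z j)))"
      by (intro finsum_cong_P[OF H3_grp]) (auto simp: H3.tens_mult BB.tens_mult intro!: H3_sum_closed)
  qed (auto intro!: finsum_closed_P[OF H3_grp] H3_sum_closed)
  finally show ?thesis .
qed

lemma triple0: "assocH (Did D1) = (\<Oplus>\<^bsub>HHH\<^esub>i<N. t3 (w i) (D (z i)))"
proof -
  have "assocH (Did D1) = (\<Oplus>\<^bsub>HHH\<^esub>i<N. idD (tH (w i) (z i)))"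
    unfolding coassoc[OF one_closed] unfolding D1_pres
    by (rule klin_finsum[OF HH.ks H3_kspace idD_klin]) auto
  also have "\<dots> = (\<Oplus>\<^bsub>HHH\<^esub>i<N. t3 (w i) (D (z i)))"
    by (intro finsum_cong_P[OF H3_grp]) (auto simp: idD_tens intro!: H3_sum_closed)
  finally show ?thesis .
qed

text \<open>Evaluating a linear map on the three presentations of \<open>\<Delta>\<^sup>2(1)\<close>.\<close>

lemma triple_apply:
  assumes "kspace P" "klin HHH P f"
  shows "f (assocH (Did D1)) = (\<Oplus>\<^bsub>P\<^esub>i<N. f (t3 (w i) (D (z i))))"
    and "f (assocH (Did D1)) = (\<Oplus>\<^bsub>P\<^esub>i<N. \<Oplus>\<^bsub>P\<^esub>j<N. f (t3 (w i) (tH (z i \<otimes> w j) (z j))))"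
    and "f (assocH (Did D1)) = (\<Oplus>\<^bsub>P\<^esub>j<N. \<Oplus>\<^bsub>P\<^esub>i<N. f (t3 (w i) (tH (w j \<otimes> z i) (z j))))"
proof -
  note kf = klin_finsum[OF H3_kspace assms]
  have dbl: "f (\<Oplus>\<^bsub>HHH\<^esub>i<N. \<Oplus>\<^bsub>HHH\<^esub>j<N. a i j) = (\<Oplus>\<^bsub>P\<^esub>i<N. \<Oplus>\<^bsub>P\<^esub>j<N. f (a i j))"
    if "\<And>i j. i < N ==> j < N ==> a i j \<in> carrier HHH" for a
  proof -
    have "f (\<Oplus>\<^bsub>HHH\<^esub>i<N. \<Oplus>\<^bsub>HHH\<^esub>j<N. a i j) = (\<Oplus>\<^bsub>P\<^esub>i<N. f (\<Oplus>\<^bsub>HHH\<^esub>j<N. a i j))"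
      by (rule kf) (use that in \<open>auto intro!: finsum_closed_P[OF H3_grp]\<close>)
    also have "\<dots> = (\<Oplus>\<^bsub>P\<^esub>i<N. \<Oplus>\<^bsub>P\<^esub>j<N. f (a i j))"
      by (rule finsum_cong_P[OF kspace.grp[OF assms(1)]])
        (use that in \<open>auto intro!: kf finsum_closed_P[OF kspace.grp[OF assms(1)]] klin_closed[OF assms(2)]\<close>)
    finally show ?thesis .
  qed
  show "f (assocH (Did D1)) = (\<Oplus>\<^bsub>P\<^esub>i<N. f (t3 (w i) (D (z i))))"
    unfolding triple0 by (rule kf) (auto intro!: H3_sum_closed)
  show "f (assocH (Did D1)) = (\<Oplus>\<^bsub>P\<^esub>i<N. \<Oplus>\<^bsub>P\<^esub>j<N. f (t3 (w i) (tH (z i \<otimes> w j) (z j))))"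
    unfolding triple1 by (rule dbl) (auto intro!: H3_sum_closed)
  show "f (assocH (Did D1)) = (\<Oplus>\<^bsub>P\<^esub>j<N. \<Oplus>\<^bsub>P\<^esub>i<N. f (t3 (w i) (tH (w j \<otimes> z i) (z j))))"
    unfolding triple2 by (rule dbl) (auto intro!: H3_sum_closed)
qed

lemma slice_first:
  assumes l: "linfun H l"
  shows "\<exists>f. klin HHH HH f \<and> (\<forall>x\<in>carrier H. \<forall>t\<in>carrier HH. f (t3 x t) = l x \<odot>\<^bsub>HH\<^esub> t)"
proof -
  have b: "balanced class_ring H HH HH (\<lambda>x t. l x \<odot>\<^bsub>HH\<^esub> t)"
    by (rule balancedI) (simp_all add: linfun_add[OF l] linfun_smult[OF l] HH.smult_distr mult.commute)
  show ?thesis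
    by (rule exI[of _ "tensor_lift class_ring H HH HH (\<lambda>x t. l x \<odot>\<^bsub>HH\<^esub> t)"])
      (auto intro!: lift_klin[OF ks HH.ks HH.ks b] H3.lift_tens[OF HH.grp b]
        simp: linfun_smult[OF l] HH.smult_distr)
qed

lemma slice_last:
  assumes l: "linfun H l"
  shows "\<exists>f. klin HH H f \<and> (\<forall>x\<in>carrier H. \<forall>y\<in>carrier H. f (tH x y) = l y \<odot> x)"
proof -
  have b: "balanced class_ring H H H (\<lambda>x y. l y \<odot> x)"
    by (rule balancedI) (simp_all add: linfun_add[OF l] linfun_smult[OF l] smult_distr mult.commute)
  show ?thesis
    by (rule exI[of _ "tensor_lift class_ring H H H (\<lambda>x y. l y \<odot> x)"])
      (auto intro!: lift_klin[OF ks ks ks b] BB.lift_tens[OF grp b]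
        simp: smult_distr mult.commute)
qed

text \<open>A product of a tensor with \<open>\<Delta>(1)\<close> is linear in the tensor, so double sums over the presentation collapse.\<close>

lemma sum_linear:
  assumes f: "klin H HH f" and p: "\<And>i. i < N ==> p i \<in> carrier H"
    and F: "\<And>i. i < N ==> f (p i) = (\<Oplus>\<^bsub>HH\<^esub>j<N. F i j)"
    and F_closed: "\<And>i j. i < N ==> j < N ==> F i j \<in> carrier HH"
  shows "(\<Oplus>\<^bsub>HH\<^esub>i<N. \<Oplus>\<^bsub>HH\<^esub>j<N. c i \<odot>\<^bsub>HH\<^esub> F i j) = f (\<Oplus>i<N. c i \<odot> p i)"
proof -
  have "f (\<Oplus>i<N. c i \<odot> p i) = (\<Oplus>\<^bsub>HH\<^esub>i<N. f (c i \<odot> p i))"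
    using p by (intro klin_finsum[OF ks HH.ks f]) auto
  also have "\<dots> = (\<Oplus>\<^bsub>HH\<^esub>i<N. \<Oplus>\<^bsub>HH\<^esub>j<N. c i \<odot>\<^bsub>HH\<^esub> F i j)"
    by (rule HH.sum_cong)
      (auto simp: klin_smult[OF f] p F F_closed intro!: HH.finsum_smult_right finsum_closed_P[OF HH.grp])
  finally show ?thesis by simp
qed

lemma sum_prod_left:
  assumes p: "\<And>i. i < N ==> p i \<in> carrier H"
  shows "(\<Oplus>\<^bsub>HH\<^esub>i<N. \<Oplus>\<^bsub>HH\<^esub>j<N. c i \<odot>\<^bsub>HH\<^esub> tH (p i \<otimes> w j) (z j)) = tH (\<Oplus>i<N. c i \<odot> p i) \<one> \<otimes>\<^bsub>HH\<^esub> D1"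
    and "(\<Oplus>\<^bsub>HH\<^esub>i<N. \<Oplus>\<^bsub>HH\<^esub>j<N. c i \<odot>\<^bsub>HH\<^esub> tH (w j \<otimes> p i) (z j)) = D1 \<otimes>\<^bsub>HH\<^esub> tH (\<Oplus>i<N. c i \<odot> p i) \<one>"
    and "(\<Oplus>\<^bsub>HH\<^esub>i<N. \<Oplus>\<^bsub>HH\<^esub>j<N. c i \<odot>\<^bsub>HH\<^esub> tH (w j) (p i \<otimes> z j)) = tH \<one> (\<Oplus>i<N. c i \<odot> p i) \<otimes>\<^bsub>HH\<^esub> D1"
    and "(\<Oplus>\<^bsub>HH\<^esub>i<N. \<Oplus>\<^bsub>HH\<^esub>j<N. c i \<odot>\<^bsub>HH\<^esub> tH (w j) (z j \<otimes> p i)) = D1 \<otimes>\<^bsub>HH\<^esub> tH \<one> (\<Oplus>i<N. c i \<odot> p i)"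
proof -
  note sum = sum_linear[OF klinI p, where c = c]
  note simps = D1_left D1_right p tH_rules HH.l_distr HH.r_distr
  show "(\<Oplus>\<^bsub>HH\<^esub>i<N. \<Oplus>\<^bsub>HH\<^esub>j<N. c i \<odot>\<^bsub>HH\<^esub> tH (p i \<otimes> w j) (z j)) = tH (\<Oplus>i<N. c i \<odot> p i) \<one> \<otimes>\<^bsub>HH\<^esub> D1"
    by (rule sum) (auto simp: simps intro!: HH.sum_cong)
  show "(\<Oplus>\<^bsub>HH\<^esub>i<N. \<Oplus>\<^bsub>HH\<^esub>j<N. c i \<odot>\<^bsub>HH\<^esub> tH (w j \<otimes> p i) (z j)) = D1 \<otimes>\<^bsub>HH\<^esub> tH (\<Oplus>i<N. c i \<odot> p i) \<one>"
    by (rule sum) (auto simp: simps intro!: HH.sum_cong)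
  show "(\<Oplus>\<^bsub>HH\<^esub>i<N. \<Oplus>\<^bsub>HH\<^esub>j<N. c i \<odot>\<^bsub>HH\<^esub> tH (w j) (p i \<otimes> z j)) = tH \<one> (\<Oplus>i<N. c i \<odot> p i) \<otimes>\<^bsub>HH\<^esub> D1"
    by (rule sum) (auto simp: simps intro!: HH.sum_cong)
  show "(\<Oplus>\<^bsub>HH\<^esub>i<N. \<Oplus>\<^bsub>HH\<^esub>j<N. c i \<odot>\<^bsub>HH\<^esub> tH (w j) (z j \<otimes> p i)) = D1 \<otimes>\<^bsub>HH\<^esub> tH \<one> (\<Oplus>i<N. c i \<odot> p i)"
    by (rule sum) (auto simp: simps intro!: HH.sum_cong)
qed

text \<open>Apply \<open>\<epsilon>(\<cdot> h)\<close> to the first leg of the three expressions for \<open>(\<Delta> \<otimes> id)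
  \<Delta>(1)\<close>.\<close>

lemma D_et:
  assumes h: "h \<in> carrier H"
  shows "D (et h) = tH (et h) \<one> \<otimes>\<^bsub>HH\<^esub> D1" "D (et h) = D1 \<otimes>\<^bsub>HH\<^esub> tH (et h) \<one>"
proof -
  have l: "linfun H (\<lambda>x. eps (x \<otimes> h))"
    using h by (simp add: linfun_def l_distr eps_add eps_smult)
  obtain f where f: "klin HHH HH f" "\<forall>x\<in>carrier H. \<forall>t\<in>carrier HH. f (t3 x t) = eps (x \<otimes> h) \<odot>\<^bsub>HH\<^esub> t"
    using slice_first[OF l] by blast
  note T = triple_apply[OF HH.ks f(1)]
  have 0: "f (assocH (Did D1)) = D (et h)"
  proof -
    have "f (assocH (Did D1)) = (\<Oplus>\<^bsub>HH\<^esub>i<N. D (eps (w i \<otimes> h) \<odot> z i))"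
      unfolding T(1) using f(2) h by (intro HH.sum_cong) (auto simp: klin_smult[OF D_klin])
    then show ?thesis unfolding et_eq[OF h] using h by (subst D_kfinsum) auto
  qed
  have 1: "f (assocH (Did D1)) = tH (et h) \<one> \<otimes>\<^bsub>HH\<^esub> D1"
  proof -
    have "f (assocH (Did D1)) = (\<Oplus>\<^bsub>HH\<^esub>i<N. \<Oplus>\<^bsub>HH\<^esub>j<N. eps (w i \<otimes> h) \<odot>\<^bsub>HH\<^esub> tH (z i \<otimes> w j) (z j))"
      unfolding T(2) using f(2) h
      by (intro HH.sum_cong) (auto intro!: HH.sum_cong finsum_closed_P[OF HH.grp])
    also have "\<dots> = tH (et h) \<one> \<otimes>\<^bsub>HH\<^esub> D1" unfolding et_eq[OF h] by (rule sum_prod_left(1)) simp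
    finally show ?thesis .
  qed
  have 2: "f (assocH (Did D1)) = D1 \<otimes>\<^bsub>HH\<^esub> tH (et h) \<one>"
  proof -
    have "f (assocH (Did D1)) = (\<Oplus>\<^bsub>HH\<^esub>j<N. \<Oplus>\<^bsub>HH\<^esub>i<N. eps (w i \<otimes> h) \<odot>\<^bsub>HH\<^esub> tH (w j \<otimes> z i) (z j))"
      unfolding T(3) using f(2) h
      by (intro HH.sum_cong) (auto intro!: HH.sum_cong finsum_closed_P[OF HH.grp])
    also have "\<dots> = (\<Oplus>\<^bsub>HH\<^esub>i<N. \<Oplus>\<^bsub>HH\<^esub>j<N. eps (w i \<otimes> h) \<odot>\<^bsub>HH\<^esub> tH (w j \<otimes> z i) (z j))"
      using h by (intro finsum_swap[OF HH.grp]) auto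
    also have "\<dots> = D1 \<otimes>\<^bsub>HH\<^esub> tH (et h) \<one>" unfolding et_eq[OF h] by (rule sum_prod_left(2)) simp
    finally show ?thesis .
  qed
  show "D (et h) = tH (et h) \<one> \<otimes>\<^bsub>HH\<^esub> D1" "D (et h) = D1 \<otimes>\<^bsub>HH\<^esub> tH (et h) \<one>" using 0 1 2 by simp_all
qed

text \<open>Apply \<open>\<epsilon>(h \<cdot>)\<close> to the last leg of the three expressions for \<open>(\<Delta> \<otimes> id)
  \<Delta>(1)\<close>.\<close>

lemma D_es:
  assumes h: "h \<in> carrier H"
  shows "D (es h) = D1 \<otimes>\<^bsub>HH\<^esub> tH \<one> (es h)" "D (es h) = tH \<one> (es h) \<otimes>\<^bsub>HH\<^esub> D1"
proof -
  have l: "linfun H (\<lambda>x. eps (h \<otimes> x))"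
    using h by (simp add: linfun_def r_distr eps_add eps_smult)
  obtain r where r: "klin HH H r" "\<forall>x\<in>carrier H. \<forall>y\<in>carrier H. r (tH x y) = eps (h \<otimes> y) \<odot> x"
    using slice_last[OF l] by blast
  define f where "f = tensor_map class_ring H HH H H (\<lambda>x. x) r"
  note fk = tensor_map_klin[OF ks HH.ks ks ks klin_id r(1), folded f_def]
  note ft = tensor_map_tens[OF ks HH.ks ks ks klin_id r(1), folded f_def]
  have f3: "f (t3 x (tH y v)) = eps (h \<otimes> v) \<odot>\<^bsub>HH\<^esub> tH x y"
    if "x \<in> carrier H" "y \<in> carrier H" "v \<in> carrier H" for x y v
    using that r(2) by (simp add: ft tH_rules)
  have fa: "f (assocH (tens class_ring HH H t v)) = eps (h \<otimes> v) \<odot>\<^bsub>HH\<^esub> t"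
    if v: "v \<in> carrier H" and t: "t \<in> carrier HH" for t v
    using t
  proof (induction rule: BB.tensor_induct)
    case (pure x y)
    then show ?case using v by (simp add: assocH_tens f3)
  next
    case (add s t)
    then show ?case using v
      by (simp add: H3'.tens_add_left H3'.tens_closed klin_add[OF assocH_klin] klin_add[OF fk] klin_closed[OF assocH_klin]
          HH.smult_distr)
  qed
  note T = triple_apply[OF HH.ks fk]
  have 0: "f (assocH (Did D1)) = D (es h)"
  proof -
    have "Did D1 = (\<Oplus>\<^bsub>HH \<otimes>\<^sub>k H\<^esub>i<N. Did (tH (w i) (z i)))"
      unfolding D1_pres by (rule klin_finsum[OF HH.ks H3'_kspace Did_klin]) auto
    also have "\<dots> = (\<Oplus>\<^bsub>HH \<otimes>\<^sub>k H\<^esub>i<N. tens class_ring HH H (D (w i)) (z i))"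
      by (intro finsum_cong_P[OF H3'_grp]) (auto simp: Did_tens intro!: H3'.tens_closed)
    finally have "f (assocH (Did D1)) = f (assocH (\<Oplus>\<^bsub>HH \<otimes>\<^sub>k H\<^esub>i<N. tens class_ring HH H (D (w i)) (z i)))" by simp
    also have "\<dots> = (\<Oplus>\<^bsub>HH\<^esub>i<N. f (assocH (tens class_ring HH H (D (w i)) (z i))))"
      by (rule klin_finsum[OF H3'_kspace HH.ks klin_comp[OF assocH_klin fk]]) (auto intro!: H3'.tens_closed)
    also have "\<dots> = (\<Oplus>\<^bsub>HH\<^esub>i<N. D (eps (h \<otimes> z i) \<odot> w i))"
      using h by (intro HH.sum_cong) (auto simp: fa klin_smult[OF D_klin])
    finally show ?thesis unfolding es_eq[OF h] using h by (subst D_kfinsum) auto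
  qed
  have 1: "f (assocH (Did D1)) = D1 \<otimes>\<^bsub>HH\<^esub> tH \<one> (es h)"
  proof -
    have "f (assocH (Did D1)) = (\<Oplus>\<^bsub>HH\<^esub>i<N. \<Oplus>\<^bsub>HH\<^esub>j<N. eps (h \<otimes> z j) \<odot>\<^bsub>HH\<^esub> tH (w i) (z i \<otimes> w j))"
      unfolding T(2) using h
      by (intro HH.sum_cong) (auto simp: f3 intro!: HH.sum_cong finsum_closed_P[OF HH.grp])
    also have "\<dots> = (\<Oplus>\<^bsub>HH\<^esub>j<N. \<Oplus>\<^bsub>HH\<^esub>i<N. eps (h \<otimes> z j) \<odot>\<^bsub>HH\<^esub> tH (w i) (z i \<otimes> w j))"
      using h by (intro finsum_swap[OF HH.grp]) auto
    also have "\<dots> = D1 \<otimes>\<^bsub>HH\<^esub> tH \<one> (es h)" unfolding es_eq[OF h] by (rule sum_prod_left(4)) simp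
    finally show ?thesis .
  qed
  have 2: "f (assocH (Did D1)) = tH \<one> (es h) \<otimes>\<^bsub>HH\<^esub> D1"
  proof -
    have "f (assocH (Did D1)) = (\<Oplus>\<^bsub>HH\<^esub>j<N. \<Oplus>\<^bsub>HH\<^esub>i<N. eps (h \<otimes> z j) \<odot>\<^bsub>HH\<^esub> tH (w i) (w j \<otimes> z i))"
      unfolding T(3) using h
      by (intro HH.sum_cong) (auto simp: f3 intro!: HH.sum_cong finsum_closed_P[OF HH.grp])
    also have "\<dots> = tH \<one> (es h) \<otimes>\<^bsub>HH\<^esub> D1" unfolding es_eq[OF h] by (rule sum_prod_left(3)) simp
    finally show ?thesis .
  qed
  show "D (es h) = D1 \<otimes>\<^bsub>HH\<^esub> tH \<one> (es h)" "D (es h) = tH \<one> (es h) \<otimes>\<^bsub>HH\<^esub> D1" using 0 1 2 by simp_all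
qed

text \<open>Apply the counit to the middle leg of \<open>(\<Delta> \<otimes> id) \<Delta>(1)\<close>: one presentation returns \<open>\<Delta>(1)\<close>, the product form puts
  a counital map on either leg.\<close>

lemma D1_legs:
  "D1 = (\<Oplus>\<^bsub>HH\<^esub>i<N. tH (w i) (et (z i)))" "D1 = (\<Oplus>\<^bsub>HH\<^esub>i<N. tH (es (w i)) (z i))"
proof -
  define f where "f = tensor_map class_ring H HH H H (\<lambda>x. x) sl1"
  note fk = tensor_map_klin[OF ks HH.ks ks ks klin_id sl1_klin, folded f_def]
  note ft = tensor_map_tens[OF ks HH.ks ks ks klin_id sl1_klin, folded f_def]
  note T = triple_apply[OF HH.ks fk]
  have "f (assocH (Did D1)) = (\<Oplus>\<^bsub>HH\<^esub>i<N. tH (w i) (z i))"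
    unfolding T(1) by (intro HH.sum_cong) (auto simp: ft counit1)
  then have 0: "f (assocH (Did D1)) = D1" using D1_pres by simp
  have 1: "f (assocH (Did D1)) = (\<Oplus>\<^bsub>HH\<^esub>j<N. \<Oplus>\<^bsub>HH\<^esub>i<N. tH (eps (w j \<otimes> z i) \<odot> w i) (z j))"
    unfolding T(3) by (intro HH.sum_cong)
      (auto simp: ft sl1_t tH_rules intro!: HH.sum_cong finsum_closed_P[OF HH.grp])
  also have "\<dots> = (\<Oplus>\<^bsub>HH\<^esub>j<N. tH (es (w j)) (z j))"
  proof (rule HH.sum_cong)
    fix j assume j: "j \<in> {..<N}"
    then show "(\<Oplus>\<^bsub>HH\<^esub>i<N. tH (eps (w j \<otimes> z i) \<odot> w i) (z j)) = tH (es (w j)) (z j)"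
      by (subst es_eq, simp) (rule BB.tens_finsum_left[symmetric], auto)
  qed auto
  finally show "D1 = (\<Oplus>\<^bsub>HH\<^esub>i<N. tH (es (w i)) (z i))" using 0 by simp
  have "f (assocH (Did D1)) = (\<Oplus>\<^bsub>HH\<^esub>j<N. \<Oplus>\<^bsub>HH\<^esub>i<N. tH (w i) (eps (w j \<otimes> z i) \<odot> z j))"
    unfolding T(3) by (intro HH.sum_cong)
      (auto simp: ft sl1_t intro!: HH.sum_cong finsum_closed_P[OF HH.grp])
  also have "\<dots> = (\<Oplus>\<^bsub>HH\<^esub>i<N. \<Oplus>\<^bsub>HH\<^esub>j<N. tH (w i) (eps (w j \<otimes> z i) \<odot> z j))"
    by (rule finsum_swap[OF HH.grp]) auto
  also have "\<dots> = (\<Oplus>\<^bsub>HH\<^esub>i<N. tH (w i) (et (z i)))"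
  proof (rule HH.sum_cong)
    fix i assume i: "i \<in> {..<N}"
    then show "(\<Oplus>\<^bsub>HH\<^esub>j<N. tH (w i) (eps (w j \<otimes> z i) \<odot> z j)) = tH (w i) (et (z i))"
      by (subst et_eq, simp) (rule BB.tens_finsum_right[symmetric], auto)
  qed auto
  finally show "D1 = (\<Oplus>\<^bsub>HH\<^esub>i<N. tH (w i) (et (z i)))" using 0 by simp
qed

end

locale whopf_legs = whopf_pres +
  assumes wHs [simp]: "\<And>i. i < N ==> w i \<in> Hs" and zHt [simp]: "\<And>i. i < N ==> z i \<in> Ht"

lemma (in whopf) legs_exist: "\<exists>N w z. whopf_legs H N w z"
proof -
  obtain N :: nat and w z where wz: "\<forall>i<N. w i \<in> carrier H \<and> z i \<in> carrier H"
    "D1 = (\<Oplus>\<^bsub>HH\<^esub>i<N. tH (w i) (z i))"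
    using BB.tensor_sum_exists[OF D_closed[OF one_closed]] by blast
  interpret P: whopf_pres H N w z using wz by unfold_locales auto
  interpret Q: whopf_pres H N w "\<lambda>i. et (z i)" using P.D1_legs(1) by unfold_locales auto
  have "whopf_legs H N (\<lambda>i. es (w i)) (\<lambda>i. et (z i))" using Q.D1_legs(2) by unfold_locales auto
  then show ?thesis by blast
qed

section \<open>Frobenius forms on a semisimple algebra\<close>

text \<open>A linear form with a pair of dual families whose product in the order \<open>z e\<close> is \<open>1\<close>. The form equals
  \<open>Tr (u \<cdot>)\<close>, and the elements \<open>u\<close> and \<open>g\<close> turn out to be inverse to each other.\<close>

locale frobenius = casimir B n X Y for B :: "('k::field_char_0, 'b, 'u) module_scheme" (structure) and n X Y +
  fixes om N z e
  assumes om: "linfun B om"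
    and z [simp]: "\<And>i. i < (N::nat) ==> z i \<in> carrier B" and e [simp]: "\<And>i. i < N ==> e i \<in> carrier B"
    and expand_z: "\<And>x. x \<in> carrier B ==> x = (\<Oplus>i<N. om (e i \<otimes> x) \<odot> z i)"
    and expand_e: "\<And>x. x \<in> carrier B ==> x = (\<Oplus>i<N. om (x \<otimes> z i) \<odot> e i)"
    and ze_one: "(\<Oplus>i<N. z i \<otimes> e i) = \<one>"
begin

definition "u = (\<Oplus>j<n. om (X j) \<odot> Y j)"
definition "g = (\<Oplus>i<N. Tr (z i) \<odot> e i)"

lemma u_closed [simp]: "u \<in> carrier B" and g_closed [simp]: "g \<in> carrier B"
  unfolding u_def g_def by (auto intro!: finsum_closed)

lemma om_sum: "(\<And>i. i \<in> I ==> a i \<in> carrier B) ==> om (\<Oplus>i\<in>I. a i) = (\<Sum>i\<in>I. om (a i))"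
  by (rule linfun_finsum[OF grp om])

lemma om_u:
  assumes b: "b \<in> carrier B"
  shows "om b = Tr (u \<otimes> b)"
proof -
  have "om b = om (\<Oplus>i<n. Tr (b \<otimes> Y i) \<odot> X i)" using expand_X[OF b] by simp
  also have "\<dots> = (\<Sum>i<n. Tr (b \<otimes> Y i) * om (X i))"
    using b by (subst om_sum) (auto simp: linfun_smult[OF om])
  also have "\<dots> = (\<Sum>i<n. Tr (b \<otimes> (om (X i) \<odot> Y i)))"
    using b by (intro sum.cong) (auto simp: Tr_smult mult.commute)
  also have "\<dots> = Tr (b \<otimes> u)"
    unfolding u_def using b by (subst finsum_rdistr, simp_all, subst Tr_finsum) auto
  finally show ?thesis using b by (simp add: Tr_comm)
qed

lemma Tr_g:
  assumes b: "b \<in> carrier B"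
  shows "Tr b = om (g \<otimes> b)"
proof -
  have "Tr b = Tr (\<Oplus>i<N. om (e i \<otimes> b) \<odot> z i)" using expand_z[OF b] by simp
  also have "\<dots> = (\<Sum>i<N. om (e i \<otimes> b) * Tr (z i))" using b by (subst Tr_finsum) (auto simp: Tr_smult)
  also have "\<dots> = (\<Sum>i<N. om ((Tr (z i) \<odot> e i) \<otimes> b))"
    using b by (intro sum.cong) (auto simp: linfun_smult[OF om])
  also have "\<dots> = om (g \<otimes> b)"
    unfolding g_def using b by (subst finsum_ldistr, simp_all, subst om_sum) auto
  finally show ?thesis .
qed

lemma ug [simp]: "u \<otimes> g = \<one>"
  by (rule Tr_eqI) (simp_all add: m_assoc Tr_g om_u)

lemma gu [simp]: "g \<otimes> u = \<one>"
proof -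
  have "g \<otimes> u = (\<Oplus>i<N. om (g \<otimes> u \<otimes> z i) \<odot> e i)" by (rule expand_e) simp
  also have "\<dots> = (\<Oplus>i<N. om (\<one> \<otimes> z i) \<odot> e i)"
    by (intro sum_cong) (auto simp: m_assoc Tr_g[symmetric] om_u[symmetric])
  finally show ?thesis using expand_e[OF one_closed] by simp
qed

lemma g_Units: "g \<in> Units B" and inv_g: "inv g = u"
  by (simp add: Units_def, use ug gu u_closed in blast) (rule inv_char, simp_all)

text \<open>Expand \<open>z\<^sub>i\<close> in the basis \<open>Y\<close> and collect the coefficients: \<open>\<Sum> Tr (z\<^sub>i X\<^sub>j)
  e\<^sub>i = g X\<^sub>j\<close>, since \<open>Tr\<close> is the form at \<open>g\<close>.\<close>

lemma frobenius_casimir: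
  assumes P: "abelian_group P" and \<beta>: "balanced class_ring B B P \<beta>"
  shows "(\<Oplus>\<^bsub>P\<^esub>i<N. \<beta> (e i) (z i)) = (\<Oplus>\<^bsub>P\<^esub>j<n. \<beta> (g \<otimes> X j) (Y j))"
proof -
  note cl = \<beta>_closed[OF P \<beta>]
  have 1: "\<beta> (e i) (z i) = (\<Oplus>\<^bsub>P\<^esub>j<n. \<beta> (Tr (z i \<otimes> X j) \<odot> e i) (Y j))" if i: "i < N" for i
  proof -
    have "\<beta> (e i) (z i) = \<beta> (e i) (\<Oplus>j<n. Tr (z i \<otimes> X j) \<odot> Y j)" using expand_Y[OF z[OF i]] by simp
    also have "\<dots> = (\<Oplus>\<^bsub>P\<^esub>j<n. \<beta> (e i) (Tr (z i \<otimes> X j) \<odot> Y j))"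
      using i by (intro \<beta>_sum_right[OF P \<beta>]) auto
    also have "\<dots> = (\<Oplus>\<^bsub>P\<^esub>j<n. \<beta> (Tr (z i \<otimes> X j) \<odot> e i) (Y j))"
      using i by (intro finsum_cong_P[OF P]) (auto simp: \<beta>_smult[OF P \<beta>] cl)
    finally show ?thesis .
  qed
  have 2: "(\<Oplus>\<^bsub>P\<^esub>i<N. \<beta> (Tr (z i \<otimes> X j) \<odot> e i) (Y j)) = \<beta> (g \<otimes> X j) (Y j)" if j: "j < n" for j
  proof -
    have "(\<Oplus>\<^bsub>P\<^esub>i<N. \<beta> (Tr (z i \<otimes> X j) \<odot> e i) (Y j)) = \<beta> (\<Oplus>i<N. Tr (z i \<otimes> X j) \<odot> e i) (Y j)"
      using j by (intro \<beta>_sum_left[OF P \<beta>, symmetric]) auto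
    also have "(\<Oplus>i<N. Tr (z i \<otimes> X j) \<odot> e i) = (\<Oplus>i<N. om (g \<otimes> X j \<otimes> z i) \<odot> e i)"
      using j by (intro sum_cong) (auto simp: m_assoc Tr_g[symmetric] Tr_comm)
    also have "\<dots> = g \<otimes> X j" using j by (intro expand_e[symmetric]) simp
    finally show ?thesis .
  qed
  have "(\<Oplus>\<^bsub>P\<^esub>i<N. \<beta> (e i) (z i)) = (\<Oplus>\<^bsub>P\<^esub>i<N. \<Oplus>\<^bsub>P\<^esub>j<n. \<beta> (Tr (z i \<otimes> X j) \<odot> e i) (Y j))"
    by (intro finsum_cong_P[OF P]) (auto simp: 1 cl intro!: finsum_closed_P[OF P])
  also have "\<dots> = (\<Oplus>\<^bsub>P\<^esub>j<n. \<Oplus>\<^bsub>P\<^esub>i<N. \<beta> (Tr (z i \<otimes> X j) \<odot> e i) (Y j))"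
    by (intro finsum_swap[OF P]) (auto simp: cl)
  also have "\<dots> = (\<Oplus>\<^bsub>P\<^esub>j<n. \<beta> (g \<otimes> X j) (Y j))"
    by (intro finsum_cong_P[OF P]) (auto simp: 2 cl)
  finally show ?thesis .
qed

lemma avg_g: "avg g = \<one>"
proof -
  have b: "balanced class_ring B B B (\<lambda>x y. y \<otimes> x)"
    by (rule balancedI) (simp_all add: l_distr r_distr)
  have "avg g = (\<Oplus>i<n. Y i \<otimes> (g \<otimes> X i))"
    unfolding avg_def by (rule casimir_sym[OF grp avg_balanced[OF g_closed]])
  also have "\<dots> = \<one>" using frobenius_casimir[OF grp b] ze_one by simp
  finally show ?thesis .
qed

end

lemma (in kspace) minus_smult: "x \<in> carrier V ==> \<ominus> x = (- 1) \<odot> x"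
  by (rule minus_equality) (simp_all flip: smult_distr(2)[of x "- 1" 1, simplified])

context kalg
begin

lemma subalgebraI:
  assumes "A \<subseteq> carrier B" "\<one> \<in> A" "\<And>x y. x \<in> A ==> y \<in> A ==> x \<oplus> y \<in> A"
    "\<And>x y. x \<in> A ==> y \<in> A ==> x \<otimes> y \<in> A" "\<And>c x. x \<in> A ==> c \<odot> x \<in> A"
  shows "subalgebra A B"
  unfolding subalgebra_def using assms by (auto intro!: subringI simp: minus_smult subsetD)

lemma subalgebra_kalg:
  assumes "subalgebra A B"
  shows "kalg (B\<lparr>carrier := A\<rparr>)"
proof -
  interpret A: kspace "B\<lparr>carrier := A\<rparr>" by (rule subspace_kspace[OF subalgebra_submodule[OF assms]])
  have sr: "subring A B" using assms by (simp add: subalgebra_def)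
  have "ring (B\<lparr>carrier := A\<rparr>)" by (rule subring_is_ring[OF sr])
  then show ?thesis
    using A.module_V subringE(1)[OF sr] by (simp add: kalg_def k_algebra_iff algebra_over_def subsetD)
qed

end

section \<open>The algebra of the counital subalgebras\<close>

context whopf_legs
begin

lemma w_es [simp]: "i < N ==> es (w i) = w i" and z_et [simp]: "i < N ==> et (z i) = z i"
  by (simp_all add: es_Hs et_Ht)

lemma D_Ht: "x \<in> Ht ==> D x = tH x \<one> \<otimes>\<^bsub>HH\<^esub> D1" "x \<in> Ht ==> D x = D1 \<otimes>\<^bsub>HH\<^esub> tH x \<one>"
  using D_et[OF Ht_closed] by (simp_all only: et_Ht)

lemma D_Hs: "y \<in> Hs ==> D y = D1 \<otimes>\<^bsub>HH\<^esub> tH \<one> y" "y \<in> Hs ==> D y = tH \<one> y \<otimes>\<^bsub>HH\<^esub> D1"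
  using D_es[OF Hs_closed] by (simp_all only: es_Hs)

text \<open>Apply the counit to the first leg.\<close>

lemma HtI: "h \<in> carrier H ==> D h = D1 \<otimes>\<^bsub>HH\<^esub> tH h \<one> ==> h \<in> Ht"
  using counit1[of h] et_in[of h] by (simp only: et_def)

lemma HsI: "h \<in> carrier H ==> D h = tH \<one> h \<otimes>\<^bsub>HH\<^esub> D1 ==> h \<in> Hs"
  using counit2[of h] es_in[of h] by (simp only: es_def)

lemma one_HH: "tH \<one> \<one> = \<one>\<^bsub>HH\<^esub>" by (simp add: BB.one_TA)

lemma one_Ht [simp]: "\<one> \<in> Ht" and one_Hs [simp]: "\<one> \<in> Hs"
  by (rule HtI HsI; simp add: one_HH)+

lemma D_Ht_mult: "x \<in> Ht ==> h \<in> carrier H ==> D (h \<otimes> x) = D h \<otimes>\<^bsub>HH\<^esub> tH x \<one>"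
  by (simp add: D_mult D_Ht(2)[of x] flip: HH.m_assoc)

lemma D_mult_Hs: "y \<in> Hs ==> h \<in> carrier H ==> D (y \<otimes> h) = tH \<one> y \<otimes>\<^bsub>HH\<^esub> D h"
    and D_Hs_mult: "y \<in> Hs ==> h \<in> carrier H ==> D (h \<otimes> y) = D h \<otimes>\<^bsub>HH\<^esub> tH \<one> y"
  by (simp add: D_mult D_Hs(2)[of y] HH.m_assoc) (simp add: D_mult D_Hs(1)[of y] flip: HH.m_assoc)

lemma Ht_mult [simp]: "x \<in> Ht ==> x' \<in> Ht ==> x \<otimes> x' \<in> Ht"
  by (rule HtI) (simp_all add: D_Ht_mult D_Ht(2)[of x] HH.m_assoc BB.tens_mult)

lemma Hs_mult [simp]: "y \<in> Hs ==> y' \<in> Hs ==> y \<otimes> y' \<in> Hs"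
  by (rule HsI) (simp_all add: D_mult_Hs D_Hs(2)[of y'] BB.tens_mult flip: HH.m_assoc)

lemma Ht_add [simp]: "x \<in> Ht ==> x' \<in> Ht ==> x \<oplus> x' \<in> Ht" and Ht_smult [simp]: "x \<in> Ht ==> c \<odot> x \<in> Ht"
  using et_in[of "x \<oplus> x'"] et_in[of "c \<odot> x"] by (simp_all add: klin_add[OF et_klin] klin_smult[OF et_klin] et_Ht)

lemma Hs_add [simp]: "x \<in> Hs ==> x' \<in> Hs ==> x \<oplus> x' \<in> Hs" and Hs_smult [simp]: "x \<in> Hs ==> c \<odot> x \<in> Hs"
  using es_in[of "x \<oplus> x'"] es_in[of "c \<odot> x"] by (simp_all add: klin_add[OF es_klin] klin_smult[OF es_klin] es_Hs)

text \<open>Both expressions for \<open>\<Delta>(x)\<close> are sliced with \<open>\<epsilon>(y \<cdot>)\<close> on the last leg.\<close>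

lemma Ht_Hs_comm:
  assumes x: "x \<in> Ht" and y: "y \<in> Hs"
  shows "y \<otimes> x = x \<otimes> y"
proof -
  have l: "linfun H (\<lambda>h. eps (y \<otimes> h))" using y by (simp add: linfun_def r_distr eps_add eps_smult)
  obtain f where f: "klin HH H f" "\<forall>a\<in>carrier H. \<forall>b\<in>carrier H. f (tH a b) = eps (y \<otimes> b) \<odot> a"
    using slice_last[OF l] by blast
  have yw: "y = (\<Oplus>i<N. eps (y \<otimes> z i) \<odot> w i)" using es_eq[of y] y by (simp add: es_Hs)
  have "f (D x) = (\<Oplus>i<N. f (tH (x \<otimes> w i) (\<one> \<otimes> z i)))"
    unfolding D_Ht(1)[OF x] D1_left[OF Ht_closed[OF x] one_closed] using x
    by (intro klin_finsum[OF HH.ks ks f(1)]) auto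
  also have "\<dots> = (\<Oplus>i<N. x \<otimes> (eps (y \<otimes> z i) \<odot> w i))"
    using x y f(2) by (intro sum_cong) auto
  also have "\<dots> = x \<otimes> (\<Oplus>i<N. eps (y \<otimes> z i) \<odot> w i)" using x y by (intro finsum_rdistr[symmetric]) auto
  finally have 1: "f (D x) = x \<otimes> y" using yw by simp
  have "f (D x) = (\<Oplus>i<N. f (tH (w i \<otimes> x) (z i \<otimes> \<one>)))"
    unfolding D_Ht(2)[OF x] D1_right[OF Ht_closed[OF x] one_closed] using x
    by (intro klin_finsum[OF HH.ks ks f(1)]) auto
  also have "\<dots> = (\<Oplus>i<N. (eps (y \<otimes> z i) \<odot> w i) \<otimes> x)"
    using x y f(2) by (intro sum_cong) auto
  also have "\<dots> = (\<Oplus>i<N. eps (y \<otimes> z i) \<odot> w i) \<otimes> x" using x y by (intro finsum_ldistr[symmetric]) auto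
  finally show ?thesis using 1 yw by simp
qed

lemma m2_right: "x \<in> carrier H ==> t \<in> carrier HH ==> m2 (t \<otimes>\<^bsub>HH\<^esub> tH \<one> x) = m2 t \<otimes> x"
proof -
  assume x: "x \<in> carrier H"
  show "m2 (t \<otimes>\<^bsub>HH\<^esub> tH \<one> x) = m2 t \<otimes> x" if "t \<in> carrier HH"
    using that
  proof (induction rule: BB.tensor_induct)
    case (pure a b)
    then show ?case using x by (simp add: BB.tens_mult m2_t m_assoc)
  next
    case (add s t)
    then show ?case using x by (simp add: HH.l_distr klin_add[OF m2_klin] klin_closed[OF m2_klin] l_distr)
  qed
qed

lemma es_right: "y \<in> Hs ==> h \<in> carrier H ==> es (h \<otimes> y) = es h \<otimes> y"
  using m2_right[of y "D h"] by (simp only: es_m2 D_Hs_mult[symmetric] Hs_closed m_closed D_closed)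

text \<open>On \<open>H\<^sub>t H\<^sub>s\<close> the antipode is expressed by the counital maps.\<close>

lemma S_Ht_Hs:
  assumes x: "x \<in> Ht" and y: "y \<in> Hs"
  shows "S (x \<otimes> y) = es x \<otimes> et y"
proof -
  have b: "balanced class_ring H H H (\<lambda>x y. es x \<otimes> S y)"
    by (rule balancedI) (simp_all add: klin_add[OF es_klin] klin_smult[OF es_klin] l_distr r_distr S_add S_smult)
  have xy: "x \<in> carrier H" "y \<in> carrier H" using x y by auto
  have Dy: "D y = (\<Oplus>\<^bsub>HH\<^esub>i<N. tH (w i) (z i \<otimes> y))"
    unfolding D_Hs(1)[OF y] D1_right[OF one_closed xy(2)] using y by (intro HH.sum_cong) auto
  have Dxy: "D (x \<otimes> y) = (\<Oplus>\<^bsub>HH\<^esub>i<N. tH (w i \<otimes> x) (z i \<otimes> y))"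
  proof -
    have "D (x \<otimes> y) = D1 \<otimes>\<^bsub>HH\<^esub> tH x y"
      using x y by (simp add: D_Hs_mult D_Ht(2)[of x] HH.m_assoc BB.tens_mult)
    then show ?thesis using D1_right[OF xy] by simp
  qed
  have "S (x \<otimes> y) = (\<Oplus>i<N. es (w i \<otimes> x) \<otimes> S (z i \<otimes> y))"
    unfolding antipode_es[OF m_closed[OF xy]] Dxy by (rule BB.lift_finsum[OF grp b]) (use xy in auto)
  also have "\<dots> = (\<Oplus>i<N. es x \<otimes> (w i \<otimes> S (z i \<otimes> y)))"
    using x y by (intro sum_cong) (auto simp: Ht_Hs_comm es_right m_assoc)
  also have "\<dots> = es x \<otimes> (\<Oplus>i<N. w i \<otimes> S (z i \<otimes> y))" using xy by (intro finsum_rdistr[symmetric]) auto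
  also have "(\<Oplus>i<N. w i \<otimes> S (z i \<otimes> y)) = m1 (D y)"
  proof -
    have "m1 (D y) = (\<Oplus>i<N. m1 (tH (w i) (z i \<otimes> y)))"
      unfolding Dy by (rule klin_finsum[OF HH.ks ks m1_klin]) (use xy in auto)
    also have "\<dots> = (\<Oplus>i<N. w i \<otimes> S (z i \<otimes> y))" using xy by (intro sum_cong) (auto simp: m1_t)
    finally show ?thesis by simp
  qed
  finally show ?thesis using et_m1[OF xy(2)] by simp
qed

lemma S_Ht: "x \<in> Ht ==> S x = es x" and S_Hs: "y \<in> Hs ==> S y = et y"
  using S_Ht_Hs[of x \<one>] S_Ht_Hs[of \<one> y] by (simp_all add: es_Hs et_Ht)

lemma S_mult: "x \<in> Ht ==> y \<in> Hs ==> S (x \<otimes> y) = S x \<otimes> S y"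
  by (simp add: S_Ht_Hs S_Ht S_Hs)

lemma S_in [simp]: "x \<in> Ht ==> S x \<in> Hs" "y \<in> Hs ==> S y \<in> Ht"
  by (simp_all add: S_Ht S_Hs)

lemma S_one [simp]: "S \<one> = \<one>" by (simp add: S_Ht es_Hs)

lemma S_anti_Ht: "x \<in> Ht ==> x' \<in> Ht ==> S (x \<otimes> x') = S x' \<otimes> S x"
  using es_es[of x x'] by (simp add: S_Ht Ht_Hs_comm[of x' "es x"] es_right)

text \<open>The inverse of the antipode \<open>H\<^sub>t \<rightarrow> H\<^sub>s\<close>.\<close>

definition "Tm y = (\<Oplus>i<N. eps (y \<otimes> w i) \<odot> z i)"

lemma Ht_sum: "(\<And>i. i \<in> I ==> a i \<in> Ht) ==> (\<Oplus>i\<in>I. a i) \<in> Ht"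
  using klin_finsum[OF ks ks et_klin, of I a] et_in[of "\<Oplus>i\<in>I. a i"]
  by (simp add: finsum_closed_P[OF grp] Pi_def et_Ht cong: finsum_cong)

lemma Tm_klin: "klin H H Tm"
proof (rule klinI)
  fix x y assume x: "x \<in> carrier H" and y: "y \<in> carrier H"
  have "Tm (x \<oplus> y) = (\<Oplus>i<N. eps (x \<otimes> w i) \<odot> z i \<oplus> eps (y \<otimes> w i) \<odot> z i)"
    unfolding Tm_def using x y by (intro sum_cong) (auto simp: l_distr eps_add smult_distr)
  also have "\<dots> = Tm x \<oplus> Tm y" unfolding Tm_def by (rule finsum_addf_P[OF grp]) auto
  finally show "Tm (x \<oplus> y) = Tm x \<oplus> Tm y" .
next
  fix c x assume x: "x \<in> carrier H"
  have "Tm (c \<odot> x) = (\<Oplus>i<N. c \<odot> (eps (x \<otimes> w i) \<odot> z i))"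
    unfolding Tm_def using x by (intro sum_cong) (auto simp: eps_smult smult_distr)
  also have "\<dots> = c \<odot> Tm x" unfolding Tm_def by (rule finsum_smult_right[symmetric]) auto
  finally show "Tm (c \<odot> x) = c \<odot> Tm x" .
qed (auto simp: Tm_def intro!: finsum_closed_P[OF grp])

lemma Tm_in [simp]: "y \<in> carrier H ==> Tm y \<in> Ht"
  unfolding Tm_def by (rule Ht_sum) simp

lemma Tm_S [simp]: "x \<in> Ht ==> Tm (S x) = x"
proof -
  assume x: "x \<in> Ht"
  have "Tm (S x) = (\<Oplus>i<N. sl1 (tH (x \<otimes> w i) (\<one> \<otimes> z i)))"
    unfolding Tm_def S_Ht[OF x] using x by (intro sum_cong) (auto simp: sl1_t)
  also have "\<dots> = sl1 (D x)"
    unfolding D_Ht(1)[OF x] D1_left[OF Ht_closed[OF x] one_closed] using x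
    by (intro klin_finsum[OF HH.ks ks sl1_klin, symmetric]) auto
  finally show ?thesis using x by (simp add: counit1)
qed

text \<open>By the first form of weak multiplicativity \<open>\<epsilon>(Tm y \<cdot> z\<^sub>j) = \<epsilon>(y z\<^sub>j)\<close>.\<close>

lemma S_Tm [simp]: "y \<in> Hs ==> S (Tm y) = y"
proof -
  assume y: "y \<in> Hs"
  have "eps (Tm y \<otimes> z j) = eps (y \<otimes> z j)" if j: "j < N" for j
  proof -
    have "Tm y \<otimes> z j = (\<Oplus>i<N. (eps (y \<otimes> w i) \<odot> z i) \<otimes> z j)"
      unfolding Tm_def using j y by (intro finsum_ldistr) auto
    then have "eps (Tm y \<otimes> z j) = (\<Sum>i<N. eps ((eps (y \<otimes> w i) \<odot> z i) \<otimes> z j))"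
      by (simp only:) (rule eps_sum, use j y in auto)
    also have "\<dots> = (\<Sum>i<N. eps (y \<otimes> w i) * eps (z i \<otimes> z j))"
      using j y by (intro sum.cong) (auto simp: eps_smult)
    finally show ?thesis using eps1[of y "z j"] j y by simp
  qed
  then have "es (Tm y) = es y"
    using y by (simp add: es_eq cong: finsum_cong_P) (auto intro!: sum_cong)
  then show ?thesis using y by (simp add: S_Ht es_Hs)
qed

lemma S_inj_Ht: "x \<in> Ht ==> x' \<in> Ht ==> S x = S x' ==> x = x'"
  by (metis Tm_S)

definition "e i = Tm (w i)"

lemma e_Ht [simp]: "i < N ==> e i \<in> Ht" and S_e [simp]: "i < N ==> S (e i) = w i"
  by (simp_all add: e_def)

lemma Ht_expand_z:
  assumes x: "x \<in> Ht"
  shows "x = (\<Oplus>i<N. eps (e i \<otimes> x) \<odot> z i)"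
proof -
  have "eps (w i \<otimes> x) = eps (e i \<otimes> x)" if i: "i < N" for i
    by (metis S_Ht S_e eps_es e_Ht Ht_closed i x)
  then have "et x = (\<Oplus>i<N. eps (e i \<otimes> x) \<odot> z i)"
    unfolding et_eq[OF Ht_closed[OF x]] using x by (intro sum_cong) auto
  then show ?thesis using x by (simp add: et_Ht)
qed

lemma Ht_expand_e:
  assumes x: "x \<in> Ht"
  shows "x = (\<Oplus>i<N. eps (x \<otimes> z i) \<odot> e i)"
proof -
  have "x = Tm (\<Oplus>i<N. eps (x \<otimes> z i) \<odot> w i)" 
    using Tm_S[OF x] unfolding S_Ht[OF x] es_eq[OF Ht_closed[OF x]] by simp
  also have "\<dots> = (\<Oplus>i<N. Tm (eps (x \<otimes> z i) \<odot> w i))"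
    by (rule klin_finsum[OF ks ks Tm_klin]) (use x in auto)
  also have "\<dots> = (\<Oplus>i<N. eps (x \<otimes> z i) \<odot> e i)"
    using x by (intro sum_cong) (auto simp: klin_smult[OF Tm_klin] e_def)
  finally show ?thesis .
qed

lemma ze_one: "(\<Oplus>i<N. z i \<otimes> e i) = \<one>"
proof (rule S_inj_Ht)
  have "S (\<Oplus>i<N. z i \<otimes> e i) = (\<Oplus>i<N. S (z i \<otimes> e i))"
    by (rule klin_finsum[OF ks ks S_klin]) auto
  also have "\<dots> = (\<Oplus>i<N. m1 (tH (w i) (z i)))"
    by (intro sum_cong) (auto simp: S_anti_Ht m1_t)
  also have "\<dots> = m1 D1"
    unfolding D1_pres by (rule klin_finsum[OF HH.ks ks m1_klin, symmetric]) auto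
  finally show "S (\<Oplus>i<N. z i \<otimes> e i) = S \<one>" by (simp add: et_m1 et_Ht)
qed (auto intro: Ht_sum)

text \<open>The square of the antipode is the Nakayama automorphism of the counit.\<close>

lemma eps_nakayama:
  assumes "x \<in> Ht" "y \<in> Ht"
  shows "eps (x \<otimes> y) = eps (y \<otimes> S (S x))"
proof -
  have "eps (y \<otimes> S (S x)) = eps (y \<otimes> S x)" using assms by (simp add: S_Hs[of "S x"])
  also have "\<dots> = eps (S x \<otimes> y)" using assms by (simp add: Ht_Hs_comm)
  finally show ?thesis using assms by (simp add: S_Ht)
qed

lemma D_Ht_S:
  assumes b: "b \<in> Ht" and c: "c \<in> Ht"
  shows "D (b \<otimes> S c) = (\<Oplus>\<^bsub>HH\<^esub>i<N. tH (b \<otimes> S (e i)) (z i \<otimes> S c))"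
proof -
  have "D (b \<otimes> S c) = D1 \<otimes>\<^bsub>HH\<^esub> tH b (S c)"
    using b c by (simp add: D_Hs_mult D_Ht(2)[of b] HH.m_assoc BB.tens_mult)
  also have "\<dots> = (\<Oplus>\<^bsub>HH\<^esub>i<N. tH (w i \<otimes> b) (z i \<otimes> S c))" using b c by (simp add: D1_right)
  also have "\<dots> = (\<Oplus>\<^bsub>HH\<^esub>i<N. tH (b \<otimes> S (e i)) (z i \<otimes> S c))"
    using b c by (intro HH.sum_cong) (auto simp: Ht_Hs_comm)
  finally show ?thesis .
qed

subsection \<open>The base algebra\<close>

definition Bt :: "('b, 'a) module" where
  "Bt = \<lparr>carrier = Ht, monoid.mult = monoid.mult H, one = \<one>, zero = \<zero>, add = add H, module.smult = module.smult H\<rparr>"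

lemma Bt_simps [simp]: "carrier Bt = Ht" "monoid.mult Bt = monoid.mult H" "\<one>\<^bsub>Bt\<^esub> = \<one>" "\<zero>\<^bsub>Bt\<^esub> = \<zero>"
  "add Bt = add H" "module.smult Bt = module.smult H"
  by (simp_all add: Bt_def)

lemma zero_Ht [simp]: "\<zero> \<in> Ht" using Ht_smult[OF one_Ht, of 0] by simp
lemma zero_Hs [simp]: "\<zero> \<in> Hs" using Hs_smult[OF one_Hs, of 0] by simp

lemma Ht_subalgebra: "subalgebra Ht H" by (rule subalgebraI) auto

lemma Bt_kalg: "kalg Bt"
  by (rule kalg_record_cong[OF subalgebra_kalg[OF Ht_subalgebra]]) simp_all

sublocale Bt: kalg Bt by (rule Bt_kalg)

lemma Bt_sum: "(\<And>i. i \<in> I ==> a i \<in> Ht) ==> (\<Oplus>\<^bsub>Bt\<^esub>i\<in>I. a i) = (\<Oplus>i\<in>I. a i)"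
  using klin_finsum[OF Bt.ks ks, of "\<lambda>x. x" I a] by (simp add: klin_def addmap_def)

lemma Bt_eps: "linfun Bt eps" by (simp add: linfun_def eps_add eps_smult)

lemma Bt_expand_z: "x \<in> Ht ==> x = (\<Oplus>\<^bsub>Bt\<^esub>i<N. eps (e i \<otimes> x) \<odot> z i)"
  and Bt_expand_e: "x \<in> Ht ==> x = (\<Oplus>\<^bsub>Bt\<^esub>i<N. eps (x \<otimes> z i) \<odot> e i)"
  by (subst Bt_sum; use Ht_expand_z Ht_expand_e in simp)+

lemma Bt_frame: "frame Bt {..<N} z (\<lambda>i x. eps (e i \<otimes> x))"
  unfolding frame_def
proof (intro conjI ballI)
  show "x = (\<Oplus>\<^bsub>Bt\<^esub>i<N. eps (e i \<otimes> x) \<odot>\<^bsub>Bt\<^esub> z i)" if "x \<in> carrier Bt" for x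
    using Bt_expand_z that by simp
qed (simp_all add: linfun_def r_distr eps_add eps_smult)

lemma Bt_ze_one: "(\<Oplus>\<^bsub>Bt\<^esub>i<N. z i \<otimes> e i) = \<one>"
  by (subst Bt_sum) (simp_all add: ze_one)

text \<open>Expand \<open>a z\<^sub>i\<close> in the \<open>z\<^sub>j\<close>; the coefficients are those of \<open>e\<^sub>j a\<close> in the
  \<open>e\<^sub>i\<close>.\<close>

lemma Bt_separable:
  assumes a: "a \<in> Ht"
  shows "(\<Oplus>\<^bsub>Bt \<otimes>\<^sub>k Bt\<^esub>i<N. tens class_ring Bt Bt (a \<otimes> z i) (e i))
       = (\<Oplus>\<^bsub>Bt \<otimes>\<^sub>k Bt\<^esub>i<N. tens class_ring Bt Bt (z i) (e i \<otimes> a))"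
proof -
  let ?t = "tens class_ring Bt Bt" and ?P = "Bt \<otimes>\<^sub>k Bt"
  note P = Bt.BB.TA_group
  note c [simp] = Bt.BB.tens_closed[unfolded Bt_simps]
  have sm: "?t (c \<odot> x) y = ?t x (c \<odot> y)" if "x \<in> Ht" "y \<in> Ht" for c x y
    using Bt.BB.tens_smult_left[of c x y] Bt.BB.tens_smult_right[of c x y] that by simp
  have "(\<Oplus>\<^bsub>?P\<^esub>i<N. ?t (a \<otimes> z i) (e i)) = (\<Oplus>\<^bsub>?P\<^esub>i<N. \<Oplus>\<^bsub>?P\<^esub>j<N. ?t (z j) (eps (e j \<otimes> (a \<otimes> z i)) \<odot> e i))"
  proof (rule finsum_cong_P[OF P])
    fix i assume i: "i \<in> {..<N}"
    have "?t (a \<otimes> z i) (e i) = ?t (\<Oplus>\<^bsub>Bt\<^esub>j<N. eps (e j \<otimes> (a \<otimes> z i)) \<odot> z j) (e i)"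
      using Bt_expand_z[of "a \<otimes> z i"] a i by simp
    also have "\<dots> = (\<Oplus>\<^bsub>?P\<^esub>j<N. ?t (eps (e j \<otimes> (a \<otimes> z i)) \<odot> z j) (e i))"
      using a i by (intro Bt.BB.tens_finsum_left) auto
    also have "\<dots> = (\<Oplus>\<^bsub>?P\<^esub>j<N. ?t (z j) (eps (e j \<otimes> (a \<otimes> z i)) \<odot> e i))"
      by (rule finsum_cong_P[OF P]) (use a i in \<open>simp_all add: sm\<close>)
    finally show "?t (a \<otimes> z i) (e i) = \<dots>" .
  qed (use a in \<open>auto intro!: finsum_closed_P[OF P]\<close>)
  also have "\<dots> = (\<Oplus>\<^bsub>?P\<^esub>j<N. \<Oplus>\<^bsub>?P\<^esub>i<N. ?t (z j) (eps (e j \<otimes> (a \<otimes> z i)) \<odot> e i))"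
    using a by (intro finsum_swap[OF P]) auto
  also have "\<dots> = (\<Oplus>\<^bsub>?P\<^esub>j<N. ?t (z j) (e j \<otimes> a))"
  proof (rule finsum_cong_P[OF P])
    fix j assume j: "j \<in> {..<N}"
    have "(\<Oplus>\<^bsub>?P\<^esub>i<N. ?t (z j) (eps (e j \<otimes> (a \<otimes> z i)) \<odot> e i))
        = ?t (z j) (\<Oplus>\<^bsub>Bt\<^esub>i<N. eps (e j \<otimes> (a \<otimes> z i)) \<odot> e i)"
      using a j by (intro Bt.BB.tens_finsum_right[symmetric]) auto
    also have "(\<Oplus>\<^bsub>Bt\<^esub>i<N. eps (e j \<otimes> (a \<otimes> z i)) \<odot> e i) = (\<Oplus>\<^bsub>Bt\<^esub>i<N. eps (e j \<otimes> a \<otimes> z i) \<odot> e i)"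
      using a j by (intro Bt.sum_cong) (auto simp: m_assoc)
    also have "\<dots> = e j \<otimes> a" using a j by (intro Bt_expand_e[symmetric]) simp
    finally show "(\<Oplus>\<^bsub>?P\<^esub>i<N. ?t (z j) (eps (e j \<otimes> (a \<otimes> z i)) \<odot> e i)) = ?t (z j) (e j \<otimes> a)" .
  qed (use a in auto)
  finally show ?thesis .
qed

end

locale whopf_base = whopf_legs H N w z
  for H :: "('k::field_char_0, 'h) weak_hopf" (structure) and N w z +
  fixes n X Y
  assumes cas: "casimir Bt n X Y"

lemma whopf_base_exists:
  fixes H :: "('k::field_char_0, 'h) weak_hopf"
  assumes "weak_hopf_algebra H"
  shows "\<exists>N w z n X Y. whopf_base H N w z n X Y"
proof -
  interpret H: whopf H using assms by (simp add: whopf_def)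
  obtain N w z where "whopf_legs H N w z" using H.legs_exist by blast
  then interpret H: whopf_legs H N w z .
  interpret B: fdalg H.Bt by unfold_locales (rule H.Bt.frame_fin_dim[OF H.Bt_frame])
  interpret B: ssalg H.Bt
  proof
    show "semisimple_ring H.Bt"
      by (rule B.separable_semisimple[of N z H.e]) (simp_all add: H.Bt_separable H.Bt_ze_one)
  qed
  obtain n :: nat and X Y where "(\<forall>i<n. X i \<in> carrier H.Bt \<and> Y i \<in> carrier H.Bt) \<and>
     frame H.Bt {..<n} X (\<lambda>i x. B.Tr (x \<otimes>\<^bsub>H.Bt\<^esub> Y i))"
    using B.dual_frame_exists by blast
  then have "casimir H.Bt n X Y" by unfold_locales auto
  then have "whopf_base H N w z n X Y"
    by (intro whopf_base.intro whopf_base_axioms.intro H.whopf_legs_axioms)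
  then show ?thesis by blast
qed

context whopf_base
begin

sublocale Bt: casimir Bt n X Y by (rule cas)

lemma X_Ht [simp]: "i < n ==> X i \<in> Ht" and Y_Ht [simp]: "i < n ==> Y i \<in> Ht"
  using Bt.X Bt.Y by simp_all

sublocale Fr: frobenius Bt n X Y eps N z e
  by unfold_locales (use Bt_expand_z Bt_expand_e Bt_ze_one in \<open>simp_all add: Bt_eps\<close>)

abbreviation "g \<equiv> Fr.g"
abbreviation "u \<equiv> Fr.u"
abbreviation "A \<equiv> Ht \<inter> Hs"
abbreviation "Tr \<equiv> reg_trace Bt"

lemma g_Ht [simp]: "g \<in> Ht" "u \<in> Ht" using Fr.g_closed Fr.u_closed by simp_all
lemma ug [simp]: "u \<otimes> g = \<one>" "g \<otimes> u = \<one>" using Fr.ug Fr.gu by simp_all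

lemma A_subalgebra: "subalgebra A Bt" by (rule Bt.subalgebraI) auto

lemma A_central: "A \<subseteq> ring_center Bt" by (auto simp: ring_center_def intro: Ht_Hs_comm)

sublocale M: hmin Bt n X Y A g
  by unfold_locales (simp_all add: A_subalgebra A_central Fr.g_Units Fr.avg_g[simplified])

lemma eps_Tr: "x \<in> Ht ==> eps x = Tr (u \<otimes> x)"
  using Fr.om_u[of x] by simp

lemma Tr_commute: "x \<in> Ht ==> y \<in> Ht ==> Tr (x \<otimes> y) = Tr (y \<otimes> x)"
  using Bt.Tr_comm[of x y] by simp

text \<open>Comparing \<open>\<epsilon>(x y) = \<epsilon>(y S\<^sup>2 x)\<close> with \<open>\<epsilon> = Tr (u \<cdot>)\<close> gives
  \<open>u x = S\<^sup>2(x) u\<close>.\<close>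

lemma S_S:
  assumes x: "x \<in> Ht"
  shows "S (S x) = u \<otimes> x \<otimes> g"
proof -
  have "u \<otimes> x = S (S x) \<otimes> u"
  proof (rule Bt.Tr_eqI[simplified])
    fix y assume y: "y \<in> Ht"
    have "Tr (u \<otimes> x \<otimes> y) = eps (x \<otimes> y)" using x y by (simp add: eps_Tr m_assoc)
    also have "\<dots> = eps (y \<otimes> S (S x))" using x y by (rule eps_nakayama)
    also have "\<dots> = Tr (u \<otimes> y \<otimes> S (S x))" using x y by (simp add: eps_Tr m_assoc)
    also have "\<dots> = Tr (S (S x) \<otimes> u \<otimes> y)" 
      using x y Tr_commute[of "u \<otimes> y" "S (S x)"] by (simp add: m_assoc)
    finally show "Tr (u \<otimes> x \<otimes> y) = Tr (S (S x) \<otimes> u \<otimes> y)" .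
  qed (use x in auto)
  then show ?thesis using x by (simp add: m_assoc)
qed

subsection \<open>The comparison map\<close>

lemma S_A: "a \<in> A ==> S a = a" by (simp add: S_Ht es_Hs)

definition "Phi = bbar_lift Bt A H (\<lambda>b c. b \<otimes> S c)"

lemma Phi_addmap: "addmap M.W H Phi" and Phi_bb: "b \<in> Ht ==> c \<in> Ht ==> Phi (M.bb b c) = b \<otimes> S c"
proof -
  have bal: "(b \<otimes> a) \<otimes> S c = b \<otimes> S (a \<otimes> c)" if "a \<in> A" "b \<in> Ht" "c \<in> Ht" for a b c
    using that S_A[of a] by (simp add: S_anti_Ht m_assoc Ht_Hs_comm)
  have 1: "addmap M.HA H Phi" unfolding Phi_def
    by (rule M.bbar_lift_addmap) (simp_all add: grp l_distr r_distr S_add bal)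
  then show "addmap M.W H Phi" by (simp add: addmap_def M.W_simps(1,5))
  show "b \<in> Ht ==> c \<in> Ht ==> Phi (M.bb b c) = b \<otimes> S c" unfolding Phi_def
    by (rule M.bbar_lift_bb) (simp_all add: grp l_distr r_distr S_add bal)
qed

lemmas Phi_closed [simp] = addmap_closed[OF Phi_addmap]
lemmas Phi_add = addmap_add[OF Phi_addmap]
lemmas wb_induct [consumes 1, case_names pure add] = M.wb_induct[simplified Bt_simps]

lemma wb_closed [simp]: "b \<in> Ht ==> c \<in> Ht ==> M.bb b c \<in> carrier M.W" using M.wb_closed by simp

lemma wb_mult: "b \<in> Ht ==> c \<in> Ht ==> b' \<in> Ht ==> c' \<in> Ht ==>
    M.bb b c \<otimes>\<^bsub>M.W\<^esub> M.bb b' c' = M.bb (b \<otimes> b') (c' \<otimes> c)"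
  using M.wb_mult[of b c b' c'] by simp

lemma Phi_mult_aux:
  assumes "b \<in> Ht" "c \<in> Ht" "b' \<in> Ht" "c' \<in> Ht"
  shows "b \<otimes> b' \<otimes> S (c' \<otimes> c) = (b \<otimes> S c) \<otimes> (b' \<otimes> S c')"
proof -
  have "b \<otimes> b' \<otimes> S (c' \<otimes> c) = b \<otimes> (b' \<otimes> S c) \<otimes> S c'" using assms by (simp add: S_anti_Ht m_assoc)
  also have "b' \<otimes> S c = S c \<otimes> b'" using assms by (simp add: Ht_Hs_comm)
  finally show ?thesis using assms by (simp add: m_assoc)
qed

lemma Phi_algebra_hom: "Phi \<in> algebra_hom M.W H"
proof (rule algebra_homI)
  show "Phi (h \<otimes>\<^bsub>M.W\<^esub> k) = Phi h \<otimes> Phi k" if "h \<in> carrier M.W" "k \<in> carrier M.W" for h k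
    using that
  proof (induction rule: wb_induct)
    case (pure b c)
    from pure(3,1,2) show ?case
    proof (induction rule: wb_induct)
      case (pure b' c')
      then show ?case by (simp add: wb_mult Phi_bb Phi_mult_aux)
    next
      case (add s t)
      then show ?case by (simp add: M.W.r_distr r_distr Phi_add)
    qed
  next
    case (add s t)
    then show ?case by (simp add: M.W.l_distr l_distr Phi_add)
  qed
  show "Phi (c \<odot>\<^bsub>M.W\<^esub> h) = c \<odot> Phi h" if "h \<in> carrier M.W" for c h
    using that
  proof (induction rule: wb_induct)
    case (pure x y)
    have "c \<odot>\<^bsub>M.W\<^esub> M.bb x y = M.bb (c \<odot> x) y" using M.wb_smult_left[of x y c] pure by simp
    then show ?case using pure by (simp add: Phi_bb)
  next
    case (add s t)
    then show ?case by (simp add: M.W.smult_distr smult_distr Phi_add)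
  qed
  show "Phi \<one>\<^bsub>M.W\<^esub> = \<one>" using M.wb_one by (simp add: Phi_bb)
qed (simp_all add: Phi_add)

lemmas Phi_klin = algebra_hom_klin[OF Phi_algebra_hom]
lemmas PP_klin = tensor_map_klin[OF M.W.ks M.W.ks ks ks Phi_klin Phi_klin]
lemmas PP_tens = tensor_map_tens[OF M.W.ks M.W.ks ks ks Phi_klin Phi_klin]

lemma Phi_comult:
  assumes "h \<in> carrier M.W"
  shows "D (Phi h) = tensor_map class_ring M.W M.W H H Phi Phi (M.D h)"
  using assms
proof (induction rule: wb_induct)
  case (pure b c)
  have bal: "balanced class_ring Bt Bt HH (\<lambda>x y. tH (b \<otimes> S x) (y \<otimes> S c))"
    by (rule balancedI) (use pure in \<open>simp_all add: S_add S_smult r_distr l_distr tH_rules\<close>)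
  have "tensor_map class_ring M.W M.W H H Phi Phi (M.D (M.bb b c))
      = (\<Oplus>\<^bsub>HH\<^esub>i<n. tensor_map class_ring M.W M.W H H Phi Phi (M.tW (M.bb b (g \<otimes> X i)) (M.bb (Y i) c)))"
    using M.D_bb[of b c] M.delta_def[of b c] pure
    by (simp only: Bt_simps, intro klin_finsum[OF M.WW.ks HH.ks PP_klin])
      (auto intro!: M.W.BB.tens_closed)
  also have "\<dots> = (\<Oplus>\<^bsub>HH\<^esub>i<n. tH (b \<otimes> S (g \<otimes> X i)) (Y i \<otimes> S c))"
    using pure by (intro HH.sum_cong) (auto simp: PP_tens Phi_bb)
  also have "\<dots> = D (b \<otimes> S c)"
    using pure Fr.frobenius_casimir[OF HH.grp bal] by (simp add: D_Ht_S)
  finally show ?case using pure by (simp add: Phi_bb)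
next
  case (add s t)
  then show ?case by (simp add: Phi_add D_add M.D_add klin_add[OF PP_klin])
qed

lemma Phi_counit: "h \<in> carrier M.W ==> eps (Phi h) = M.eps h"
proof (induction rule: wb_induct)
  case (pure b c)
  have "eps (b \<otimes> S c) = eps (es c \<otimes> b)" using pure by (simp add: S_Ht Ht_Hs_comm)
  also have "\<dots> = Tr (u \<otimes> c \<otimes> b)" using pure by (simp add: eps_Tr m_assoc)
  finally show ?case using pure M.eps_bb[of b c] by (simp add: Phi_bb Fr.inv_g)
next
  case (add s t)
  then show ?case by (simp add: Phi_add eps_add M.eps_add)
qed

lemma Phi_antipode: "h \<in> carrier M.W ==> S (Phi h) = Phi (M.S h)"
proof (induction rule: wb_induct)
  case (pure b c)
  have "S (b \<otimes> S c) = S (S c) \<otimes> S b"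
    using pure Ht_Hs_comm[of "S (S c)" "S b"] by (simp add: S_mult)
  then show ?case using pure M.S_bb[of b c] by (simp add: Phi_bb Fr.inv_g S_S)
next
  case (add s t)
  then show ?case by (simp add: Phi_add S_add klin_add[OF M.S_klin] klin_closed[OF M.S_klin])
qed

lemma Phi_weak_hopf_hom: "Phi \<in> weak_hopf_hom M.W H"
  unfolding weak_hopf_hom_def using Phi_algebra_hom Phi_comult Phi_counit Phi_antipode by simp

lemma Phi_image: "weak_hopf_subalgebra (Phi ` carrier M.W) H"
  unfolding weak_hopf_subalgebra_def
proof (intro conjI ballI)
  note hom = algebra_homD[OF Phi_algebra_hom]
  have I: "x \<in> carrier M.W ==> Phi x = y ==> y \<in> Phi ` carrier M.W" for x y by blast
  show "subalgebra (Phi ` carrier M.W) H"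
  proof (rule subalgebraI)
    show "\<one> \<in> Phi ` carrier M.W" by (rule I[OF M.W.one_closed hom(4)])
    fix x y assume "x \<in> Phi ` carrier M.W" "y \<in> Phi ` carrier M.W"
    then obtain x' y' where xy: "x' \<in> carrier M.W" "y' \<in> carrier M.W" "x = Phi x'" "y = Phi y'" by blast
    show "x \<oplus> y \<in> Phi ` carrier M.W"
      unfolding xy(3,4) by (rule I[OF M.W.add.m_closed[OF xy(1,2)] hom(3)[OF xy(1,2)]])
    show "x \<otimes> y \<in> Phi ` carrier M.W"
      unfolding xy(3,4) by (rule I[OF M.W.m_closed[OF xy(1,2)] hom(2)[OF xy(1,2)]])
    show "c \<odot> x \<in> Phi ` carrier M.W" for c
      unfolding xy(3) by (rule I[OF M.W.smult_simps(1)[OF xy(1)] hom(5)[OF xy(1)]])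
  qed auto
  fix y assume "y \<in> Phi ` carrier M.W"
  then obtain h where h: "h \<in> carrier M.W" "y = Phi h" by blast
  show "S y \<in> Phi ` carrier M.W"
    unfolding h(2) Phi_antipode[OF h(1)] using klin_closed[OF M.S_klin h(1)] by (rule imageI)
  let ?G = "{tH x y |x y. x \<in> Phi ` carrier M.W \<and> y \<in> Phi ` carrier M.W}"
  have G: "?G \<subseteq> carrier HH" by auto
  have "tensor_map class_ring M.W M.W H H Phi Phi t \<in> LinearCombinations.module.span class_ring HH ?G" if "t \<in> carrier M.WW" for t
    using that
  proof (induction rule: M.W.BB.tensor_induct)
    case (pure a b)
    then have "tH (Phi a) (Phi b) \<in> ?G" by blast
    then show ?case using BB.TA.in_own_span[OF G] pure by (simp only: PP_tens) blast
  next
    case (add s t)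
    then show ?case by (simp only: klin_add[OF PP_klin]) (rule submodule.m_closed[OF BB.TA.span_is_submodule[OF G]])
  qed
  then show "D y \<in> LinearCombinations.module.span class_ring HH ?G" unfolding h(2) Phi_comult[OF h(1)] using klin_closed[OF M.D_klin h(1)] by blast
qed

lemma Phi_surj:
  assumes "minimal_weak_hopf_algebra H"
  shows "Phi ` carrier M.W = carrier H"
  using assms Phi_image by (simp add: minimal_weak_hopf_algebra_def)

end

section \<open>The enveloping algebra\<close>

text \<open>A right identity \<open>i\<close> of \<open>I\<close> is also a left identity: for \<open>x \<in> I\<close> the element \<open>y =
  x - i x\<close> satisfies \<open>y B y = 0\<close>, so the idempotent that generates \<open>B y\<close> vanishes.\<close>

lemma (in ssalg) two_sided_ideal_idempotent:
  assumes I: "left_ideal I B" and right: "\<And>x y. x \<in> I ==> y \<in> carrier B ==> x \<otimes> y \<in> I"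
  shows "\<exists>i\<in>I. i \<in> ring_center B \<and> (\<forall>x\<in>I. x \<otimes> i = x)"
proof -
  interpret S: additive_subgroup I B using I by (simp add: left_ideal_def)
  have Ic: "x \<in> carrier B" if "x \<in> I" for x using that S.a_subset by blast
  have left: "y \<otimes> x \<in> I" if "x \<in> I" "y \<in> carrier B" for x y using I that by (simp add: left_ideal_def)
  have minus: "x \<ominus> y \<in> I" if "x \<in> I" "y \<in> I" for x y
    using that by (simp add: a_minus_def S.a_closed S.a_inv_closed)
  obtain i where i: "i \<in> I" "i \<otimes> i = i" "\<forall>x\<in>I. x \<otimes> i = x" using left_ideal_idempotent[OF I] by blast
  have "i \<otimes> x = x" if x: "x \<in> I" for x
  proof -
    define y where "y = x \<ominus> i \<otimes> x"
    have y: "y \<in> I" unfolding y_def using x i(1) by (intro minus right) (auto intro: Ic)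
    have iy: "i \<otimes> y = \<zero>" using x i(1,2) Ic by (simp add: y_def a_minus_def r_distr r_minus r_neg flip: m_assoc)
    have nil: "y \<otimes> t \<otimes> y = \<zero>" if t: "t \<in> carrier B" for t
    proof -
      have "y \<otimes> t \<otimes> y = (y \<otimes> t \<otimes> i) \<otimes> y" using i(3) right[OF y t] by simp
      then show ?thesis using iy Ic[OF y] Ic[OF i(1)] t by (simp add: m_assoc)
    qed
    have L: "left_ideal ((\<lambda>t. t \<otimes> y) ` carrier B) B"
    proof (rule left_idealI)
      show "\<zero> \<in> (\<lambda>t. t \<otimes> y) ` carrier B" by (rule image_eqI[of _ _ \<zero>]) (simp_all add: Ic y)
      fix a b assume a: "a \<in> (\<lambda>t. t \<otimes> y) ` carrier B"
      then obtain s where s: "a = s \<otimes> y" "s \<in> carrier B" by blast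
      show "b \<otimes> a \<in> (\<lambda>t. t \<otimes> y) ` carrier B" if "b \<in> carrier B"
        by (rule image_eqI[of _ _ "b \<otimes> s"]) (simp_all add: s that Ic y m_assoc)
      assume "b \<in> (\<lambda>t. t \<otimes> y) ` carrier B"
      then obtain t where t: "b = t \<otimes> y" "t \<in> carrier B" by blast
      show "a \<oplus> b \<in> (\<lambda>t. t \<otimes> y) ` carrier B"
        by (rule image_eqI[of _ _ "s \<oplus> t"]) (simp_all add: s t Ic y l_distr)
    qed (use Ic[OF y] in auto)
    obtain j where j: "j \<in> (\<lambda>t. t \<otimes> y) ` carrier B" "\<forall>x\<in>(\<lambda>t. t \<otimes> y) ` carrier B. x \<otimes> j = x"
      using left_ideal_idempotent[OF L] by blast
    then obtain t where t: "j = t \<otimes> y" "t \<in> carrier B" by blast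
    have "y \<in> (\<lambda>t. t \<otimes> y) ` carrier B" by (rule image_eqI[of _ _ \<one>]) (simp_all add: Ic y)
    then have "y \<otimes> j = y" using j(2) by blast
    then have "y = \<zero>" using nil[OF t(2)] t Ic[OF y] by (simp add: m_assoc)
    then show ?thesis using x i(1) Ic by (simp add: y_def)
  qed
  then have "i \<otimes> t = t \<otimes> i" if "t \<in> carrier B" for t
    using i(3) left[OF i(1) that] right[OF i(1) that] that Ic[OF i(1)] by (metis m_assoc)
  then show ?thesis using i Ic by (auto simp: ring_center_def)
qed

text \<open>A double sum as a single one; separability elements are indexed by an initial segment of the naturals.\<close>

lemma finsum_div_mod:
  assumes P: "abelian_group P" and f: "\<And>i j. i < m ==> j < n ==> f i j \<in> carrier P"
  shows "(\<Oplus>\<^bsub>P\<^esub>k<m * n. f (k div n) (k mod n)) = (\<Oplus>\<^bsub>P\<^esub>i<m. \<Oplus>\<^bsub>P\<^esub>j\<in>{..<n::nat}. f i j)"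
proof -
  interpret P: abelian_group P by fact
  show ?thesis using f
  proof (induction m)
    case (Suc m)
    have sp: "{..<Suc m * n} = {..<m * n} \<union> (\<lambda>j. m * n + j) ` {..<n}"
    proof (intro equalityI subsetI)
      fix k assume "k \<in> {..<Suc m * n}"
      then show "k \<in> {..<m * n} \<union> (\<lambda>j. m * n + j) ` {..<n}"
        by (cases "k < m * n") (auto intro!: image_eqI[of _ _ "k - m * n"])
    qed auto
    have c: "f (k div n) (k mod n) \<in> carrier P" if "k < Suc m * n" for k
    proof (rule Suc.prems)
      show "k div n < Suc m" using that by (metis less_mult_imp_div_less)
      show "k mod n < n" using that by (cases n) auto
    qed
    have "(\<Oplus>\<^bsub>P\<^esub>k\<in>(\<lambda>j. m * n + j) ` {..<n}. f (k div n) (k mod n)) = (\<Oplus>\<^bsub>P\<^esub>j<n. f m j)"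
      by (subst P.add.finprod_reindex) (auto intro!: Suc.prems inj_onI finsum_cong_P[OF P])
    moreover have "(\<Oplus>\<^bsub>P\<^esub>k<Suc m * n. f (k div n) (k mod n))
        = (\<Oplus>\<^bsub>P\<^esub>k<m * n. f (k div n) (k mod n)) \<oplus>\<^bsub>P\<^esub> (\<Oplus>\<^bsub>P\<^esub>k\<in>(\<lambda>j. m * n + j) ` {..<n}. f (k div n) (k mod n))"
      unfolding sp by (rule P.add.finprod_Un_disjoint) (auto intro!: c)
    moreover have "(\<Oplus>\<^bsub>P\<^esub>k<m * n. f (k div n) (k mod n)) = (\<Oplus>\<^bsub>P\<^esub>i<m. \<Oplus>\<^bsub>P\<^esub>j<n. f i j)"
      using Suc by simp
    ultimately show ?case
      using Suc.prems by (simp add: lessThan_Suc P.a_comm finsum_closed_P[OF P] Pi_def)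
  qed simp
qed

lemma opposite_kalg:
  fixes B :: "('k::field, 'b) module" (structure)
  assumes "kalg B"
  shows "kalg (opposite B)"
proof -
  interpret kalg B by fact
  have s: "carrier (opposite B) = carrier B" "add (opposite B) = add B" "zero (opposite B) = zero B"
    "module.smult (opposite B) = module.smult B" "monoid.mult (opposite B) = (\<lambda>x y. y \<otimes> x)" "one (opposite B) = one B"
    by (simp_all add: opposite_def)
  have "ring (opposite B)"
  proof (rule ringI[OF abelian_groupI monoidI], goal_cases)
    case 6
    then show ?case using l_neg a_inv_closed by (auto simp: s)
  qed (simp_all add: s a_ac m_assoc l_distr r_distr)
  then show ?thesis
    using module_cong[OF module_V s(1-4)] by (simp add: kalg_def k_algebra_iff algebra_over_def s)
qed

locale enveloping = casimir B n X Y for B :: "('k::field_char_0, 'b) module" (structure) and n X Y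
begin

abbreviation "Bo \<equiv> opposite B"
abbreviation "T \<equiv> B \<otimes>\<^sub>k Bo"
abbreviation "tT \<equiv> tens class_ring B Bo"

sublocale Bo: kalg Bo by (rule opposite_kalg[OF kalg_axioms])
sublocale TT: algebra_pair class_ring B Bo by (rule algebra_pairI[OF k_algebra_B Bo.k_algebra_B])
lemma T_kalg: "kalg T" using TT.algebra_over_TA by (simp add: kalg_def k_algebra_iff)
sublocale T: kalg T by (rule T_kalg)

lemma Bo_simps [simp]: "carrier Bo = carrier B" "add Bo = add B" "\<one>\<^bsub>Bo\<^esub> = \<one>" "\<zero>\<^bsub>Bo\<^esub> = \<zero>"
  "module.smult Bo = module.smult B" "x \<otimes>\<^bsub>Bo\<^esub> y = y \<otimes> x"
  by (simp_all add: opposite_def)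

lemma Bo_finsum: "(\<And>i. i \<in> I ==> a i \<in> carrier B) ==> (\<Oplus>\<^bsub>Bo\<^esub>i\<in>I. a i) = (\<Oplus>i\<in>I. a i)"
  using addmap_finsum[OF Bo.grp grp, of "\<lambda>x. x" I a] by (simp add: addmap_def)

lemmas tT_rules = TT.tens_rules[simplified]
lemmas tT_closed [simp] = tT_rules(1)
lemmas T_induct [consumes 1, case_names pure add] = TT.tensor_induct[simplified]
lemmas T_one = TT.one_TA[simplified]

lemma tT_mult: "b \<in> carrier B ==> c \<in> carrier B ==> b' \<in> carrier B ==> c' \<in> carrier B ==>
    tT b c \<otimes>\<^bsub>T\<^esub> tT b' c' = tT (b \<otimes> b') (c' \<otimes> c)"
  using TT.tens_mult[of b c b' c'] by simp

lemma tT_sums: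
  assumes "\<And>i. i \<in> I ==> a i \<in> carrier B" "\<And>j. j \<in> J ==> b j \<in> carrier B"
  shows "(\<Oplus>\<^bsub>T\<^esub>i\<in>I. \<Oplus>\<^bsub>T\<^esub>j\<in>J. tT (a i) (b j)) = tT (\<Oplus>i\<in>I. a i) (\<Oplus>j\<in>J. b j)"
proof -
  have b: "(\<Oplus>j\<in>J. b j) \<in> carrier B" using assms by (intro finsum_closed) auto
  have "tT (\<Oplus>i\<in>I. a i) (\<Oplus>j\<in>J. b j) = (\<Oplus>\<^bsub>T\<^esub>i\<in>I. tT (a i) (\<Oplus>j\<in>J. b j))"
    using assms b by (intro TT.tens_finsum_left) auto
  also have "\<dots> = (\<Oplus>\<^bsub>T\<^esub>i\<in>I. \<Oplus>\<^bsub>T\<^esub>j\<in>J. tT (a i) (b j))"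
  proof (rule T.sum_cong)
    show "tT (a i) (\<Oplus>j\<in>J. b j) = (\<Oplus>\<^bsub>T\<^esub>j\<in>J. tT (a i) (b j))" if "i \<in> I" for i
      using TT.tens_finsum_right[of J b "a i"] Bo_finsum[of J b] assms that by simp
  qed (use assms in \<open>auto intro!: finsum_closed_P[OF T.grp]\<close>)
  finally show ?thesis by simp
qed

definition "XX k = tT (X (k div n)) (X (k mod n))"
definition "YY k = tT (Y (k div n)) (Y (k mod n))"

lemma div_mod [simp]: "k < n * n ==> k div n < n" "k < n * n ==> k mod n < n"
  by (metis less_mult_imp_div_less) (cases n, auto)

lemma XX_closed [simp]: "k < n * n ==> XX k \<in> carrier T" and YY_closed [simp]: "k < n * n ==> YY k \<in> carrier T"
  by (simp_all add: XX_def YY_def)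

lemma XX_YY_tT:
  assumes "b \<in> carrier B" "c \<in> carrier B"
  shows "(\<Oplus>\<^bsub>T\<^esub>k<n * n. XX k \<otimes>\<^bsub>T\<^esub> tT b c \<otimes>\<^bsub>T\<^esub> YY k) = tT (avg b) (avg c)"
proof -
  have "(\<Oplus>\<^bsub>T\<^esub>k<n * n. XX k \<otimes>\<^bsub>T\<^esub> tT b c \<otimes>\<^bsub>T\<^esub> YY k)
      = (\<Oplus>\<^bsub>T\<^esub>k<n * n. (\<lambda>i j. tT (X i \<otimes> (b \<otimes> Y i)) (Y j \<otimes> (c \<otimes> X j))) (k div n) (k mod n))"
    using assms by (intro T.sum_cong) (auto simp: XX_def YY_def tT_mult m_assoc)
  also have "\<dots> = (\<Oplus>\<^bsub>T\<^esub>i<n. \<Oplus>\<^bsub>T\<^esub>j<n. tT (X i \<otimes> (b \<otimes> Y i)) (Y j \<otimes> (c \<otimes> X j)))"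
    using assms by (intro finsum_div_mod[OF T.grp]) auto
  also have "\<dots> = tT (avg b) (\<Oplus>j<n. Y j \<otimes> (c \<otimes> X j))"
    unfolding avg_def using assms by (intro tT_sums) auto
  also have "(\<Oplus>j<n. Y j \<otimes> (c \<otimes> X j)) = avg c"
    unfolding avg_def using casimir_sym[OF grp avg_balanced[OF assms(2)]] by simp
  finally show ?thesis .
qed

lemma avg_one: "avg \<one> = \<one>"
  unfolding avg_def by (rule trans[OF sum_cong casimir_one]) auto

lemma XX_YY_one: "(\<Oplus>\<^bsub>T\<^esub>k<n * n. XX k \<otimes>\<^bsub>T\<^esub> YY k) = \<one>\<^bsub>T\<^esub>"
proof -
  have "(\<Oplus>\<^bsub>T\<^esub>k<n * n. XX k \<otimes>\<^bsub>T\<^esub> YY k) = (\<Oplus>\<^bsub>T\<^esub>k<n * n. XX k \<otimes>\<^bsub>T\<^esub> tT \<one> \<one> \<otimes>\<^bsub>T\<^esub> YY k)"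
    by (intro T.sum_cong) (auto simp flip: T_one)
  then show ?thesis using XX_YY_tT[of \<one> \<one>] by (simp add: avg_one T_one)
qed

lemma T_fin_dim: "T.vs.fin_dim"
proof -
  let ?G = "XX ` {..<n * n}"
  have G: "?G \<subseteq> carrier T" by auto
  note sp = TT.TA.span_is_submodule[OF G]
  have sum: "(\<Oplus>\<^bsub>T\<^esub>k\<in>K. a k) \<in> TT.TA.span ?G" if "finite K" "\<And>k. k \<in> K ==> a k \<in> TT.TA.span ?G" for K :: "nat set" and a
    using that
  proof (induction K)
    case empty
    show ?case using submodule.zero_closed[OF sp] abelian_monoid.finsum_empty[OF abelian_group.axioms(1)[OF T.grp]] by simp
  next
    case (insert k K)
    have "a i \<in> carrier T" if "i \<in> insert k K" for i
      by (rule subsetD[OF submodule.subset[OF sp] insert.prems[OF that]])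
    then show ?case using insert by (simp add: Pi_def submodule.m_closed[OF sp])
  qed
  have pure: "tT b c \<in> TT.TA.span ?G" if bc: "b \<in> carrier B" "c \<in> carrier B" for b c
  proof -
    have "tT b c = tT (\<Oplus>i<n. Tr (b \<otimes> Y i) \<odot> X i) (\<Oplus>j<n. Tr (c \<otimes> Y j) \<odot> X j)"
      using expand_X[OF bc(1)] expand_X[OF bc(2)] by simp
    also have "\<dots> = (\<Oplus>\<^bsub>T\<^esub>i<n. \<Oplus>\<^bsub>T\<^esub>j<n. tT (Tr (b \<otimes> Y i) \<odot> X i) (Tr (c \<otimes> Y j) \<odot> X j))"
      by (rule tT_sums[symmetric]) auto
    also have "\<dots> = (\<Oplus>\<^bsub>T\<^esub>k<n * n. (\<lambda>i j. tT (Tr (b \<otimes> Y i) \<odot> X i) (Tr (c \<otimes> Y j) \<odot> X j)) (k div n) (k mod n))"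
      by (rule finsum_div_mod[OF T.grp, symmetric]) auto
    also have "\<dots> \<in> TT.TA.span ?G"
    proof (rule sum)
      fix k assume k: "k \<in> {..<n * n}"
      then have "XX k \<in> TT.TA.span ?G" using TT.TA.in_own_span[OF G] by blast
      then show "(\<lambda>i j. tT (Tr (b \<otimes> Y i) \<odot> X i) (Tr (c \<otimes> Y j) \<odot> X j)) (k div n) (k mod n) \<in> TT.TA.span ?G"
        using k by (simp add: tT_rules XX_def[symmetric] submodule.smult_closed[OF sp])
    qed simp
    finally show ?thesis .
  qed
  have "t \<in> TT.TA.span ?G" if "t \<in> carrier T" for t
    using that by (induction rule: T_induct) (simp_all add: pure submodule.m_closed[OF sp])
  then have "TT.TA.span ?G = carrier T" using submodule.subset[OF sp] by blast
  then show ?thesis unfolding T.vs.fin_dim_def using G by blast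
qed

text \<open>The Casimir element of \<open>B\<close> in the first leg and its mirror image in the second.\<close>

lemma T_separable:
  assumes a: "a \<in> carrier T"
  shows "(\<Oplus>\<^bsub>T \<otimes>\<^sub>k T\<^esub>k<n * n. tens class_ring T T (a \<otimes>\<^bsub>T\<^esub> XX k) (YY k))
       = (\<Oplus>\<^bsub>T \<otimes>\<^sub>k T\<^esub>k<n * n. tens class_ring T T (XX k) (YY k \<otimes>\<^bsub>T\<^esub> a))"
  using a
proof (induction rule: T_induct)
  case (pure b c)
  let ?t = "tens class_ring T T" and ?P = "T \<otimes>\<^sub>k T"
  note P = T.BB.TA_group
  note cl [simp] = T.BB.tens_closed
  have b1: "balanced class_ring B B ?P (\<lambda>x y. ?t (tT x (X j \<otimes> c)) (tT y (Y j)))" if "j < n" for j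
    using pure that by (intro balancedI) (simp_all add: tT_rules T.BB.tens_rules)
  have b2: "balanced class_ring B B ?P (\<lambda>x y. ?t (tT (X i) x) (tT (Y i \<otimes> b) y))" if "i < n" for i
    using pure that by (intro balancedI) (simp_all add: tT_rules T.BB.tens_rules)
  have "(\<Oplus>\<^bsub>?P\<^esub>k<n * n. ?t (tT b c \<otimes>\<^bsub>T\<^esub> XX k) (YY k))
      = (\<Oplus>\<^bsub>?P\<^esub>k<n * n. (\<lambda>i j. ?t (tT (b \<otimes> X i) (X j \<otimes> c)) (tT (Y i) (Y j))) (k div n) (k mod n))"
    using pure by (intro finsum_cong_P[OF P]) (auto simp: XX_def YY_def tT_mult)
  also have "\<dots> = (\<Oplus>\<^bsub>?P\<^esub>i<n. \<Oplus>\<^bsub>?P\<^esub>j<n. ?t (tT (b \<otimes> X i) (X j \<otimes> c)) (tT (Y i) (Y j)))"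
    using pure by (intro finsum_div_mod[OF P]) auto
  also have "\<dots> = (\<Oplus>\<^bsub>?P\<^esub>j<n. \<Oplus>\<^bsub>?P\<^esub>i<n. ?t (tT (b \<otimes> X i) (X j \<otimes> c)) (tT (Y i) (Y j)))"
    using pure by (intro finsum_swap[OF P]) auto
  also have "\<dots> = (\<Oplus>\<^bsub>?P\<^esub>j<n. \<Oplus>\<^bsub>?P\<^esub>i<n. ?t (tT (X i) (X j \<otimes> c)) (tT (Y i \<otimes> b) (Y j)))"
    by (rule finsum_cong_P[OF P]) (use pure in \<open>auto intro!: casimir_left[OF P b1] finsum_closed_P[OF P]\<close>)
  also have "\<dots> = (\<Oplus>\<^bsub>?P\<^esub>i<n. \<Oplus>\<^bsub>?P\<^esub>j<n. ?t (tT (X i) (X j \<otimes> c)) (tT (Y i \<otimes> b) (Y j)))"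
    using pure by (intro finsum_swap[OF P]) auto
  also have "\<dots> = (\<Oplus>\<^bsub>?P\<^esub>i<n. \<Oplus>\<^bsub>?P\<^esub>j<n. ?t (tT (X i) (X j)) (tT (Y i \<otimes> b) (c \<otimes> Y j)))"
    by (rule finsum_cong_P[OF P]) (use pure in \<open>auto intro!: casimir_right[OF P b2] finsum_closed_P[OF P]\<close>)
  also have "\<dots> = (\<Oplus>\<^bsub>?P\<^esub>k<n * n. (\<lambda>i j. ?t (tT (X i) (X j)) (tT (Y i \<otimes> b) (c \<otimes> Y j))) (k div n) (k mod n))"
    using pure by (intro finsum_div_mod[OF P, symmetric]) auto
  also have "\<dots> = (\<Oplus>\<^bsub>?P\<^esub>k<n * n. ?t (XX k) (YY k \<otimes>\<^bsub>T\<^esub> tT b c))"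
    using pure by (intro finsum_cong_P[OF P]) (auto simp: XX_def YY_def tT_mult)
  finally show ?case .
next
  case (add s t)
  let ?t = "tens class_ring T T" and ?P = "T \<otimes>\<^sub>k T"
  note P = T.BB.TA_group
  note cl [simp] = T.BB.tens_closed
  have "(\<Oplus>\<^bsub>?P\<^esub>k<n * n. ?t ((s \<oplus>\<^bsub>T\<^esub> t) \<otimes>\<^bsub>T\<^esub> XX k) (YY k))
      = (\<Oplus>\<^bsub>?P\<^esub>k<n * n. ?t (s \<otimes>\<^bsub>T\<^esub> XX k) (YY k) \<oplus>\<^bsub>?P\<^esub> ?t (t \<otimes>\<^bsub>T\<^esub> XX k) (YY k))"
    using add by (intro finsum_cong_P[OF P]) (auto simp: T.l_distr T.BB.tens_rules intro!: abelian_monoid.a_closed[OF abelian_group.axioms(1)[OF P]])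
  also have "\<dots> = (\<Oplus>\<^bsub>?P\<^esub>k<n * n. ?t (XX k) (YY k \<otimes>\<^bsub>T\<^esub> s)) \<oplus>\<^bsub>?P\<^esub> (\<Oplus>\<^bsub>?P\<^esub>k<n * n. ?t (XX k) (YY k \<otimes>\<^bsub>T\<^esub> t))"
    using add by (subst finsum_addf_P[OF P]) auto
  also have "\<dots> = (\<Oplus>\<^bsub>?P\<^esub>k<n * n. ?t (XX k) (YY k \<otimes>\<^bsub>T\<^esub> s) \<oplus>\<^bsub>?P\<^esub> ?t (XX k) (YY k \<otimes>\<^bsub>T\<^esub> t))"
    using add by (intro finsum_addf_P[OF P, symmetric]) auto
  also have "\<dots> = (\<Oplus>\<^bsub>?P\<^esub>k<n * n. ?t (XX k) (YY k \<otimes>\<^bsub>T\<^esub> (s \<oplus>\<^bsub>T\<^esub> t)))"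
    using add by (intro finsum_cong_P[OF P]) (auto simp: T.r_distr T.BB.tens_rules)
  finally show ?case .
qed

lemma T_ssalg: "ssalg T"
proof -
  interpret T: fdalg T by unfold_locales (rule T_fin_dim)
  have "semisimple_ring T"
    by (rule T.separable_semisimple[of "n * n" XX YY]) (simp_all add: T_separable XX_YY_one)
  then show ?thesis by unfold_locales
qed

text \<open>Averaging over the separability element fixes the central element \<open>p\<close> and makes each leg of each summand central.\<close>

lemma T_center:
  assumes p: "p \<in> ring_center T"
  shows "\<exists>m a b. (\<forall>r<m. a r \<in> ring_center B \<and> b r \<in> ring_center B) \<and> p = (\<Oplus>\<^bsub>T\<^esub>r\<in>{..<m::nat}. tT (a r) (b r))"
proof -
  have pc: "p \<in> carrier T" and comm: "\<And>t. t \<in> carrier T ==> p \<otimes>\<^bsub>T\<^esub> t = t \<otimes>\<^bsub>T\<^esub> p"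
    using p by (auto simp: ring_center_def)
  obtain m :: nat and b c where bc: "\<forall>r<m. b r \<in> carrier B \<and> c r \<in> carrier B" "p = (\<Oplus>\<^bsub>T\<^esub>r<m. tT (b r) (c r))"
    using TT.tensor_sum_exists[OF pc] by auto
  define K where "K t = (\<Oplus>\<^bsub>T\<^esub>k<n * n. XX k \<otimes>\<^bsub>T\<^esub> t \<otimes>\<^bsub>T\<^esub> YY k)" for t
  have K: "addmap T T K"
  proof (rule addmapI)
    fix s t assume st: "s \<in> carrier T" "t \<in> carrier T"
    have "K (s \<oplus>\<^bsub>T\<^esub> t) = (\<Oplus>\<^bsub>T\<^esub>k<n * n. XX k \<otimes>\<^bsub>T\<^esub> s \<otimes>\<^bsub>T\<^esub> YY k \<oplus>\<^bsub>T\<^esub> XX k \<otimes>\<^bsub>T\<^esub> t \<otimes>\<^bsub>T\<^esub> YY k)"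
      unfolding K_def using st by (intro T.sum_cong) (auto simp: T.l_distr T.r_distr)
    also have "\<dots> = K s \<oplus>\<^bsub>T\<^esub> K t" unfolding K_def using st by (intro finsum_addf_P[OF T.grp]) auto
    finally show "K (s \<oplus>\<^bsub>T\<^esub> t) = K s \<oplus>\<^bsub>T\<^esub> K t" .
  qed (auto simp: K_def intro!: finsum_closed_P[OF T.grp])
  have "K p = (\<Oplus>\<^bsub>T\<^esub>k<n * n. p \<otimes>\<^bsub>T\<^esub> (XX k \<otimes>\<^bsub>T\<^esub> YY k))"
    unfolding K_def using pc by (intro T.sum_cong) (auto simp: T.m_assoc simp flip: comm)
  also have "\<dots> = p \<otimes>\<^bsub>T\<^esub> \<one>\<^bsub>T\<^esub>"
    unfolding XX_YY_one[symmetric] using pc by (intro T.finsum_rdistr[symmetric]) auto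
  finally have "p = K (\<Oplus>\<^bsub>T\<^esub>r<m. tT (b r) (c r))" using pc bc(2) by simp
  also have "\<dots> = (\<Oplus>\<^bsub>T\<^esub>r<m. K (tT (b r) (c r)))" using bc(1) by (intro addmap_finsum[OF T.grp T.grp K]) auto
  also have "\<dots> = (\<Oplus>\<^bsub>T\<^esub>r<m. tT (avg (b r)) (avg (c r)))"
    using bc(1) by (intro T.sum_cong) (auto simp: K_def XX_YY_tT avg_closed)
  finally show ?thesis using bc(1) avg_central by (intro exI[of _ m] exI[of _ "\<lambda>r. avg (b r)"] exI[of _ "\<lambda>r. avg (c r)"]) auto
qed

end

section \<open>Minimal weak Hopf algebras come from triples\<close>

locale whopf_min = whopf_base H N w z n X Y
  for H :: "('k::field_char_0, 'h) weak_hopf" (structure) and N w z n X Y +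
  assumes minimal: "minimal_weak_hopf_algebra H"
begin

sublocale E: enveloping Bt n X Y ..

abbreviation "T \<equiv> E.T"
abbreviation "tT \<equiv> E.tT"

lemmas wb_rules = M.wb_rules[simplified Bt_simps]
lemmas T_induct [consumes 1, case_names pure add] = E.T_induct[simplified Bt_simps]
lemmas tT_rules = E.tT_rules[simplified Bt_simps]
lemmas tT_closed [simp] = tT_rules(1)
lemmas tT_mult = E.tT_mult[simplified Bt_simps]

definition "q = tensor_lift class_ring Bt E.Bo M.W M.bb"

lemma q_balanced: "balanced class_ring Bt E.Bo M.W M.bb"
  by (rule balancedI) (simp_all add: wb_rules)

lemma q_klin: "klin T M.W q"
  unfolding q_def by (rule lift_klin[OF Bt.ks E.Bo.ks M.W.ks q_balanced])
    (simp add: wb_rules)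

lemma q_t: "x \<in> Ht ==> y \<in> Ht ==> q (tT x y) = M.bb x y"
  unfolding q_def by (rule E.TT.lift_tens[OF M.W.grp q_balanced]) simp_all

lemmas q_closed [simp] = klin_closed[OF q_klin]
lemmas q_add = klin_add[OF q_klin]

lemma q_mult: "s \<in> carrier T ==> t \<in> carrier T ==> q (s \<otimes>\<^bsub>T\<^esub> t) = q s \<otimes>\<^bsub>M.W\<^esub> q t"
proof (induction rule: T_induct)
  case (pure x y)
  from pure(3,1,2) show ?case
    by (induction rule: T_induct) (simp_all add: tT_mult q_t wb_mult E.T.r_distr M.W.r_distr q_add)
next
  case (add s s')
  then show ?case by (simp add: E.T.l_distr M.W.l_distr q_add)
qed

lemma q_surj: "h \<in> carrier M.W ==> \<exists>t\<in>carrier T. q t = h"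
proof (induction rule: wb_induct)
  case (pure x y)
  then show ?case by (intro bexI[of _ "tT x y"]) (simp_all add: q_t)
next
  case (add s t)
  then obtain s' t' where "s' \<in> carrier T" "t' \<in> carrier T" "q s' = s" "q t' = t" by blast
  then show ?case by (intro bexI[of _ "s' \<oplus>\<^bsub>T\<^esub> t'"]) (simp_all add: q_add)
qed

definition "phi t = Phi (q t)"

lemma phi_klin: "klin T H phi"
  unfolding phi_def by (rule klin_comp[OF q_klin Phi_klin])

lemmas phi_closed [simp] = klin_closed[OF phi_klin]
lemmas phi_add = klin_add[OF phi_klin]
lemmas phi_smult = klin_smult[OF phi_klin]

lemma phi_t: "x \<in> Ht ==> y \<in> Ht ==> phi (tT x y) = x \<otimes> S y"
  by (simp add: phi_def q_t Phi_bb)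

lemma phi_mult: "s \<in> carrier T ==> t \<in> carrier T ==> phi (s \<otimes>\<^bsub>T\<^esub> t) = phi s \<otimes> phi t"
  by (simp add: phi_def q_mult algebra_homD(2)[OF Phi_algebra_hom])

lemma T_one: "\<one>\<^bsub>T\<^esub> = tT \<one> \<one>" by (simp add: E.T_one)

lemma phi_one: "phi \<one>\<^bsub>T\<^esub> = \<one>" by (simp add: T_one phi_t)

lemma phi_surj: "h \<in> carrier H ==> \<exists>t\<in>carrier T. phi t = h"
proof -
  assume "h \<in> carrier H"
  then obtain k where "k \<in> carrier M.W" "h = Phi k" using Phi_surj[OF minimal] by blast
  then show ?thesis using q_surj[of k] by (auto simp: phi_def)
qed

lemma (in kspace) add_neg: "x \<in> carrier V ==> x \<oplus> (- 1) \<odot> x = \<zero>"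
  using smult_distr(2)[of x 1 "- 1"] by simp

lemma (in kspace) add_neg_eqD:
  assumes "x \<in> carrier V" "y \<in> carrier V" "x \<oplus> (- 1) \<odot> y = \<zero>"
  shows "x = y"
  using minus_equality[OF assms(3)] minus_smult[of "(- 1) \<odot> y"] assms(1,2) by (simp add: smult_distr(3))

lemma phi_zero: "phi \<zero>\<^bsub>T\<^esub> = \<zero>" by (rule addmap_zero[OF E.T.grp grp klin_addmap[OF phi_klin]])

text \<open>With \<open>i\<close> the identity element of the kernel, \<open>p = 1 - i\<close>.\<close>

lemma kernel_idempotent:
  "\<exists>p\<in>ring_center T. phi p = \<one> \<and> (\<forall>t\<in>carrier T. phi t = \<zero> \<longrightarrow> t \<otimes>\<^bsub>T\<^esub> p = \<zero>\<^bsub>T\<^esub>)"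
proof -
  interpret ET: ssalg T by (rule E.T_ssalg)
  let ?I = "{t \<in> carrier T. phi t = \<zero>}"
  have L: "left_ideal ?I T"
    by (rule E.T.left_idealI) (auto simp: phi_add phi_mult phi_zero)
  have "\<exists>i\<in>?I. i \<in> ring_center T \<and> (\<forall>x\<in>?I. x \<otimes>\<^bsub>T\<^esub> i = x)"
    by (rule ET.two_sided_ideal_idempotent[OF L]) (auto simp: phi_mult)
  then obtain i where i: "i \<in> carrier T" "phi i = \<zero>" "i \<in> ring_center T" "\<forall>x\<in>?I. x \<otimes>\<^bsub>T\<^esub> i = x" by blast
  define p where "p = \<one>\<^bsub>T\<^esub> \<oplus>\<^bsub>T\<^esub> (- 1) \<odot>\<^bsub>T\<^esub> i"
  have "p \<in> ring_center T"
    using i(1,3) by (simp add: ring_center_def p_def E.T.l_distr E.T.r_distr)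
  moreover have "phi p = \<one>" using i(1,2) by (simp add: p_def phi_add phi_smult phi_one)
  moreover have "t \<otimes>\<^bsub>T\<^esub> p = \<zero>\<^bsub>T\<^esub>" if "t \<in> carrier T" "phi t = \<zero>" for t
    using that i(1,4) by (simp add: p_def E.T.r_distr E.T.add_neg)
  ultimately show ?thesis by blast
qed

end

locale whopf_idem = whopf_min H N w z n X Y
  for H :: "('k::field_char_0, 'h) weak_hopf" (structure) and N w z n X Y +
  fixes p m a b
  assumes p: "p \<in> carrier T" "phi p = \<one>" "\<And>t. t \<in> carrier T ==> phi t = \<zero> ==> t \<otimes>\<^bsub>T\<^esub> p = \<zero>\<^bsub>T\<^esub>"
    and ab_center: "\<And>r. r < (m::nat) ==> a r \<in> ring_center Bt" "\<And>r. r < m ==> b r \<in> ring_center Bt"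
    and p_sum: "p = (\<Oplus>\<^bsub>T\<^esub>r<m. tT (a r) (b r))"
begin

lemma ab [simp]: "r < m ==> a r \<in> Ht" "r < m ==> b r \<in> Ht"
  using ab_center by (simp_all add: ring_center_def)

lemma ab_comm: "r < m ==> x \<in> Ht ==> a r \<otimes> x = x \<otimes> a r" "r < m ==> x \<in> Ht ==> b r \<otimes> x = x \<otimes> b r"
  using ab_center by (simp_all add: ring_center_def)

text \<open>Multiplication by \<open>p\<close> kills the kernel of \<open>phi\<close>, so the choice of a preimage is immaterial.\<close>

definition "psi h = (SOME t. t \<in> carrier T \<and> phi t = h) \<otimes>\<^bsub>T\<^esub> p"

lemma psi_phi: "t \<in> carrier T ==> psi (phi t) = t \<otimes>\<^bsub>T\<^esub> p"
proof -
  assume t: "t \<in> carrier T"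
  define s where "s = (SOME s. s \<in> carrier T \<and> phi s = phi t)"
  have s: "s \<in> carrier T" "phi s = phi t"
    using someI_ex[of "\<lambda>s. s \<in> carrier T \<and> phi s = phi t"] t unfolding s_def by blast+
  have "(s \<oplus>\<^bsub>T\<^esub> (- 1) \<odot>\<^bsub>T\<^esub> t) \<otimes>\<^bsub>T\<^esub> p = \<zero>\<^bsub>T\<^esub>"
    by (rule p(3)) (use s t in \<open>simp_all add: phi_add phi_smult add_neg\<close>)
  moreover have "(s \<oplus>\<^bsub>T\<^esub> (- 1) \<odot>\<^bsub>T\<^esub> t) \<otimes>\<^bsub>T\<^esub> p = s \<otimes>\<^bsub>T\<^esub> p \<oplus>\<^bsub>T\<^esub> (- 1) \<odot>\<^bsub>T\<^esub> (t \<otimes>\<^bsub>T\<^esub> p)"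
    using s(1) t p(1) by (simp add: E.T.l_distr)
  ultimately have eq: "s \<otimes>\<^bsub>T\<^esub> p \<oplus>\<^bsub>T\<^esub> (- 1) \<odot>\<^bsub>T\<^esub> (t \<otimes>\<^bsub>T\<^esub> p) = \<zero>\<^bsub>T\<^esub>" by (rule trans[OF sym, rotated])
  have "s \<otimes>\<^bsub>T\<^esub> p = t \<otimes>\<^bsub>T\<^esub> p"
    by (rule E.T.add_neg_eqD[OF _ _ eq]) (simp_all add: s(1) t p(1))
  then show ?thesis by (simp add: psi_def s_def)
qed

lemma psi_klin: "klin H T psi"
proof (rule klinI)
  fix x y assume "x \<in> carrier H" "y \<in> carrier H"
  then obtain s t where st: "s \<in> carrier T" "t \<in> carrier T" "x = phi s" "y = phi t" using phi_surj by metis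
  then show "psi x \<in> carrier T" "psi (x \<oplus> y) = psi x \<oplus>\<^bsub>T\<^esub> psi y"
    using p(1) by (simp_all add: psi_phi E.T.l_distr flip: phi_add)
  show "psi (c \<odot> x) = c \<odot>\<^bsub>T\<^esub> psi x" for c
    using st(1) p(1) unfolding st(3) by (simp add: psi_phi flip: phi_smult)
qed

context
  fixes l assumes l: "linfun Bt l"
begin

lemma l_add: "x \<in> Ht ==> y \<in> Ht ==> l (x \<oplus> y) = l x + l y" and l_smult: "x \<in> Ht ==> l (c \<odot> x) = c * l x"
  using linfun_add[OF l] linfun_smult[OF l] by simp_all

definition "rho = tensor_lift class_ring Bt E.Bo Bt (\<lambda>x y. l y \<odot> x)"
definition "R h = rho (psi h)"
text \<open>The slice of \<open>p\<close> by the functional \<open>l(\<cdot> c)\<close> on the second leg.\<close>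

definition "E c = (\<Oplus>r<m. l (b r \<otimes> c) \<odot> a r)"

lemma rho_bal: "balanced class_ring Bt E.Bo Bt (\<lambda>x y. l y \<odot> x)"
  by (rule balancedI) (simp_all add: l_add l_smult smult_distr mult.commute)

lemma rho_klin: "klin T Bt rho"
  unfolding rho_def
  by (rule lift_klin[OF Bt.ks E.Bo.ks Bt.ks rho_bal])
    (simp add: smult_distr mult.commute)

lemma rho_t: "x \<in> Ht ==> y \<in> Ht ==> rho (tT x y) = l y \<odot> x"
  unfolding rho_def by (rule E.TT.lift_tens[OF Bt.grp rho_bal]) simp_all

lemma R_klin: "klin H Bt R"
  unfolding R_def by (rule klin_comp[OF psi_klin rho_klin])

lemma E_Ht [simp]: "c \<in> Ht ==> E c \<in> Ht"
  unfolding E_def by (rule Ht_sum) simp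

lemma E_comm: "c \<in> Ht ==> x \<in> Ht ==> E c \<otimes> x = x \<otimes> E c"
  unfolding E_def
  by (subst finsum_ldistr, simp_all, subst finsum_rdistr, simp_all)
    (intro sum_cong, simp_all add: ab_comm)

lemma R_phi:
  assumes x: "x \<in> Ht" and c: "c \<in> Ht"
  shows "R (x \<otimes> S c) = x \<otimes> E c"
proof -
  have "tT x c \<otimes>\<^bsub>T\<^esub> p = (\<Oplus>\<^bsub>T\<^esub>r<m. tT x c \<otimes>\<^bsub>T\<^esub> tT (a r) (b r))"
    unfolding p_sum using x c by (intro E.T.finsum_rdistr) auto
  also have "\<dots> = (\<Oplus>\<^bsub>T\<^esub>r<m. tT (x \<otimes> a r) (b r \<otimes> c))"
    using x c by (intro E.T.sum_cong) (auto simp: tT_mult)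
  finally have "R (phi (tT x c)) = rho (\<Oplus>\<^bsub>T\<^esub>r<m. tT (x \<otimes> a r) (b r \<otimes> c))"
    using x c by (simp add: R_def psi_phi)
  also have "\<dots> = (\<Oplus>\<^bsub>Bt\<^esub>r<m. rho (tT (x \<otimes> a r) (b r \<otimes> c)))"
    using x c by (intro klin_finsum[OF E.T.ks Bt.ks rho_klin]) auto
  also have "\<dots> = (\<Oplus>\<^bsub>Bt\<^esub>r<m. x \<otimes> (l (b r \<otimes> c) \<odot> a r))"
    using x c by (intro Bt.sum_cong) (auto simp: rho_t)
  also have "\<dots> = (\<Oplus>r<m. x \<otimes> (l (b r \<otimes> c) \<odot> a r))" using x c by (intro Bt_sum) auto
  also have "\<dots> = x \<otimes> E c" unfolding E_def using x c by (intro finsum_rdistr[symmetric]) auto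
  finally show ?thesis using x c by (simp add: phi_t)
qed

lemma R_Ht [simp]: "h \<in> carrier H ==> R h \<in> Ht"
  using klin_closed[OF R_klin] by simp

text \<open>Chosen so that on \<open>\<Delta>(x S c)\<close> the legs \<open>z\<^sub>i\<close> and \<open>S e\<^sub>i\<close> of
  \<open>\<Delta>(1)\<close> meet as \<open>S(u e\<^sub>i z\<^sub>i)\<close>, whose sum is \<open>S(u g) = 1\<close>.\<close>

definition "theta = tensor_lift class_ring H H H (\<lambda>h h'. S (R h') \<otimes> h \<otimes> S u)"

lemma R_add: "x \<in> carrier H ==> y \<in> carrier H ==> R (x \<oplus> y) = R x \<oplus> R y"
  and R_smult: "x \<in> carrier H ==> R (c \<odot> x) = c \<odot> R x"
  using klin_add[OF R_klin, of x y] klin_smult[OF R_klin, of x c] by simp_all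

lemma theta_bal: "balanced class_ring H H H (\<lambda>h h'. S (R h') \<otimes> h \<otimes> S u)"
  by (rule balancedI) (simp_all add: R_add R_smult S_add S_smult l_distr r_distr)

lemma ez_g: "(\<Oplus>i<N. e i \<otimes> z i) = g"
proof -
  have "(\<Oplus>\<^bsub>Bt\<^esub>i<N. e i \<otimes>\<^bsub>Bt\<^esub> z i) = (\<Oplus>\<^bsub>Bt\<^esub>j<n. g \<otimes>\<^bsub>Bt\<^esub> X j \<otimes>\<^bsub>Bt\<^esub> Y j)"
    by (rule Fr.frobenius_casimir[OF Bt.grp Bt.balanced_mult])
  also have "\<dots> = (\<Oplus>\<^bsub>Bt\<^esub>j<n. g \<otimes>\<^bsub>Bt\<^esub> (X j \<otimes>\<^bsub>Bt\<^esub> Y j))"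
    by (intro Bt.sum_cong) (auto simp: m_assoc)
  also have "\<dots> = g \<otimes>\<^bsub>Bt\<^esub> (\<Oplus>\<^bsub>Bt\<^esub>j<n. X j \<otimes>\<^bsub>Bt\<^esub> Y j)" by (rule Bt.finsum_rdistr[symmetric]) auto
  finally show ?thesis using Bt.casimir_one Bt_sum[of "{..<N}" "\<lambda>i. e i \<otimes> z i"] by simp
qed

lemma theta_D:
  assumes x: "x \<in> Ht" and c: "c \<in> Ht"
  shows "theta (D (x \<otimes> S c)) = x \<otimes> S (E c)"
proof -
  have "theta (D (x \<otimes> S c)) = (\<Oplus>i<N. S (R (z i \<otimes> S c)) \<otimes> (x \<otimes> S (e i)) \<otimes> S u)"
    unfolding D_Ht_S[OF x c] theta_def by (rule BB.lift_finsum[OF grp theta_bal]) (use x c in auto)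
  also have "\<dots> = (\<Oplus>i<N. x \<otimes> S (u \<otimes> (e i \<otimes> z i) \<otimes> E c))"
  proof (rule sum_cong)
    fix i assume i: "i \<in> {..<N}"
    have "S (z i \<otimes> E c) \<otimes> (x \<otimes> S (e i)) \<otimes> S u = x \<otimes> S (z i \<otimes> E c) \<otimes> S (e i) \<otimes> S u"
      using i x c Ht_Hs_comm[of x "S (z i \<otimes> E c)"] by (simp flip: m_assoc)
    also have "\<dots> = x \<otimes> S (u \<otimes> (e i \<otimes> z i) \<otimes> E c)" using i x c by (simp add: S_anti_Ht m_assoc)
    finally show "S (R (z i \<otimes> S c)) \<otimes> (x \<otimes> S (e i)) \<otimes> S u = x \<otimes> S (u \<otimes> (e i \<otimes> z i) \<otimes> E c)"
      using i c by (simp add: R_phi)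
  qed (use x c in auto)
  also have "\<dots> = x \<otimes> S (\<Oplus>i<N. u \<otimes> (e i \<otimes> z i) \<otimes> E c)"
    using x c by (subst klin_finsum[OF ks ks S_klin], simp_all, subst finsum_rdistr) auto
  also have "(\<Oplus>i<N. u \<otimes> (e i \<otimes> z i) \<otimes> E c) = u \<otimes> (\<Oplus>i<N. e i \<otimes> z i) \<otimes> E c"
    using c by (subst finsum_rdistr, simp_all, subst finsum_ldistr) auto
  finally show ?thesis unfolding ez_g using x c by simp
qed

text \<open>Apply \<open>theta\<close> to \<open>\<Delta>(1) = \<Delta>(\<phi> p)\<close>. The left-hand side is \<open>S\<close> of the slice
  and the right-hand side is \<open>\<Sum> l(b\<^sub>s b\<^sub>r) a\<^sub>r S(a\<^sub>s)\<close>, which is invariant under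
  \<open>S\<close> because \<open>S\<^sup>2\<close> fixes central elements.\<close>

lemma leg_in_A: "(\<Oplus>r<m. l (b r) \<odot> a r) \<in> A"
proof -
  have E1: "E \<one> = (\<Oplus>r<m. l (b r) \<odot> a r)"
    unfolding E_def by (intro sum_cong) auto
  have eq: "S (E \<one>) = (\<Oplus>r<m. \<Oplus>s<m. l (b s \<otimes> b r) \<odot> (a r \<otimes> S (a s)))"
  proof -
    have th: "klin HH H theta" unfolding theta_def
      by (rule lift_klin[OF ks ks ks theta_bal]) simp
    have "phi p = (\<Oplus>r<m. phi (tT (a r) (b r)))"
      unfolding p_sum by (rule klin_finsum[OF E.T.ks ks phi_klin]) auto
    also have "\<dots> = (\<Oplus>r<m. a r \<otimes> S (b r))" by (intro sum_cong) (auto simp: phi_t)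
    finally have "D1 = D (\<Oplus>r<m. a r \<otimes> S (b r))" using p(2) by simp
    also have "\<dots> = (\<Oplus>\<^bsub>HH\<^esub>r<m. D (a r \<otimes> S (b r)))" by (rule D_kfinsum) auto
    finally have "theta D1 = theta (\<Oplus>\<^bsub>HH\<^esub>r<m. D (a r \<otimes> S (b r)))" by simp
    also have "\<dots> = (\<Oplus>r<m. theta (D (a r \<otimes> S (b r))))"
      by (rule klin_finsum[OF HH.ks ks th]) auto
    also have "\<dots> = (\<Oplus>r<m. a r \<otimes> S (E (b r)))"
      by (intro sum_cong) (auto simp: theta_D)
    also have "\<dots> = (\<Oplus>r<m. \<Oplus>s<m. l (b s \<otimes> b r) \<odot> (a r \<otimes> S (a s)))"
    proof (rule sum_cong)
      fix r assume r: "r \<in> {..<m}"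
      have "S (E (b r)) = (\<Oplus>s<m. S (l (b s \<otimes> b r) \<odot> a s))"
        unfolding E_def using r by (intro klin_finsum[OF ks ks S_klin]) auto
      then have "a r \<otimes> S (E (b r)) = (\<Oplus>s<m. a r \<otimes> S (l (b s \<otimes> b r) \<odot> a s))"
        using r by (simp only:) (intro finsum_rdistr, auto)
      also have "\<dots> = (\<Oplus>s<m. l (b s \<otimes> b r) \<odot> (a r \<otimes> S (a s)))"
        using r by (intro sum_cong) (auto simp: S_smult)
      finally show "a r \<otimes> S (E (b r)) = \<dots>" .
    qed (auto intro!: finsum_closed_P[OF grp])
    finally show ?thesis using theta_D[of \<one> \<one>] by simp
  qed
  have SSa: "S (S (a s)) = a s" if "s < m" for s
    using that by (simp add: S_S m_assoc ab_comm(1)[of s g]) (simp flip: m_assoc)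
  have "S (S (E \<one>)) = (\<Oplus>r<m. \<Oplus>s<m. S (l (b s \<otimes> b r) \<odot> (a r \<otimes> S (a s))))"
    unfolding eq
    by (subst klin_finsum[OF ks ks S_klin])
      (auto intro!: sum_cong finsum_closed_P[OF grp] klin_finsum[OF ks ks S_klin])
  also have "\<dots> = (\<Oplus>r<m. \<Oplus>s<m. l (b r \<otimes> b s) \<odot> (a s \<otimes> S (a r)))"
  proof (intro sum_cong)
    fix r s assume rs: "r \<in> {..<m}" "s \<in> {..<m}"
    then have "S (a r \<otimes> S (a s)) = a s \<otimes> S (a r)"
      using Ht_Hs_comm[of "a s" "S (a r)"] by (simp add: S_mult SSa)
    then show "S (l (b s \<otimes> b r) \<odot> (a r \<otimes> S (a s))) = l (b r \<otimes> b s) \<odot> (a s \<otimes> S (a r))"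
      using rs by (simp add: S_smult ab_comm(2)[of s "b r"])
  qed (auto intro!: finsum_closed_P[OF grp])
  also have "\<dots> = S (E \<one>)" unfolding eq by (rule finsum_swap[OF grp]) auto
  finally have inv: "S (S (E \<one>)) = S (E \<one>)" .
  have "S (S (E \<one>)) = u \<otimes> (E \<one> \<otimes> g)" by (simp add: S_S m_assoc)
  also have "\<dots> = u \<otimes> g \<otimes> E \<one>" using E_comm[of \<one> g] by (simp add: m_assoc del: ug)
  finally have "S (S (E \<one>)) = u \<otimes> g \<otimes> E \<one>" .
  then have "E \<one> = S (E \<one>)" using inv by simp
  then have "E \<one> \<in> Hs" using S_in(1)[of "E \<one>"] by simp
  then show ?thesis using E_Ht[OF one_Ht] unfolding E1 by (rule IntI[rotated])
qed

end

text \<open>Expand the second leg of \<open>p\<close> in the basis \<open>Y\<close>. The first legs are then slices, so they lie in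
  \<open>A\<close> and can be moved to the right.\<close>

lemma q_p: "q p = \<one>\<^bsub>M.W\<^esub>"
proof -
  define c where "c k = (\<Oplus>r<m. Tr (b r \<otimes> X k) \<odot> a r)" for k
  have cA: "c k \<in> A" if k: "k < n" for k
    unfolding c_def by (rule leg_in_A) (use k in \<open>simp add: linfun_def l_distr Bt.Tr_add[simplified] Bt.Tr_smult[simplified]\<close>)
  define y where "y = (\<Oplus>k<n. c k \<otimes> Y k)"
  have y: "y \<in> Ht" unfolding y_def by (rule Ht_sum) (use cA in auto)
  have "p = (\<Oplus>\<^bsub>T\<^esub>r<m. \<Oplus>\<^bsub>T\<^esub>k<n. tT (Tr (b r \<otimes> X k) \<odot> a r) (Y k))"
    unfolding p_sum
  proof (rule E.T.sum_cong)
    fix r assume r: "r \<in> {..<m}"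
    have "tT (a r) (b r) = tT (a r) (\<Oplus>\<^bsub>E.Bo\<^esub>k<n. Tr (b r \<otimes> X k) \<odot> Y k)"
      using Bt.expand_Y[of "b r"] r E.Bo_finsum[of "{..<n}" "\<lambda>k. Tr (b r \<otimes> X k) \<odot> Y k"] by simp
    also have "\<dots> = (\<Oplus>\<^bsub>T\<^esub>k<n. tT (a r) (Tr (b r \<otimes> X k) \<odot> Y k))"
      by (rule E.TT.tens_finsum_right) (use r in auto)
    also have "\<dots> = (\<Oplus>\<^bsub>T\<^esub>k<n. tT (Tr (b r \<otimes> X k) \<odot> a r) (Y k))"
      using r by (intro E.T.sum_cong) (auto simp: tT_rules)
    finally show "tT (a r) (b r) = \<dots>" .
  qed (auto intro!: finsum_closed_P[OF E.T.grp])
  also have "\<dots> = (\<Oplus>\<^bsub>T\<^esub>k<n. \<Oplus>\<^bsub>T\<^esub>r<m. tT (Tr (b r \<otimes> X k) \<odot> a r) (Y k))"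
    by (rule finsum_swap[OF E.T.grp]) auto
  also have "\<dots> = (\<Oplus>\<^bsub>T\<^esub>k<n. tT (c k) (Y k))"
  proof (rule E.T.sum_cong)
    fix k assume k: "k \<in> {..<n}"
    show "(\<Oplus>\<^bsub>T\<^esub>r<m. tT (Tr (b r \<otimes> X k) \<odot> a r) (Y k)) = tT (c k) (Y k)"
      using E.TT.tens_finsum_left[of "{..<m}" "\<lambda>r. Tr (b r \<otimes> X k) \<odot> a r" "Y k"] k
        Bt_sum[of "{..<m}" "\<lambda>r. Tr (b r \<otimes> X k) \<odot> a r"] by (simp add: c_def)
  qed (use cA in auto)
  finally have "q p = (\<Oplus>\<^bsub>M.W\<^esub>k<n. q (tT (c k) (Y k)))"
    using cA by (simp only:) (intro klin_finsum[OF E.T.ks M.W.ks q_klin], auto)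
  also have "\<dots> = (\<Oplus>\<^bsub>M.W\<^esub>k<n. M.bb \<one> (c k \<otimes> Y k))"
  proof (rule M.W.sum_cong)
    fix k assume k: "k \<in> {..<n}"
    then show "q (tT (c k) (Y k)) = M.bb \<one> (c k \<otimes> Y k)"
      using cA[of k] M.bb_balanced[of "c k" \<one> "Y k"] by (simp add: q_t)
  qed (use cA in auto)
  also have "\<dots> = M.bb \<one> y"
    using M.wb_finsum_right[of "{..<n}" "\<lambda>k. c k \<otimes> Y k" \<one>] cA
      Bt_sum[of "{..<n}" "\<lambda>k. c k \<otimes> Y k"] by (simp add: y_def)
  finally have qp: "q p = M.bb \<one> y" .
  have "\<one> \<otimes> S y = \<one>" using p(2) unfolding phi_def qp Phi_bb[OF one_Ht y] .
  then have "S y = S \<one>" unfolding S_one l_one[OF S_closed[OF Ht_closed[OF y]]] .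
  then have "y = \<one>" by (rule S_inj_Ht[OF y one_Ht])
  then show ?thesis using M.wb_one unfolding qp by simp
qed

lemma Phi_inj:
  assumes h: "h \<in> carrier M.W" and z: "Phi h = \<zero>"
  shows "h = \<zero>\<^bsub>M.W\<^esub>"
proof -
  obtain t where t: "t \<in> carrier T" "q t = h" using q_surj[OF h] by blast
  have tp: "t \<otimes>\<^bsub>T\<^esub> p = \<zero>\<^bsub>T\<^esub>" by (rule p(3)[OF t(1)]) (simp only: phi_def t(2) z)
  have "q \<zero>\<^bsub>T\<^esub> = h \<otimes>\<^bsub>M.W\<^esub> \<one>\<^bsub>M.W\<^esub>" using q_mult[OF t(1) p(1)] unfolding tp t(2) q_p .
  then show ?thesis unfolding addmap_zero[OF E.T.grp M.W.grp klin_addmap[OF q_klin]] M.W.r_one[OF h] by (rule sym)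
qed

lemma Phi_bij: "bij_betw Phi (carrier M.W) (carrier H)"
proof (rule bij_betw_imageI[OF inj_onI Phi_surj[OF minimal]])
  fix h k assume hk: "h \<in> carrier M.W" "k \<in> carrier M.W" "Phi h = Phi k"
  have "h \<oplus>\<^bsub>M.W\<^esub> (- 1) \<odot>\<^bsub>M.W\<^esub> k = \<zero>\<^bsub>M.W\<^esub>"
    by (rule Phi_inj) (use hk in \<open>simp_all add: Phi_add klin_smult[OF Phi_klin] add_neg\<close>)
  then show "h = k" by (rule M.W.add_neg_eqD[OF hk(1,2)])
qed

lemma isomorphic_Hmin: "weak_hopf_isomorphic H (Hmin Bt A g)"
  by (rule weak_hopf_isomorphic_inverse[OF M.W_kalg kalg_axioms M.D_klin D_klin _ Phi_weak_hopf_hom Phi_bij])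
    (rule klin_closed[OF M.S_klin])

end

text \<open>The triple is \<open>(H\<^sub>t, H\<^sub>t \<inter> H\<^sub>s, g)\<close>.\<close>

lemma minimal_weak_hopf_algebra_triple:
  fixes H :: "('k::field_char_0, 'h) weak_hopf"
  assumes "minimal_weak_hopf_algebra H"
  shows "\<exists>(B :: ('k, 'h) module) A g. admissible_triple B A g \<and> weak_hopf_isomorphic H (Hmin B A g)"
proof -
  have "weak_hopf_algebra H" using assms by (simp add: minimal_weak_hopf_algebra_def)
  then obtain N w z n X Y where "whopf_base H N w z n X Y" using whopf_base_exists by blast
  then interpret H: whopf_min H N w z n X Y using assms by (simp add: whopf_min_def whopf_min_axioms_def)
  obtain p where p: "p \<in> ring_center H.T" "H.phi p = \<one>\<^bsub>H\<^esub>"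
      "\<forall>t\<in>carrier H.T. H.phi t = \<zero>\<^bsub>H\<^esub> \<longrightarrow> t \<otimes>\<^bsub>H.T\<^esub> p = \<zero>\<^bsub>H.T\<^esub>"
    using H.kernel_idempotent by blast
  obtain m a b where ab: "\<forall>r<m. a r \<in> ring_center H.Bt \<and> b r \<in> ring_center H.Bt"
      "p = (\<Oplus>\<^bsub>H.T\<^esub>r\<in>{..<m::nat}. H.tT (a r) (b r))"
    using H.E.T_center[OF p(1)] by blast
  have pc: "p \<in> carrier H.T" using p(1) by (simp add: ring_center_def)
  have "whopf_idem H N w z n X Y p m a b"
    by (intro whopf_idem.intro whopf_idem_axioms.intro H.whopf_min_axioms) (use p(2,3) ab pc in auto)
  then interpret H: whopf_idem H N w z n X Y p m a b .
  have "admissible_triple H.Bt (H.Ht \<inter> H.Hs) H.g"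
    unfolding admissible_triple_def
    using H.Bt.k_algebra_B H.Bt.fd H.Bt.ss H.A_subalgebra H.A_central H.Fr.g_Units
      H.Bt.avg_one_imp_trace[OF H.Fr.g_closed H.Fr.avg_g] by blast
  then show ?thesis using H.isomorphic_Hmin by blast
qed

lemma admissible_triples_isomorphic_iff:
  fixes B :: "('k::{alg_closed_field,field_char_0}, 'b) module" and B' :: "('k, 'c) module"
  assumes "admissible_triple B A g \<and> admissible_triple B' A' g'"
  shows "weak_hopf_isomorphic (Hmin B A g) (Hmin B' A' g') \<longleftrightarrow>
    (\<exists>\<tau>\<in>algebra_iso B B'. \<tau> ` A = A' \<and> \<tau> g = g')"
proof -
  obtain n X Y where H: "hmin B n X Y A g" using admissible_triple_hmin[OF conjunct1[OF assms]] by blast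
  obtain n' X' Y' where "hmin B' n' X' Y' A' g'" using admissible_triple_hmin[OF conjunct2[OF assms]] by blast
  then show ?thesis by (rule Hmin_isomorphic_iff[OF H])
qed

theorem proposition3p4:
  shows
    "(\<forall>(B :: ('k::{alg_closed_field,field_char_0}, 'b) module) A g.
        admissible_triple B A g \<longrightarrow>
          (\<exists>!E. two_sided_separability_element B E) \<and>
          minimal_weak_hopf_algebra (Hmin B A g) \<and>
          (\<forall>E. two_sided_separability_element B E \<longrightarrow>
             (\<forall>b\<in>carrier B. \<forall>c\<in>carrier B.
                comult (Hmin B A g) (bbar B A b c) = Hmin_delta B A g E b c \<and>
                counit (Hmin B A g) (bbar B A b c)
                  = reg_trace B (inv\<^bsub>B\<^esub> g \<otimes>\<^bsub>B\<^esub> c \<otimes>\<^bsub>B\<^esub> b) \<and>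
                antipode (Hmin B A g) (bbar B A b c)
                  = bbar B A (inv\<^bsub>B\<^esub> g \<otimes>\<^bsub>B\<^esub> c \<otimes>\<^bsub>B\<^esub> g) b)))
     \<and>
     (\<forall>H :: ('k, 'h) weak_hopf. minimal_weak_hopf_algebra H \<longrightarrow>
        (\<exists>(B :: ('k, 'h) module) A g.
           admissible_triple B A g \<and> weak_hopf_isomorphic H (Hmin B A g)))
     \<and>
     (\<forall>(B :: ('k, 'b) module) A g (B' :: ('k, 'c) module) A' g'.
        admissible_triple B A g \<and> admissible_triple B' A' g' \<longrightarrow>
          (weak_hopf_isomorphic (Hmin B A g) (Hmin B' A' g') \<longleftrightarrow>
             (\<exists>\<tau>\<in>algebra_iso B B'. \<tau> ` A = A' \<and> \<tau> g = g')))"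
  by (rule conjI[OF _ conjI]; intro allI impI)
    (rule admissible_triple_Hmin minimal_weak_hopf_algebra_triple admissible_triples_isomorphic_iff; assumption)+

end
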